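(* Let $u_\epsilon$ be the weak solution of the wave equation with coefficient $a_\epsilon$, source $f$ and initial values $u^0,v^0$, and let $u^{ms}_{H,m}$ be the semi-discrete multiscale (LOD) approximation, with discrete initial velocity $v^0_{H,m}$, all as defined in the context and under the standing assumptions stated there. Let $\pi_h$ be the Ritz projection onto $V_h$ and $\gamma\in(0,1)$ the localization constant from the context. (a) Assume that $\partial_t^3u_\epsilon,\partial_tf\in L^\infty(L^2)$, $\partial_t^4u_\epsilon,\partial_{tt}f\in L^1(L^2)$, $\partial_tu_\epsilon\in L^\infty(H^1_0)$ and $\partial_{tt}u_\epsilon\in L^1(H^1_0)$. If $v^0_{H,m}=\pi^{ms}_{H,m}(v^0)$, then \begin{align*} &\|\partial_tu_\epsilon-\partial_tu^{ms}_{H,m}\|_{L^\infty(L^2)}+\|\sqrt{a_\epsilon}\nabla(u_\epsilon-u^{ms}_{H,m})\|_{L^\infty(L^2)}\\ &\quad\lesssim(H+m^{d/2}\gamma^m)\Bigl(\sum_{i=0}^1\|a_\epsilon^{-1/2}(\partial_t^{i+2}u_\epsilon-\partial_t^if)\|_{L^\infty(L^2)}+\|a_\epsilon^{-1/2}(\partial_t^4u_\epsilon-\partial_{tt}f)\|_{L^1(L^2)}\\ &\qquad\qquad+\sum_{i=0}^1\|\sqrt{a_\epsilon}\nabla\partial_t^iu_\epsilon\|_{L^\infty(L^2)}+\|\sqrt{a_\epsilon}\nabla\partial_{tt}u_\epsilon\|_{L^1(L^2)}\Bigr)+e^1_{\mathrm{disc}}(h), \end{align*} where \[e^1_{\mathrm{disc}}(h)=\|(1-\pi_h)\partial_tu_\epsilon\|_{L^\infty(L^2)}+\|\sqrt{a_\epsilon}\nabla(1-\pi_h)u_\epsilon\|_{L^\infty(L^2)}+\|(1-\pi_h)\partial_{tt}u_\epsilon\|_{L^\infty(L^2)}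 .\] (b) Assume that $\partial_{tt}u_\epsilon\in L^\infty(L^2)$, $\partial_t^3u_\epsilon,\partial_tf\in L^1(L^2)$ and $\partial_tu_\epsilon\in L^1(H^1_0)$. Then \begin{align*} \|u_\epsilon-u^{ms}_{H,m}\|_{L^\infty(L^2)}&\lesssim(H+m^{d/2}\gamma^m)\Bigl(\|a_\epsilon^{-1/2}(\partial_{tt}u_\epsilon-f)\|_{L^\infty(L^2)}+\|a_\epsilon^{-1/2}(\partial_t^3u_\epsilon-\partial_tf)\|_{L^1(L^2)}\\ &\qquad+\|\sqrt{a_\epsilon}\nabla u_\epsilon\|_{L^\infty(L^2)}+\|\sqrt{a_\epsilon}\nabla\partial_tu_\epsilon\|_{L^1(L^2)}\Bigr)+e^2_{\mathrm{disc}}(h), \end{align*} where \[e^2_{\mathrm{disc}}(h)=\|(1-\pi_h)u_\epsilon\|_{L^\infty(L^2)}+\|(1-\pi_h)\partial_tu_\epsilon\|_{L^1(L^2)} .\]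
   Context: Conventions. $L^p(X)$ means the Bochner space $L^p(0,T;X)$, with $L^2=L^2(\Omega)$, $H^1_0=H^1_0(\Omega)$. $A\lesssim B$ means $A\le CB$ with a constant $C$ that does not depend on $\epsilon$, $H$, $h$, $m$; it may depend on the final time $T$. Problem. $\Omega\subset\mathbb{R}^d$ is an open, connected Lipschitz domain, $T>0$, $f\in L^2(0,T;L^2(\Omega))$, $u^0\in H^1_0(\Omega)$, $v^0\in L^2(\Omega)$. The coefficient is $a_\epsilon=a_0$ in $\Omega_\epsilon\subset\Omega$ and $a_\epsilon=1$ in $\Omega\setminus\Omega_\epsilon$, with a constant $a_0>0$, in the high-contrast regime $a_0=\mathcal{O}(\epsilon^2)$, where $\epsilon>0$ is the fine-scale parameter; $\Omega_\epsilon$ consists of $\mathcal{O}(\epsilon^{-d})$ connected components of diameter $\mathcal{O}(\epsilon)$, not necessarily periodically arranged. Let $b_\epsilon(v,w)=\int_\Omega a_\epsilon\nabla v\cdot\nabla w\,dx$. The weak solution $u_\epsilon\in L^2(0,T;H^1_0(\Omega))$, with $\partial_tu_\epsilon\in L^2(0,T;L^2(\Omega))$, $\partial_{tt}u_\epsilon\in L^2(0,T;H^{-1}(\Omega))$, satisfies $\langle\partial_{tt}u_\epsilon,v\rangle+b_\epsilon(u_\epsilon,v)=(f,v)_{L^2(\Omega)}$ for all $v\in H^1_0(\Omega)$ and a.e. $t$, $u_\epsilon(\cdot,0)=u^0$, $\partial_tu_\epsilon(\cdot,0)=v^0$; here $\langle\cdot,\cdot\rangle$ is the duality pairing between $H^{-1}(\Omega)$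 and $H^1_0(\Omega)$. Meshes and spaces. $\mathcal{T}_H$ (coarse, mesh size $H$) and $\mathcal{T}_h$ (fine, mesh size $h$) are shape-regular rectangular meshes of $\Omega$; $\mathcal{T}_H$ is quasi-uniform, $\mathcal{T}_h$ is a refinement of $\mathcal{T}_H$ and resolves the variations of $a_\epsilon$. $Q_1(\mathcal{T})$ is the space of (possibly discontinuous) functions that are polynomials of coordinate degree at most one on each element. $V_H=Q_1(\mathcal{T}_H)\cap H^1_0(\Omega)$, $V_h=Q_1(\mathcal{T}_h)\cap H^1_0(\Omega)$. For $K\in\mathcal{T}_H$: $U_0(K)=K$ and $U_m(K)=\bigcup\{T'\in\mathcal{T}_H: T'\cap U_{m-1}(K)\ne\emptyset\}$ for $m\ge1$. Standing assumptions. (i) $I_H:H^1_0(\Omega)\to V_H$ is a projection ($I_H\circ I_H=I_H$), with $W_h=\{w\in V_h: I_Hw=0\}$, such that, with $C_I$ independent of $\epsilon,H,h$, \[\|\sqrt{a_\epsilon}\nabla I_Hv\|_{L^2(K)}\le C_I\|\sqrt{a_\epsilon}\nabla v\|_{L^2(U_1(K))},\qquad\|\sqrt{a_\epsilon}w\|_{L^2(K)}\le C_IH\|\sqrt{a_\epsilon}\nabla w\|_{L^2(U_1(K))}\] for all $v\in H^1_0(\Omega)$, $w\in W_h$, $K\in\mathcal{T}_H$; this $I_H$ is the one used in the construction below. (ii) There is $C_P$ independent of $\epsilon$ with $\|v\|_{L^2(\Omega)}\le C_P\|\sqrt{a_\epsilon}\nabla v\|_{L^2(\Omega)}$ for all $v\in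 H^1_0(\Omega)$. Correctors. $\mathcal{C}_{h,\Omega}:V_H\to W_h$ is defined by $b_\epsilon(\mathcal{C}_{h,\Omega}(v_H),w_h)=-b_\epsilon(v_H,w_h)$ for all $w_h\in W_h$. With $W_h(U_m(K))=\{w_h\in W_h: w_h=0\text{ in }\Omega\setminus U_m(K)\}$, $\mathcal{C}^K_{h,m}(v_H)\in W_h(U_m(K))$ solves \[\int_{U_m(K)}a_\epsilon\nabla\mathcal{C}^K_{h,m}(v_H)\cdot\nabla w_h=-\int_Ka_\epsilon\nabla v_H\cdot\nabla w_h\quad\text{for all }w_h\in W_h(U_m(K)),\] and $\mathcal{C}_{h,m}(v_H)=\sum_{K\in\mathcal{T}_H}\mathcal{C}^K_{h,m}(v_H)$. The LOD space is $V^{ms}_{H,m}=\{v_H+\mathcal{C}_{h,m}(v_H): v_H\in V_H\}$. Localization constant. By a known result from the literature there is a constant $0<\gamma<1$, independent of $H,h,\epsilon$, such that for all $v_H\in V_H$ \[\|\sqrt{a_\epsilon}\nabla(\mathcal{C}_{h,m}-\mathcal{C}_{h,\Omega})(v_H)\|_{L^2(\Omega)}\lesssim m^{d/2}\gamma^m\|\sqrt{a_\epsilon}\nabla v_H\|_{L^2(\Omega)};\] $\gamma$ denotes this constant. Projections. $\pi_h:H^1_0(\Omega)\to V_h$ and $\pi^{ms}_{H,m}:H^1_0(\Omega)\to V^{ms}_{H,m}$ are the elliptic (Ritz) projections, i.e. orthogonal projections with respect to $b_\epsilon$; $P^{ms}_{H,m}$ is the $L^2(\Omega)$-orthogonal projection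 onto $V^{ms}_{H,m}$. They are applied pointwise in time. Semi-discrete LOD approximation. $u_{H,m}\in H^2(0,T;V_H)$ and $u^{ms}_{H,m}=(1+\mathcal{C}_{h,m})u_{H,m}\in H^2(0,T;V^{ms}_{H,m})$ are determined by \[(\partial_{tt}u^{ms}_{H,m}(\cdot,t),w)_{L^2(\Omega)}+b_\epsilon(u^{ms}_{H,m}(\cdot,t),w)=(f(\cdot,t),w)_{L^2(\Omega)}\quad\text{for all }w\in V^{ms}_{H,m}\text{ and a.e. }t>0,\] with $u^{ms}_{H,m}(\cdot,0)=\pi^{ms}_{H,m}(u^0)$ and $\partial_tu^{ms}_{H,m}(\cdot,0)=v^0_{H,m}$, where $v^0_{H,m}$ can be chosen as either $\pi^{ms}_{H,m}(v^0)$ or $P^{ms}_{H,m}(v^0)$.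
   Formalization: In (b) with initial velocity π^ms_{H,m}(v^0), the bound as printed fails with a data-independent constant, so the term ‖v^0−π^ms_{H,m}(v^0)‖_{L^2} is added on the right; for P^ms_{H,m}(v^0) the bound is as printed. *)

theory Defs
  imports "HOL-Analysis.Analysis" "HOL-Probability.Essential_Supremum"
begin

text \<open>
  Elements of Lebesgue and Sobolev spaces are represented by functions that matter only up to null
  sets; all spaces below are saturated under almost-everywhere equality. The space dimension \<open>d\<close> is
  \<open>DIM('a)\<close>. Bochner functions are curried: \<open>u t x\<close>.
\<close>

section \<open>Sobolev spaces\<close>

text \<open>\<open>D [i\<^sub>1, \<dots>, i\<^sub>k]\<close> is the iterated partial derivative in the directions \<open>i\<^sub>1, \<dots>, i\<^sub>k \<in> Basis\<close>.\<close>
definition smooth :: "('a::euclidean_space \<Rightarrow> real) \<Rightarrow> bool" where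
  "smooth \<phi> \<longleftrightarrow> (\<exists>D. D [] = \<phi> \<and>
     (\<forall>is x. (D is has_derivative (\<lambda>h. \<Sum>i\<in>Basis. D (i # is) x * (h \<bullet> i))) (at x)))"

definition test_functions :: "'a::euclidean_space set \<Rightarrow> ('a \<Rightarrow> real) set" where
  "test_functions S = {\<phi>. smooth \<phi> \<and> compact (closure {x. \<phi> x \<noteq> 0}) \<and> closure {x. \<phi> x \<noteq> 0} \<subseteq> S}"

definition L2 :: "'a::euclidean_space set \<Rightarrow> ('a \<Rightarrow> 'b::euclidean_space) set" where
  "L2 S = {g. g \<in> borel_measurable (lebesgue_on S) \<and>
              integrable (lebesgue_on S) (\<lambda>x. (norm (g x))\<^sup>2)}"

definition l2norm :: "'a::euclidean_space set \<Rightarrow> ('a \<Rightarrow> 'b::euclidean_space) \<Rightarrow> real" where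
  "l2norm S g = sqrt (LINT x|lebesgue_on S. (norm (g x))\<^sup>2)"

definition l2ip :: "'a::euclidean_space set \<Rightarrow> ('a \<Rightarrow> real) \<Rightarrow> ('a \<Rightarrow> real) \<Rightarrow> real" where
  "l2ip S v w = (LINT x|lebesgue_on S. v x * w x)"

definition is_wgrad ::
  "'a::euclidean_space set \<Rightarrow> ('a \<Rightarrow> real) \<Rightarrow> ('a \<Rightarrow> 'a) \<Rightarrow> bool" where
  "is_wgrad \<Omega> v g \<longleftrightarrow> g \<in> L2 \<Omega> \<and>
     (\<forall>\<psi>\<in>test_functions \<Omega>. \<forall>i\<in>Basis.
        (LINT x|lebesgue_on \<Omega>. v x * frechet_derivative \<psi> (at x) i) =
        - (LINT x|lebesgue_on \<Omega>. (g x \<bullet> i) * \<psi> x))"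

definition wgrad :: "'a::euclidean_space set \<Rightarrow> ('a \<Rightarrow> real) \<Rightarrow> 'a \<Rightarrow> 'a" where
  "wgrad \<Omega> v = (SOME g. is_wgrad \<Omega> v g)"

definition H1 :: "'a::euclidean_space set \<Rightarrow> ('a \<Rightarrow> real) set" where
  "H1 \<Omega> = {v \<in> L2 \<Omega>. \<exists>g. is_wgrad \<Omega> v g}"

definition h1norm :: "'a::euclidean_space set \<Rightarrow> ('a \<Rightarrow> real) \<Rightarrow> real" where
  "h1norm \<Omega> v = sqrt ((l2norm \<Omega> v)\<^sup>2 + (l2norm \<Omega> (wgrad \<Omega> v))\<^sup>2)"

definition H10 :: "'a::euclidean_space set \<Rightarrow> ('a \<Rightarrow> real) set" where
  "H10 \<Omega> = {v \<in> H1 \<Omega>. \<exists>\<phi>. (\<forall>k. \<phi> k \<in> test_functions \<Omega>) \<and>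
                (\<lambda>k::nat. h1norm \<Omega> (\<lambda>x. v x - \<phi> k x)) \<longlonglongrightarrow> 0}"

text \<open>A functional is a total function; only its values on \<^term>\<open>H10 \<Omega>\<close> are relevant.\<close>
definition Hm1 :: "'a::euclidean_space set \<Rightarrow> (('a \<Rightarrow> real) \<Rightarrow> real) set" where
  "Hm1 \<Omega> = {F. (\<forall>v\<in>H10 \<Omega>. \<forall>w\<in>H10 \<Omega>. F (\<lambda>x. v x + w x) = F v + F w) \<and>
                (\<forall>v\<in>H10 \<Omega>. \<forall>c. F (\<lambda>x. c * v x) = c * F v) \<and>
                (\<exists>B. \<forall>v\<in>H10 \<Omega>. \<bar>F v\<bar> \<le> B * h1norm \<Omega> v)}"

definition hm1norm :: "'a::euclidean_space set \<Rightarrow> (('a \<Rightarrow> real) \<Rightarrow> real) \<Rightarrow> real" where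
  "hm1norm \<Omega> F = (SUP v\<in>{v \<in> H10 \<Omega>. h1norm \<Omega> v \<le> 1}. \<bar>F v\<bar>)"

section \<open>Bochner spaces and weak time derivatives\<close>

abbreviation time_measure :: "real \<Rightarrow> real measure" where
  "time_measure T \<equiv> lebesgue_on {0<..<T}"

text \<open>\<open>Lp_norm p T g\<close> is the norm of the scalar function \<open>g\<close> in \<open>L\<^sup>p(0,T)\<close>, infinite if \<open>g\<close> is
  not in that space.\<close>
definition Lp_norm :: "ennreal \<Rightarrow> real \<Rightarrow> (real \<Rightarrow> real) \<Rightarrow> ennreal" where
  "Lp_norm p T g =
     (if p = \<infinity> then esssup (time_measure T) (\<lambda>t. ennreal \<bar>g t\<bar>)
      else let I = (\<integral>\<^sup>+t. ennreal (\<bar>g t\<bar> powr enn2real p) \<partial>time_measure T)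
           in if I = \<infinity> then \<infinity> else ennreal (enn2real I powr (1 / enn2real p)))"

text \<open>Strong measurability of a function with values in a space given by its carrier \<open>X\<close> and its
  norm \<open>N\<close>. The index type \<open>'x\<close> is the space domain if \<open>X\<close> consists of functions, and the type of
  functions on it if \<open>X\<close> consists of functionals.\<close>
definition bochner_measurable ::
  "real \<Rightarrow> ('x \<Rightarrow> real) set \<Rightarrow> (('x \<Rightarrow> real) \<Rightarrow> real) \<Rightarrow> (real \<Rightarrow> 'x \<Rightarrow> real) \<Rightarrow> bool" where
  "bochner_measurable T X N u \<longleftrightarrow>
     (\<exists>s :: nat \<Rightarrow> real \<Rightarrow> 'x \<Rightarrow> real.
        (\<forall>k. simple_function (time_measure T) (s k) \<and> (\<forall>t\<in>{0<..<T}. s k t \<in> X)) \<and>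
        (AE t in time_measure T. (\<lambda>k. N (\<lambda>x. u t x - s k t x)) \<longlonglongrightarrow> 0))"

definition Lp_bochner ::
  "ennreal \<Rightarrow> real \<Rightarrow> ('x \<Rightarrow> real) set \<Rightarrow> (('x \<Rightarrow> real) \<Rightarrow> real) \<Rightarrow> (real \<Rightarrow> 'x \<Rightarrow> real) set" where
  "Lp_bochner p T X N =
     {u. (AE t in time_measure T. u t \<in> X) \<and> bochner_measurable T X N u \<and>
         Lp_norm p T (\<lambda>t. N (u t)) < \<infinity>}"

abbreviation Lp_L2 ::
  "ennreal \<Rightarrow> real \<Rightarrow> 'a::euclidean_space set \<Rightarrow> (real \<Rightarrow> 'a \<Rightarrow> real) set" where
  "Lp_L2 p T \<Omega> \<equiv> Lp_bochner p T (L2 \<Omega>) (l2norm \<Omega>)"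

abbreviation Lp_H10 ::
  "ennreal \<Rightarrow> real \<Rightarrow> 'a::euclidean_space set \<Rightarrow> (real \<Rightarrow> 'a \<Rightarrow> real) set" where
  "Lp_H10 p T \<Omega> \<equiv> Lp_bochner p T (H10 \<Omega>) (h1norm \<Omega>)"

definition Lp_L2_norm ::
  "ennreal \<Rightarrow> real \<Rightarrow> 'a::euclidean_space set \<Rightarrow> (real \<Rightarrow> 'a \<Rightarrow> 'b::euclidean_space) \<Rightarrow> ennreal" where
  "Lp_L2_norm p T \<Omega> g = Lp_norm p T (\<lambda>t. l2norm \<Omega> (g t))"

text \<open>The identity \<open>\<integral> \<phi>' P = - \<integral> \<phi> Q\<close> of vector-valued integrals, tested with the elements of \<open>D\<close>;
  \<open>P t v\<close> and \<open>Q t v\<close> are the pairings of the values at time \<open>t\<close> with \<open>v\<close>.\<close>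
definition weak_time_deriv ::
  "real \<Rightarrow> 'v set \<Rightarrow> (real \<Rightarrow> 'v \<Rightarrow> real) \<Rightarrow> (real \<Rightarrow> 'v \<Rightarrow> real) \<Rightarrow> bool" where
  "weak_time_deriv T D P Q \<longleftrightarrow>
     (\<forall>\<phi>\<in>test_functions {0<..<T}. \<forall>v\<in>D.
        (LINT t|time_measure T. deriv \<phi> t * P t v) = - (LINT t|time_measure T. \<phi> t * Q t v))"

definition has_dt ::
  "real \<Rightarrow> 'a::euclidean_space set \<Rightarrow> (real \<Rightarrow> 'a \<Rightarrow> real) \<Rightarrow> (real \<Rightarrow> 'a \<Rightarrow> real) \<Rightarrow> bool" where
  "has_dt T \<Omega> u w \<longleftrightarrow> u \<in> Lp_L2 1 T \<Omega> \<and> w \<in> Lp_L2 1 T \<Omega> \<and>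
     weak_time_deriv T (L2 \<Omega>) (\<lambda>t. l2ip \<Omega> (u t)) (\<lambda>t. l2ip \<Omega> (w t))"

text \<open>The value at time 0 is that of the representative that is continuous from \<open>[0,T]\<close> into \<open>X\<close>.\<close>
definition has_initial_value ::
  "real \<Rightarrow> ('x \<Rightarrow> real) set \<Rightarrow> (('x \<Rightarrow> real) \<Rightarrow> real) \<Rightarrow> (real \<Rightarrow> 'x \<Rightarrow> real) \<Rightarrow> ('x \<Rightarrow> real) \<Rightarrow> bool" where
  "has_initial_value T X N u z \<longleftrightarrow>
     (AE t in time_measure T. u t \<in> X) \<and> z \<in> X \<and>
     (\<exists>w. (\<forall>t\<in>{0..T}. w t \<in> X \<and> ((\<lambda>s. N (\<lambda>x. w s x - w t x)) \<longlongrightarrow> 0) (at t within {0..T})) \<and>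
          (AE t in time_measure T. N (\<lambda>x. u t x - w t x) = 0) \<and>
          N (\<lambda>x. w 0 x - z x) = 0)"

section \<open>The wave equation\<close>

text \<open>Locally, the domain is the part above the graph of a Lipschitz function over the hyperplane
  orthogonal to the unit vector \<open>e\<close>.\<close>
definition lipschitz_domain :: "'a::euclidean_space set \<Rightarrow> bool" where
  "lipschitz_domain \<Omega> \<longleftrightarrow> open \<Omega> \<and> connected \<Omega> \<and> \<Omega> \<noteq> {} \<and>
     (\<forall>x\<in>frontier \<Omega>. \<exists>e r L g. norm e = 1 \<and> 0 < r \<and> L-lipschitz_on UNIV g \<and>
        (\<forall>y\<in>ball x r. y \<in> \<Omega> \<longleftrightarrow> g (y - (y \<bullet> e) *\<^sub>R e) < y \<bullet> e))"

text \<open>The single number \<open>c\<close> bounds the implied constants of all three \<open>\<O>\<close>-terms.\<close>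
definition high_contrast_coeff ::
  "'a::euclidean_space set \<Rightarrow> real \<Rightarrow> real \<Rightarrow> ('a \<Rightarrow> real) \<Rightarrow> bool" where
  "high_contrast_coeff \<Omega> c \<epsilon> a \<longleftrightarrow>
     (\<exists>a0 \<Omega>\<epsilon>. 0 < a0 \<and> a0 \<le> c * \<epsilon>\<^sup>2 \<and> \<Omega>\<epsilon> \<subseteq> \<Omega> \<and> \<Omega>\<epsilon> \<in> sets lebesgue \<and>
        finite (components \<Omega>\<epsilon>) \<and> real (card (components \<Omega>\<epsilon>)) \<le> c * (1 / \<epsilon>) ^ DIM('a) \<and>
        (\<forall>S\<in>components \<Omega>\<epsilon>. diameter S \<le> c * \<epsilon>) \<and>
        a = (\<lambda>x. if x \<in> \<Omega>\<epsilon> then a0 else 1))"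

text \<open>\<open>bform \<Omega> a S\<close> is the form with the integral restricted to \<open>S\<close>, so that \<open>b\<^sub>\<epsilon>\<close> is
  \<open>bform \<Omega> a \<Omega>\<close>; \<open>sgrad \<Omega> a v\<close> is \<open>\<surd>a \<nabla>v\<close>.\<close>
definition bform ::
  "'a::euclidean_space set \<Rightarrow> ('a \<Rightarrow> real) \<Rightarrow> 'a set \<Rightarrow> ('a \<Rightarrow> real) \<Rightarrow> ('a \<Rightarrow> real) \<Rightarrow> real" where
  "bform \<Omega> a S v w = (LINT x|lebesgue_on S. a x * (wgrad \<Omega> v x \<bullet> wgrad \<Omega> w x))"

definition sgrad ::
  "'a::euclidean_space set \<Rightarrow> ('a \<Rightarrow> real) \<Rightarrow> ('a \<Rightarrow> real) \<Rightarrow> 'a \<Rightarrow> 'a" where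
  "sgrad \<Omega> a v = (\<lambda>x. sqrt (a x) *\<^sub>R wgrad \<Omega> v x)"

definition weak_solution ::
  "'a::euclidean_space set \<Rightarrow> real \<Rightarrow> ('a \<Rightarrow> real) \<Rightarrow> (real \<Rightarrow> 'a \<Rightarrow> real) \<Rightarrow>
   ('a \<Rightarrow> real) \<Rightarrow> ('a \<Rightarrow> real) \<Rightarrow> (real \<Rightarrow> 'a \<Rightarrow> real) \<Rightarrow> bool" where
  "weak_solution \<Omega> T a f u0 v0 u \<longleftrightarrow>
     u \<in> Lp_H10 2 T \<Omega> \<and>
     (\<exists>ut utt. has_dt T \<Omega> u ut \<and> ut \<in> Lp_L2 2 T \<Omega> \<and>
        utt \<in> Lp_bochner 2 T (Hm1 \<Omega>) (hm1norm \<Omega>) \<and>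
        weak_time_deriv T (H10 \<Omega>) (\<lambda>t. l2ip \<Omega> (ut t)) utt \<and>
        (\<forall>v\<in>H10 \<Omega>. AE t in time_measure T. utt t v + bform \<Omega> a \<Omega> (u t) v = l2ip \<Omega> (f t) v) \<and>
        has_initial_value T (L2 \<Omega>) (l2norm \<Omega>) u u0 \<and>
        has_initial_value T (Hm1 \<Omega>) (hm1norm \<Omega>) (\<lambda>t. l2ip \<Omega> (ut t)) (l2ip \<Omega> v0))"

section \<open>Meshes and finite element spaces\<close>

definition rect_mesh :: "'a::euclidean_space set \<Rightarrow> 'a set set \<Rightarrow> bool" where
  "rect_mesh \<Omega> \<T> \<longleftrightarrow> finite \<T> \<and> \<Union>\<T> = closure \<Omega> \<and>
     (\<forall>K\<in>\<T>. \<exists>l r. K = cbox l r \<and> box l r \<noteq> {}) \<and>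
     (\<forall>K\<in>\<T>. \<forall>K'\<in>\<T>. K \<noteq> K' \<longrightarrow> interior K \<inter> interior K' = {})"

definition mesh_size :: "'a::euclidean_space set set \<Rightarrow> real" where
  "mesh_size \<T> = Max (diameter ` \<T>)"

text \<open>The diameter of the largest ball inscribed in a box is its shortest edge.\<close>
definition shape_regular :: "real \<Rightarrow> 'a::euclidean_space set set \<Rightarrow> bool" where
  "shape_regular \<sigma> \<T> \<longleftrightarrow>
     (\<forall>l r. cbox l r \<in> \<T> \<longrightarrow> (\<forall>i\<in>Basis. diameter (cbox l r) \<le> \<sigma> * ((r - l) \<bullet> i)))"

definition quasi_uniform :: "real \<Rightarrow> 'a::euclidean_space set set \<Rightarrow> bool" where
  "quasi_uniform \<sigma> \<T> \<longleftrightarrow> (\<forall>K\<in>\<T>. mesh_size \<T> \<le> \<sigma> * diameter K)"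

definition mesh_refines :: "'a set set \<Rightarrow> 'a set set \<Rightarrow> bool" where
  "mesh_refines \<T>' \<T> \<longleftrightarrow> (\<forall>K'\<in>\<T>'. \<exists>K\<in>\<T>. K' \<subseteq> K)"

definition resolves :: "'a::euclidean_space set set \<Rightarrow> ('a \<Rightarrow> real) \<Rightarrow> bool" where
  "resolves \<T> a \<longleftrightarrow> (\<forall>K\<in>\<T>. \<exists>c. AE x in lebesgue_on K. a x = c)"

fun patch :: "'a set set \<Rightarrow> nat \<Rightarrow> 'a set \<Rightarrow> 'a set" where
  "patch \<T> 0 K = K"
| "patch \<T> (Suc m) K = \<Union>{K' \<in> \<T>. K' \<inter> patch \<T> m K \<noteq> {}}"

definition Q1_poly :: "('a::euclidean_space \<Rightarrow> real) \<Rightarrow> bool" where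
  "Q1_poly q \<longleftrightarrow> (\<exists>c :: 'a set \<Rightarrow> real. \<forall>x. q x = (\<Sum>S\<in>Pow Basis. c S * (\<Prod>i\<in>S. x \<bullet> i)))"

definition Q1 :: "'a::euclidean_space set set \<Rightarrow> ('a \<Rightarrow> real) set" where
  "Q1 \<T> = {v. \<forall>K\<in>\<T>. \<exists>q. Q1_poly q \<and> (AE x in lebesgue_on K. v x = q x)}"

definition fe_space :: "'a::euclidean_space set \<Rightarrow> 'a set set \<Rightarrow> ('a \<Rightarrow> real) set" where
  "fe_space \<Omega> \<T> = Q1 \<T> \<inter> H10 \<Omega>"

section \<open>Localized orthogonal decomposition\<close>

definition kernel_space ::
  "'a::euclidean_space set \<Rightarrow> 'a set set \<Rightarrow> (('a \<Rightarrow> real) \<Rightarrow> 'a \<Rightarrow> real) \<Rightarrow> ('a \<Rightarrow> real) set" where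
  "kernel_space \<Omega> Th IH = {w \<in> fe_space \<Omega> Th. AE x in lebesgue_on \<Omega>. IH w x = 0}"

definition local_kernel_space ::
  "'a::euclidean_space set \<Rightarrow> 'a set set \<Rightarrow> (('a \<Rightarrow> real) \<Rightarrow> 'a \<Rightarrow> real) \<Rightarrow> 'a set \<Rightarrow>
   ('a \<Rightarrow> real) set" where
  "local_kernel_space \<Omega> Th IH U =
     {w \<in> kernel_space \<Omega> Th IH. AE x in lebesgue_on (\<Omega> - U). w x = 0}"

definition stable_projection ::
  "'a::euclidean_space set \<Rightarrow> ('a \<Rightarrow> real) \<Rightarrow> 'a set set \<Rightarrow> 'a set set \<Rightarrow> real \<Rightarrow>
   (('a \<Rightarrow> real) \<Rightarrow> 'a \<Rightarrow> real) \<Rightarrow> bool" where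
  "stable_projection \<Omega> a TH Th CI IH \<longleftrightarrow>
     (\<forall>v\<in>H10 \<Omega>. IH v \<in> fe_space \<Omega> TH) \<and>
     (\<forall>v\<in>H10 \<Omega>. \<forall>w\<in>H10 \<Omega>. AE x in lebesgue_on \<Omega>. IH (\<lambda>x. v x + w x) x = IH v x + IH w x) \<and>
     (\<forall>v\<in>H10 \<Omega>. \<forall>c. AE x in lebesgue_on \<Omega>. IH (\<lambda>x. c * v x) x = c * IH v x) \<and>
     (\<forall>v\<in>H10 \<Omega>. AE x in lebesgue_on \<Omega>. IH (IH v) x = IH v x) \<and>
     (\<forall>v\<in>H10 \<Omega>. \<forall>K\<in>TH. l2norm K (sgrad \<Omega> a (IH v)) \<le> CI * l2norm (patch TH 1 K) (sgrad \<Omega> a v)) \<and>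
     (\<forall>w\<in>kernel_space \<Omega> Th IH. \<forall>K\<in>TH.
        l2norm K (\<lambda>x. sqrt (a x) * w x) \<le> CI * mesh_size TH * l2norm (patch TH 1 K) (sgrad \<Omega> a w))"

definition poincare ::
  "'a::euclidean_space set \<Rightarrow> ('a \<Rightarrow> real) \<Rightarrow> real \<Rightarrow> bool" where
  "poincare \<Omega> a CP \<longleftrightarrow> (\<forall>v\<in>H10 \<Omega>. l2norm \<Omega> v \<le> CP * l2norm \<Omega> (sgrad \<Omega> a v))"

definition is_corrector ::
  "'a::euclidean_space set \<Rightarrow> ('a \<Rightarrow> real) \<Rightarrow> 'a set set \<Rightarrow> 'a set set \<Rightarrow>
   (('a \<Rightarrow> real) \<Rightarrow> 'a \<Rightarrow> real) \<Rightarrow> (('a \<Rightarrow> real) \<Rightarrow> 'a \<Rightarrow> real) \<Rightarrow> bool" where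
  "is_corrector \<Omega> a TH Th IH \<C> \<longleftrightarrow>
     (\<forall>v\<in>fe_space \<Omega> TH. \<C> v \<in> kernel_space \<Omega> Th IH \<and>
        (\<forall>w\<in>kernel_space \<Omega> Th IH. bform \<Omega> a \<Omega> (\<C> v) w = - bform \<Omega> a \<Omega> v w))"

definition is_element_corrector ::
  "'a::euclidean_space set \<Rightarrow> ('a \<Rightarrow> real) \<Rightarrow> 'a set set \<Rightarrow> 'a set set \<Rightarrow>
   (('a \<Rightarrow> real) \<Rightarrow> 'a \<Rightarrow> real) \<Rightarrow> nat \<Rightarrow> ('a set \<Rightarrow> ('a \<Rightarrow> real) \<Rightarrow> 'a \<Rightarrow> real) \<Rightarrow> bool" where
  "is_element_corrector \<Omega> a TH Th IH m \<C>K \<longleftrightarrow>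
     (\<forall>K\<in>TH. \<forall>v\<in>fe_space \<Omega> TH.
        \<C>K K v \<in> local_kernel_space \<Omega> Th IH (patch TH m K) \<and>
        (\<forall>w\<in>local_kernel_space \<Omega> Th IH (patch TH m K).
           bform \<Omega> a (patch TH m K) (\<C>K K v) w = - bform \<Omega> a K v w))"

definition local_corrector ::
  "'a set set \<Rightarrow> ('a set \<Rightarrow> ('a \<Rightarrow> real) \<Rightarrow> 'a \<Rightarrow> real) \<Rightarrow> ('a \<Rightarrow> real) \<Rightarrow> 'a \<Rightarrow> real" where
  "local_corrector TH \<C>K v = (\<lambda>x. \<Sum>K\<in>TH. \<C>K K v x)"

definition lod_space ::
  "'a::euclidean_space set \<Rightarrow> 'a set set \<Rightarrow> ('a set \<Rightarrow> ('a \<Rightarrow> real) \<Rightarrow> 'a \<Rightarrow> real) \<Rightarrow>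
   ('a \<Rightarrow> real) set" where
  "lod_space \<Omega> TH \<C>K =
     {w. \<exists>v\<in>fe_space \<Omega> TH. AE x in lebesgue_on \<Omega>. w x = v x + local_corrector TH \<C>K v x}"

definition localization_bound ::
  "'a::euclidean_space set \<Rightarrow> ('a \<Rightarrow> real) \<Rightarrow> 'a set set \<Rightarrow> nat \<Rightarrow> real \<Rightarrow> real \<Rightarrow>
   (('a \<Rightarrow> real) \<Rightarrow> 'a \<Rightarrow> real) \<Rightarrow> ('a set \<Rightarrow> ('a \<Rightarrow> real) \<Rightarrow> 'a \<Rightarrow> real) \<Rightarrow> bool" where
  "localization_bound \<Omega> a TH m Cloc \<gamma> \<C> \<C>K \<longleftrightarrow>
     (\<forall>v\<in>fe_space \<Omega> TH.
        l2norm \<Omega> (sgrad \<Omega> a (\<lambda>x. local_corrector TH \<C>K v x - \<C> v x))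
          \<le> Cloc * (real m powr (real DIM('a) / 2) * \<gamma> ^ m) * l2norm \<Omega> (sgrad \<Omega> a v))"

text \<open>\<open>p\<close> is the image of \<open>v\<close> under the \<open>b\<^sub>\<epsilon>\<close>-orthogonal projection onto \<open>V\<close>, which is defined for
  \<open>v\<close> in \<^term>\<open>H10 \<Omega>\<close> only.\<close>
definition ritz_proj ::
  "'a::euclidean_space set \<Rightarrow> ('a \<Rightarrow> real) \<Rightarrow> ('a \<Rightarrow> real) set \<Rightarrow> ('a \<Rightarrow> real) \<Rightarrow> ('a \<Rightarrow> real) \<Rightarrow> bool" where
  "ritz_proj \<Omega> a V v p \<longleftrightarrow> v \<in> H10 \<Omega> \<and> p \<in> V \<and> (\<forall>w\<in>V. bform \<Omega> a \<Omega> (\<lambda>x. v x - p x) w = 0)"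

definition l2_proj ::
  "'a::euclidean_space set \<Rightarrow> ('a \<Rightarrow> real) set \<Rightarrow> ('a \<Rightarrow> real) \<Rightarrow> ('a \<Rightarrow> real) \<Rightarrow> bool" where
  "l2_proj \<Omega> V v p \<longleftrightarrow> v \<in> L2 \<Omega> \<and> p \<in> V \<and> (\<forall>w\<in>V. l2ip \<Omega> (\<lambda>x. v x - p x) w = 0)"

definition H2_bochner ::
  "real \<Rightarrow> 'a::euclidean_space set \<Rightarrow> ('a \<Rightarrow> real) set \<Rightarrow> (real \<Rightarrow> 'a \<Rightarrow> real) \<Rightarrow>
   (real \<Rightarrow> 'a \<Rightarrow> real) \<Rightarrow> (real \<Rightarrow> 'a \<Rightarrow> real) \<Rightarrow> bool" where
  "H2_bochner T \<Omega> V w wt wtt \<longleftrightarrow>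
     w \<in> Lp_bochner 2 T V (h1norm \<Omega>) \<and> wt \<in> Lp_bochner 2 T V (h1norm \<Omega>) \<and>
     wtt \<in> Lp_bochner 2 T V (h1norm \<Omega>) \<and> has_dt T \<Omega> w wt \<and> has_dt T \<Omega> wt wtt"

text \<open>Semi-discrete solution with discrete initial values \<open>u0d\<close> and \<open>v0d\<close>.\<close>
definition lod_solution ::
  "'a::euclidean_space set \<Rightarrow> real \<Rightarrow> ('a \<Rightarrow> real) \<Rightarrow> (real \<Rightarrow> 'a \<Rightarrow> real) \<Rightarrow> 'a set set \<Rightarrow>
   ('a set \<Rightarrow> ('a \<Rightarrow> real) \<Rightarrow> 'a \<Rightarrow> real) \<Rightarrow> ('a \<Rightarrow> real) \<Rightarrow> ('a \<Rightarrow> real) \<Rightarrow>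
   (real \<Rightarrow> 'a \<Rightarrow> real) \<Rightarrow> bool" where
  "lod_solution \<Omega> T a f TH \<C>K u0d v0d U \<longleftrightarrow>
     (\<exists>uH uHt uHtt Ut Utt.
        H2_bochner T \<Omega> (fe_space \<Omega> TH) uH uHt uHtt \<and>
        H2_bochner T \<Omega> (lod_space \<Omega> TH \<C>K) U Ut Utt \<and>
        (AE t in time_measure T. AE x in lebesgue_on \<Omega>.
           U t x = uH t x + local_corrector TH \<C>K (uH t) x) \<and>
        (\<forall>w\<in>lod_space \<Omega> TH \<C>K. AE t in time_measure T.
           l2ip \<Omega> (Utt t) w + bform \<Omega> a \<Omega> (U t) w = l2ip \<Omega> (f t) w) \<and>
        has_initial_value T (L2 \<Omega>) (l2norm \<Omega>) U u0d \<and>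
        has_initial_value T (L2 \<Omega>) (l2norm \<Omega>) Ut v0d)"

end

theory Submission imports Defs begin

text \<open>
  Let \<open>u\<close> be the exact and \<open>U\<close> the semi-discrete solution, \<open>b\<close> the energy form, \<open>V\<close> the multiscale
  space, \<open>W\<close> the kernel of \<open>I\<^sub>H\<close> on the fine space, and \<open>R\<close> the \<open>b\<close>-orthogonal projection onto \<open>V\<close>. The
  error splits as \<open>u - U = (u - R u) - (U - R u)\<close>.

  \<^emph>\<open>The Ritz error.\<close> At almost every time the wave equation is an elliptic problem
  \<open>b(u, w) = (f - u'', w)\<close> for \<open>u(t)\<close>, and its time derivatives are elliptic problems for \<open>u'\<close> and
  \<open>u''\<close> (\<open>elliptic_0\<close>, \<open>elliptic_1\<close>, \<open>elliptic_2\<close>). If \<open>b(v, w) = (F, w)\<close>, put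
  \<open>v\<^sub>H = I\<^sub>H \<pi>\<^sub>h v\<close> and write \<open>\<pi>\<^sub>h v = v\<^sub>H + C v\<^sub>H + w\<close> with the global corrector \<open>C\<close>. The remainder
  \<open>w\<close> lies in \<open>W\<close>, which is \<open>b\<close>-orthogonal to \<open>v\<^sub>H + C v\<^sub>H\<close>, so that
  \<open>b(w, w) = b(\<pi>\<^sub>h v, w) = (F, w)\<close>. The weighted approximation property of \<open>I\<^sub>H\<close> bounds \<open>\<surd>a w\<close> by
  \<open>H\<close> times the energy norm of \<open>w\<close>; hence the energy norm of \<open>w\<close> is at most a constant times
  \<open>H \<parallel>F / \<surd>a\<parallel>\<close>. Replacing \<open>C v\<^sub>H\<close> by the localized corrector, which leads into \<open>V\<close>, costs the
  localization error, and \<open>R v = R \<pi>\<^sub>h v\<close> is the best approximation of \<open>\<pi>\<^sub>h v\<close> in \<open>V\<close>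
  (\<open>ritz_ms_error\<close>). The elementwise bounds of \<open>I\<^sub>H\<close> become global ones because an element has boundedly
  many neighbours, by comparison of volumes (\<open>mesh_overlap\<close>). The Poincare inequality turns the
  energy bound into one in \<open>L\<^sup>2\<close>.

  \<^emph>\<open>The discrete error.\<close> For \<open>\<theta> = U - R u\<close> and all \<open>w\<close> in \<open>V\<close>,
  \<open>(\<theta>'', w) + b(\<theta>, w) = (u'' - R u'', w)\<close>. In part (a) both initial values of \<open>\<theta>\<close> vanish, and testing
  with \<open>\<theta>'\<close> bounds \<open>\<theta>'\<close> in \<open>L\<^sup>2\<close> and \<open>\<theta>\<close> in the energy norm by \<open>2 \<integral> \<parallel>u'' - R u''\<parallel>\<close> (\<open>error_energy\<close>). For
  part (b) the equation is integrated in time first and tested with \<open>\<theta>\<close>, which leaves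
  \<open>2 \<integral> \<parallel>u' - R u'\<parallel>\<close> plus a term with the error of the initial velocity. That error enters only
  through its \<open>L\<^sup>2\<close> products with \<open>V\<close>, so it drops out for the \<open>L\<^sup>2\<close> projection (\<open>error_L2\<close>).

  \<^emph>\<open>Regularity in time.\<close> All time derivatives are weak: they are tested with fixed elements of the
  space. The argument is therefore run for the coefficients of \<open>\<theta>\<close> in a \<open>b\<close>-orthonormal basis of \<open>V\<close>. These are
  scalar functions, and by the lemma of du Bois-Reymond (\<open>weak_derivative_imp_prim\<close>) they are
  primitives of integrable functions, which obey the product rule (\<open>prim_product_rule\<close>). The
  derivatives of \<open>u\<close> are given in \<open>L\<^sup>2\<close>, whereas the coefficients are products in the energy form. The
  two are reconciled in \<open>energy_prim\<close>: paired with a test function, a partial derivative can be moved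
  to the test function, and test functions are dense in \<open>L\<^sup>2\<close> (\<open>test_functions_dense\<close>).
\<close>

section \<open>Semi-inner products on spaces of functions\<close>

locale semi_inner_space =
  fixes X :: "('x \<Rightarrow> 'b::real_vector) set" and ip :: "('x \<Rightarrow> 'b) \<Rightarrow> ('x \<Rightarrow> 'b) \<Rightarrow> real"
  assumes zero_mem: "(\<lambda>x. 0) \<in> X"
    and add_mem: "v \<in> X \<Longrightarrow> w \<in> X \<Longrightarrow> (\<lambda>x. v x + w x) \<in> X"
    and scale_mem: "v \<in> X \<Longrightarrow> (\<lambda>x. c *\<^sub>R v x) \<in> X"
    and ip_add: "u \<in> X \<Longrightarrow> v \<in> X \<Longrightarrow> w \<in> X \<Longrightarrow> ip (\<lambda>x. u x + v x) w = ip u w + ip v w"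
    and ip_scale: "v \<in> X \<Longrightarrow> w \<in> X \<Longrightarrow> ip (\<lambda>x. c *\<^sub>R v x) w = c * ip v w"
    and ip_sym: "v \<in> X \<Longrightarrow> w \<in> X \<Longrightarrow> ip v w = ip w v"
    and ip_pos: "v \<in> X \<Longrightarrow> 0 \<le> ip v v"
begin

definition nrm :: "('x \<Rightarrow> 'b) \<Rightarrow> real" where "nrm v = sqrt (ip v v)"

lemma diff_mem: assumes "v \<in> X" "w \<in> X" shows "(\<lambda>x. v x - w x) \<in> X"
  using add_mem[OF assms(1) scale_mem[OF assms(2), of "-1"]] by simp

lemma sum_mem: "(\<And>i. i \<in> I \<Longrightarrow> e i \<in> X) \<Longrightarrow> (\<lambda>x. \<Sum>i\<in>I. e i x) \<in> X"
  by (induction I rule: infinite_finite_induct) (auto simp: zero_mem add_mem)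

lemma comb_mem: "(\<And>i. i \<in> I \<Longrightarrow> e i \<in> X) \<Longrightarrow> (\<lambda>x. \<Sum>i\<in>I. c i *\<^sub>R e i x) \<in> X"
  by (intro sum_mem scale_mem)

lemma ip_zero: "w \<in> X \<Longrightarrow> ip (\<lambda>x. 0) w = 0"
  using ip_scale[OF zero_mem, of w 0] by simp

lemma ip_diff: assumes "u \<in> X" "v \<in> X" "w \<in> X"
  shows "ip (\<lambda>x. u x - v x) w = ip u w - ip v w"
  using ip_add[OF assms(1) scale_mem[OF assms(2), of "-1"] assms(3)] ip_scale[OF assms(2,3), of "-1"]
  by simp

lemma ip_add_right: "u \<in> X \<Longrightarrow> v \<in> X \<Longrightarrow> w \<in> X \<Longrightarrow> ip w (\<lambda>x. u x + v x) = ip w u + ip w v"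
  using ip_add[of u v w] ip_sym[OF add_mem, of u v w] ip_sym[of u w] ip_sym[of v w] by simp

lemma ip_scale_right: "v \<in> X \<Longrightarrow> w \<in> X \<Longrightarrow> ip w (\<lambda>x. c *\<^sub>R v x) = c * ip w v"
  using ip_scale[of v w c] ip_sym[OF scale_mem, of v w c] ip_sym[of v w] by simp

lemma ip_diff_right: "u \<in> X \<Longrightarrow> v \<in> X \<Longrightarrow> w \<in> X \<Longrightarrow> ip w (\<lambda>x. u x - v x) = ip w u - ip w v"
  using ip_diff[of u v w] ip_sym[OF diff_mem, of u v w] ip_sym[of u w] ip_sym[of v w] by simp

lemma ip_comb: assumes "\<And>i. i \<in> I \<Longrightarrow> e i \<in> X" "w \<in> X"
  shows "ip (\<lambda>x. \<Sum>i\<in>I. c i *\<^sub>R e i x) w = (\<Sum>i\<in>I. c i * ip (e i) w)"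
  using assms
proof (induction I rule: infinite_finite_induct)
  case (insert i I)
  then have "ip (\<lambda>x. c i *\<^sub>R e i x + (\<Sum>i\<in>I. c i *\<^sub>R e i x)) w
      = c i * ip (e i) w + ip (\<lambda>x. \<Sum>i\<in>I. c i *\<^sub>R e i x) w"
    by (subst ip_add) (auto simp: ip_scale scale_mem comb_mem)
  with insert show ?case by simp
qed (auto simp: ip_zero)

lemma ip_comb_right: assumes "\<And>i. i \<in> I \<Longrightarrow> e i \<in> X" "w \<in> X"
  shows "ip w (\<lambda>x. \<Sum>i\<in>I. c i *\<^sub>R e i x) = (\<Sum>i\<in>I. c i * ip w (e i))"
  using ip_comb[OF assms, where c=c] assms by (simp add: comb_mem ip_sym)

lemma nrm_nonneg: "v \<in> X \<Longrightarrow> 0 \<le> nrm v"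
  by (simp add: nrm_def ip_pos)

lemma nrm_sq: "v \<in> X \<Longrightarrow> (nrm v)\<^sup>2 = ip v v"
  by (simp add: nrm_def ip_pos)

lemma cauchy_schwarz: assumes v: "v \<in> X" and w: "w \<in> X" shows "\<bar>ip v w\<bar> \<le> nrm v * nrm w"
proof -
  have q: "0 \<le> ip v v - 2 * t * ip v w + t\<^sup>2 * ip w w" for t
  proof -
    have "0 \<le> ip (\<lambda>x. v x - t *\<^sub>R w x) (\<lambda>x. v x - t *\<^sub>R w x)"
      by (intro ip_pos diff_mem scale_mem v w)
    also have "\<dots> = ip v v - t * ip v w - t * (ip w v - t * ip w w)"
      using v w by (simp add: ip_diff ip_diff_right ip_scale ip_scale_right diff_mem scale_mem
          algebra_simps)
    finally show ?thesis using ip_sym[OF v w] by (simp add: power2_eq_square algebra_simps)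
  qed
  have "(ip v w)\<^sup>2 \<le> ip v v * ip w w"
  proof (cases "ip w w = 0")
    case True
    have "ip v w = 0"
    proof (rule ccontr)
      assume n: "ip v w \<noteq> 0"
      show False using q[of "(ip v v + 1) / (2 * ip v w)"] True n by (simp add: field_simps)
    qed
    then show ?thesis using True by simp
  next
    case False
    then have "ip w w > 0" using ip_pos[OF w] by simp
    then show ?thesis using q[of "ip v w / ip w w"]
      by (simp add: power2_eq_square field_simps)
  qed
  then have "sqrt ((ip v w)\<^sup>2) \<le> sqrt (ip v v * ip w w)" by (rule real_sqrt_le_mono)
  then show ?thesis by (simp add: nrm_def real_sqrt_mult)
qed

lemma ip_null: "v \<in> X \<Longrightarrow> w \<in> X \<Longrightarrow> nrm v = 0 \<Longrightarrow> ip v w = 0"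
  using cauchy_schwarz[of v w] by simp

lemma nrm_triangle: assumes v: "v \<in> X" and w: "w \<in> X"
  shows "nrm (\<lambda>x. v x + w x) \<le> nrm v + nrm w"
proof -
  have "(nrm (\<lambda>x. v x + w x))\<^sup>2 = ip v v + 2 * ip v w + ip w w"
    using v w ip_sym[OF v w] by (simp add: nrm_sq add_mem ip_add ip_add_right)
  also have "\<dots> \<le> (nrm v + nrm w)\<^sup>2"
    using cauchy_schwarz[OF v w] v w by (simp add: power2_sum nrm_sq)
  finally show ?thesis using v w by (meson add_nonneg_nonneg nrm_nonneg power2_le_imp_le)
qed

lemma nrm_scale: "v \<in> X \<Longrightarrow> nrm (\<lambda>x. c *\<^sub>R v x) = \<bar>c\<bar> * nrm v"
  by (simp add: nrm_def ip_scale ip_scale_right scale_mem real_sqrt_mult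
      flip: mult.assoc power2_eq_square)

lemma nrm_minus: "v \<in> X \<Longrightarrow> nrm (\<lambda>x. - v x) = nrm v"
  using nrm_scale[of v "-1"] by simp

lemma nrm_minus_commute: "v \<in> X \<Longrightarrow> w \<in> X \<Longrightarrow> nrm (\<lambda>x. v x - w x) = nrm (\<lambda>x. w x - v x)"
  using nrm_minus[OF diff_mem, of v w] by simp

lemma nrm_diff_triangle: assumes v: "v \<in> X" and w: "w \<in> X"
  shows "nrm (\<lambda>x. v x - w x) \<le> nrm v + nrm w"
  using nrm_triangle[OF v scale_mem[OF w, of "-1"]] nrm_minus[OF w] by simp

lemma nrm_triangle_sub: assumes v: "v \<in> X" and w: "w \<in> X"
  shows "nrm v \<le> nrm w + nrm (\<lambda>x. v x - w x)"
  using nrm_triangle[OF w diff_mem[OF v w]] by simp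

lemma nrm_triangle_via: assumes "u \<in> X" "v \<in> X" "w \<in> X"
  shows "nrm (\<lambda>x. u x - w x) \<le> nrm (\<lambda>x. u x - v x) + nrm (\<lambda>x. v x - w x)"
  using nrm_triangle[OF diff_mem[OF assms(1,2)] diff_mem[OF assms(2,3)]] by simp

text \<open>By Pythagoras, \<open>\<parallel>v - z\<parallel>\<^sup>2 = \<parallel>v - p\<parallel>\<^sup>2 + \<parallel>p - z\<parallel>\<^sup>2\<close>. Orthogonality is asked for one direction only, so
  that \<open>p\<close> need not be a projection of \<open>v\<close>.\<close>
lemma best_approximation: assumes "v \<in> X" "p \<in> X" "z \<in> X"
  and orth: "ip (\<lambda>x. v x - p x) (\<lambda>x. p x - z x) = 0"
  shows "nrm (\<lambda>x. v x - p x) \<le> nrm (\<lambda>x. v x - z x)"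
proof -
  let ?f = "\<lambda>x. v x - p x" and ?g = "\<lambda>x. p x - z x"
  have f: "?f \<in> X" and g: "?g \<in> X" using assms by (auto intro: diff_mem)
  have "(nrm (\<lambda>x. ?f x + ?g x))\<^sup>2 = ip ?f (\<lambda>x. ?f x + ?g x) + ip ?g (\<lambda>x. ?f x + ?g x)"
    unfolding nrm_sq[OF add_mem[OF f g]] by (rule ip_add[OF f g add_mem[OF f g]])
  also have "\<dots> = (nrm ?f)\<^sup>2 + (nrm ?g)\<^sup>2"
    unfolding ip_add_right[OF f g f] ip_add_right[OF f g g] nrm_sq[OF f] nrm_sq[OF g] orth
      ip_sym[OF g f] by (rule refl[THEN trans]) (simp only: add_0_left add_0_right)
  finally have "(nrm (\<lambda>x. v x - z x))\<^sup>2 = (nrm ?f)\<^sup>2 + (nrm ?g)\<^sup>2" by simp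
  then have "(nrm (\<lambda>x. v x - p x))\<^sup>2 \<le> (nrm (\<lambda>x. v x - z x))\<^sup>2" by simp
  then show ?thesis by (rule power2_le_imp_le) (intro nrm_nonneg diff_mem assms)
qed

definition orthonormal :: "nat \<Rightarrow> (nat \<Rightarrow> 'x \<Rightarrow> 'b) \<Rightarrow> bool" where
  "orthonormal n e \<longleftrightarrow> (\<forall>i<n. e i \<in> X) \<and> (\<forall>i<n. \<forall>j<n. ip (e i) (e j) = (if i = j then 1 else 0))"

definition proj :: "nat \<Rightarrow> (nat \<Rightarrow> 'x \<Rightarrow> 'b) \<Rightarrow> ('x \<Rightarrow> 'b) \<Rightarrow> 'x \<Rightarrow> 'b" where
  "proj n e v = (\<lambda>x. \<Sum>i<n. ip v (e i) *\<^sub>R e i x)"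

lemma proj_mem: "orthonormal n e \<Longrightarrow> proj n e v \<in> X"
  unfolding proj_def orthonormal_def by (intro comb_mem) auto

lemma proj_orth: assumes o: "orthonormal n e" and v: "v \<in> X" and "i < n"
  shows "ip (\<lambda>x. v x - proj n e v x) (e i) = 0"
proof -
  have e: "\<And>j. j < n \<Longrightarrow> e j \<in> X" using o by (simp add: orthonormal_def)
  have "ip (proj n e v) (e i) = (\<Sum>j<n. ip v (e j) * ip (e j) (e i))"
    unfolding proj_def using e \<open>i < n\<close> by (subst ip_comb) auto
  also have "\<dots> = (\<Sum>j<n. if j = i then ip v (e j) else 0)"
    using o \<open>i < n\<close> by (intro sum.cong) (auto simp: orthonormal_def)
  also have "\<dots> = ip v (e i)" using \<open>i < n\<close> by simp
  finally show ?thesis using proj_mem[OF o] v e[OF \<open>i < n\<close>] by (simp add: ip_diff)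
qed

text \<open>Elements of \<open>V\<close> are recovered from their coefficients only up to a function of norm zero: functions
  that agree almost everywhere are different elements of \<open>X\<close>.\<close>
definition spans :: "('x \<Rightarrow> 'b) set \<Rightarrow> nat \<Rightarrow> (nat \<Rightarrow> 'x \<Rightarrow> 'b) \<Rightarrow> bool" where
  "spans V n e \<longleftrightarrow> orthonormal n e \<and> (\<forall>i<n. e i \<in> V) \<and>
     (\<forall>v\<in>V. nrm (\<lambda>x. v x - proj n e v x) = 0)"

lemma proj_orth_spanned: assumes V: "spans V n e" "V \<subseteq> X" and v: "v \<in> X" and w: "w \<in> V"
  shows "ip (\<lambda>x. v x - proj n e v x) w = 0"
proof -
  have o: "orthonormal n e" using V by (simp add: spans_def)
  have e: "\<And>j. j < n \<Longrightarrow> e j \<in> X" using o by (simp add: orthonormal_def)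
  have w': "w \<in> X" using V w by auto
  let ?d = "\<lambda>x. v x - proj n e v x"
  have d: "?d \<in> X" using v proj_mem[OF o] by (intro diff_mem)
  have "ip (\<lambda>x. w x - proj n e w x) ?d = 0"
    using V w by (intro ip_null[OF diff_mem[OF w' proj_mem[OF o]] d]) (auto simp: spans_def)
  then have "ip w ?d = ip (proj n e w) ?d" using w' d proj_mem[OF o] by (simp add: ip_diff)
  also have "\<dots> = (\<Sum>i<n. ip w (e i) * ip (e i) ?d)"
    unfolding proj_def[of _ _ w] using e d by (subst ip_comb) auto
  also have "\<dots> = 0" using proj_orth[OF o v] e d by (intro sum.neutral) (auto simp: ip_sym)
  finally show ?thesis using w' d by (simp add: ip_sym)
qed

lemma ip_spanned_expand: assumes V: "spans V n e" "V \<subseteq> X" and v: "v \<in> V" and w: "w \<in> X"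
  shows "ip v w = (\<Sum>i<n. ip v (e i) * ip (e i) w)"
proof -
  have o: "orthonormal n e" using V by (simp add: spans_def)
  have e: "\<And>j. j < n \<Longrightarrow> e j \<in> X" using o by (simp add: orthonormal_def)
  have v': "v \<in> X" using V v by auto
  have "ip (\<lambda>x. v x - proj n e v x) w = 0"
    using V v by (intro ip_null[OF diff_mem[OF v' proj_mem[OF o]] w]) (auto simp: spans_def)
  then have "ip v w = ip (proj n e v) w" using v' w proj_mem[OF o] by (simp add: ip_diff)
  also have "\<dots> = (\<Sum>i<n. ip v (e i) * ip (e i) w)"
    unfolding proj_def using e w by (subst ip_comb) auto
  finally show ?thesis .
qed

lemma nrm_comb: assumes o: "orthonormal n e"
  shows "(nrm (\<lambda>x. \<Sum>i<n. c i *\<^sub>R e i x))\<^sup>2 = (\<Sum>i<n. (c i)\<^sup>2)"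
proof -
  have e: "\<And>j. j < n \<Longrightarrow> e j \<in> X" using o by (simp add: orthonormal_def)
  have "(nrm (\<lambda>x. \<Sum>i<n. c i *\<^sub>R e i x))\<^sup>2 = (\<Sum>i<n. c i * (\<Sum>j<n. c j * ip (e i) (e j)))"
  proof -
    have m: "(\<lambda>x. \<Sum>i<n. c i *\<^sub>R e i x) \<in> X" by (rule comb_mem) (simp add: e)
    then have "ip (\<lambda>x. \<Sum>i<n. c i *\<^sub>R e i x) (\<lambda>x. \<Sum>i<n. c i *\<^sub>R e i x)
        = (\<Sum>i<n. c i * ip (e i) (\<lambda>x. \<Sum>j<n. c j *\<^sub>R e j x))"
      using e by (intro ip_comb) auto
    also have "\<dots> = (\<Sum>i<n. c i * (\<Sum>j<n. c j * ip (e i) (e j)))"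
      using e by (intro sum.cong refl arg_cong2[where f="(*)"] ip_comb_right) auto
    finally show ?thesis by (simp add: nrm_sq[OF m])

  qed
  also have "\<dots> = (\<Sum>i<n. c i * (\<Sum>j<n. if j = i then c j else 0))"
    using o by (intro sum.cong refl arg_cong2[where f="(*)"]) (auto simp: orthonormal_def)
  finally show ?thesis by (simp add: power2_eq_square)
qed

text \<open>Gram-Schmidt, by induction on the number of coordinates: the elements whose coordinate \<open>j\<close> vanishes
  form a subspace that has a basis by induction, and one further vector suffices to span \<open>V\<close>. The
  relation \<open>R v c\<close> says that \<open>c\<close> is a coordinate vector of \<open>v\<close>; it need not be functional, because
  coordinates of almost everywhere defined functions are not unique.\<close>
lemma finite_orthonormal_basis:
  fixes R :: "('x \<Rightarrow> 'b) \<Rightarrow> ('k \<Rightarrow> real) \<Rightarrow> bool"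
  assumes "finite J" "V \<subseteq> X"
    and "\<And>v w. v \<in> V \<Longrightarrow> w \<in> V \<Longrightarrow> (\<lambda>x. v x + w x) \<in> V"
    and "\<And>v k. v \<in> V \<Longrightarrow> (\<lambda>x. k *\<^sub>R v x) \<in> V"
    and "\<And>v. v \<in> V \<Longrightarrow> \<exists>c. R v c"
    and "\<And>v w c d. v \<in> V \<Longrightarrow> w \<in> V \<Longrightarrow> R v c \<Longrightarrow> R w d \<Longrightarrow> R (\<lambda>x. v x + w x) (\<lambda>j. c j + d j)"
    and "\<And>v c k. v \<in> V \<Longrightarrow> R v c \<Longrightarrow> R (\<lambda>x. k *\<^sub>R v x) (\<lambda>j. k * c j)"
    and "\<And>v c. v \<in> V \<Longrightarrow> R v c \<Longrightarrow> (\<forall>j\<in>J. c j = 0) \<Longrightarrow> nrm v = 0"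
  shows "\<exists>n e. spans V n e"
  using assms
proof (induction J arbitrary: V R rule: finite_induct)
  case empty
  have "spans V 0 e" for e
    using empty(1,4,7) by (fastforce simp: spans_def orthonormal_def proj_def)
  then show ?case by blast
next
  case (insert j J)
  note VX = insert.prems(1) and Va = insert.prems(2) and Vs = insert.prems(3)
    and Re = insert.prems(4) and Ra = insert.prems(5) and Rs = insert.prems(6)
    and R0 = insert.prems(7)
  \<comment> \<open>The subspace on which the coordinate \<open>j\<close> can be chosen to be zero.\<close>
  define V' where "V' = {v \<in> V. \<exists>c. R v c \<and> c j = 0}"
  have "\<exists>n e. spans V' n e"
  proof (rule insert.IH[where R = "\<lambda>v c. R v c \<and> c j = 0"])
    show "V' \<subseteq> X" using VX by (auto simp: V'_def)
    show "(\<lambda>x. v x + w x) \<in> V'" if vw: "v \<in> V'" "w \<in> V'" for v w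
    proof -
      obtain c d where "R v c" "c j = 0" "R w d" "d j = 0" using vw by (auto simp: V'_def)
      with vw have "R (\<lambda>x. v x + w x) (\<lambda>j. c j + d j)" "c j + d j = 0" by (auto simp: V'_def intro!: Ra)
      moreover have "(\<lambda>x. v x + w x) \<in> V" using vw by (auto simp: V'_def intro!: Va)
      ultimately show ?thesis unfolding V'_def by (auto intro!: exI[of _ "\<lambda>j. c j + d j"])
    qed
    show "(\<lambda>x. k *\<^sub>R v x) \<in> V'" if v: "v \<in> V'" for v k
    proof -
      obtain c where "R v c" "c j = 0" using v by (auto simp: V'_def)
      with v have "R (\<lambda>x. k *\<^sub>R v x) (\<lambda>j. k * c j)" "k * c j = 0" by (auto simp: V'_def intro!: Rs)
      moreover have "(\<lambda>x. k *\<^sub>R v x) \<in> V" using v by (auto simp: V'_def intro!: Vs)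
      ultimately show ?thesis unfolding V'_def by (auto intro!: exI[of _ "\<lambda>j. k * c j"])
    qed
    show "\<exists>c. R v c \<and> c j = 0" if "v \<in> V'" for v using that by (simp add: V'_def)
    show "nrm v = 0" if "v \<in> V'" "R v c \<and> c j = 0" "\<forall>i\<in>J. c i = 0" for v c
      using that by (intro R0[of v c]) (auto simp: V'_def)
  qed (auto simp: V'_def intro!: Ra Rs)
  then obtain n e where V': "spans V' n e" by blast
  have o: "orthonormal n e" and eV': "\<And>i. i < n \<Longrightarrow> e i \<in> V'" using V' by (auto simp: spans_def)
  have e: "\<And>i. i < n \<Longrightarrow> e i \<in> X" using o by (simp add: orthonormal_def)
  show ?case
  proof (cases "\<forall>v\<in>V. nrm (\<lambda>x. v x - proj n e v x) = 0")
    case True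
    then have "spans V n e" using V' by (auto simp: spans_def V'_def)
    then show ?thesis by blast
  next
    case False
    then obtain v0 where v0: "v0 \<in> V" "nrm (\<lambda>x. v0 x - proj n e v0 x) \<noteq> 0" by blast
    define r0 where "r0 = (\<lambda>x. v0 x - proj n e v0 x)"
    define r where "r = (\<lambda>x. (1 / nrm r0) *\<^sub>R r0 x)"
    have v0X: "v0 \<in> X" using VX v0 by auto
    have VdiffV: "(\<lambda>x. v x - w x) \<in> V" if "v \<in> V" "w \<in> V" for v w
      using Va[OF that(1) Vs[OF that(2), of "-1"]] by simp
    have V0: "(\<lambda>x. 0) \<in> V" using Vs[OF v0(1), of 0] by simp
    have combV: "(\<lambda>x. \<Sum>i\<in>I. c i *\<^sub>R e i x) \<in> V" if "I \<subseteq> {..<n}" for c I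
      using finite_subset[OF that finite_lessThan] that
    proof (induction I rule: finite_induct)
      case (insert i I)
      then show ?case using Va[OF Vs[of "e i" "c i"], of "\<lambda>x. \<Sum>i\<in>I. c i *\<^sub>R e i x"] eV'[of i]
        by (simp add: V'_def)
    qed (simp add: V0)
    have projV: "proj n e v \<in> V" for v unfolding proj_def by (rule combV[OF order_refl])
    have r0V: "r0 \<in> V" unfolding r0_def using v0 projV by (intro VdiffV)
    have rV: "r \<in> V" unfolding r_def using r0V by (intro Vs)
    have r0X: "r0 \<in> X" and rX: "r \<in> X" using r0V rV VX by auto
    have nr: "nrm r = 1" unfolding r_def using r0X v0 nrm_nonneg[OF r0X] by (subst nrm_scale) (auto simp: r0_def)
    then have irr: "ip r r = 1" using nrm_sq[OF rX] by simp
    have ire: "ip r (e i) = 0" "ip (e i) r = 0" if "i < n" for i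
    proof -
      show "ip r (e i) = 0" unfolding r_def using proj_orth[OF o v0X that] r0X e[OF that]
        by (simp add: ip_scale r0_def)
      then show "ip (e i) r = 0" using ip_sym rX e that by auto
    qed
    define e' where "e' = e(n := r)"
    have o': "orthonormal (Suc n) e'"
      using o rX irr ire by (auto simp: orthonormal_def e'_def less_Suc_eq)
    have e'V: "\<And>i. i < Suc n \<Longrightarrow> e' i \<in> V" using eV' rV by (auto simp: e'_def V'_def less_Suc_eq)
    obtain d where d: "R r d" using Re[OF rV] by blast
    \<comment> \<open>Otherwise \<open>r\<close> would be in the smaller space and orthogonal to it, hence null.\<close>
    have dj: "d j \<noteq> 0"
    proof
      assume "d j = 0"
      then have "r \<in> V'" using d rV by (auto simp: V'_def)
      then have "nrm (\<lambda>x. r x - proj n e r x) = 0" using V' by (auto simp: spans_def)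
      moreover have "proj n e r = (\<lambda>x. 0)" using ire by (auto simp: proj_def)
      ultimately show False using nr by simp
    qed
    have "nrm (\<lambda>x. v x - proj (Suc n) e' v x) = 0" if v: "v \<in> V" for v
    proof -
      have vX: "v \<in> X" using v VX by auto
      obtain c where c: "R v c" using Re[OF v] by blast
      \<comment> \<open>Subtracting this multiple of \<open>r\<close> makes the coordinate \<open>j\<close> vanish.\<close>
      define k where "k = c j / d j"
      define w where "w = (\<lambda>x. v x + (- k) *\<^sub>R r x)"
      have "R w (\<lambda>j. c j + (- k) * d j)" unfolding w_def
        by (intro Ra Rs Vs v rV c d)
      moreover have "c j + (- k) * d j = 0" using dj by (simp add: k_def)
      moreover have wV: "w \<in> V" unfolding w_def by (intro Va Vs v rV)
      ultimately have "w \<in> V'" unfolding V'_def by (auto intro!: exI[of _ "\<lambda>j. c j + (- k) * d j"])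
      then have w0: "nrm (\<lambda>x. w x - proj n e w x) = 0" using V' by (auto simp: spans_def)
      have wX: "w \<in> X" using wV VX by auto
      let ?f = "\<lambda>x. w x - proj n e w x"
      have fX: "?f \<in> X" by (intro diff_mem wX proj_mem o)
      have we: "ip w (e i) = ip v (e i)" if "i < n" for i
        using ire[OF that] e[OF that] vX rX
        unfolding w_def by (subst ip_add) (auto simp: ip_scale scale_mem simp del: scaleR_minus_left)
      have pw: "proj n e w = proj n e v" unfolding proj_def using we by (intro ext sum.cong) auto
      have "ip ?f r = 0" using ip_null[OF fX rX w0] .
      moreover have "ip (proj n e v) r = 0"
        unfolding proj_def using e rX ire by (subst ip_comb) auto
      moreover have "ip w r = ip v r - k"
        unfolding w_def using vX rX irr
        by (subst ip_add) (auto simp: ip_scale scale_mem simp del: scaleR_minus_left)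
      ultimately have vr: "ip v r = k" using wX proj_mem[OF o] rX by (simp add: ip_diff pw)
      have "proj (Suc n) e' v = (\<lambda>x. proj n e v x + k *\<^sub>R r x)"
        unfolding proj_def by (auto simp: e'_def vr)
      then have "(\<lambda>x. v x - proj (Suc n) e' v x) = ?f"
        unfolding pw by (auto simp: w_def)
      then show ?thesis using w0 by simp
    qed
    then have "spans V (Suc n) e'" using o' e'V by (auto simp: spans_def)
    then show ?thesis by blast
  qed
qed

end

section \<open>The space of square integrable functions\<close>

lemma L2_I: "g \<in> borel_measurable (lebesgue_on S) \<Longrightarrow>
    integrable (lebesgue_on S) (\<lambda>x. (norm (g x))\<^sup>2) \<Longrightarrow> g \<in> L2 S"
  by (simp add: L2_def)

lemma L2_measurable: "g \<in> L2 S \<Longrightarrow> g \<in> borel_measurable (lebesgue_on S)"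
  by (simp add: L2_def)

lemma L2_zero: "(\<lambda>x. 0) \<in> L2 S" by (simp add: L2_def)

lemma L2_scale: "g \<in> L2 S \<Longrightarrow> (\<lambda>x. c *\<^sub>R g x) \<in> L2 S"
  by (auto simp: L2_def power_mult_distrib)

lemma L2_bound: assumes "f \<in> borel_measurable (lebesgue_on S)" "g \<in> L2 S"
  "AE x in lebesgue_on S. norm (f x) \<le> c * norm (g x)" shows "f \<in> L2 S"
proof (rule L2_I[OF assms(1)], rule Bochner_Integration.integrable_bound)
  show "integrable (lebesgue_on S) (\<lambda>x. c\<^sup>2 * (norm (g x))\<^sup>2)" using assms(2) by (simp add: L2_def)
  show "AE x in lebesgue_on S. norm ((norm (f x))\<^sup>2) \<le> norm (c\<^sup>2 * (norm (g x))\<^sup>2)"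
    using assms(3) by eventually_elim (simp add: flip: power_mult_distrib, intro power_mono, auto)
qed (use assms(1) in measurable)

lemma L2_add: fixes f g :: "'a::euclidean_space \<Rightarrow> 'b::euclidean_space"
  assumes f: "f \<in> L2 S" and g: "g \<in> L2 S" shows "(\<lambda>x. f x + g x) \<in> L2 S"
proof (rule L2_I)
  note [measurable] = L2_measurable[OF f] L2_measurable[OF g]
  show "(\<lambda>x. f x + g x) \<in> borel_measurable (lebesgue_on S)" by measurable
  show "integrable (lebesgue_on S) (\<lambda>x. (norm (f x + g x))\<^sup>2)"
  proof (rule Bochner_Integration.integrable_bound)
    show "integrable (lebesgue_on S) (\<lambda>x. 2 * (norm (f x))\<^sup>2 + 2 * (norm (g x))\<^sup>2)"
      using f g by (simp add: L2_def)
    have "(norm (f x + g x))\<^sup>2 \<le> 2 * (norm (f x))\<^sup>2 + 2 * (norm (g x))\<^sup>2" for x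
    proof -
      have "(norm (f x + g x))\<^sup>2 \<le> (norm (f x) + norm (g x))\<^sup>2"
        by (intro power_mono norm_triangle_ineq) auto
      also have "\<dots> \<le> 2 * (norm (f x))\<^sup>2 + 2 * (norm (g x))\<^sup>2"
        using sum_squares_bound[of "norm (f x)" "norm (g x)"] by (simp add: power2_sum)
      finally show ?thesis .
    qed
    then show "AE x in lebesgue_on S. norm ((norm (f x + g x))\<^sup>2)
        \<le> norm (2 * (norm (f x))\<^sup>2 + 2 * (norm (g x))\<^sup>2)" by auto
  qed measurable
qed

lemma L2_diff: fixes f g :: "'a::euclidean_space \<Rightarrow> 'b::euclidean_space"
  assumes "f \<in> L2 S" "g \<in> L2 S" shows "(\<lambda>x. f x - g x) \<in> L2 S"
  using L2_add[OF assms(1) L2_scale[OF assms(2), of "-1"]] by simp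

text \<open>For vector-valued functions, so that it covers gradients as well as the scalar case \<open>l2ip\<close>.\<close>
definition vip :: "'a::euclidean_space set \<Rightarrow> ('a \<Rightarrow> 'b::euclidean_space) \<Rightarrow> ('a \<Rightarrow> 'b) \<Rightarrow> real" where
  "vip S f g = (LINT x|lebesgue_on S. f x \<bullet> g x)"

lemma L2_integrable_inner: fixes f g :: "'a::euclidean_space \<Rightarrow> 'b::euclidean_space"
  assumes f: "f \<in> L2 S" and g: "g \<in> L2 S" shows "integrable (lebesgue_on S) (\<lambda>x. f x \<bullet> g x)"
proof (rule Bochner_Integration.integrable_bound)
  note [measurable] = L2_measurable[OF f] L2_measurable[OF g]
  show "integrable (lebesgue_on S) (\<lambda>x. (norm (f x))\<^sup>2 + (norm (g x))\<^sup>2)"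
    using f g by (simp add: L2_def)
  show "(\<lambda>x. f x \<bullet> g x) \<in> borel_measurable (lebesgue_on S)" by measurable
  have "\<bar>f x \<bullet> g x\<bar> \<le> (norm (f x))\<^sup>2 + (norm (g x))\<^sup>2" for x
  proof -
    have "\<bar>f x \<bullet> g x\<bar> \<le> norm (f x) * norm (g x)" by (rule Cauchy_Schwarz_ineq2)
    then show ?thesis using sum_squares_bound[of "norm (f x)" "norm (g x)"]
        mult_nonneg_nonneg[OF norm_ge_zero[of "f x"] norm_ge_zero[of "g x"]] by linarith
  qed
  then show "AE x in lebesgue_on S. norm (f x \<bullet> g x) \<le> norm ((norm (f x))\<^sup>2 + (norm (g x))\<^sup>2)"
    by auto
qed

interpretation L2: semi_inner_space "L2 S" "vip S"
  for S :: "'a::euclidean_space set"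
proof unfold_locales
  show "vip S v w = vip S w v" for v w :: "'a \<Rightarrow> 'b"
    unfolding vip_def by (simp only: inner_commute)
qed (auto simp: L2_zero L2_add L2_scale vip_def inner_add_left L2_integrable_inner)

lemma l2norm_eq_nrm: "l2norm S g = L2.nrm S g"
  by (simp add: l2norm_def L2.nrm_def vip_def power2_norm_eq_inner)

lemma l2ip_eq_vip: "l2ip S = vip S"
  by (intro ext) (simp add: l2ip_def vip_def)

lemma l2norm_nonneg [simp]: "0 \<le> l2norm S g"
  by (simp add: l2norm_def)

lemma l2norm_zero_iff: assumes "g \<in> L2 S" shows "l2norm S g = 0 \<longleftrightarrow> (AE x in lebesgue_on S. g x = 0)"
  using assms by (auto simp: l2norm_def L2_def integral_nonneg_eq_0_iff_AE)

lemma vip_cong: assumes "AE x in lebesgue_on S. f x = f' x" "AE x in lebesgue_on S. g x = g' x"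
  "f \<in> L2 S" "g \<in> L2 S" "f' \<in> L2 S" "g' \<in> L2 S"
  shows "vip S f g = vip S f' g'"
  unfolding vip_def
  by (intro integral_cong_AE borel_measurable_inner L2_measurable assms)
    (use assms(1,2) in eventually_elim, simp)

lemma L2_AE_cong: "f \<in> L2 S \<Longrightarrow> g \<in> borel_measurable (lebesgue_on S) \<Longrightarrow>
   AE x in lebesgue_on S. f x = g x \<Longrightarrow> g \<in> L2 S"
  by (rule L2_bound[where c=1 and g=f]) auto

lemma l2norm_cong: assumes "AE x in lebesgue_on S. norm (f x) = norm (g x)"
  "f \<in> borel_measurable (lebesgue_on S)" "g \<in> borel_measurable (lebesgue_on S)"
  shows "l2norm S f = l2norm S g"
proof -
  note [measurable] = assms(2,3)
  have "(LINT x|lebesgue_on S. (norm (f x))\<^sup>2) = (LINT x|lebesgue_on S. (norm (g x))\<^sup>2)"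
  proof (rule integral_cong_AE)
    show "AE x in lebesgue_on S. (norm (f x))\<^sup>2 = (norm (g x))\<^sup>2"
      using assms(1) by eventually_elim simp
  qed measurable
  then show ?thesis unfolding l2norm_def by simp
qed

lemma l2norm_mono: assumes "AE x in lebesgue_on S. norm (f x) \<le> norm (g x)"
  "f \<in> borel_measurable (lebesgue_on S)" "g \<in> L2 S"
  shows "l2norm S f \<le> l2norm S g"
proof -
  have "f \<in> L2 S" using assms by (auto intro: L2_bound[where c=1, OF _ assms(3)])
  then have "integrable (lebesgue_on S) (\<lambda>x. (norm (f x))\<^sup>2)" by (simp add: L2_def)
  moreover have "integrable (lebesgue_on S) (\<lambda>x. (norm (g x))\<^sup>2)" using assms(3) by (simp add: L2_def)
  moreover have "AE x in lebesgue_on S. (norm (f x))\<^sup>2 \<le> (norm (g x))\<^sup>2"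
    using assms(1) by eventually_elim (intro power_mono, auto)
  ultimately have "(LINT x|lebesgue_on S. (norm (f x))\<^sup>2) \<le> (LINT x|lebesgue_on S. (norm (g x))\<^sup>2)"
    by (rule integral_mono_AE)
  then show ?thesis unfolding l2norm_def by simp
qed

section \<open>Smooth functions\<close>

text \<open>A class of functions that contains the partial derivatives of its members consists of smooth
  functions. This replaces the choice of all iterated derivatives at once.\<close>
lemma smooth_coinduct:
  fixes P :: "('a::euclidean_space \<Rightarrow> real) \<Rightarrow> bool"
  assumes "P \<phi>"
    and step: "\<And>f. P f \<Longrightarrow> \<exists>g. (\<forall>i\<in>Basis. P (g i)) \<and>
      (\<forall>x. (f has_derivative (\<lambda>h. \<Sum>i\<in>Basis. g i x * (h \<bullet> i))) (at x))"
  shows "smooth \<phi>"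
proof -
  define G where "G f = (SOME g. (\<forall>i\<in>Basis. P (g i)) \<and>
      (\<forall>x. (f has_derivative (\<lambda>h. \<Sum>i\<in>Basis. g i x * (h \<bullet> i))) (at x)))" for f
  have G: "(\<forall>i\<in>Basis. P (G f i)) \<and>
      (\<forall>x. (f has_derivative (\<lambda>h. \<Sum>i\<in>Basis. G f i x * (h \<bullet> i))) (at x))" if "P f" for f
    unfolding G_def by (rule someI_ex[OF step[OF that]])
  define D where "D = rec_list \<phi> (\<lambda>i is d. if i \<in> Basis \<and> P d then G d i else (\<lambda>x::'a. 0::real))"
  have D: "D [] = \<phi>" "\<And>i is. D (i # is) = (if i \<in> Basis \<and> P (D is) then G (D is) i else (\<lambda>x. 0))"
    by (simp_all add: D_def)
  have P: "P (D is) \<or> D is = (\<lambda>x. 0)" for "is"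
    by (induction "is") (use G in \<open>auto simp: D assms(1)\<close>)
  have "(D is has_derivative (\<lambda>h. \<Sum>i\<in>Basis. D (i # is) x * (h \<bullet> i))) (at x)" for "is" x
  proof (cases "P (D is)")
    case True
    then show ?thesis using G[OF True] by (simp add: D cong: sum.cong)
  next
    case False
    then show ?thesis using P[of "is"] by (simp add: D)
  qed
  then show ?thesis unfolding smooth_def by (intro exI[of _ D] conjI allI D(1))
qed

lemma smooth_derivatives:
  assumes "smooth f"
  obtains g where "\<And>i. smooth (g i)"
    "\<And>x. (f has_derivative (\<lambda>h. \<Sum>i\<in>Basis. g i x * (h \<bullet> i))) (at x)"
proof -
  obtain D where D: "D [] = f" "\<And>is x. (D is has_derivative (\<lambda>h. \<Sum>i\<in>Basis. D (i # is) x * (h \<bullet> i))) (at x)"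
    using assms unfolding smooth_def by blast
  show ?thesis
  proof
    show "smooth (D [i])" for i
      unfolding smooth_def
      by (rule exI[of _ "\<lambda>is. D (is @ [i])"]) (use D(2)[of "_ @ [i]"] in auto)
    show "(f has_derivative (\<lambda>h. \<Sum>i\<in>Basis. D [i] x * (h \<bullet> i))) (at x)" for x
      using D(2)[of "[]"] D(1) by simp
  qed
qed

lemma smooth_const: "smooth (\<lambda>x. c)"
proof (rule smooth_coinduct[where P="\<lambda>f. \<exists>c. f = (\<lambda>x. c)"])
  fix f :: "'a \<Rightarrow> real" assume "\<exists>c. f = (\<lambda>x. c)"
  then show "\<exists>g. (\<forall>i\<in>Basis. \<exists>c. g i = (\<lambda>x. c)) \<and>
      (\<forall>x. (f has_derivative (\<lambda>h. \<Sum>i\<in>Basis. g i x * (h \<bullet> i))) (at x))"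
    by (intro exI[of _ "\<lambda>i x. 0"]) auto
qed auto

text \<open>Products of smooth functions are not closed under differentiation, because the product rule yields
  sums of products. The algebra generated by the smooth functions is closed, so coinduction
  applies to it.\<close>
inductive smooth_algebra :: "('a::euclidean_space \<Rightarrow> real) \<Rightarrow> bool" where
  base: "smooth f \<Longrightarrow> smooth_algebra f"
| add: "smooth_algebra f \<Longrightarrow> smooth_algebra g \<Longrightarrow> smooth_algebra (\<lambda>x. f x + g x)"
| mult: "smooth_algebra f \<Longrightarrow> smooth_algebra g \<Longrightarrow> smooth_algebra (\<lambda>x. f x * g x)"

lemma smooth_algebra_smooth: "smooth_algebra f \<Longrightarrow> smooth f"
proof (erule smooth_coinduct)
  show "\<exists>g. (\<forall>i\<in>Basis. smooth_algebra (g i)) \<and>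
      (\<forall>x. (f has_derivative (\<lambda>h. \<Sum>i\<in>Basis. g i x * (h \<bullet> i))) (at x))"
    if "smooth_algebra f" for f :: "'a \<Rightarrow> real"
    using that
  proof induction
    case (base f)
    obtain g where g: "\<And>i. smooth (g i)"
      "\<And>x. (f has_derivative (\<lambda>h. \<Sum>i\<in>Basis. g i x * (h \<bullet> i))) (at x)"
      by (rule smooth_derivatives[OF base]) (rule that)
    then show ?case by (intro exI[of _ g]) (auto intro: smooth_algebra.base)
  next
    case (add f1 f2)
    then obtain g1 g2 where
      g: "\<forall>i\<in>Basis. smooth_algebra (g1 i)" "\<forall>i\<in>Basis. smooth_algebra (g2 i)" and
      d: "\<And>x. (f1 has_derivative (\<lambda>h. \<Sum>i\<in>Basis. g1 i x * (h \<bullet> i))) (at x)"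
        "\<And>x. (f2 has_derivative (\<lambda>h. \<Sum>i\<in>Basis. g2 i x * (h \<bullet> i))) (at x)" by blast
    show ?case
    proof (intro exI[of _ "\<lambda>i x. g1 i x + g2 i x"] conjI ballI allI)
      show "((\<lambda>x. f1 x + f2 x) has_derivative (\<lambda>h. \<Sum>i\<in>Basis. (g1 i x + g2 i x) * (h \<bullet> i))) (at x)" for x
        using has_derivative_add[OF d(1)[of x] d(2)[of x]] by (simp add: sum.distrib distrib_right)
      show "smooth_algebra (\<lambda>x. g1 i x + g2 i x)" if "i \<in> Basis" for i
        using g that by (intro smooth_algebra.add) auto
    qed
  next
    case (mult f1 f2)
    then obtain g1 g2 where
      g: "\<forall>i\<in>Basis. smooth_algebra (g1 i)" "\<forall>i\<in>Basis. smooth_algebra (g2 i)" and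
      d: "\<And>x. (f1 has_derivative (\<lambda>h. \<Sum>i\<in>Basis. g1 i x * (h \<bullet> i))) (at x)"
        "\<And>x. (f2 has_derivative (\<lambda>h. \<Sum>i\<in>Basis. g2 i x * (h \<bullet> i))) (at x)" by blast
    show ?case
    proof (intro exI[of _ "\<lambda>i x. f1 x * g2 i x + g1 i x * f2 x"] conjI ballI allI)
      show "((\<lambda>x. f1 x * f2 x) has_derivative
          (\<lambda>h. \<Sum>i\<in>Basis. (f1 x * g2 i x + g1 i x * f2 x) * (h \<bullet> i))) (at x)" for x
        using has_derivative_mult[OF d(1)[of x] d(2)[of x]]
        by (simp add: sum.distrib algebra_simps sum_distrib_left sum_distrib_right)
      show "smooth_algebra (\<lambda>x. f1 x * g2 i x + g1 i x * f2 x)" if "i \<in> Basis" for i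
        using g that mult.hyps by (intro smooth_algebra.add smooth_algebra.mult) auto
    qed
  qed
qed

lemma smooth_add: "smooth f \<Longrightarrow> smooth g \<Longrightarrow> smooth (\<lambda>x. f x + g x)"
  by (rule smooth_algebra_smooth[OF smooth_algebra.add[OF smooth_algebra.base smooth_algebra.base]])

lemma smooth_mult: "smooth f \<Longrightarrow> smooth g \<Longrightarrow> smooth (\<lambda>x. f x * g x)"
  by (rule smooth_algebra_smooth[OF smooth_algebra.mult[OF smooth_algebra.base smooth_algebra.base]])

lemma smooth_scale: "smooth f \<Longrightarrow> smooth (\<lambda>x. c * f x)"
  by (rule smooth_mult[OF smooth_const])

lemma smooth_diff: "smooth f \<Longrightarrow> smooth g \<Longrightarrow> smooth (\<lambda>x. f x - g x)"
  using smooth_add[of f "\<lambda>x. -1 * g x"] smooth_scale[of g "-1"] by simp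

lemma smooth_prod: "(\<And>i. i \<in> I \<Longrightarrow> smooth (f i)) \<Longrightarrow> smooth (\<lambda>x. \<Prod>i\<in>I. f i x)"
  by (induction I rule: infinite_finite_induct) (auto simp: smooth_const smooth_mult)

lemma smooth_compose_affine:
  fixes F :: "real \<Rightarrow> real" and e :: "'a::euclidean_space"
  assumes "smooth F" and e: "e \<in> Basis"
  shows "smooth (\<lambda>x. F (c * (x \<bullet> e) + d))"
proof (rule smooth_coinduct[where P="\<lambda>f. \<exists>F. smooth F \<and> f = (\<lambda>x. F (c * (x \<bullet> e) + d))"])
  fix f :: "'a \<Rightarrow> real"
  assume "\<exists>F. smooth F \<and> f = (\<lambda>x. F (c * (x \<bullet> e) + d))"
  then obtain F where F: "smooth F" "f = (\<lambda>x. F (c * (x \<bullet> e) + d))" by blast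
  obtain g where g: "\<And>i. smooth (g i)"
    "\<And>x. (F has_derivative (\<lambda>h. \<Sum>i\<in>Basis. g i x * (h \<bullet> i))) (at x)"
    by (rule smooth_derivatives[OF F(1)]) (rule that)
  have F': "(F has_derivative (\<lambda>h. g 1 x * h)) (at x)" for x
    using g(2)[of x] by simp
  define G where "G i = (if i = e then (\<lambda>s. c * g 1 s) else (\<lambda>s. 0))" for i
  have "(f has_derivative (\<lambda>h. g 1 (c * (x \<bullet> e) + d) * (c * (h \<bullet> e)))) (at x)" for x
    unfolding F(2)
    by (rule has_derivative_compose[where f="\<lambda>x. c * (x \<bullet> e) + d", OF _ F'])
      (auto intro!: derivative_eq_intros)
  moreover have "(\<Sum>i\<in>Basis. G i s * (h \<bullet> i)) = g 1 s * (c * (h \<bullet> e))" for h :: 'a and s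
  proof -
    have "(\<Sum>i\<in>Basis. G i s * (h \<bullet> i)) = (\<Sum>i\<in>Basis. if i = e then g 1 s * (c * (h \<bullet> e)) else 0)"
      by (intro sum.cong) (auto simp: G_def)
    then show ?thesis using e by simp
  qed
  ultimately have "(f has_derivative (\<lambda>h. \<Sum>i\<in>Basis. G i (c * (x \<bullet> e) + d) * (h \<bullet> i))) (at x)" for x
    by simp
  moreover have "smooth (G i)" for i using g(1) by (auto simp: G_def smooth_const smooth_scale)
  ultimately show "\<exists>g. (\<forall>i\<in>Basis. \<exists>F. smooth F \<and> g i = (\<lambda>x. F (c * (x \<bullet> e) + d))) \<and>
      (\<forall>x. (f has_derivative (\<lambda>h. \<Sum>i\<in>Basis. g i x * (h \<bullet> i))) (at x))"
    by (intro exI[of _ "\<lambda>i x. G i (c * (x \<bullet> e) + d)"]) blast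
qed (use assms in auto)

definition flat_exp :: "real \<Rightarrow> real" where
  "flat_exp s = (if 0 < s then exp (- inverse s) else 0)"

lemma poly_exp_tendsto_0: "((\<lambda>x. poly p x * exp (- x)) \<longlongrightarrow> 0) at_top" for p :: "real poly"
proof -
  have "((\<lambda>x. \<Sum>i\<le>degree p. coeff p i * (x ^ i / exp x)) \<longlongrightarrow> (\<Sum>i\<le>degree p. coeff p i * 0)) at_top"
    by (intro tendsto_intros tendsto_power_div_exp_0)
  then show ?thesis by (simp add: poly_altdef exp_minus sum_distrib_right divide_inverse mult.assoc)
qed

text \<open>Every derivative has the form \<open>p (1 / s) * exp (- 1 / s)\<close> with a polynomial \<open>p\<close> on the positive
  half line and vanishes elsewhere. At zero the exponential beats every polynomial in \<open>1 / s\<close>.\<close>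
lemma smooth_flat_exp: "smooth flat_exp"
proof (rule smooth_coinduct[where
      P="\<lambda>f. \<exists>p. f = (\<lambda>s. if 0 < s then poly p (inverse s) * exp (- inverse s) else 0)"])
  show "\<exists>p. flat_exp = (\<lambda>s. if 0 < s then poly p (inverse s) * exp (- inverse s) else 0)"
    by (intro exI[of _ 1]) (auto simp: flat_exp_def)
next
  fix f :: "real \<Rightarrow> real"
  assume "\<exists>p. f = (\<lambda>s. if 0 < s then poly p (inverse s) * exp (- inverse s) else 0)"
  then obtain p where f: "f = (\<lambda>s. if 0 < s then poly p (inverse s) * exp (- inverse s) else 0)" by blast
  \<comment> \<open>The polynomial of the derivative, by the chain rule for \<open>1 / s\<close>.\<close>
  define q where "q = [:0, 0, 1:] * (p - pderiv p)"
  define g where "g = (\<lambda>s. if 0 < s then poly q (inverse s) * exp (- inverse s) else 0)"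
  have "(f has_real_derivative g s) (at s)" for s
  proof -
    consider "s > 0" | "s < 0" | "s = 0" by linarith
    then show ?thesis
    proof cases
      case 1
      have "((\<lambda>s. poly p (inverse s) * exp (- inverse s)) has_real_derivative
          poly q (inverse s) * exp (- inverse s)) (at s)"
        using 1 by (auto intro!: derivative_eq_intros DERIV_chain'[OF _ poly_DERIV]
            simp: q_def power2_eq_square field_simps)
      then show ?thesis
      proof (rule has_field_derivative_transform_within_open[where S="{0<..}", THEN DERIV_cong])
        show "poly q (inverse s) * exp (- inverse s) = g s" using 1 by (simp add: g_def)
      qed (use 1 in \<open>auto simp: f\<close>)
    next
      case 2
      have "((\<lambda>s. 0) has_real_derivative 0) (at s)" by simp
      then show ?thesis
      proof (rule has_field_derivative_transform_within_open[where S="{..<0}", THEN DERIV_cong])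
        show "0 = g s" using 2 by (simp add: g_def)
      qed (use 2 in \<open>auto simp: f\<close>)
    next
      case 3
      have "((\<lambda>h. poly ([:0, 1:] * p) (inverse h) * exp (- inverse h)) \<longlongrightarrow> 0) (at_right 0)"
        by (rule filterlim_compose[OF poly_exp_tendsto_0 filterlim_inverse_at_top_right])
      then have "((\<lambda>h. (f h - f 0) / h) \<longlongrightarrow> 0) (at_right 0)"
        by (rule tendsto_cong[THEN iffD1, rotated])
          (auto simp: f eventually_at_filter field_simps intro!: always_eventually)
      moreover have "((\<lambda>h. (f h - f 0) / h) \<longlongrightarrow> 0) (at_left 0)"
        by (rule tendsto_eventually) (auto simp: f eventually_at_filter intro!: always_eventually)
      ultimately have "((\<lambda>h. (f h - f 0) / h) \<longlongrightarrow> 0) (at 0)" by (simp add: filterlim_at_split)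
      then show ?thesis using 3 by (simp add: DERIV_def g_def)
    qed
  qed
  then have "\<And>x. (f has_derivative (\<lambda>h. g x * h)) (at x)"
    by (simp add: has_field_derivative_def)
  then show "\<exists>g. (\<forall>i\<in>Basis. \<exists>p. g i = (\<lambda>s. if 0 < s then poly p (inverse s) * exp (- inverse s) else 0)) \<and>
      (\<forall>x. (f has_derivative (\<lambda>h. \<Sum>i\<in>Basis. g i x * (h \<bullet> i))) (at x))"
    by (intro exI[of _ "\<lambda>_. g"]) (auto simp: g_def)
qed

lemma flat_exp_bounds: "0 \<le> flat_exp s" "flat_exp s \<le> 1" "flat_exp s \<noteq> 0 \<longleftrightarrow> 0 < s"
  by (auto simp: flat_exp_def)

lemma flat_exp_scaled_tendsto: "(\<lambda>k. flat_exp (real k * s)) \<longlonglongrightarrow> (if 0 < s then 1 else 0)"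
proof (cases "0 < s")
  case True
  have "(\<lambda>k. exp (- inverse (real k) * inverse s)) \<longlonglongrightarrow> exp (- 0 * inverse s)"
    by (intro tendsto_intros lim_inverse_n)
  then have "(\<lambda>k. flat_exp (real k * s)) \<longlonglongrightarrow> exp (- 0 * inverse s)"
    by (rule Lim_transform_eventually)
      (use True in \<open>auto simp: flat_exp_def eventually_sequentially intro!: exI[of _ 1]\<close>)
  then show ?thesis using True by simp
next
  case False
  then have "flat_exp (real k * s) = 0" for k
    by (simp add: flat_exp_def not_less mult_le_0_iff zero_less_mult_iff)
  then show ?thesis using False by simp
qed

section \<open>Test functions\<close>

lemma test_functions_mono: "S \<subseteq> S' \<Longrightarrow> test_functions S \<subseteq> test_functions S'"
  by (auto simp: test_functions_def)

lemma test_functionsI: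
  assumes "smooth \<phi>" "compact K" "K \<subseteq> S" "\<And>x. \<phi> x \<noteq> 0 \<Longrightarrow> x \<in> K"
  shows "\<phi> \<in> test_functions S"
proof -
  have "closure {x. \<phi> x \<noteq> 0} \<subseteq> K" using assms compact_imp_closed by (intro closure_minimal) auto
  moreover from this have "compact (closure {x. \<phi> x \<noteq> 0})"
    using assms(2) bounded_subset[of K] by (auto simp: compact_eq_bounded_closed)
  ultimately show ?thesis using assms by (auto simp: test_functions_def)
qed

lemma test_functionsE:
  assumes "\<phi> \<in> test_functions S"
  obtains K where "smooth \<phi>" "compact K" "K \<subseteq> S" "\<And>x. \<phi> x \<noteq> 0 \<Longrightarrow> x \<in> K"
proof
  show "smooth \<phi>" "compact (closure {x. \<phi> x \<noteq> 0})" "closure {x. \<phi> x \<noteq> 0} \<subseteq> S"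
    using assms by (simp_all add: test_functions_def)
  show "x \<in> closure {x. \<phi> x \<noteq> 0}" if "\<phi> x \<noteq> 0" for x
    using that closure_subset[of "{x. \<phi> x \<noteq> 0}"] by blast
qed

lemma test_add: assumes "\<phi> \<in> test_functions S" "\<psi> \<in> test_functions S"
  shows "(\<lambda>x. \<phi> x + \<psi> x) \<in> test_functions S"
proof -
  obtain K K' where "smooth \<phi>" "compact K" "K \<subseteq> S" "\<And>x. \<phi> x \<noteq> 0 \<Longrightarrow> x \<in> K"
    "smooth \<psi>" "compact K'" "K' \<subseteq> S" "\<And>x. \<psi> x \<noteq> 0 \<Longrightarrow> x \<in> K'"
    using assms by (elim test_functionsE) blast
  then show ?thesis
    by (intro test_functionsI[where K="K \<union> K'"] smooth_add compact_Un) (auto, metis add_0)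
qed

lemma test_smooth_mult: assumes "\<phi> \<in> test_functions S" "smooth \<psi>"
  shows "(\<lambda>x. \<psi> x * \<phi> x) \<in> test_functions S"
proof -
  obtain K where "smooth \<phi>" "compact K" "K \<subseteq> S" "\<And>x. \<phi> x \<noteq> 0 \<Longrightarrow> x \<in> K"
    using assms(1) by (elim test_functionsE) blast
  then show ?thesis using assms(2)
    by (intro test_functionsI[where K="K"] smooth_mult) auto
qed

lemma test_scale: "\<phi> \<in> test_functions S \<Longrightarrow> (\<lambda>x. c * \<phi> x) \<in> test_functions S"
  by (intro test_smooth_mult smooth_const)

lemma test_diff: "\<phi> \<in> test_functions S \<Longrightarrow> \<psi> \<in> test_functions S \<Longrightarrow> (\<lambda>x. \<phi> x - \<psi> x) \<in> test_functions S"
  using test_add[of \<phi> S "\<lambda>x. -1 * \<psi> x"] test_scale[of \<psi> S "-1"] by simp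

lemma test_zero: "(\<lambda>x. 0) \<in> test_functions S"
  by (rule test_functionsI[where K="{}"]) (auto simp: smooth_const)

definition partial :: "'a::euclidean_space \<Rightarrow> ('a \<Rightarrow> real) \<Rightarrow> 'a \<Rightarrow> real" where
  "partial i \<phi> = (\<lambda>x. frechet_derivative \<phi> (at x) i)"

lemma smooth_differentiable: assumes "smooth f" shows "f differentiable (at x)"
  by (rule smooth_derivatives[OF assms]) (auto simp: differentiable_def)

lemma smooth_continuous_on: "smooth f \<Longrightarrow> continuous_on S f"
  by (intro continuous_at_imp_continuous_on ballI differentiable_imp_continuous_within smooth_differentiable)

lemma smooth_partial: assumes "smooth f" "i \<in> Basis" shows "smooth (partial i f)"
proof -
  obtain g where g: "\<And>i. smooth (g i)"
    "\<And>x. (f has_derivative (\<lambda>h. \<Sum>i\<in>Basis. g i x * (h \<bullet> i))) (at x)"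
    by (rule smooth_derivatives[OF assms(1)]) (rule that)
  have "frechet_derivative f (at x) = (\<lambda>h. \<Sum>i\<in>Basis. g i x * (h \<bullet> i))" for x
    by (rule frechet_derivative_at[OF g(2), symmetric])
  then have "partial i f = g i" using assms(2) by (auto simp: partial_def inner_Basis if_distrib cong: if_cong)
  then show ?thesis using g(1) by simp
qed

lemma smooth_has_derivative: assumes "smooth f"
  shows "(f has_derivative (\<lambda>h. \<Sum>i\<in>Basis. partial i f x * (h \<bullet> i))) (at x)"
proof -
  obtain g where g: "\<And>x. (f has_derivative (\<lambda>h. \<Sum>i\<in>Basis. g i x * (h \<bullet> i))) (at x)"
    by (rule smooth_derivatives[OF assms(1)]) (rule that)
  have "frechet_derivative f (at x) = (\<lambda>h. \<Sum>i\<in>Basis. g i x * (h \<bullet> i))" for x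
    by (rule frechet_derivative_at[OF g, symmetric])
  then have "\<And>i. i \<in> Basis \<Longrightarrow> partial i f x = g i x" by (auto simp: partial_def inner_Basis if_distrib cong: if_cong)
  then show ?thesis using g[of x] by (simp cong: sum.cong)
qed

lemma partial_mult: assumes "smooth f" "smooth g"
  shows "partial i (\<lambda>x. f x * g x) x = f x * partial i g x + partial i f x * g x"
  unfolding partial_def
  using frechet_derivative_at[OF has_derivative_mult[OF
        frechet_derivative_works[THEN iffD1, OF smooth_differentiable[OF assms(1), of x]]
        frechet_derivative_works[THEN iffD1, OF smooth_differentiable[OF assms(2), of x]]], symmetric]
  by simp

lemma partial_zero_outside: assumes "closed K" "\<And>x. x \<notin> K \<Longrightarrow> \<phi> x = 0" "x \<notin> K"
  shows "partial i \<phi> x = 0"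
proof -
  have "(\<phi> has_derivative (\<lambda>h. 0)) (at x)"
    by (rule has_derivative_transform_within_open[OF has_derivative_const, of "-K"])
      (use assms in auto)
  then show ?thesis by (simp add: partial_def frechet_derivative_at[symmetric])
qed

lemma test_partial: assumes "\<phi> \<in> test_functions S" "i \<in> Basis" shows "partial i \<phi> \<in> test_functions S"
proof -
  obtain K where K: "smooth \<phi>" "compact K" "K \<subseteq> S" "\<And>x. \<phi> x \<noteq> 0 \<Longrightarrow> x \<in> K"
    using assms(1) by (elim test_functionsE) blast
  show ?thesis
    by (rule test_functionsI[OF smooth_partial K(2,3)])
      (use K(1) assms(2) partial_zero_outside[OF compact_imp_closed[OF K(2)], of \<phi> _ i] K(4) in blast)+
qed

text \<open>Smooth functions supported in a box that increase to its indicator function as \<open>k\<close> grows: every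
  factor vanishes on one side of a face of the box and tends to 1 on the other.\<close>
definition bump :: "nat \<Rightarrow> 'a::euclidean_space \<Rightarrow> 'a \<Rightarrow> 'a \<Rightarrow> real" where
  "bump k l r x = (\<Prod>i\<in>Basis. flat_exp (real k * ((x - l) \<bullet> i)) * flat_exp (real k * ((r - x) \<bullet> i)))"

lemma smooth_bump: "smooth (bump k l r)"
proof -
  have 1: "smooth (\<lambda>x. flat_exp (real k * ((x - l) \<bullet> i)))" if "i \<in> Basis" for i
    using smooth_compose_affine[OF smooth_flat_exp that, of "real k" "- real k * (l \<bullet> i)"]
    by (simp add: inner_diff_left algebra_simps)
  have 2: "smooth (\<lambda>x. flat_exp (real k * ((r - x) \<bullet> i)))" if "i \<in> Basis" for i
    using smooth_compose_affine[OF smooth_flat_exp that, of "- real k" "real k * (r \<bullet> i)"]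
    by (simp add: inner_diff_left algebra_simps)
  show ?thesis unfolding bump_def[abs_def] by (intro smooth_prod smooth_mult 1 2)
qed

lemma bump_bounds: "0 \<le> bump k l r x" "bump k l r x \<le> 1"
  unfolding bump_def
  by (auto intro!: prod_nonneg prod_le_1 mult_le_one mult_nonneg_nonneg flat_exp_bounds simp del: zero_le_mult_iff)

lemma bump_outside: assumes "x \<notin> box l r" shows "bump k l r x = 0"
proof -
  obtain i where i: "i \<in> Basis" "(x - l) \<bullet> i \<le> 0 \<or> (r - x) \<bullet> i \<le> 0"
    using assms by (auto simp: mem_box inner_diff_left not_less)
  then have "real k * ((x - l) \<bullet> i) \<le> 0 \<or> real k * ((r - x) \<bullet> i) \<le> 0"
    by (auto intro: mult_nonneg_nonpos)
  then have "flat_exp (real k * ((x - l) \<bullet> i)) * flat_exp (real k * ((r - x) \<bullet> i)) = 0"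
    using flat_exp_bounds(3) by (metis mult_eq_0_iff not_less)
  then show ?thesis unfolding bump_def using i(1) by (intro prod_zero) auto
qed

lemma bump_tendsto: assumes "x \<in> box l r" shows "(\<lambda>k. bump k l r x) \<longlonglongrightarrow> 1"
proof -
  have "(\<lambda>k. bump k l r x) \<longlonglongrightarrow> (\<Prod>i\<in>(Basis::'a set). 1 * 1)"
    unfolding bump_def
  proof (intro tendsto_prod tendsto_mult)
    fix i :: 'a assume "i \<in> Basis"
    then have "0 < (x - l) \<bullet> i" "0 < (r - x) \<bullet> i" using assms by (auto simp: mem_box inner_diff_left)
    then show "(\<lambda>k. flat_exp (real k * ((x - l) \<bullet> i))) \<longlonglongrightarrow> 1"
      "(\<lambda>k. flat_exp (real k * ((r - x) \<bullet> i))) \<longlonglongrightarrow> 1"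
      using flat_exp_scaled_tendsto by metis+
  qed
  then show ?thesis by simp
qed

text \<open>The set is a countable union of boxes whose closures it contains. The test functions
  \<open>1 - (\<Prod>n<k. 1 - bump k (l n) (r n))\<close> see the first \<open>k\<close> boxes, and they are close to 1 as soon as one
  of the factors is close to 0.\<close>
lemma open_indicator_limit_of_tests:
  assumes "open S"
  obtains \<psi> :: "nat \<Rightarrow> 'a::euclidean_space \<Rightarrow> real" where "\<And>k. \<psi> k \<in> test_functions S" "\<And>k x. 0 \<le> \<psi> k x" "\<And>k x. \<psi> k x \<le> 1"
    "\<And>x. (\<lambda>k. \<psi> k x) \<longlonglongrightarrow> indicator S x"
proof -
  define F where "F = {box l r | l r. cbox l r \<subseteq> S}"
  obtain F' where F': "F' \<subseteq> F" "countable F'" "\<Union>F' = \<Union>F"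
    using Lindelof[of F] by (auto simp: F_def)
  have "\<Union>F = S"
  proof
    show "\<Union>F \<subseteq> S" using box_subset_cbox by (auto simp: F_def)
    show "S \<subseteq> \<Union>F"
    proof
      fix x assume "x \<in> S"
      then obtain a b where "cbox a b \<subseteq> S" "x \<in> box a b" using open_contains_cbox[of S x] assms by metis
      then show "x \<in> \<Union>F" by (auto simp: F_def)
    qed
  qed
  have "\<exists>i::'a. i \<in> Basis" using nonempty_Basis by blast
  then have "box One (0::'a) = {}" "cbox One (0::'a) = {}" by (auto simp: box_eq_empty)
  then have "{} \<in> F" unfolding F_def by (metis (mono_tags, lifting) empty_subsetI mem_Collect_eq)
  then have F'': "insert {} F' \<subseteq> F" "countable (insert {} F')" "\<Union>(insert {} F') = S" using F' \<open>\<Union>F = S\<close> by auto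
  define B where "B = from_nat_into (insert {} F')"
  have B: "range B = insert {} F'" unfolding B_def using F''(2) by (intro range_from_nat_into) auto
  then have "\<And>n. B n \<in> F" using F''(1) rangeI[of B] unfolding B by (meson subsetD)
  then have "\<forall>n. \<exists>l r. B n = box l r \<and> cbox l r \<subseteq> S" by (simp add: F_def)
  then obtain l r where lr: "\<And>n. B n = box (l n) (r n)" "\<And>n. cbox (l n) (r n) \<subseteq> S" by metis
  define \<psi> where "\<psi> k x = 1 - (\<Prod>n<k. 1 - bump k (l n) (r n) x)" for k x
  have p01: "0 \<le> (\<Prod>n\<in>I. 1 - bump k (l n) (r n) x)" "(\<Prod>n\<in>I. 1 - bump k (l n) (r n) x) \<le> 1" for I k x
    using bump_bounds by (auto intro!: prod_nonneg prod_le_1)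
  show thesis
  proof
    show "\<psi> k \<in> test_functions S" for k
    proof (rule test_functionsI[where K="\<Union>n<k. cbox (l n) (r n)"])
      show "smooth (\<psi> k)" unfolding \<psi>_def[abs_def] by (intro smooth_diff smooth_const smooth_prod smooth_bump)
      show "x \<in> (\<Union>n<k. cbox (l n) (r n))" if "\<psi> k x \<noteq> 0" for x
      proof (rule ccontr)
        assume "x \<notin> (\<Union>n<k. cbox (l n) (r n))"
        then have "\<And>n. n < k \<Longrightarrow> bump k (l n) (r n) x = 0"
          by (intro bump_outside) (use box_subset_cbox in fastforce)
        then show False using that by (simp add: \<psi>_def)
      qed
    qed (use lr in auto)
    show "0 \<le> \<psi> k x" "\<psi> k x \<le> 1" for k x using p01 by (auto simp: \<psi>_def)
    show "(\<lambda>k. \<psi> k x) \<longlonglongrightarrow> indicator S x" for x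
    proof (cases "x \<in> S")
      case True
      then obtain n where n: "x \<in> box (l n) (r n)" using B F''(3) lr by (metis UN_E image_iff)
      have "(\<lambda>k. \<psi> k x) \<longlonglongrightarrow> 1"
      proof (rule tendsto_sandwich)
        show "\<forall>\<^sub>F k in sequentially. bump k (l n) (r n) x \<le> \<psi> k x"
        proof (rule eventually_sequentiallyI[of "Suc n"])
          fix k assume "Suc n \<le> k"
          then have "(\<Prod>n<k. 1 - bump k (l n) (r n) x)
              = (1 - bump k (l n) (r n) x) * (\<Prod>n\<in>{..<k} - {n}. 1 - bump k (l n) (r n) x)"
            by (intro prod.remove) auto
          also have "\<dots> \<le> (1 - bump k (l n) (r n) x) * 1"
            using bump_bounds p01 by (intro mult_left_mono) auto
          finally show "bump k (l n) (r n) x \<le> \<psi> k x" by (simp add: \<psi>_def)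
        qed
        show "\<forall>\<^sub>F k in sequentially. \<psi> k x \<le> 1" using p01 by (auto simp: \<psi>_def)
        show "(\<lambda>k. bump k (l n) (r n) x) \<longlonglongrightarrow> 1" by (rule bump_tendsto[OF n])
      qed auto
      then show ?thesis using True by simp
    next
      case False
      then have "bump k (l n) (r n) x = 0" for k n using bump_outside box_subset_cbox lr by blast
      then show ?thesis using False by (simp add: \<psi>_def)
    qed
  qed
qed

section \<open>Integrals of test functions\<close>

lemma test_continuous: "\<psi> \<in> test_functions S \<Longrightarrow> continuous_on A \<psi>"
  by (auto elim: test_functionsE intro: smooth_continuous_on)

lemma test_borel: "\<psi> \<in> test_functions S \<Longrightarrow> \<psi> \<in> borel_measurable borel"
  by (intro borel_measurable_continuous_onI test_continuous)

lemma borel_measurable_lebesgue_on: "f \<in> borel_measurable borel \<Longrightarrow> f \<in> borel_measurable (lebesgue_on S)"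
  by (intro measurable_restrict_space1 measurable_completion) simp

lemma test_measurable: "\<psi> \<in> test_functions S \<Longrightarrow> \<psi> \<in> borel_measurable (lebesgue_on A)"
  by (intro borel_measurable_lebesgue_on test_borel)

lemma test_bounded: assumes "\<psi> \<in> test_functions S" obtains B where "0 \<le> B" "\<And>x. \<bar>\<psi> x\<bar> \<le> B"
proof -
  obtain K where K: "smooth \<psi>" "compact K" "K \<subseteq> S" "\<And>x. \<psi> x \<noteq> 0 \<Longrightarrow> x \<in> K"
    by (rule test_functionsE[OF assms]) (rule that)
  have "bounded (\<psi> ` K)" using compact_continuous_image[OF test_continuous[OF assms] K(2)] compact_imp_bounded by blast
  then obtain B where B: "\<And>x. x \<in> K \<Longrightarrow> \<bar>\<psi> x\<bar> \<le> B" by (auto simp: bounded_iff)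
  have "\<bar>\<psi> x\<bar> \<le> max 0 B" for x using B[of x] K(4)[of x] by (cases "\<psi> x = 0") auto
  then show thesis using that[of "max 0 B"] by simp
qed

lemma test_integrable: assumes "\<psi> \<in> test_functions S" shows "integrable lborel \<psi>"
proof -
  obtain K where K: "smooth \<psi>" "compact K" "K \<subseteq> S" "\<And>x. \<psi> x \<noteq> 0 \<Longrightarrow> x \<in> K"
    by (rule test_functionsE[OF assms]) (rule that)
  obtain B where B: "0 \<le> B" "\<And>x. \<bar>\<psi> x\<bar> \<le> B" by (rule test_bounded[OF assms]) (rule that)
  show ?thesis
  proof (rule Bochner_Integration.integrable_bound)
    show "integrable lborel (\<lambda>x. B * indicator K x)"
      using K(2) emeasure_compact_finite[OF K(2)] by (intro integrable_mult_right integrable_real_indicator) (auto simp: compact_imp_closed)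
    show "AE x in lborel. norm (\<psi> x) \<le> norm (B * indicator K x)"
      using B K(4) by (intro AE_I2) (auto simp: indicator_def)
  qed (use test_borel[OF assms] in simp)
qed

lemma integral_lebesgue_on_lborel:
  fixes f :: "'a::euclidean_space \<Rightarrow> real"
  assumes "S \<in> sets lebesgue" "f \<in> borel_measurable borel" "\<And>x. f x \<noteq> 0 \<Longrightarrow> x \<in> S"
  shows "(LINT x|lebesgue_on S. f x) = (LINT x|lborel. f x)"
    and "integrable (lebesgue_on S) f \<longleftrightarrow> integrable lborel f"
proof -
  have e: "(\<lambda>x. indicator S x *\<^sub>R f x) = f"
  proof
    fix x show "indicator S x *\<^sub>R f x = f x" using assms(3)[of x] by (cases "f x = 0") auto
  qed
  have m: "f \<in> borel_measurable lborel" using assms(2) by simp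
  show "(LINT x|lebesgue_on S. f x) = (LINT x|lborel. f x)"
    using assms(1) integral_completion[OF m] by (subst integral_restrict_space) (simp_all only: e space_completion space_lborel space_borel Int_UNIV_right)
  show "integrable (lebesgue_on S) f \<longleftrightarrow> integrable lborel f"
    using assms(1) integrable_completion[OF m] by (subst integrable_restrict_space) (simp_all only: e space_completion space_lborel space_borel Int_UNIV_right)
qed

lemma test_support: "\<psi> \<in> test_functions S \<Longrightarrow> \<psi> x \<noteq> 0 \<Longrightarrow> x \<in> S"
  by (auto elim!: test_functionsE)

lemma test_integrable_on: "\<psi> \<in> test_functions S \<Longrightarrow> S \<in> sets lebesgue \<Longrightarrow> integrable (lebesgue_on S) \<psi>"
  using integral_lebesgue_on_lborel(2)[of S \<psi>] test_borel test_support test_integrable by blast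

lemma test_mult: "\<phi> \<in> test_functions S \<Longrightarrow> \<psi> \<in> test_functions S \<Longrightarrow> (\<lambda>x. \<phi> x * \<psi> x) \<in> test_functions S"
  by (rule test_smooth_mult) (auto elim: test_functionsE)

lemma test_L2: assumes "\<psi> \<in> test_functions S" "S \<in> sets lebesgue" shows "\<psi> \<in> L2 S"
proof (rule L2_I[OF test_measurable[OF assms(1)]])
  show "integrable (lebesgue_on S) (\<lambda>x. (norm (\<psi> x))\<^sup>2)"
    using test_integrable_on[OF test_mult[OF assms(1,1)] assms(2)] by (simp add: power2_eq_square)
qed

lemma smooth_line_derivative: assumes "smooth f" "i \<in> Basis"
  shows "((\<lambda>t. f (x + t *\<^sub>R i)) has_real_derivative partial i f (x + t *\<^sub>R i)) (at t)"
proof -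
  have "((\<lambda>t. f (x + t *\<^sub>R i)) has_derivative
      (\<lambda>h. \<Sum>j\<in>Basis. partial j f (x + t *\<^sub>R i) * ((h *\<^sub>R i) \<bullet> j))) (at t)"
    by (rule has_derivative_compose[where f="\<lambda>t. x + t *\<^sub>R i", OF _ smooth_has_derivative[OF assms(1)]])
      (auto intro!: derivative_eq_intros)
  moreover have "(\<Sum>j\<in>Basis. partial j f y * ((h *\<^sub>R i) \<bullet> j)) = partial i f y * h" for h y
  proof -
    have "(\<Sum>j\<in>Basis. partial j f y * ((h *\<^sub>R i) \<bullet> j)) = (\<Sum>j\<in>Basis. if j = i then partial i f y * h else 0)"
      using assms(2) by (intro sum.cong) (auto simp: inner_Basis)
    then show ?thesis using assms(2) by simp
  qed
  ultimately show ?thesis by (simp add: has_field_derivative_def)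
qed

text \<open>The difference quotients of \<open>\<psi>\<close> have integral zero because Lebesgue measure is invariant under
  translations, and they converge boundedly to the derivative.\<close>
lemma integral_partial_test_zero:
  fixes \<psi> :: "'a::euclidean_space \<Rightarrow> real"
  assumes "\<psi> \<in> test_functions S" "i \<in> Basis"
  shows "(LINT x|lborel. partial i \<psi> x) = 0"
proof -
  obtain K where K: "smooth \<psi>" "compact K" "K \<subseteq> S" "\<And>x. \<psi> x \<noteq> 0 \<Longrightarrow> x \<in> K"
    by (rule test_functionsE[OF assms(1)]) (rule that)
  obtain R where R: "K \<subseteq> cball 0 R" using compact_imp_bounded[OF K(2)] unfolding bounded_iff by (auto simp: subset_eq)
  have p: "partial i \<psi> \<in> test_functions S" using assms by (rule test_partial)
  obtain B where B: "0 \<le> B" "\<And>x. \<bar>partial i \<psi> x\<bar> \<le> B" by (rule test_bounded[OF p]) (rule that)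
  define h where "h n = inverse (real (Suc n))" for n
  have h: "h n > 0" "h n \<le> 1" for n by (auto simp: h_def inverse_le_1_iff)
  define q where "q n x = (\<psi> (h n *\<^sub>R i + x) - \<psi> x) / h n" for n x
  note [measurable] = test_borel[OF assms(1)] test_borel[OF p]
  have tr: "integrable lborel (\<lambda>x. \<psi> (c + x))" "(LINT x|lborel. \<psi> (c + x)) = (LINT x|lborel. \<psi> x)" for c
  proof -
    have "integrable (distr lborel borel ((+) c)) \<psi>" using test_integrable[OF assms(1)] lborel_distr_plus[of c] by simp
    then show "integrable lborel (\<lambda>x. \<psi> (c + x))" by (subst (asm) integrable_distr_eq) auto
    have "(LINT x|distr lborel borel ((+) c). \<psi> x) = (LINT x|lborel. \<psi> (c + x))"
      by (rule integral_distr) auto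
    then show "(LINT x|lborel. \<psi> (c + x)) = (LINT x|lborel. \<psi> x)" by (simp add: lborel_distr_plus)
  qed
  have "(LINT x|lborel. q n x) = 0" for n
    unfolding q_def using tr test_integrable[OF assms(1)] by simp
  moreover have "(\<lambda>n. LINT x|lborel. q n x) \<longlonglongrightarrow> (LINT x|lborel. partial i \<psi> x)"
  proof (rule integral_dominated_convergence[where w="\<lambda>x. B * indicator (cball 0 (R + 1)) x"])
    show "partial i \<psi> \<in> borel_measurable lborel" by measurable
    show "q n \<in> borel_measurable lborel" for n unfolding q_def by measurable
    show "integrable lborel (\<lambda>x::'a. B * indicator (cball 0 (R + 1)) x)"
    proof (intro integrable_mult_right integrable_real_indicator)
      show "emeasure lborel (cball (0::'a) (R + 1)) < \<infinity>" by (rule emeasure_compact_finite) simp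
    qed simp
    show "AE x in lborel. (\<lambda>n. q n x) \<longlonglongrightarrow> partial i \<psi> x"
    proof (intro AE_I2)
      fix x
      have "((\<lambda>t. (\<psi> (x + t *\<^sub>R i) - \<psi> x) / t) \<longlongrightarrow> partial i \<psi> x) (at 0)"
        using smooth_line_derivative[OF K(1) assms(2), of x 0] by (simp add: DERIV_def)
      moreover have "filterlim h (at 0) sequentially" unfolding filterlim_at h_def
        using LIMSEQ_inverse_real_of_nat by auto
      ultimately show "(\<lambda>n. q n x) \<longlonglongrightarrow> partial i \<psi> x"
        unfolding q_def using filterlim_compose by (fastforce simp: add.commute)
    qed
    show "AE x in lborel. norm (q n x) \<le> B * indicator (cball 0 (R + 1)) x" for n
    proof (intro AE_I2)
      fix x
      show "norm (q n x) \<le> B * indicator (cball 0 (R + 1)) x"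
      proof (cases "x \<in> cball 0 (R + 1)")
        case True
        obtain z where "0 < z" "z < h n"
          "\<psi> (x + h n *\<^sub>R i) - \<psi> (x + 0 *\<^sub>R i) = (h n - 0) * partial i \<psi> (x + z *\<^sub>R i)"
          using MVT2[OF h(1)[of n], of "\<lambda>t. \<psi> (x + t *\<^sub>R i)" "\<lambda>t. partial i \<psi> (x + t *\<^sub>R i)"]
            smooth_line_derivative[OF K(1) assms(2), of x] by blast
        then have "q n x = partial i \<psi> (x + z *\<^sub>R i)" using h(1)[of n] by (simp add: q_def add.commute)
        then show ?thesis using B True by simp
      next
        case False
        then have n: "norm x > R + 1" by simp
        have "norm x \<le> norm (h n *\<^sub>R i + x) + norm (h n *\<^sub>R i)"
          by (metis add.commute add_diff_cancel_left' norm_triangle_ineq4 norm_minus_commute diff_add_cancel)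
        moreover have "norm (h n *\<^sub>R i) \<le> 1" using h[of n] assms(2) by simp
        ultimately have "norm (h n *\<^sub>R i + x) > R" using n by simp
        then have "\<psi> (h n *\<^sub>R i + x) = 0" "\<psi> x = 0" using K(4) R n by (force, force)
        then show ?thesis using B by (simp add: q_def)
      qed
    qed
  qed
  ultimately show ?thesis by (simp add: LIMSEQ_const_iff)
qed

text \<open>Only the product \<open>\<psi> \<phi>\<close> has to be a test function, so \<open>\<psi>\<close> may be any smooth function.\<close>
lemma test_integration_by_parts:
  assumes \<phi>: "\<phi> \<in> test_functions S" and \<psi>: "smooth \<psi>" and i: "i \<in> Basis" and S: "S \<in> sets lebesgue"
  shows "(LINT x|lebesgue_on S. \<psi> x * partial i \<phi> x) = - (LINT x|lebesgue_on S. partial i \<psi> x * \<phi> x)"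
proof -
  have sm: "smooth \<phi>" using \<phi> by (auto elim: test_functionsE)
  have t: "(\<lambda>x. \<psi> x * \<phi> x) \<in> test_functions S" by (rule test_smooth_mult[OF \<phi> \<psi>])
  have p: "partial i (\<lambda>x. \<psi> x * \<phi> x) \<in> test_functions S" by (rule test_partial[OF t i])
  have t1: "(\<lambda>x. \<psi> x * partial i \<phi> x) \<in> test_functions S"
    by (rule test_smooth_mult[OF test_partial[OF \<phi> i] \<psi>])
  have t2: "(\<lambda>x. partial i \<psi> x * \<phi> x) \<in> test_functions S"
    by (rule test_smooth_mult[OF \<phi> smooth_partial[OF \<psi> i]])
  have "0 = (LINT x|lebesgue_on S. partial i (\<lambda>x. \<psi> x * \<phi> x) x)"
    using integral_lebesgue_on_lborel(1)[OF S test_borel[OF p] test_support[OF p]]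
      integral_partial_test_zero[OF t i] by simp
  also have "\<dots> = (LINT x|lebesgue_on S. \<psi> x * partial i \<phi> x + partial i \<psi> x * \<phi> x)"
    by (simp add: partial_mult[OF \<psi> sm])
  also have "\<dots> = (LINT x|lebesgue_on S. \<psi> x * partial i \<phi> x) + (LINT x|lebesgue_on S. partial i \<psi> x * \<phi> x)"
    by (intro Bochner_Integration.integral_add test_integrable_on t1 t2 S)
  finally show ?thesis by simp
qed

section \<open>Density of test functions\<close>

lemma l2norm_dominated_convergence:
  fixes g :: "'a::euclidean_space \<Rightarrow> 'b::euclidean_space"
  assumes w: "w \<in> L2 S" and m: "\<And>k. h k \<in> borel_measurable (lebesgue_on S)" "g \<in> borel_measurable (lebesgue_on S)"
    and lim: "AE x in lebesgue_on S. (\<lambda>k. h k x) \<longlonglongrightarrow> g x"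
    and b: "\<And>k. AE x in lebesgue_on S. norm (g x - h k x) \<le> norm (w x :: real)"
  shows "(\<lambda>k. l2norm S (\<lambda>x. g x - h k x)) \<longlonglongrightarrow> 0"
proof -
  note [measurable] = m L2_measurable[OF w]
  have "(\<lambda>k. LINT x|lebesgue_on S. (norm (g x - h k x))\<^sup>2) \<longlonglongrightarrow> (LINT x|lebesgue_on S. 0)"
  proof (rule integral_dominated_convergence[where w="\<lambda>x. (norm (w x))\<^sup>2"])
    show "integrable (lebesgue_on S) (\<lambda>x. (norm (w x))\<^sup>2)" using w by (simp add: L2_def)
    show "AE x in lebesgue_on S. (\<lambda>k. (norm (g x - h k x))\<^sup>2) \<longlonglongrightarrow> 0"
      using lim
    proof eventually_elim
      case (elim x)
      have "(\<lambda>k. (norm (g x - h k x))\<^sup>2) \<longlonglongrightarrow> (norm (g x - g x))\<^sup>2"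
        by (intro tendsto_intros elim)
      then show ?case by simp
    qed
    show "AE x in lebesgue_on S. norm ((norm (g x - h k x))\<^sup>2) \<le> (norm (w x))\<^sup>2" for k
      using b[of k]
    proof eventually_elim
      case (elim x)
      then have "(norm (g x - h k x))\<^sup>2 \<le> (norm (w x))\<^sup>2" by (rule power_mono) simp
      then show ?case by simp
    qed
  qed measurable
  then have "(\<lambda>k. sqrt (LINT x|lebesgue_on S. (norm (g x - h k x))\<^sup>2)) \<longlonglongrightarrow> sqrt 0"
    by (intro tendsto_real_sqrt) simp
  then show ?thesis by (simp add: l2norm_def)
qed

lemma l2norm_triangle_via: fixes f g h :: "'a::euclidean_space \<Rightarrow> 'b::euclidean_space"
  assumes "f \<in> L2 S" "g \<in> L2 S" "h \<in> L2 S"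
  shows "l2norm S (\<lambda>x. f x - h x) \<le> l2norm S (\<lambda>x. f x - g x) + l2norm S (\<lambda>x. g x - h x)"
  unfolding l2norm_eq_nrm by (rule L2.nrm_triangle_via[OF assms])

definition test_closure :: "'a::euclidean_space set \<Rightarrow> ('a \<Rightarrow> real) set" where
  "test_closure S = {g \<in> L2 S. \<forall>e>0. \<exists>\<psi>\<in>test_functions S. l2norm S (\<lambda>x. g x - \<psi> x) < e}"

lemma test_closure_closed:
  assumes S: "S \<in> sets lebesgue" and g: "g \<in> L2 S"
    and a: "\<And>e. 0 < e \<Longrightarrow> \<exists>h\<in>test_closure S. l2norm S (\<lambda>x. g x - h x) < e"
  shows "g \<in> test_closure S"
proof -
  have "\<exists>\<psi>\<in>test_functions S. l2norm S (\<lambda>x. g x - \<psi> x) < e" if "e > 0" for e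
  proof -
    obtain h where h: "h \<in> test_closure S" "l2norm S (\<lambda>x. g x - h x) < e / 2" using a[of "e/2"] half_gt_zero[OF \<open>e > 0\<close>] by blast
    then obtain \<psi> where \<psi>: "\<psi> \<in> test_functions S" "l2norm S (\<lambda>x. h x - \<psi> x) < e / 2"
      using half_gt_zero[OF \<open>e > 0\<close>] unfolding test_closure_def by blast
    have "l2norm S (\<lambda>x. g x - \<psi> x) \<le> l2norm S (\<lambda>x. g x - h x) + l2norm S (\<lambda>x. h x - \<psi> x)"
      using g h test_L2[OF \<psi>(1) S] by (intro l2norm_triangle_via) (auto simp: test_closure_def)
    then show ?thesis using h(2) \<psi> by (intro bexI[of _ \<psi>]) auto
  qed
  then show ?thesis using g by (simp add: test_closure_def)
qed

lemma test_closure_limit: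
  assumes S: "S \<in> sets lebesgue" and g: "g \<in> L2 S" and h: "\<And>k. h k \<in> test_closure S"
    and lim: "(\<lambda>k. l2norm S (\<lambda>x. g x - h k x)) \<longlonglongrightarrow> 0"
  shows "g \<in> test_closure S"
proof (rule test_closure_closed[OF S g])
  fix e :: real assume "e > 0"
  then have "\<forall>\<^sub>F k in sequentially. l2norm S (\<lambda>x. g x - h k x) < e" using lim by (intro order_tendstoD) auto
  then obtain k where "l2norm S (\<lambda>x. g x - h k x) < e" by (auto simp: eventually_sequentially)
  then show "\<exists>h\<in>test_closure S. l2norm S (\<lambda>x. g x - h x) < e" using h by blast
qed

lemma test_in_closure: "S \<in> sets lebesgue \<Longrightarrow> \<psi> \<in> test_functions S \<Longrightarrow> \<psi> \<in> test_closure S"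
  unfolding test_closure_def by (auto simp: test_L2 l2norm_def intro!: bexI[of _ \<psi>])

lemma test_closure_add: assumes S: "S \<in> sets lebesgue" and f: "f \<in> test_closure S" and g: "g \<in> test_closure S"
  shows "(\<lambda>x. f x + g x) \<in> test_closure S"
proof -
  have L: "f \<in> L2 S" "g \<in> L2 S" using f g by (auto simp: test_closure_def)
  have "\<exists>\<psi>\<in>test_functions S. l2norm S (\<lambda>x. (f x + g x) - \<psi> x) < e" if "e > 0" for e
  proof -
    have e2: "0 < e / 2" using that by simp
    obtain \<phi> where \<phi>: "\<phi> \<in> test_functions S" "l2norm S (\<lambda>x. f x - \<phi> x) < e / 2"
      using f e2 unfolding test_closure_def by blast
    obtain \<psi> where \<psi>: "\<psi> \<in> test_functions S" "l2norm S (\<lambda>x. g x - \<psi> x) < e / 2"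
      using g e2 unfolding test_closure_def by blast
    have "l2norm S (\<lambda>x. (f x - \<phi> x) + (g x - \<psi> x)) \<le> l2norm S (\<lambda>x. f x - \<phi> x) + l2norm S (\<lambda>x. g x - \<psi> x)"
      unfolding l2norm_eq_nrm using L test_L2[OF _ S] \<phi> \<psi> by (intro L2.nrm_triangle L2_diff) auto
    then show ?thesis using \<phi> \<psi> by (intro bexI[OF _ test_add[OF \<phi>(1) \<psi>(1)]]) (simp add: algebra_simps)
  qed
  then show ?thesis using L2_add[OF L] by (simp add: test_closure_def)
qed

lemma test_closure_scale: assumes S: "S \<in> sets lebesgue" and f: "f \<in> test_closure S"
  shows "(\<lambda>x. c * f x) \<in> test_closure S"
proof -
  have L: "f \<in> L2 S" using f by (auto simp: test_closure_def)
  have "\<exists>\<psi>\<in>test_functions S. l2norm S (\<lambda>x. c * f x - \<psi> x) < e" if "e > 0" for e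
  proof -
    have e2: "0 < e / (\<bar>c\<bar> + 1)" using that by simp
    then obtain \<phi> where \<phi>: "\<phi> \<in> test_functions S" "l2norm S (\<lambda>x. f x - \<phi> x) < e / (\<bar>c\<bar> + 1)"
      using f unfolding test_closure_def by blast
    have "l2norm S (\<lambda>x. c *\<^sub>R (f x - \<phi> x)) = \<bar>c\<bar> * l2norm S (\<lambda>x. f x - \<phi> x)"
      unfolding l2norm_eq_nrm using L test_L2[OF _ S] \<phi> by (intro L2.nrm_scale L2_diff) auto
    also have "\<dots> \<le> (\<bar>c\<bar> + 1) * l2norm S (\<lambda>x. f x - \<phi> x)" by (intro mult_right_mono) auto
    also have "\<dots> < e" using \<phi>(2) by (simp add: field_simps add_pos_nonneg)
    finally show ?thesis using \<phi> by (intro bexI[OF _ test_scale[OF \<phi>(1), of c]]) (simp add: algebra_simps)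
  qed
  then show ?thesis using L2_scale[OF L, of c] by (simp add: test_closure_def)
qed

lemma test_closure_sum: assumes S: "S \<in> sets lebesgue" and f: "\<And>i. i \<in> I \<Longrightarrow> f i \<in> test_closure S"
  shows "(\<lambda>x. \<Sum>i\<in>I. f i x) \<in> test_closure S"
  using f by (induction I rule: infinite_finite_induct)
    (auto simp: test_closure_add[OF S] test_in_closure[OF S test_zero])

lemma l2norm_cong_on: "(\<And>x. x \<in> S \<Longrightarrow> f x = g x) \<Longrightarrow> l2norm S f = l2norm S g"
  unfolding l2norm_def by (intro arg_cong[where f=sqrt] Bochner_Integration.integral_cong) auto

lemma bounded_L2: fixes f :: "'a::euclidean_space \<Rightarrow> real"
  assumes "S \<in> lmeasurable" "f \<in> borel_measurable (lebesgue_on S)" "\<And>x. x \<in> S \<Longrightarrow> \<bar>f x\<bar> \<le> B"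
  shows "f \<in> L2 S"
proof -
  interpret finite_measure "lebesgue_on S" by (rule finite_measure_lebesgue_on[OF assms(1)])
  have "(\<lambda>x. B) \<in> L2 S" by (simp add: L2_def)
  then show ?thesis using assms(3) by (intro L2_bound[OF assms(2), where c=1]) (auto intro!: AE_I2 order_trans[OF _ abs_ge_self])
qed

text \<open>The closure contains the indicator functions of open sets, then those of measurable sets by outer
  regularity, then simple functions, and finally all limits of simple functions.\<close>
theorem test_functions_dense:
  assumes S: "open S" "bounded S" and g: "g \<in> L2 S"
  shows "g \<in> test_closure S"
proof -
  have Sl: "S \<in> sets lebesgue" using S by simp
  have Sm: "S \<in> lmeasurable" using S by (simp add: lmeasurable_open)
  interpret finite_measure "lebesgue_on S" by (rule finite_measure_lebesgue_on[OF Sm])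
  have one: "(\<lambda>x. 1::real) \<in> L2 S" by (simp add: L2_def)
  have openc: "indicator U \<in> test_closure S" if U: "open U" "U \<subseteq> S" for U
  proof -
    obtain \<psi> :: "nat \<Rightarrow> 'a \<Rightarrow> real" where \<psi>: "\<And>k. \<psi> k \<in> test_functions U" "\<And>k x. 0 \<le> \<psi> k x"
      "\<And>k x. \<psi> k x \<le> 1" "\<And>x. (\<lambda>k. \<psi> k x) \<longlonglongrightarrow> indicator U x"
      by (rule open_indicator_limit_of_tests[OF U(1)]) (rule that)
    have m: "(indicator U :: 'a \<Rightarrow> real) \<in> borel_measurable (lebesgue_on S)"
      using U by (intro borel_measurable_lebesgue_on) auto
    show ?thesis
    proof (rule test_closure_limit[OF Sl, where h=\<psi>])
      show "indicat_real U \<in> L2 S" by (rule bounded_L2[OF Sm m, where B=1]) (auto simp: indicator_def)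
      show "\<psi> k \<in> test_closure S" for k
        using test_in_closure[OF Sl] \<psi>(1) test_functions_mono[OF U(2)] by blast
      have b: "\<bar>indicat_real U x - \<psi> k x\<bar> \<le> 1" for k x
        using \<psi>(2)[of k x] \<psi>(3)[of k x] by (auto simp: indicator_def)
      show "(\<lambda>k. l2norm S (\<lambda>x. indicator U x - \<psi> k x)) \<longlonglongrightarrow> 0"
        by (rule l2norm_dominated_convergence[OF one])
          (use m \<psi>(4) b test_measurable[OF \<psi>(1)] in auto)
    qed
  qed
  have setc: "indicator A \<in> test_closure S" if A: "A \<in> sets (lebesgue_on S)" for A
  proof (rule test_closure_closed[OF Sl])
    have AS: "A \<subseteq> S" and Al: "A \<in> sets lebesgue" using A Sl by (auto simp: sets_restrict_space_iff)
    have m: "(indicator A :: 'a \<Rightarrow> real) \<in> borel_measurable (lebesgue_on S)" using A by simp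
    show "indicat_real A \<in> L2 S" by (rule bounded_L2[OF Sm m, where B=1]) (auto simp: indicator_def)
    fix e :: real assume e: "e > 0"
    then have "e\<^sup>2 > 0" by simp
    then obtain U where U: "open U" "A \<subseteq> U" "(U - A) \<in> lmeasurable" "emeasure lebesgue (U - A) < ennreal (e\<^sup>2)"
      by (rule sets_lebesgue_outer_open[OF Al])
    let ?D = "(U \<inter> S) - A"
    have D: "?D \<in> sets (lebesgue_on S)" using U(1) A Sl S AS by (auto simp: sets_restrict_space_iff)
    have "emeasure (lebesgue_on S) ?D = emeasure lebesgue ?D" using Sl by (intro emeasure_restrict_space) auto
    also have "\<dots> \<le> emeasure lebesgue (U - A)" using U(3) by (intro emeasure_mono) (auto simp: fmeasurable_def)
    also have "\<dots> < ennreal (e\<^sup>2)" by (rule U(4))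
    finally have "measure (lebesgue_on S) ?D < e\<^sup>2"
      by (simp add: emeasure_eq_measure ennreal_less_iff)
    moreover have "l2norm S (\<lambda>x. indicator A x - indicat_real (U \<inter> S) x) = sqrt (measure (lebesgue_on S) ?D)"
    proof -
      have "(norm (indicator A x - indicat_real (U \<inter> S) x))\<^sup>2 = indicator ?D x" for x
        using U(2) AS by (auto simp: indicator_def)
      moreover have "?D \<inter> S = ?D" by auto
      ultimately show ?thesis using D by (simp add: l2norm_def)
    qed
    ultimately have "l2norm S (\<lambda>x. indicator A x - indicat_real (U \<inter> S) x) < e"
      using e real_less_rsqrt real_sqrt_less_mono by (metis abs_of_pos real_sqrt_abs)
    moreover have "indicator (U \<inter> S) \<in> test_closure S" using U S by (intro openc) auto
    ultimately show "\<exists>h\<in>test_closure S. l2norm S (\<lambda>x. indicator A x - h x) < e" by blast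
  qed
  have simplec: "s \<in> test_closure S" if s: "simple_function (lebesgue_on S) s" for s
  proof -
    define s' where "s' = (\<lambda>x. \<Sum>y\<in>s ` S. y * indicator (s -` {y} \<inter> S) x)"
    have fin: "finite (s ` S)" using s by (simp add: simple_function_def)
    have "s -` {y} \<inter> S \<in> sets (lebesgue_on S)" if "y \<in> s ` S" for y
      using s that by (auto simp: simple_function_def)
    then have s': "s' \<in> test_closure S" unfolding s'_def
      by (intro test_closure_sum[OF Sl] test_closure_scale[OF Sl] setc)
    have eq: "s' x = s x" if "x \<in> S" for x
    proof -
      have "s' x = (\<Sum>y\<in>s ` S. if y = s x then y else 0)"
        unfolding s'_def using that by (intro sum.cong) auto
      then show ?thesis using fin that by simp
    qed
    have sm: "s \<in> borel_measurable (lebesgue_on S)" using s by (rule borel_measurable_simple_function)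
    have "s \<in> L2 S"
    proof (rule L2_AE_cong[OF _ sm])
      show "s' \<in> L2 S" using s' by (simp add: test_closure_def)
    qed (use eq in \<open>auto intro!: AE_I2\<close>)
    then show ?thesis
    proof (rule test_closure_closed[OF Sl])
      fix e :: real assume "e > 0"
      have "l2norm S (\<lambda>x. s x - s' x) = l2norm S (\<lambda>x. 0::real)" by (rule l2norm_cong_on) (simp add: eq)
      then have "l2norm S (\<lambda>x. s x - s' x) < e" using \<open>e > 0\<close> by (simp add: l2norm_def)
      then show "\<exists>h\<in>test_closure S. l2norm S (\<lambda>x. s x - h x) < e" using s' by blast
    qed
  qed
  have gm: "g \<in> borel_measurable (lebesgue_on S)" by (rule L2_measurable[OF g])
  obtain s where s: "\<And>k. simple_function (lebesgue_on S) (s k)"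
    "\<And>x. x \<in> S \<Longrightarrow> (\<lambda>k. s k x) \<longlonglongrightarrow> g x" "\<And>k x. x \<in> S \<Longrightarrow> dist (s k x) 0 \<le> 2 * dist (g x) 0"
    using borel_measurable_implies_sequence_metric[OF gm, of 0] unfolding space_lebesgue_on by metis
  show ?thesis
  proof (rule test_closure_limit[OF Sl g, where h=s])
    show "s k \<in> test_closure S" for k by (rule simplec[OF s(1)])
    show "(\<lambda>k. l2norm S (\<lambda>x. g x - s k x)) \<longlonglongrightarrow> 0"
    proof (rule l2norm_dominated_convergence[OF L2_scale[OF g, of 3]])
      show "AE x in lebesgue_on S. norm (g x - s k x) \<le> norm (3 *\<^sub>R g x)" for k
      proof (intro AE_I2)
        fix x assume "x \<in> space (lebesgue_on S)"
        then have "\<bar>s k x\<bar> \<le> 2 * \<bar>g x\<bar>" using s(3)[of x k] by simp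
        then show "norm (g x - s k x) \<le> norm (3 *\<^sub>R g x)" by simp
      qed
    qed (use s gm in \<open>auto intro!: AE_I2 borel_measurable_simple_function\<close>)
  qed
qed

corollary test_function_sequence:
  assumes "open S" "bounded S" "g \<in> L2 S"
  obtains \<psi> where "\<And>k::nat. \<psi> k \<in> test_functions S" "(\<lambda>k. l2norm S (\<lambda>x. g x - \<psi> k x)) \<longlonglongrightarrow> 0"
proof -
  have "\<exists>\<psi>\<in>test_functions S. l2norm S (\<lambda>x. g x - \<psi> x) < inverse (real (Suc k))" for k
    using test_functions_dense[OF assms] unfolding test_closure_def by simp
  then obtain \<psi> where \<psi>: "\<And>k. \<psi> k \<in> test_functions S" "\<And>k. l2norm S (\<lambda>x. g x - \<psi> k x) < inverse (real (Suc k))"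
    by metis
  have "(\<lambda>k. l2norm S (\<lambda>x. g x - \<psi> k x)) \<longlonglongrightarrow> 0"
    by (rule tendsto_sandwich[OF _ _ tendsto_const LIMSEQ_inverse_real_of_nat])
      (use \<psi>(2) in \<open>auto intro!: always_eventually less_imp_le\<close>)
  with \<psi>(1) show thesis by (rule that)
qed

text \<open>\<open>g\<close> is orthogonal to a dense set, hence to itself.\<close>
lemma fundamental_lemma_L2:
  assumes S: "open S" "bounded S" and g: "g \<in> L2 S"
    and z: "\<And>\<psi>. \<psi> \<in> test_functions S \<Longrightarrow> (LINT x|lebesgue_on S. g x * \<psi> x) = 0"
  shows "AE x in lebesgue_on S. g x = 0"
proof -
  have Sl: "S \<in> sets lebesgue" using S by simp
  obtain \<psi> where \<psi>: "\<And>k::nat. \<psi> k \<in> test_functions S" "(\<lambda>k. l2norm S (\<lambda>x. g x - \<psi> k x)) \<longlonglongrightarrow> 0"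
    by (rule test_function_sequence[OF assms(1-3)]) (rule that)
  have "vip S g g \<le> l2norm S g * l2norm S (\<lambda>x. g x - \<psi> k x)" for k
  proof -
    have \<psi>L: "\<psi> k \<in> L2 S" by (rule test_L2[OF \<psi>(1) Sl])
    have "vip S g (\<lambda>x. g x - \<psi> k x) = vip S g g - vip S g (\<psi> k)"
      by (rule L2.ip_diff_right[OF g \<psi>L g])
    moreover have "vip S g (\<psi> k) = 0" using z[OF \<psi>(1)] by (simp add: vip_def)
    moreover have "\<bar>vip S g (\<lambda>x. g x - \<psi> k x)\<bar> \<le> l2norm S g * l2norm S (\<lambda>x. g x - \<psi> k x)"
      unfolding l2norm_eq_nrm by (intro L2.cauchy_schwarz g L2_diff \<psi>L)
    ultimately show ?thesis by simp
  qed
  moreover have "(\<lambda>k. l2norm S g * l2norm S (\<lambda>x. g x - \<psi> k x)) \<longlonglongrightarrow> l2norm S g * 0"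
    by (intro tendsto_intros \<psi>(2))
  ultimately have "vip S g g \<le> 0" by (intro LIMSEQ_le_const) auto
  then have "l2norm S g = 0" using L2.ip_pos[OF g] by (simp add: l2norm_eq_nrm L2.nrm_def)
  then show ?thesis using l2norm_zero_iff[OF g] by simp
qed

text \<open>The density argument is not available for integrable functions, as their product with an
  approximating sequence need not converge. Instead, the integral of \<open>f\<close> over every open subset
  vanishes, as the indicator of such a set is a bounded limit of test functions. The set where \<open>f\<close>
  is positive is, up to a null set, a decreasing intersection of open sets; so \<open>f\<close> has integral zero
  over it. The same applies to \<open>- f\<close>.\<close>
lemma fundamental_lemma_L1:
  fixes f :: "'a::euclidean_space \<Rightarrow> real"
  assumes S: "open S" and f: "integrable (lebesgue_on S) f"
    and z: "\<And>\<psi>. \<psi> \<in> test_functions S \<Longrightarrow> (LINT x|lebesgue_on S. \<psi> x * f x) = 0"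
  shows "AE x in lebesgue_on S. f x = 0"
proof -
  have Sl: "S \<in> sets lebesgue" using S by simp
  note [measurable] = borel_measurable_integrable[OF f]
  have o: "(LINT x|lebesgue_on S. indicator U x * f x) = 0" if U: "open U" "U \<subseteq> S" for U
  proof -
    obtain \<psi> :: "nat \<Rightarrow> 'a \<Rightarrow> real" where \<psi>: "\<And>k. \<psi> k \<in> test_functions U" "\<And>k x. 0 \<le> \<psi> k x"
      "\<And>k x. \<psi> k x \<le> 1" "\<And>x. (\<lambda>k. \<psi> k x) \<longlonglongrightarrow> indicator U x"
      by (rule open_indicator_limit_of_tests[OF U(1)]) (rule that)
    have [measurable]: "(indicator U :: 'a \<Rightarrow> real) \<in> borel_measurable (lebesgue_on S)"
      using U by (intro borel_measurable_lebesgue_on) auto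
    have [measurable]: "\<psi> k \<in> borel_measurable (lebesgue_on S)" for k by (rule test_measurable[OF \<psi>(1)])
    have "(\<lambda>k. LINT x|lebesgue_on S. \<psi> k x * f x) \<longlonglongrightarrow> (LINT x|lebesgue_on S. indicator U x * f x)"
    proof (rule integral_dominated_convergence[where w="\<lambda>x. norm (f x)"])
      show "AE x in lebesgue_on S. norm (\<psi> k x * f x) \<le> norm (f x)" for k
        using \<psi>(2,3) by (auto simp: abs_mult intro!: mult_left_le_one_le)
    qed (use f \<psi>(4) in \<open>auto intro!: tendsto_mult\<close>)
    moreover have "(LINT x|lebesgue_on S. \<psi> k x * f x) = 0" for k
      using \<psi>(1) test_functions_mono[OF U(2)] by (intro z) blast
    ultimately show ?thesis by (simp add: LIMSEQ_const_iff)
  qed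
  have pos: "AE x in lebesgue_on S. F x \<le> 0" if F: "integrable (lebesgue_on S) F"
    and oF: "\<And>U. open U \<Longrightarrow> U \<subseteq> S \<Longrightarrow> (LINT x|lebesgue_on S. indicator U x * F x) = 0" for F :: "'a \<Rightarrow> real"
  proof -
    note [measurable] = borel_measurable_integrable[OF F]
    define A where "A = {x \<in> S. F x > 0}"
    have A: "A \<in> sets (lebesgue_on S)"
      using borel_measurable_integrable[OF F, THEN measurable_sets, of "{0<..}"]
      by (simp add: A_def vimage_def Collect_conj_eq Int_commute)
    then have Al: "A \<in> sets lebesgue" "A \<subseteq> S" using Sl by (auto simp: sets_restrict_space_iff)
    have "\<exists>U. open U \<and> A \<subseteq> U \<and> (U - A) \<in> lmeasurable \<and> emeasure lebesgue (U - A) < ennreal (inverse (real (Suc n)))" for n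
      by (rule sets_lebesgue_outer_open[OF Al(1), of "inverse (real (Suc n))"]) auto
    then obtain U where U: "\<And>n. open (U n)" "\<And>n. A \<subseteq> U n" "\<And>n. (U n - A) \<in> lmeasurable"
      "\<And>n. emeasure lebesgue (U n - A) < ennreal (inverse (real (Suc n)))" by metis
    define V where "V n = S \<inter> (\<Inter>k\<le>n. U k)" for n
    have V: "open (V n)" "V n \<subseteq> S" for n unfolding V_def using S U(1) by auto
    define C where "C = S \<inter> (\<Inter>k. U k)"
    have Cl: "C \<in> sets lebesgue" unfolding C_def using U(1) Sl by (intro sets.Int sets.countable_INT) auto
    have CA: "C - A \<in> null_sets lebesgue"
    proof -
      have "emeasure lebesgue (C - A) \<le> ennreal (inverse (real (Suc n)))" for n
      proof -
        have "emeasure lebesgue (C - A) \<le> emeasure lebesgue (U n - A)"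
          using U(3)[of n] by (intro emeasure_mono) (auto simp: C_def fmeasurable_def)
        then show ?thesis using U(4)[of n] by simp
      qed
      moreover have "(\<lambda>n. ennreal (inverse (real (Suc n)))) \<longlonglongrightarrow> ennreal 0"
        by (intro tendsto_ennrealI LIMSEQ_inverse_real_of_nat)
      ultimately have "emeasure lebesgue (C - A) \<le> 0"
        by (intro LIMSEQ_le_const[where X="\<lambda>n. ennreal (inverse (real (Suc n)))"]) auto
      then show ?thesis using Cl Al by (auto simp: null_sets_def)
    qed
    have [measurable]: "(indicator (V n) :: 'a \<Rightarrow> real) \<in> borel_measurable (lebesgue_on S)" for n
      using V by (intro borel_measurable_lebesgue_on) auto
    have [measurable]: "(indicator C :: 'a \<Rightarrow> real) \<in> borel_measurable (lebesgue_on S)"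
      using Cl Sl by (intro borel_measurable_indicator) (auto simp: sets_restrict_space_iff C_def)
    have "(\<lambda>n. LINT x|lebesgue_on S. indicator (V n) x * F x) \<longlonglongrightarrow> (LINT x|lebesgue_on S. indicator C x * F x)"
    proof (rule integral_dominated_convergence[where w="\<lambda>x. norm (F x)"])
      show "AE x in lebesgue_on S. (\<lambda>n. indicator (V n) x * F x) \<longlonglongrightarrow> indicator C x * F x"
      proof (intro AE_I2 tendsto_mult tendsto_const)
        fix x
        have "\<forall>\<^sub>F n in sequentially. indicator (V n) x = indicat_real C x"
        proof (cases "x \<in> C")
          case True
          then show ?thesis by (auto simp: V_def C_def)
        next
          case False
          then obtain k where "x \<notin> S \<or> x \<notin> U k" by (auto simp: C_def)
          then have "\<And>n. n \<ge> k \<Longrightarrow> x \<notin> V n" by (auto simp: V_def)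
          then show ?thesis using False by (auto simp: eventually_sequentially intro!: exI[of _ k])
        qed
        then show "(\<lambda>n. indicat_real (V n) x) \<longlonglongrightarrow> indicat_real C x" by (rule tendsto_eventually)
      qed
      show "AE x in lebesgue_on S. norm (indicator (V n) x * F x) \<le> norm (F x)" for n
        by (auto simp: indicator_def)
    qed (use F in auto)
    moreover have "(LINT x|lebesgue_on S. indicator (V n) x * F x) = 0" for n by (rule oF[OF V])
    ultimately have i0: "(LINT x|lebesgue_on S. indicator C x * F x) = 0"
      by (simp add: LIMSEQ_const_iff)
    have "AE x in lebesgue. x \<notin> C - A" using CA by (rule AE_not_in)
    then have ae: "AE x in lebesgue_on S. x \<notin> C - A" using Sl by (subst AE_restrict_space_iff) auto
    have int: "integrable (lebesgue_on S) (\<lambda>x. indicator C x * F x)"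
      by (rule Bochner_Integration.integrable_bound[OF F]) (measurable, auto simp: indicator_def)
    have "AE x in lebesgue_on S. indicator C x * F x = 0"
    proof (rule integral_nonneg_eq_0_iff_AE[THEN iffD1, OF int _ i0])
      show "AE x in lebesgue_on S. 0 \<le> indicator C x * F x"
        using ae by eventually_elim (auto simp: indicator_def A_def)
    qed
    then show ?thesis
      using AE_space[of "lebesgue_on S"]
      by eventually_elim (use U(2) in \<open>force simp: indicator_def A_def C_def not_less split: if_splits\<close>)
  qed
  have "AE x in lebesgue_on S. f x \<le> 0" by (rule pos[OF f o])
  moreover have "AE x in lebesgue_on S. - f x \<le> 0" using f o by (intro pos) auto
  ultimately show ?thesis by eventually_elim auto
qed

section \<open>Weak gradients and the energy form\<close>

lemma measurable_AE_cong:
  fixes f g :: "'a::euclidean_space \<Rightarrow> 'b::euclidean_space"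
  assumes S: "S \<in> sets lebesgue" and g: "g \<in> borel_measurable (lebesgue_on S)"
    and eq: "AE x in lebesgue_on S. f x = g x"
  shows "f \<in> borel_measurable (lebesgue_on S)"
proof -
  have "(\<lambda>x. if x \<in> S then g x else 0) \<in> borel_measurable lebesgue"
    using g S by (simp add: borel_measurable_if)
  moreover have "AE x in lebesgue. (if x \<in> S then g x else 0) = (if x \<in> S then f x else 0)"
    using eq S by (simp add: AE_restrict_space_iff) (auto elim!: eventually_mono)
  ultimately have "(\<lambda>x. if x \<in> S then f x else 0) \<in> borel_measurable lebesgue"
    by (rule borel_measurable_AE)
  then show ?thesis using S by (simp add: borel_measurable_if)
qed

lemma L2_AE_cong': fixes f g :: "'a::euclidean_space \<Rightarrow> 'b::euclidean_space"
  assumes "S \<in> sets lebesgue" "g \<in> L2 S" "AE x in lebesgue_on S. f x = g x"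
  shows "f \<in> L2 S"
  by (rule L2_AE_cong[OF assms(2) measurable_AE_cong[OF assms(1) L2_measurable[OF assms(2)] assms(3)]])
    (use assms(3) in \<open>auto elim: eventually_mono\<close>)

lemma L2_component: fixes g :: "'a::euclidean_space \<Rightarrow> 'a"
  assumes "g \<in> L2 S" "i \<in> Basis" shows "(\<lambda>x. g x \<bullet> i) \<in> L2 S"
proof (rule L2_bound[OF _ assms(1), where c=1])
  show "AE x in lebesgue_on S. norm (g x \<bullet> i) \<le> 1 * norm (g x)"
    using assms(2) Basis_le_norm by auto
qed (use L2_measurable[OF assms(1)] in measurable)

lemma L2_mult_bounded: fixes g :: "'a::euclidean_space \<Rightarrow> 'b::euclidean_space"
  assumes "g \<in> L2 S" "m \<in> borel_measurable (lebesgue_on S)" "\<And>x. \<bar>m x\<bar> \<le> B"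
  shows "(\<lambda>x. m x *\<^sub>R g x) \<in> L2 S"
proof (rule L2_bound[OF _ assms(1), where c=B])
  show "AE x in lebesgue_on S. norm (m x *\<^sub>R g x) \<le> B * norm (g x)"
    using assms(3) by (auto intro!: mult_right_mono)
qed (use L2_measurable[OF assms(1)] assms(2) in measurable)

lemma L2_integrable_mult: "f \<in> L2 S \<Longrightarrow> g \<in> L2 S \<Longrightarrow> integrable (lebesgue_on S) (\<lambda>x. f x * g x :: real)"
  using L2_integrable_inner[of f S g] by simp

lemma vector_AE_zero: fixes g :: "'a \<Rightarrow> 'b::euclidean_space"
  assumes "\<And>i. i \<in> Basis \<Longrightarrow> AE x in M. g x \<bullet> i = 0" shows "AE x in M. g x = 0"
proof -
  have "AE x in M. \<forall>i\<in>Basis. g x \<bullet> i = 0" using assms by (subst AE_finite_all) auto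
  then show ?thesis by eventually_elim (auto intro: euclidean_eqI)
qed

locale bounded_domain =
  fixes \<Omega> :: "'a::euclidean_space set"
  assumes open_domain: "open \<Omega>" and bounded_domain: "bounded \<Omega>"
begin

lemma domain_lebesgue: "\<Omega> \<in> sets lebesgue" using open_domain by simp

lemma is_wgradD: assumes "is_wgrad \<Omega> v g" "\<psi> \<in> test_functions \<Omega>" "i \<in> Basis"
  shows "(LINT x|lebesgue_on \<Omega>. v x * partial i \<psi> x) = - (LINT x|lebesgue_on \<Omega>. (g x \<bullet> i) * \<psi> x)"
  using assms by (auto simp: is_wgrad_def partial_def)

lemma is_wgradI: assumes "g \<in> L2 \<Omega>" "\<And>\<psi> i. \<psi> \<in> test_functions \<Omega> \<Longrightarrow> i \<in> Basis \<Longrightarrow>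
    (LINT x|lebesgue_on \<Omega>. v x * partial i \<psi> x) = - (LINT x|lebesgue_on \<Omega>. (g x \<bullet> i) * \<psi> x)"
  shows "is_wgrad \<Omega> v g"
  using assms by (auto simp: is_wgrad_def partial_def)

lemma is_wgrad_L2: "is_wgrad \<Omega> v g \<Longrightarrow> g \<in> L2 \<Omega>" by (simp add: is_wgrad_def)

lemma test_L2': "\<psi> \<in> test_functions \<Omega> \<Longrightarrow> \<psi> \<in> L2 \<Omega>" by (rule test_L2[OF _ domain_lebesgue])

lemma is_wgrad_unique: assumes "is_wgrad \<Omega> v g" "is_wgrad \<Omega> v g'"
  shows "AE x in lebesgue_on \<Omega>. g x = g' x"
proof -
  have g: "g \<in> L2 \<Omega>" "g' \<in> L2 \<Omega>" using assms by (auto dest: is_wgrad_L2)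
  have "AE x in lebesgue_on \<Omega>. g x - g' x = 0"
  proof (rule vector_AE_zero, rule fundamental_lemma_L2[OF open_domain bounded_domain])
    fix i :: 'a assume i: "i \<in> Basis"
    show "(\<lambda>x. (g x - g' x) \<bullet> i) \<in> L2 \<Omega>" by (intro L2_component L2_diff g i)
    fix \<psi> assume \<psi>: "\<psi> \<in> test_functions \<Omega>"
    have "(LINT x|lebesgue_on \<Omega>. (g x - g' x) \<bullet> i * \<psi> x)
        = (LINT x|lebesgue_on \<Omega>. (g x \<bullet> i) * \<psi> x) - (LINT x|lebesgue_on \<Omega>. (g' x \<bullet> i) * \<psi> x)"
      using g i \<psi> by (simp add: inner_diff_left left_diff_distrib L2_integrable_mult L2_component test_L2')
    then show "(LINT x|lebesgue_on \<Omega>. (g x - g' x) \<bullet> i * \<psi> x) = 0"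
      using is_wgradD[OF assms(1) \<psi> i] is_wgradD[OF assms(2) \<psi> i] by simp
  qed
  then show ?thesis by eventually_elim simp
qed

lemma is_wgrad_add: assumes "is_wgrad \<Omega> v g" "is_wgrad \<Omega> w h" "v \<in> L2 \<Omega>" "w \<in> L2 \<Omega>"
  shows "is_wgrad \<Omega> (\<lambda>x. v x + w x) (\<lambda>x. g x + h x)"
proof (rule is_wgradI)
  have gh: "g \<in> L2 \<Omega>" "h \<in> L2 \<Omega>" using assms by (auto dest: is_wgrad_L2)
  then show "(\<lambda>x. g x + h x) \<in> L2 \<Omega>" by (rule L2_add)
  fix \<psi> i assume \<psi>: "\<psi> \<in> test_functions \<Omega>" and i: "i \<in> (Basis::'a set)"
  show "(LINT x|lebesgue_on \<Omega>. (v x + w x) * partial i \<psi> x) = - (LINT x|lebesgue_on \<Omega>. (g x + h x) \<bullet> i * \<psi> x)"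
    using gh assms \<psi> i is_wgradD[OF assms(1) \<psi> i] is_wgradD[OF assms(2) \<psi> i]
    by (simp add: inner_add_left distrib_right L2_integrable_mult L2_component test_L2' test_partial)
qed

lemma is_wgrad_scale: assumes "is_wgrad \<Omega> v g"
  shows "is_wgrad \<Omega> (\<lambda>x. c * v x) (\<lambda>x. c *\<^sub>R g x)"
proof (rule is_wgradI)
  show "(\<lambda>x. c *\<^sub>R g x) \<in> L2 \<Omega>" using assms by (intro L2_scale is_wgrad_L2)
qed (use is_wgradD[OF assms] in \<open>simp add: mult.assoc\<close>)

lemma is_wgrad_cong: assumes "is_wgrad \<Omega> v g" "v \<in> L2 \<Omega>" "AE x in lebesgue_on \<Omega>. v' x = v x"
  shows "is_wgrad \<Omega> v' g"
proof (rule is_wgradI)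
  show "g \<in> L2 \<Omega>" using assms(1) by (rule is_wgrad_L2)
  have v': "v' \<in> L2 \<Omega>" by (rule L2_AE_cong'[OF domain_lebesgue assms(2,3)])
  fix \<psi> i assume \<psi>: "\<psi> \<in> test_functions \<Omega>" and i: "i \<in> (Basis::'a set)"
  note [measurable] = L2_measurable[OF v'] L2_measurable[OF assms(2)] test_measurable[OF test_partial[OF \<psi> i]]
  have "(LINT x|lebesgue_on \<Omega>. v' x * partial i \<psi> x) = (LINT x|lebesgue_on \<Omega>. v x * partial i \<psi> x)"
    by (rule integral_cong_AE) (measurable, use assms(3) in \<open>auto elim: eventually_mono\<close>)
  then show "(LINT x|lebesgue_on \<Omega>. v' x * partial i \<psi> x) = - (LINT x|lebesgue_on \<Omega>. g x \<bullet> i * \<psi> x)"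
    using is_wgradD[OF assms(1) \<psi> i] by simp
qed

lemma H1_L2: "v \<in> H1 \<Omega> \<Longrightarrow> v \<in> L2 \<Omega>" by (simp add: H1_def)

lemma H1_wgrad: "v \<in> H1 \<Omega> \<Longrightarrow> is_wgrad \<Omega> v (wgrad \<Omega> v)"
  by (simp add: H1_def wgrad_def someI_ex)

lemma H1_wgrad_L2: "v \<in> H1 \<Omega> \<Longrightarrow> wgrad \<Omega> v \<in> L2 \<Omega>"
  using H1_wgrad is_wgrad_L2 by blast

lemma H1I: "v \<in> L2 \<Omega> \<Longrightarrow> is_wgrad \<Omega> v g \<Longrightarrow> v \<in> H1 \<Omega>" by (auto simp: H1_def)

lemma wgrad_eq: assumes "is_wgrad \<Omega> v g" shows "AE x in lebesgue_on \<Omega>. wgrad \<Omega> v x = g x"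
proof -
  have "is_wgrad \<Omega> v (wgrad \<Omega> v)" unfolding wgrad_def by (rule someI[of "is_wgrad \<Omega> v", OF assms])
  then show ?thesis by (rule is_wgrad_unique[OF _ assms])
qed

lemma H1_zero: "(\<lambda>x. 0) \<in> H1 \<Omega>"
  by (rule H1I[of _ "\<lambda>x. 0"]) (auto simp: L2_zero intro!: is_wgradI)

lemma H1_add: "v \<in> H1 \<Omega> \<Longrightarrow> w \<in> H1 \<Omega> \<Longrightarrow> (\<lambda>x. v x + w x) \<in> H1 \<Omega>"
  by (rule H1I[OF L2_add is_wgrad_add[OF H1_wgrad H1_wgrad]]) (auto simp: H1_L2)

lemma H1_scale: "v \<in> H1 \<Omega> \<Longrightarrow> (\<lambda>x. c * v x) \<in> H1 \<Omega>"
  by (rule H1I[OF _ is_wgrad_scale[OF H1_wgrad]]) (use L2_scale[of v \<Omega> c] in \<open>auto simp: H1_L2\<close>)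

lemma wgrad_add: "v \<in> H1 \<Omega> \<Longrightarrow> w \<in> H1 \<Omega> \<Longrightarrow>
    AE x in lebesgue_on \<Omega>. wgrad \<Omega> (\<lambda>x. v x + w x) x = wgrad \<Omega> v x + wgrad \<Omega> w x"
  by (intro wgrad_eq is_wgrad_add H1_wgrad H1_L2)

lemma wgrad_scale: "v \<in> H1 \<Omega> \<Longrightarrow>
    AE x in lebesgue_on \<Omega>. wgrad \<Omega> (\<lambda>x. c * v x) x = c *\<^sub>R wgrad \<Omega> v x"
  by (intro wgrad_eq is_wgrad_scale H1_wgrad)

lemma H1_cong: assumes "v \<in> H1 \<Omega>" "AE x in lebesgue_on \<Omega>. v' x = v x" shows "v' \<in> H1 \<Omega>"
  by (rule H1I[OF L2_AE_cong'[OF domain_lebesgue H1_L2 assms(2)] is_wgrad_cong[OF H1_wgrad H1_L2 assms(2)]])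
    (use assms in auto)

lemma wgrad_cong: assumes "v \<in> H1 \<Omega>" "AE x in lebesgue_on \<Omega>. v' x = v x"
  shows "AE x in lebesgue_on \<Omega>. wgrad \<Omega> v' x = wgrad \<Omega> v x"
  by (rule wgrad_eq[OF is_wgrad_cong[OF H1_wgrad[OF assms(1)] H1_L2[OF assms(1)] assms(2)]])

lemma test_is_wgrad: assumes "\<psi> \<in> test_functions \<Omega>"
  shows "is_wgrad \<Omega> \<psi> (\<lambda>x. \<Sum>i\<in>Basis. partial i \<psi> x *\<^sub>R i)"
proof (rule is_wgradI)
  show "(\<lambda>x. \<Sum>i\<in>Basis. partial i \<psi> x *\<^sub>R i) \<in> L2 \<Omega>"
  proof (rule L2.sum_mem)
    fix i :: 'a assume i: "i \<in> Basis"
    show "(\<lambda>x. partial i \<psi> x *\<^sub>R i) \<in> L2 \<Omega>"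
      using test_measurable[OF test_partial[OF assms i], of \<Omega>] i
      by (intro L2_bound[OF _ test_L2'[OF test_partial[OF assms i]], where c=1]) auto
  qed
  fix \<phi> i assume \<phi>: "\<phi> \<in> test_functions \<Omega>" and i: "i \<in> (Basis::'a set)"
  have "(\<Sum>j\<in>Basis. partial j \<psi> x *\<^sub>R j) \<bullet> i = partial i \<psi> x" for x
    using i by simp
  moreover have "smooth \<psi>" using assms by (auto elim: test_functionsE)
  ultimately show "(LINT x|lebesgue_on \<Omega>. \<psi> x * partial i \<phi> x)
      = - (LINT x|lebesgue_on \<Omega>. ((\<Sum>j\<in>Basis. partial j \<psi> x *\<^sub>R j) \<bullet> i) * \<phi> x)"
    using test_integration_by_parts[OF \<phi> _ i domain_lebesgue] by simp
qed

lemma test_H1: "\<psi> \<in> test_functions \<Omega> \<Longrightarrow> \<psi> \<in> H1 \<Omega>"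
  using test_is_wgrad test_L2' H1I by blast

text \<open>A test function on \<open>U\<close> is a test function on the whole domain, so the weak gradient on \<open>U\<close> is
  determined by the values of the function on \<open>U\<close>.\<close>
lemma wgrad_zero_on_open:
  assumes v: "v \<in> H1 \<Omega>" and U: "open U" "U \<subseteq> \<Omega>" and z: "AE x in lebesgue_on U. v x = 0"
  shows "AE x in lebesgue_on U. wgrad \<Omega> v x = 0"
proof (rule vector_AE_zero, rule fundamental_lemma_L2[OF U(1)])
  have Ul: "U \<in> sets lebesgue" using U by simp
  have restr: "(LINT x|lebesgue_on U. f x) = (LINT x|lebesgue_on \<Omega>. f x)"
    if "\<And>x. x \<notin> U \<Longrightarrow> f x = 0" for f :: "'a \<Rightarrow> real"
  proof -
    have "indicator U x *\<^sub>R f x = indicator \<Omega> x *\<^sub>R f x" for x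
      using that[of x] U(2) by (auto simp: indicator_def)
    then have "(LINT x|lebesgue. indicator U x *\<^sub>R f x) = (LINT x|lebesgue. indicator \<Omega> x *\<^sub>R f x)"
      by (simp only:)
    then show ?thesis using Ul domain_lebesgue by (simp add: integral_restrict_space)
  qed
  have L2_sub: "g \<in> L2 U" if "g \<in> L2 \<Omega>" for g :: "'a \<Rightarrow> real"
  proof (rule L2_I)
    show "g \<in> borel_measurable (lebesgue_on U)"
      using L2_measurable[OF that] measurable_restrict_mono[OF _ U(2)] by blast
    have "integrable lebesgue (\<lambda>x. indicator U x *\<^sub>R (indicator \<Omega> x *\<^sub>R (norm (g x))\<^sup>2))"
    proof (rule integrable_mult_indicator)
      show "integrable lebesgue (\<lambda>x. indicator \<Omega> x *\<^sub>R (norm (g x))\<^sup>2)"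
        using that domain_lebesgue by (simp add: L2_def integrable_restrict_space)
    qed (rule Ul)
    moreover have "indicator U x *\<^sub>R (indicator \<Omega> x *\<^sub>R (norm (g x))\<^sup>2) = indicator U x *\<^sub>R (norm (g x))\<^sup>2" for x
      using U(2) by (auto simp: indicator_def)
    ultimately have "integrable lebesgue (\<lambda>x. indicator U x *\<^sub>R (norm (g x))\<^sup>2)" by (simp only:)
    then show "integrable (lebesgue_on U) (\<lambda>x. (norm (g x))\<^sup>2)"
      using Ul by (simp add: integrable_restrict_space)
  qed
  show "bounded U" using bounded_subset[OF bounded_domain U(2)] .
  fix i :: 'a assume i: "i \<in> Basis"
  show "(\<lambda>x. wgrad \<Omega> v x \<bullet> i) \<in> L2 U" by (intro L2_sub L2_component H1_wgrad_L2 v i)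
  fix \<psi> assume \<psi>: "\<psi> \<in> test_functions U"
  then have \<psi>': "\<psi> \<in> test_functions \<Omega>" using test_functions_mono[OF U(2)] by blast
  have p: "partial i \<psi> \<in> test_functions U" using \<psi> i by (rule test_partial)
  have "(LINT x|lebesgue_on U. wgrad \<Omega> v x \<bullet> i * \<psi> x) = (LINT x|lebesgue_on \<Omega>. wgrad \<Omega> v x \<bullet> i * \<psi> x)"
    using test_support[OF \<psi>] by (intro restr) auto
  also have "\<dots> = - (LINT x|lebesgue_on \<Omega>. v x * partial i \<psi> x)"
    using is_wgradD[OF H1_wgrad[OF v] \<psi>' i] by simp
  also have "(LINT x|lebesgue_on \<Omega>. v x * partial i \<psi> x) = (LINT x|lebesgue_on U. v x * partial i \<psi> x)"
    using test_support[OF p] by (intro restr[symmetric]) auto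
  also have "\<dots> = 0"
    using z by (intro integral_eq_zero_AE) (auto elim: eventually_mono)
  finally show "(LINT x|lebesgue_on U. wgrad \<Omega> v x \<bullet> i * \<psi> x) = 0" by simp
qed

definition h1ip :: "('a \<Rightarrow> real) \<Rightarrow> ('a \<Rightarrow> real) \<Rightarrow> real" where
  "h1ip v w = vip \<Omega> v w + vip \<Omega> (wgrad \<Omega> v) (wgrad \<Omega> w)"

lemma vip_wgrad_add: "u \<in> H1 \<Omega> \<Longrightarrow> v \<in> H1 \<Omega> \<Longrightarrow> g \<in> L2 \<Omega> \<Longrightarrow>
   vip \<Omega> (wgrad \<Omega> (\<lambda>x. u x + v x)) g = vip \<Omega> (wgrad \<Omega> u) g + vip \<Omega> (wgrad \<Omega> v) g"
  by (subst L2.ip_add[symmetric]) (auto intro!: vip_cong wgrad_add H1_wgrad_L2 H1_add L2_add)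

lemma vip_wgrad_scale: "v \<in> H1 \<Omega> \<Longrightarrow> g \<in> L2 \<Omega> \<Longrightarrow>
   vip \<Omega> (wgrad \<Omega> (\<lambda>x. c * v x)) g = c * vip \<Omega> (wgrad \<Omega> v) g"
  by (subst L2.ip_scale[symmetric]) (auto intro!: vip_cong wgrad_scale H1_wgrad_L2 H1_scale L2_scale)

sublocale H: semi_inner_space "H1 \<Omega>" h1ip
proof unfold_locales
  show "h1ip (\<lambda>x. u x + v x) w = h1ip u w + h1ip v w" if "u \<in> H1 \<Omega>" "v \<in> H1 \<Omega>" "w \<in> H1 \<Omega>" for u v w
    using that by (simp add: h1ip_def vip_wgrad_add H1_wgrad_L2 H1_L2 L2.ip_add)
  show "h1ip (\<lambda>x. c *\<^sub>R v x) w = c * h1ip v w" if "v \<in> H1 \<Omega>" "w \<in> H1 \<Omega>" for c v w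
    using that L2.ip_scale[of v \<Omega> w c] by (simp add: h1ip_def vip_wgrad_scale H1_wgrad_L2 H1_L2 algebra_simps)
  show "h1ip v w = h1ip w v" if "v \<in> H1 \<Omega>" "w \<in> H1 \<Omega>" for v w
    using that L2.ip_sym[OF H1_L2 H1_L2, of v w] L2.ip_sym[OF H1_wgrad_L2 H1_wgrad_L2, of v w] by (simp add: h1ip_def)
  show "0 \<le> h1ip v v" if "v \<in> H1 \<Omega>" for v
    using L2.ip_pos[OF H1_L2[OF that]] L2.ip_pos[OF H1_wgrad_L2[OF that]] by (simp add: h1ip_def)
qed (auto simp: H1_zero H1_add H1_scale)

lemma h1norm_eq_nrm: "v \<in> H1 \<Omega> \<Longrightarrow> h1norm \<Omega> v = H.nrm v"
  unfolding h1norm_def H.nrm_def h1ip_def l2norm_eq_nrm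
  by (simp add: L2.nrm_sq H1_L2 H1_wgrad_L2)

lemma l2norm_le_h1norm: "l2norm \<Omega> v \<le> h1norm \<Omega> v"
  unfolding h1norm_def by (rule real_le_rsqrt) simp

lemma l2norm_wgrad_le_h1norm: "l2norm \<Omega> (wgrad \<Omega> v) \<le> h1norm \<Omega> v"
  unfolding h1norm_def by (rule real_le_rsqrt) simp

lemma h1norm_nonneg: "0 \<le> h1norm \<Omega> v" by (simp add: h1norm_def)

lemma h1norm_cong: assumes "v \<in> H1 \<Omega>" "AE x in lebesgue_on \<Omega>. v' x = v x"
  shows "h1norm \<Omega> v' = h1norm \<Omega> v"
proof -
  have v': "v' \<in> H1 \<Omega>" by (rule H1_cong[OF assms])
  have "l2norm \<Omega> v' = l2norm \<Omega> v"
    by (rule l2norm_cong) (use assms v' in \<open>auto intro: L2_measurable H1_L2 elim: eventually_mono\<close>)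
  moreover have "l2norm \<Omega> (wgrad \<Omega> v') = l2norm \<Omega> (wgrad \<Omega> v)"
    by (rule l2norm_cong) (use wgrad_cong[OF assms] assms v' in \<open>auto intro: L2_measurable H1_wgrad_L2 elim: eventually_mono\<close>)
  ultimately show ?thesis by (simp add: h1norm_def)
qed

lemma H10_H1: "v \<in> H10 \<Omega> \<Longrightarrow> v \<in> H1 \<Omega>" by (simp add: H10_def)

lemma H10_L2: "v \<in> H10 \<Omega> \<Longrightarrow> v \<in> L2 \<Omega>" by (simp add: H10_H1 H1_L2)

lemma test_H10: assumes "\<psi> \<in> test_functions \<Omega>" shows "\<psi> \<in> H10 \<Omega>"
proof -
  have "h1norm \<Omega> (\<lambda>x. \<psi> x - \<psi> x) = 0"
    using h1norm_eq_nrm[OF H1_zero] H.nrm_scale[OF H1_zero, of 0] by simp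
  then show ?thesis using assms test_H1[OF assms] by (auto simp: H10_def intro!: exI[of _ "\<lambda>k. \<psi>"])
qed

lemma H10_cong: assumes v: "v \<in> H10 \<Omega>" and eq: "AE x in lebesgue_on \<Omega>. v' x = v x" shows "v' \<in> H10 \<Omega>"
proof -
  obtain \<phi> where \<phi>: "\<And>k. \<phi> k \<in> test_functions \<Omega>" "(\<lambda>k::nat. h1norm \<Omega> (\<lambda>x. v x - \<phi> k x)) \<longlonglongrightarrow> 0"
    using v by (auto simp: H10_def)
  have "h1norm \<Omega> (\<lambda>x. v' x - \<phi> k x) = h1norm \<Omega> (\<lambda>x. v x - \<phi> k x)" for k
    using eq by (intro h1norm_cong H.diff_mem H10_H1 v test_H1 \<phi>) (auto elim: eventually_mono)
  then show ?thesis using \<phi> H1_cong[OF H10_H1[OF v] eq] by (auto simp: H10_def intro!: exI[of _ \<phi>])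
qed

lemma H10_add: assumes v: "v \<in> H10 \<Omega>" and w: "w \<in> H10 \<Omega>" shows "(\<lambda>x. v x + w x) \<in> H10 \<Omega>"
proof -
  obtain \<phi> where \<phi>: "\<And>k. \<phi> k \<in> test_functions \<Omega>" "(\<lambda>k::nat. h1norm \<Omega> (\<lambda>x. v x - \<phi> k x)) \<longlonglongrightarrow> 0"
    using v by (auto simp: H10_def)
  obtain \<psi> where \<psi>: "\<And>k. \<psi> k \<in> test_functions \<Omega>" "(\<lambda>k::nat. h1norm \<Omega> (\<lambda>x. w x - \<psi> k x)) \<longlonglongrightarrow> 0"
    using w by (auto simp: H10_def)
  note H = H10_H1[OF v] H10_H1[OF w] test_H1[OF \<phi>(1)] test_H1[OF \<psi>(1)]
  have "(\<lambda>k. h1norm \<Omega> (\<lambda>x. (v x + w x) - (\<phi> k x + \<psi> k x))) \<longlonglongrightarrow> 0"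
  proof (rule tendsto_sandwich[OF _ _ tendsto_const tendsto_add_zero[OF \<phi>(2) \<psi>(2)]])
    have "h1norm \<Omega> (\<lambda>x. (v x - \<phi> k x) + (w x - \<psi> k x)) \<le> h1norm \<Omega> (\<lambda>x. v x - \<phi> k x) + h1norm \<Omega> (\<lambda>x. w x - \<psi> k x)" for k
      using H.nrm_triangle[OF H.diff_mem[OF H(1,3)] H.diff_mem[OF H(2,4)], of k k] H
      by (simp add: h1norm_eq_nrm H.diff_mem H1_add)
    then show "\<forall>\<^sub>F k in sequentially. h1norm \<Omega> (\<lambda>x. (v x + w x) - (\<phi> k x + \<psi> k x))
        \<le> h1norm \<Omega> (\<lambda>x. v x - \<phi> k x) + h1norm \<Omega> (\<lambda>x. w x - \<psi> k x)"
      by (simp add: algebra_simps)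
  qed (simp add: h1norm_nonneg)
  then show ?thesis using H1_add[OF H(1,2)] test_add[OF \<phi>(1) \<psi>(1)]
    by (auto simp: H10_def intro!: exI[of _ "\<lambda>k x. \<phi> k x + \<psi> k x"])
qed

lemma H10_scale: assumes v: "v \<in> H10 \<Omega>" shows "(\<lambda>x. c * v x) \<in> H10 \<Omega>"
proof -
  obtain \<phi> where \<phi>: "\<And>k. \<phi> k \<in> test_functions \<Omega>" "(\<lambda>k::nat. h1norm \<Omega> (\<lambda>x. v x - \<phi> k x)) \<longlonglongrightarrow> 0"
    using v by (auto simp: H10_def)
  have d: "(\<lambda>x. v x - \<phi> k x) \<in> H1 \<Omega>" for k by (intro H.diff_mem H10_H1 v test_H1 \<phi>)
  have "h1norm \<Omega> (\<lambda>x. c * (v x - \<phi> k x)) = \<bar>c\<bar> * h1norm \<Omega> (\<lambda>x. v x - \<phi> k x)" for k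
    using H.nrm_scale[OF d, of c k] by (simp add: h1norm_eq_nrm d H1_scale[OF d])
  moreover have "(\<lambda>k. \<bar>c\<bar> * h1norm \<Omega> (\<lambda>x. v x - \<phi> k x)) \<longlonglongrightarrow> 0"
    using tendsto_mult_left[OF \<phi>(2), of "\<bar>c\<bar>"] by simp
  ultimately have "(\<lambda>k. h1norm \<Omega> (\<lambda>x. c * v x - c * \<phi> k x)) \<longlonglongrightarrow> 0"
    by (simp add: right_diff_distrib)
  then show ?thesis using H1_scale[OF H10_H1[OF v]] test_scale[OF \<phi>(1)]
    by (auto simp: H10_def intro!: exI[of _ "\<lambda>k x. c * \<phi> k x"])
qed

lemma H10_zero: "(\<lambda>x. 0) \<in> H10 \<Omega>" by (intro test_H10 test_zero)

lemma H10_diff: "v \<in> H10 \<Omega> \<Longrightarrow> w \<in> H10 \<Omega> \<Longrightarrow> (\<lambda>x. v x - w x) \<in> H10 \<Omega>"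
  using H10_add[of v "\<lambda>x. -1 * w x"] H10_scale[of w "-1"] by simp

end

locale energy_form = bounded_domain +
  fixes a :: "'a \<Rightarrow> real" and amin amax :: real
  assumes a_measurable: "a \<in> borel_measurable (lebesgue_on \<Omega>)"
    and a_bounds: "0 < amin" "\<And>x. amin \<le> a x" "\<And>x. a x \<le> amax"
begin

lemma a_pos: "0 < a x" using a_bounds(1) a_bounds(2)[of x] by simp

lemma amax_pos: "0 < amax" using a_pos a_bounds(3) by (meson less_le_trans)

abbreviation energy :: "('a \<Rightarrow> real) \<Rightarrow> ('a \<Rightarrow> real) \<Rightarrow> real" where
  "energy \<equiv> bform \<Omega> a \<Omega>"

abbreviation enorm :: "('a \<Rightarrow> real) \<Rightarrow> real" where
  "enorm v \<equiv> l2norm \<Omega> (sgrad \<Omega> a v)"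

lemma sgrad_L2: assumes "v \<in> H1 \<Omega>" shows "sgrad \<Omega> a v \<in> L2 \<Omega>"
  unfolding sgrad_def
proof (rule L2_mult_bounded[OF H1_wgrad_L2[OF assms], where B="sqrt amax"])
  show "(\<lambda>x. sqrt (a x)) \<in> borel_measurable (lebesgue_on \<Omega>)" using a_measurable by measurable
qed (use a_bounds(3) a_pos in \<open>simp add: less_imp_le\<close>)

lemma energy_eq_vip: "energy v w = vip \<Omega> (sgrad \<Omega> a v) (sgrad \<Omega> a w)"
proof -
  have "a x * (g \<bullet> h) = (sqrt (a x) *\<^sub>R g) \<bullet> (sqrt (a x) *\<^sub>R h)" for x and g h :: 'a
    using a_pos[of x] by (simp add: abs_of_pos flip: mult.assoc)
  then show ?thesis unfolding bform_def vip_def sgrad_def by (simp only:)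
qed

lemma energy_eq_vip_weighted: "energy v w = vip \<Omega> (wgrad \<Omega> v) (\<lambda>x. a x *\<^sub>R wgrad \<Omega> w x)"
  by (simp add: bform_def vip_def)

lemma weighted_wgrad_L2: assumes "v \<in> H1 \<Omega>" shows "(\<lambda>x. a x *\<^sub>R wgrad \<Omega> v x) \<in> L2 \<Omega>"
  by (rule L2_mult_bounded[OF H1_wgrad_L2[OF assms] a_measurable, where B=amax])
    (use a_bounds(3) a_pos in \<open>simp add: less_imp_le\<close>)

lemma enorm_eq: "enorm v = sqrt (energy v v)"
  by (simp add: energy_eq_vip l2norm_eq_nrm L2.nrm_def)

sublocale E: semi_inner_space "H10 \<Omega>" "energy"
proof unfold_locales
  show "energy (\<lambda>x. u x + v x) w = energy u w + energy v w" if "u \<in> H10 \<Omega>" "v \<in> H10 \<Omega>" "w \<in> H10 \<Omega>" for u v w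
    unfolding energy_eq_vip_weighted using that
    by (intro vip_wgrad_add weighted_wgrad_L2 H10_H1)
  show "energy (\<lambda>x. c *\<^sub>R v x) w = c * energy v w" if "v \<in> H10 \<Omega>" "w \<in> H10 \<Omega>" for c v w
    unfolding energy_eq_vip_weighted real_scaleR_def using that
    by (intro vip_wgrad_scale weighted_wgrad_L2 H10_H1)
  show "energy v w = energy w v" for v w
    by (simp add: bform_def inner_commute)
  show "0 \<le> energy v v" if "v \<in> H10 \<Omega>" for v
    unfolding energy_eq_vip by (intro L2.ip_pos sgrad_L2 H10_H1 that)
qed (auto simp: H10_zero H10_add H10_scale)

lemma enorm_eq_nrm: "enorm v = E.nrm v"
  by (simp add: enorm_eq E.nrm_def)

lemma enorm_le_h1norm: assumes "v \<in> H1 \<Omega>" shows "enorm v \<le> sqrt amax * h1norm \<Omega> v"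
proof -
  have "enorm v \<le> l2norm \<Omega> (\<lambda>x. sqrt amax *\<^sub>R wgrad \<Omega> v x)"
  proof (rule l2norm_mono)
    show "AE x in lebesgue_on \<Omega>. norm (sgrad \<Omega> a v x) \<le> norm (sqrt amax *\<^sub>R wgrad \<Omega> v x)"
    proof (intro AE_I2)
      fix x
      have "sqrt (a x) \<le> sqrt amax" using a_bounds(3) by simp
      then show "norm (sgrad \<Omega> a v x) \<le> norm (sqrt amax *\<^sub>R wgrad \<Omega> v x)"
        using a_pos[of x] amax_pos by (simp add: sgrad_def mult_right_mono)
    qed
  qed (use sgrad_L2[OF assms] H1_wgrad_L2[OF assms] in \<open>auto intro: L2_measurable L2_scale\<close>)
  also have "\<dots> = sqrt amax * l2norm \<Omega> (wgrad \<Omega> v)"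
    unfolding l2norm_eq_nrm using amax_pos by (subst L2.nrm_scale) (auto simp: H1_wgrad_L2[OF assms])
  also have "\<dots> \<le> sqrt amax * h1norm \<Omega> v"
    using amax_pos by (intro mult_left_mono l2norm_wgrad_le_h1norm) auto
  finally show ?thesis .
qed

lemma energy_cong: assumes "v \<in> H1 \<Omega>" "AE x in lebesgue_on \<Omega>. v' x = v x"
  "w \<in> H1 \<Omega>" "AE x in lebesgue_on \<Omega>. w' x = w x"
  shows "energy v' w' = energy v w"
proof -
  note s = sgrad_L2[OF assms(1)] sgrad_L2[OF H1_cong[OF assms(1,2)]] sgrad_L2[OF assms(3)] sgrad_L2[OF H1_cong[OF assms(3,4)]]
  show ?thesis unfolding energy_eq_vip
    using wgrad_cong[OF assms(1,2)] wgrad_cong[OF assms(3,4)] s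
    by (intro vip_cong) (auto simp: sgrad_def elim: eventually_mono)
qed

lemma enorm_cong: "v \<in> H1 \<Omega> \<Longrightarrow> AE x in lebesgue_on \<Omega>. v' x = v x \<Longrightarrow> enorm v' = enorm v"
  unfolding enorm_eq using energy_cong[of v v' v v'] by simp

end

section \<open>Absolutely continuous functions of time\<close>

text \<open>The primitive of \<open>f\<close> that vanishes at time 0. The indicator function keeps all integrals over the
  same measure space, so that Fubini applies directly. Equality with \<open>c + prim T f\<close> is the form in
  which absolute continuity is used.\<close>
definition prim :: "real \<Rightarrow> (real \<Rightarrow> real) \<Rightarrow> real \<Rightarrow> real" where
  "prim T f t = (LINT s|time_measure T. indicator {..<t} s * f s)"

lemma time_finite: "finite_measure (time_measure T)"
  by (intro finite_measure_lebesgue_on lmeasurable_open) auto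

lemma time_indicator_measurable [measurable]: "(indicator {..<t} :: real \<Rightarrow> real) \<in> borel_measurable (lebesgue_on S)"
  by (intro borel_measurable_lebesgue_on) auto

lemma prim_integrable: fixes f :: "real \<Rightarrow> real" assumes "integrable (time_measure T) f"
  shows "integrable (time_measure T) (\<lambda>s. indicator {..<t} s * f s)"
proof (rule Bochner_Integration.integrable_bound[OF assms])
  note [measurable] = borel_measurable_integrable[OF assms]
  show "(\<lambda>s. indicator {..<t} s * f s) \<in> borel_measurable (time_measure T)" by measurable
qed (auto simp: indicator_def)

lemma prim_0: "prim T f 0 = 0"
proof -
  have "prim T f 0 = (LINT s|time_measure T. 0)"
    unfolding prim_def by (rule Bochner_Integration.integral_cong) (auto simp: indicator_def)
  then show ?thesis by simp
qed

lemma prim_T: "prim T f T = (LINT s|time_measure T. f s)"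
  unfolding prim_def by (rule Bochner_Integration.integral_cong) (auto simp: indicator_def)

lemma prim_add: "integrable (time_measure T) f \<Longrightarrow> integrable (time_measure T) g \<Longrightarrow>
    prim T (\<lambda>s. f s + g s) t = prim T f t + prim T g t"
  unfolding prim_def distrib_left by (intro Bochner_Integration.integral_add prim_integrable)

lemma prim_diff: "integrable (time_measure T) f \<Longrightarrow> integrable (time_measure T) g \<Longrightarrow>
    prim T (\<lambda>s. f s - g s) t = prim T f t - prim T g t"
  unfolding prim_def right_diff_distrib by (intro Bochner_Integration.integral_diff prim_integrable)

lemma prim_mult: "prim T (\<lambda>s. c * f s) t = c * prim T f t"
  unfolding prim_def by (simp add: mult.left_commute)

lemma prim_sum: "(\<And>i. i \<in> I \<Longrightarrow> integrable (time_measure T) (f i)) \<Longrightarrow>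
    prim T (\<lambda>s. \<Sum>i\<in>I. f i s) t = (\<Sum>i\<in>I. prim T (f i) t)"
  unfolding prim_def sum_distrib_left by (intro Bochner_Integration.integral_sum prim_integrable)

lemma prim_cong: assumes "AE s in time_measure T. f s = g s"
    "f \<in> borel_measurable (time_measure T)" "g \<in> borel_measurable (time_measure T)"
  shows "prim T f t = prim T g t"
proof -
  note [measurable] = assms(2,3)
  show ?thesis unfolding prim_def
    by (rule integral_cong_AE) (measurable, use assms(1) in \<open>auto elim: eventually_mono\<close>)
qed

lemma prim_mono: assumes "integrable (time_measure T) f" "integrable (time_measure T) g"
    "AE s in time_measure T. f s \<le> g s"
  shows "prim T f t \<le> prim T g t"
  unfolding prim_def
  by (intro integral_mono_AE prim_integrable assms) (use assms(3) in \<open>auto simp: indicator_def elim: eventually_mono\<close>)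

lemma prim_abs_le: assumes "integrable (time_measure T) f"
  shows "\<bar>prim T f t\<bar> \<le> (LINT s|time_measure T. \<bar>f s\<bar>)"
proof -
  have "norm (prim T f t) \<le> (LINT s|time_measure T. norm (indicator {..<t} s * f s))"
    unfolding prim_def by (rule integral_norm_bound)
  also have "\<dots> \<le> (LINT s|time_measure T. \<bar>f s\<bar>)"
    using assms by (intro integral_mono_AE integrable_norm prim_integrable) (auto simp: indicator_def)
  finally show ?thesis by simp
qed

lemma prim_nonneg_le: assumes "integrable (time_measure T) f" "AE s in time_measure T. 0 \<le> f s"
  shows "prim T f t \<le> (LINT s|time_measure T. f s)"
  unfolding prim_def
  by (intro integral_mono_AE prim_integrable assms) (use assms in \<open>auto simp: indicator_def elim: eventually_mono\<close>)

lemma time_point_null: "AE s in time_measure T. s \<noteq> t"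
proof -
  have "AE s in lebesgue. s \<noteq> t" by (intro AE_completion) (use AE_lborel_singleton[of t] in auto)
  then show ?thesis by (subst AE_restrict_space_iff) auto
qed

lemma prim_continuous: assumes "integrable (time_measure T) f" shows "continuous_on A (prim T f)"
proof (rule continuous_on_subset[OF _ subset_UNIV], rule continuous_at_imp_continuous_on, intro ballI)
  fix t :: real
  note [measurable] = borel_measurable_integrable[OF assms]
  show "isCont (prim T f) t"
    unfolding continuous_at_sequentially comp_def
  proof (intro allI impI)
    fix x :: "nat \<Rightarrow> real" assume x: "x \<longlonglongrightarrow> t"
    show "(\<lambda>n. prim T f (x n)) \<longlonglongrightarrow> prim T f t"
      unfolding prim_def
    proof (rule integral_dominated_convergence[where w="\<lambda>s. norm (f s)"])
      show "AE s in time_measure T. (\<lambda>n. indicator {..<x n} s * f s) \<longlonglongrightarrow> indicator {..<t} s * f s"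
        using time_point_null[where t=t]
      proof eventually_elim
        case (elim s)
        have "\<forall>\<^sub>F n in sequentially. indicator {..<x n} s = indicat_real {..<t} s"
        proof (cases "s < t")
          case True
          then have "\<forall>\<^sub>F n in sequentially. s < x n" using x by (rule order_tendstoD[rotated])
          then show ?thesis using True by (auto elim: eventually_mono)
        next
          case False
          then have "\<forall>\<^sub>F n in sequentially. x n < s" using x elim by (intro order_tendstoD) auto
          then show ?thesis using False by (auto elim: eventually_mono)
        qed
        then have "(\<lambda>n. indicat_real {..<x n} s) \<longlonglongrightarrow> indicator {..<t} s" by (rule tendsto_eventually)
        then show ?case by (intro tendsto_mult tendsto_const)
      qed
      show "AE s in time_measure T. norm (indicator {..<x n} s * f s) \<le> norm (f s)" for n
        by (auto simp: indicator_def)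
    qed (use assms in auto)
  qed
qed

lemma prim_measurable [measurable]: assumes "integrable (time_measure T) f"
  shows "prim T f \<in> borel_measurable (time_measure T)"
  by (intro borel_measurable_lebesgue_on borel_measurable_continuous_onI prim_continuous assms)

lemma integrable_times_prim: assumes "integrable (time_measure T) f" "integrable (time_measure T) g"
  shows "integrable (time_measure T) (\<lambda>s. f s * prim T g s)"
proof (rule Bochner_Integration.integrable_bound)
  note [measurable] = borel_measurable_integrable[OF assms(1)] prim_measurable[OF assms(2)]
  show "(\<lambda>s. f s * prim T g s) \<in> borel_measurable (time_measure T)" by measurable
  show "integrable (time_measure T) (\<lambda>s. f s * (LINT s|time_measure T. \<bar>g s\<bar>))" using assms by simp
  show "AE s in time_measure T. norm (f s * prim T g s) \<le> norm (f s * (LINT s|time_measure T. \<bar>g s\<bar>))"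
    using prim_abs_le[OF assms(2)] by (auto simp: abs_mult intro!: AE_I2 mult_left_mono)
qed

lemma integrable_prim: assumes "integrable (time_measure T) f" shows "integrable (time_measure T) (prim T f)"
proof -
  interpret finite_measure "time_measure T" by (rule time_finite)
  have "integrable (time_measure T) (\<lambda>s. 1 * prim T f s)"
    by (rule integrable_times_prim[OF _ assms]) auto
  then show ?thesis by simp
qed

text \<open>The product is a double integral over a square, which splits along the diagonal into two
  triangles; Fubini evaluates each of them in the suitable order.\<close>
lemma prim_product_rule:
  assumes f: "integrable (time_measure T) f" and g: "integrable (time_measure T) g"
  shows "prim T f t * prim T g t = prim T (\<lambda>s. f s * prim T g s + g s * prim T f s) t"
proof -
  let ?M = "time_measure T"
  interpret finite_measure ?M by (rule time_finite)
  interpret P: pair_sigma_finite ?M ?M by unfold_locales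
  note [measurable] = borel_measurable_integrable[OF f] borel_measurable_integrable[OF g]
  define ft where "ft s = indicator {..<t} s * f s" for s
  define gt where "gt s = indicator {..<t} s * g s" for s
  have [measurable]: "ft \<in> borel_measurable ?M" "gt \<in> borel_measurable ?M" unfolding ft_def gt_def by measurable
  have ift: "integrable ?M ft" and igt: "integrable ?M gt" unfolding ft_def gt_def by (intro prim_integrable f g)+
  have id_m [measurable]: "(\<lambda>x. x) \<in> borel_measurable ?M" by (intro borel_measurable_lebesgue_on) simp
  \<comment> \<open>The triangle \<open>s < r\<close>; the diagonal is a null set.\<close>
  define D :: "real \<times> real \<Rightarrow> real" where "D = (\<lambda>(s, r). if s < r then 1 else 0)"
  have [measurable]: "D \<in> borel_measurable (?M \<Otimes>\<^sub>M ?M)" unfolding D_def by measurable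
  have [measurable]: "(\<lambda>r. D (s, r)) \<in> borel_measurable ?M" for s
    unfolding D_def split_conv by measurable
  have split: "(LINT r|?M. gt r) = (LINT r|?M. indicator {..<s} r * gt r) + (LINT r|?M. D (s, r) * gt r)" for s
  proof -
    have "integrable ?M (\<lambda>r. indicator {..<s} r * gt r)" by (rule prim_integrable[OF igt])
    moreover have "integrable ?M (\<lambda>r. D (s, r) * gt r)"
      by (rule Bochner_Integration.integrable_bound[OF igt]) (measurable, auto simp: D_def)
    ultimately have "(LINT r|?M. indicator {..<s} r * gt r) + (LINT r|?M. D (s, r) * gt r)
        = (LINT r|?M. indicator {..<s} r * gt r + D (s, r) * gt r)" by simp
    also have "\<dots> = (LINT r|?M. gt r)"
    proof (rule integral_cong_AE)
      show "AE r in ?M. indicator {..<s} r * gt r + D (s, r) * gt r = gt r"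
        using time_point_null[where t=s] by eventually_elim (auto simp: D_def indicator_def)
    qed measurable
    finally show ?thesis by simp
  qed
  define h :: "real \<times> real \<Rightarrow> real" where "h = (\<lambda>(s, r). D (s, r) * (ft s * gt r))"
  have [measurable]: "h \<in> borel_measurable (?M \<Otimes>\<^sub>M ?M)" unfolding h_def by measurable
  have hs [measurable]: "(\<lambda>r. h (s, r)) \<in> borel_measurable ?M" for s
    unfolding h_def split_conv by measurable
  have "integrable (?M \<Otimes>\<^sub>M ?M) h"
  proof (rule P.Fubini_integrable)
    have b: "(LINT r|?M. norm (h (s, r))) \<le> \<bar>ft s\<bar> * (LINT r|?M. \<bar>gt r\<bar>)" for s
    proof -
      have "(LINT r|?M. norm (h (s, r))) \<le> (LINT r|?M. \<bar>ft s\<bar> * \<bar>gt r\<bar>)"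
        using igt by (intro integral_mono_AE') (auto simp: h_def D_def abs_mult)
      then show ?thesis by simp
    qed
    show "integrable ?M (\<lambda>s. LINT r|?M. norm (h (s, r)))"
    proof (rule Bochner_Integration.integrable_bound)
      show "integrable ?M (\<lambda>s. \<bar>ft s\<bar> * (LINT r|?M. \<bar>gt r\<bar>))" using ift by simp
      show "AE s in ?M. norm (LINT r|?M. norm (h (s, r))) \<le> norm (\<bar>ft s\<bar> * (LINT r|?M. \<bar>gt r\<bar>))"
        using b by (auto intro!: AE_I2 order_trans[OF _ abs_ge_self])
    qed measurable
    show "AE s in ?M. integrable ?M (\<lambda>r. h (s, r))"
    proof (intro AE_I2)
      fix s
      have "integrable ?M (\<lambda>r. ft s * gt r)" using igt by simp
      then show "integrable ?M (\<lambda>r. h (s, r))"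
        by (rule Bochner_Integration.integrable_bound[OF _ hs]) (auto simp: h_def D_def)
    qed
  qed measurable
  then have "integrable (?M \<Otimes>\<^sub>M ?M) (case_prod (\<lambda>s r. h (s, r)))" by simp
  from P.Fubini_integral[OF this]
  have fub: "(LINT r|?M. (LINT s|?M. h (s, r))) = (LINT s|?M. (LINT r|?M. h (s, r)))" .
  have l1: "ft s * (LINT r|?M. indicator {..<s} r * gt r) = indicator {..<t} s * (f s * prim T g s)" for s
  proof (cases "s < t")
    case True
    have "(LINT r|?M. indicator {..<s} r * gt r) = prim T g s"
      unfolding prim_def gt_def using True by (intro Bochner_Integration.integral_cong) (auto simp: indicator_def)
    then show ?thesis using True by (simp add: ft_def)
  qed (simp add: ft_def)
  have l2: "(LINT s|?M. h (s, r)) = indicator {..<t} r * (g r * prim T f r)" for r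
  proof (cases "r < t")
    case True
    have "(LINT s|?M. h (s, r)) = (LINT s|?M. gt r * (indicator {..<r} s * f s))"
      unfolding h_def D_def ft_def using True by (intro Bochner_Integration.integral_cong) (auto simp: indicator_def)
    then show ?thesis using True by (simp add: gt_def prim_def)
  qed (simp add: h_def gt_def)
  have "prim T f t * prim T g t = (LINT s|?M. ft s * (LINT r|?M. gt r))"
    by (simp add: prim_def ft_def[symmetric] gt_def[symmetric])
  also have "\<dots> = (LINT s|?M. ft s * (LINT r|?M. indicator {..<s} r * gt r) + (LINT r|?M. h (s, r)))"
  proof (intro Bochner_Integration.integral_cong refl)
    fix s
    have "(LINT r|?M. h (s, r)) = ft s * (LINT r|?M. D (s, r) * gt r)"
      unfolding h_def by (simp add: mult.left_commute)
    then show "ft s * (LINT r|?M. gt r) = ft s * (LINT r|?M. indicator {..<s} r * gt r) + (LINT r|?M. h (s, r))"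
      by (subst split[of s]) (simp add: distrib_left)
  qed
  also have "\<dots> = (LINT s|?M. ft s * (LINT r|?M. indicator {..<s} r * gt r)) + (LINT s|?M. (LINT r|?M. h (s, r)))"
  proof (rule Bochner_Integration.integral_add)
    show "integrable ?M (\<lambda>s. ft s * (LINT r|?M. indicator {..<s} r * gt r))"
      unfolding l1 by (intro prim_integrable integrable_times_prim f g)
    show "integrable ?M (\<lambda>s. LINT r|?M. h (s, r))"
      using P.integrable_fst'[OF \<open>integrable (?M \<Otimes>\<^sub>M ?M) h\<close>] .
  qed
  also have "\<dots> = prim T (\<lambda>s. f s * prim T g s) t + prim T (\<lambda>s. g s * prim T f s) t"
    unfolding l1 fub[symmetric] l2 by (simp add: prim_def)
  also have "\<dots> = prim T (\<lambda>s. f s * prim T g s + g s * prim T f s) t"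
    by (intro prim_add[symmetric] integrable_times_prim f g)
  finally show ?thesis .
qed

lemma deriv_eq_partial: "deriv \<phi> t = partial 1 \<phi> t" if "smooth \<phi>" for \<phi> :: "real \<Rightarrow> real"
  using smooth_line_derivative[OF that, of 1 0 t] by (intro DERIV_imp_deriv) simp

lemma time_test_deriv: assumes "\<phi> \<in> test_functions {0<..<T}"
  shows "deriv \<phi> \<in> test_functions {0<..<T}" "(\<phi> has_real_derivative deriv \<phi> t) (at t)"
proof -
  have s: "smooth \<phi>" using assms by (auto elim: test_functionsE)
  have "deriv \<phi> = partial 1 \<phi>" using deriv_eq_partial[OF s] by auto
  then show "deriv \<phi> \<in> test_functions {0<..<T}" using test_partial[OF assms, of 1] by simp
  show "(\<phi> has_real_derivative deriv \<phi> t) (at t)"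
    using smooth_line_derivative[OF s, of 1 0 t] deriv_eq_partial[OF s] by simp
qed

lemma prim_deriv_test: assumes "\<phi> \<in> test_functions {0<..<T}" "0 \<le> t" "t \<le> T"
  shows "prim T (deriv \<phi>) t = \<phi> t"
proof -
  note d = time_test_deriv[OF assms(1)]
  have m: "deriv \<phi> \<in> borel_measurable borel" by (rule test_borel[OF d(1)])
  have z: "\<phi> 0 = 0" using test_support[OF assms(1), of 0] by auto
  have "prim T (deriv \<phi>) t = (LINT s|lborel. indicator {..<t} s * deriv \<phi> s)"
    unfolding prim_def using m test_support[OF d(1)] by (intro integral_lebesgue_on_lborel) auto
  also have "\<dots> = (LINT s|lborel. deriv \<phi> s * indicator {0..t} s)"
  proof (rule integral_cong_AE)
    show "AE s in lborel. indicator {..<t} s * deriv \<phi> s = deriv \<phi> s * indicator {0..t} s"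
      using AE_lborel_singleton[of t]
    proof eventually_elim
      case (elim s)
      show ?case using test_support[OF d(1), of s] elim by (cases "deriv \<phi> s = 0") (auto simp: indicator_def)
    qed
  qed (use m in measurable)
  also have "\<dots> = \<phi> t - \<phi> 0"
    by (rule integral_FTC_Icc_real[OF assms(2)])
      (use d(2) test_continuous[OF d(1), of UNIV] in \<open>auto simp: continuous_on_eq_continuous_at\<close>)
  finally show ?thesis using z by simp
qed

lemma time_integration_by_parts:
  assumes "\<phi> \<in> test_functions {0<..<T}" "integrable (time_measure T) Q" "0 < T"
  shows "(LINT t|time_measure T. deriv \<phi> t * prim T Q t) = - (LINT t|time_measure T. \<phi> t * Q t)"
proof -
  note d = time_test_deriv[OF assms(1)]
  have i: "integrable (time_measure T) (deriv \<phi>)" by (rule test_integrable_on[OF d(1)]) simp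
  have "\<phi> T = 0" using test_support[OF assms(1), of T] by auto
  then have "0 = prim T (deriv \<phi>) T * prim T Q T" using prim_deriv_test[OF assms(1), of T] assms(3) by simp
  also have "\<dots> = (LINT s|time_measure T. deriv \<phi> s * prim T Q s + Q s * prim T (deriv \<phi>) s)"
    by (subst prim_product_rule[OF i assms(2)]) (rule prim_T)
  also have "\<dots> = (LINT s|time_measure T. deriv \<phi> s * prim T Q s) + (LINT s|time_measure T. Q s * prim T (deriv \<phi>) s)"
    by (intro Bochner_Integration.integral_add integrable_times_prim i assms)
  also have "(LINT s|time_measure T. Q s * prim T (deriv \<phi>) s) = (LINT s|time_measure T. \<phi> s * Q s)"
    using prim_deriv_test[OF assms(1)] by (intro Bochner_Integration.integral_cong) auto
  finally show ?thesis by simp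
qed

text \<open>The primitive vanishes to the right of the support because the total integral is zero.\<close>
lemma time_test_antiderivative:
  fixes \<eta> :: "real \<Rightarrow> real"
  assumes \<eta>: "\<eta> \<in> test_functions {0<..<T}" and z: "(LINT t|time_measure T. \<eta> t) = 0" and T: "0 < T"
  obtains \<phi> where "\<phi> \<in> test_functions {0<..<T}" "deriv \<phi> = \<eta>"
proof -
  obtain K where K: "smooth \<eta>" "compact K" "K \<subseteq> {0<..<T}" "\<And>x. \<eta> x \<noteq> 0 \<Longrightarrow> x \<in> K"
    by (rule test_functionsE[OF \<eta>]) (rule that)
  obtain \<alpha> \<beta> where ab: "0 < \<alpha>" "\<beta> < T" "\<alpha> \<le> \<beta>" "K \<subseteq> {\<alpha>..\<beta>}"
  proof (cases "K = {}")
    case True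
    then show ?thesis using that[of "T/2" "T/2"] T by simp
  next
    case False
    obtain l where l: "l \<in> K" "\<forall>x\<in>K. l \<le> x" using compact_attains_inf[OF K(2) False] by blast
    obtain u where u: "u \<in> K" "\<forall>x\<in>K. x \<le> u" using compact_attains_sup[OF K(2) False] by blast
    show ?thesis by (rule that[of l u]) (use l u K(3) in auto)
  qed
  have \<eta>0: "\<eta> x = 0" if "x < \<alpha> \<or> \<beta> < x" for x using K(4)[of x] ab(4) that by force
  have cont: "continuous_on A \<eta>" for A by (rule test_continuous[OF \<eta>])
  define \<phi> where "\<phi> x = integral {0..x} \<eta>" for x
  have \<phi>0: "\<phi> x = 0" if "x < \<alpha>" for x
  proof -
    have "\<phi> x = integral {0..x} (\<lambda>_. 0)" unfolding \<phi>_def using that by (intro integral_cong \<eta>0) auto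
    then show ?thesis by simp
  qed
  have d: "(\<phi> has_real_derivative \<eta> x) (at x)" for x
  proof (cases "x < \<alpha>")
    case True
    have "((\<lambda>x. 0) has_real_derivative 0) (at x)" by simp
    then have "(\<phi> has_real_derivative 0) (at x)"
      by (rule has_field_derivative_transform_within_open[where S="{..<\<alpha>}"]) (use True \<phi>0 in auto)
    then show ?thesis using \<eta>0[of x] True by simp
  next
    case False
    then have "((\<lambda>x. integral {0..x} \<eta>) has_real_derivative \<eta> x) (at x within {0..x+1})"
      using ab(1) by (intro integral_has_real_derivative cont) auto
    moreover have "at x within {0..x+1} = at x" using False ab(1) by (intro at_within_interior) auto
    ultimately show ?thesis by (simp add: \<phi>_def[abs_def])
  qed
  have \<phi>1: "\<phi> x = 0" if "\<beta> < x" for x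
  proof -
    have "(LINT t|lborel. \<eta> t * indicator {0..x} t) = \<phi> x - \<phi> 0"
      by (rule integral_FTC_Icc_real) (use d cont[of UNIV] that ab in \<open>auto simp: continuous_on_eq_continuous_at\<close>)
    moreover have "(\<lambda>t. \<eta> t * indicator {0..x} t) = \<eta>"
    proof
      fix t show "\<eta> t * indicator {0..x} t = \<eta> t"
        using \<eta>0[of t] ab that by (cases "t < \<alpha> \<or> \<beta> < t") (auto simp: indicator_def)
    qed
    moreover have "(LINT t|lborel. \<eta> t) = 0"
      using z integral_lebesgue_on_lborel(1)[OF _ test_borel[OF \<eta>] test_support[OF \<eta>]] by simp
    ultimately show ?thesis using \<phi>0[of 0] ab(1) by simp
  qed
  have "smooth \<phi>"
  proof (rule smooth_coinduct[where P="\<lambda>f. f = \<phi> \<or> smooth f"])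
    fix f assume "f = \<phi> \<or> smooth f"
    then show "\<exists>g. (\<forall>i\<in>Basis. g i = \<phi> \<or> smooth (g i)) \<and>
      (\<forall>x. (f has_derivative (\<lambda>h. \<Sum>i\<in>Basis. g i x * (h \<bullet> i))) (at x))"
    proof
      assume "f = \<phi>"
      then show ?thesis using d K(1) by (intro exI[of _ "\<lambda>_. \<eta>"]) (auto simp: has_field_derivative_def)
    next
      assume f: "smooth f"
      obtain g where "\<And>i. smooth (g i)" "\<And>x. (f has_derivative (\<lambda>h. \<Sum>i\<in>Basis. g i x * (h \<bullet> i))) (at x)"
        by (rule smooth_derivatives[OF f]) (rule that)
      then show ?thesis by (intro exI[of _ g]) auto
    qed
  qed simp
  then have "\<phi> \<in> test_functions {0<..<T}"
  proof (rule test_functionsI[where K="{\<alpha>..\<beta>}"])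
    show "x \<in> {\<alpha>..\<beta>}" if "\<phi> x \<noteq> 0" for x using \<phi>0[of x] \<phi>1[of x] that by force
  qed (use ab in auto)
  moreover have "deriv \<phi> = \<eta>" using d DERIV_imp_deriv by blast
  ultimately show thesis by (rule that)
qed

lemma time_test_normalized: assumes "0 < T"
  obtains \<psi> where "\<psi> \<in> test_functions {0<..<T}" "(LINT t|time_measure T. \<psi> t) = 1"
proof -
  define b where "b = bump 1 (T / 3) (2 * T / 3)"
  have b: "b \<in> test_functions {0<..<T}"
    by (rule test_functionsI[where K="{T/3..2*T/3}"])
      (use assms bump_outside[of _ "T/3" "2*T/3" 1] in \<open>auto simp: b_def smooth_bump box_real intro: ccontr\<close>)
  have i: "integrable (time_measure T) b" by (rule test_integrable_on[OF b]) simp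
  have "(LINT t|time_measure T. b t) \<noteq> 0"
  proof
    assume "(LINT t|time_measure T. b t) = 0"
    moreover have "AE t in time_measure T. 0 \<le> b t" unfolding b_def by (intro AE_I2 bump_bounds)
    ultimately have "AE t in time_measure T. b t = 0"
      using integral_nonneg_eq_0_iff_AE[OF i] by blast
    then have ae: "AE t in lebesgue. t \<in> {0<..<T} \<longrightarrow> b t = 0" by (simp add: AE_restrict_space_iff)
    have bn: "b t \<noteq> 0" if "t \<in> {T/3<..<2*T/3}" for t
      using that flat_exp_bounds(3) by (simp add: b_def bump_def flat_exp_def)
    from ae have "AE t in lebesgue. t \<notin> {T/3<..<2*T/3}"
    proof eventually_elim
      case (elim t)
      then show ?case using assms bn[of t] by force
    qed
    then have "{T/3<..<2*T/3} \<in> null_sets lebesgue"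
      by (subst (asm) AE_iff_null_sets[symmetric]) auto
    then show False using assms by (auto simp: null_sets_def)
  qed
  then show thesis
    using that[OF test_scale[OF b, of "inverse (LINT t|time_measure T. b t)"]] by simp
qed

text \<open>The lemma of du Bois-Reymond. The difference \<open>P - prim T Q\<close> has weak derivative zero, so it is
  orthogonal to all derivatives of test functions. These are the test functions of mean zero, and subtracting a
  multiple of a fixed normalized test function makes the mean of an arbitrary one vanish.\<close>
lemma weak_derivative_imp_prim:
  assumes T: "0 < T" and P: "integrable (time_measure T) P" and Q: "integrable (time_measure T) Q"
    and w: "\<And>\<phi>. \<phi> \<in> test_functions {0<..<T} \<Longrightarrow>
      (LINT t|time_measure T. deriv \<phi> t * P t) = - (LINT t|time_measure T. \<phi> t * Q t)"
  obtains c where "AE t in time_measure T. P t = c + prim T Q t"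
proof -
  let ?M = "time_measure T"
  define R where "R t = P t - prim T Q t" for t
  have R: "integrable ?M R" unfolding R_def by (intro Bochner_Integration.integrable_diff P integrable_prim Q)
  have tb: "integrable ?M (\<lambda>t. \<phi> t * f t)" if "\<phi> \<in> test_functions {0<..<T}" "integrable ?M f" for \<phi> f
  proof -
    note \<phi>f = that
    obtain B where B: "0 \<le> B" "\<And>x. \<bar>\<phi> x\<bar> \<le> B" by (rule test_bounded[OF \<phi>f(1)]) (rule that)
    have "integrable ?M (\<lambda>t. B * f t)" using \<phi>f(2) by simp
    then show ?thesis
    proof (rule Bochner_Integration.integrable_bound)
      show "(\<lambda>t. \<phi> t * f t) \<in> borel_measurable ?M"
        by (intro borel_measurable_times test_measurable[OF \<phi>f(1)] borel_measurable_integrable[OF \<phi>f(2)])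
      show "AE t in ?M. norm (\<phi> t * f t) \<le> norm (B * f t)"
        using B by (auto simp: abs_mult intro!: mult_right_mono)
    qed
  qed
  have z: "(LINT t|?M. deriv \<phi> t * R t) = 0" if \<phi>: "\<phi> \<in> test_functions {0<..<T}" for \<phi>
  proof -
    note d = time_test_deriv(1)[OF \<phi>]
    have "(LINT t|?M. deriv \<phi> t * R t) = (LINT t|?M. deriv \<phi> t * P t) - (LINT t|?M. deriv \<phi> t * prim T Q t)"
      unfolding R_def right_diff_distrib by (intro Bochner_Integration.integral_diff tb d P integrable_prim Q)
    then show ?thesis using w[OF \<phi>] time_integration_by_parts[OF \<phi> Q T] by simp
  qed
  obtain \<psi>0 where \<psi>0: "\<psi>0 \<in> test_functions {0<..<T}" "(LINT t|?M. \<psi>0 t) = 1"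
    by (rule time_test_normalized[OF T]) (rule that)
  define c where "c = (LINT t|?M. \<psi>0 t * R t)"
  interpret finite_measure ?M by (rule time_finite)
  have "AE t in ?M. R t - c = 0"
  proof (rule fundamental_lemma_L1)
    show "integrable ?M (\<lambda>t. R t - c)" using R by simp
    fix \<psi> :: "real \<Rightarrow> real" assume \<psi>: "\<psi> \<in> test_functions {0<..<T}"
    have i\<psi>: "integrable ?M \<psi>" by (rule test_integrable_on[OF \<psi>]) simp
    have i\<psi>0: "integrable ?M \<psi>0" by (rule test_integrable_on[OF \<psi>0(1)]) simp
    define k where "k = (LINT t|?M. \<psi> t)"
    \<comment> \<open>Of mean zero, hence the derivative of a test function.\<close>
    have \<eta>: "(\<lambda>t. \<psi> t - k * \<psi>0 t) \<in> test_functions {0<..<T}" by (intro test_diff \<psi> test_scale \<psi>0)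
    have "(LINT t|?M. \<psi> t - k * \<psi>0 t) = 0" using i\<psi> i\<psi>0 \<psi>0(2) by (simp add: k_def)
    then obtain \<phi> where \<phi>: "\<phi> \<in> test_functions {0<..<T}" "deriv \<phi> = (\<lambda>t. \<psi> t - k * \<psi>0 t)"
      by (rule time_test_antiderivative[OF \<eta> _ T])
    have "0 = (LINT t|?M. (\<psi> t - k * \<psi>0 t) * R t)" using z[OF \<phi>(1)] \<phi>(2) by simp
    also have "\<dots> = (LINT t|?M. \<psi> t * R t - k * (\<psi>0 t * R t))" by (simp add: left_diff_distrib mult.assoc)
    also have "\<dots> = (LINT t|?M. \<psi> t * R t) - k * c"
      using tb[OF \<psi> R] tb[OF \<psi>0(1) R] by (simp add: c_def)
    finally show "(LINT t|?M. \<psi> t * (R t - c)) = 0"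
      using tb[OF \<psi> R] i\<psi> by (simp add: right_diff_distrib k_def mult.commute)
  qed auto
  then have "AE t in ?M. P t = c + prim T Q t" by eventually_elim (simp add: R_def)
  then show thesis by (rule that)
qed

lemma continuous_AE_eq:
  fixes f g :: "real \<Rightarrow> real"
  assumes "0 < T" "continuous_on {0..T} f" "continuous_on {0..T} g" "AE t in time_measure T. f t = g t"
    and t: "t \<in> {0..T}"
  shows "f t = g t"
proof -
  define d where "d t = f t - g t" for t
  have dc: "continuous_on {0..T} d" unfolding d_def by (intro continuous_intros assms)
  have "d t = 0" if t: "t \<in> {0<..<T}" for t
  proof (rule ccontr)
    assume "d t \<noteq> 0"
    define U where "U = {0<..<T} \<inter> d -` (- {0})"
    have U: "open U" unfolding U_def
      by (rule continuous_open_preimage) (auto intro: continuous_on_subset[OF dc])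
    have "AE t in lebesgue. t \<in> {0<..<T} \<longrightarrow> f t = g t" using assms(4) by (simp add: AE_restrict_space_iff)
    then have "AE t in lebesgue. t \<notin> U" by eventually_elim (auto simp: U_def d_def)
    then have "U \<in> null_sets lebesgue" using U by (subst (asm) AE_iff_null_sets[symmetric]) auto
    then have "negligible U" by (simp add: negligible_iff_null_sets)
    then have "U = {}" using U open_not_negligible by blast
    then show False using t \<open>d t \<noteq> 0\<close> by (auto simp: U_def)
  qed
  then have "d t = 0" using continuous_constant_on_closure[of "{0<..<T}" d 0 t] dc t assms(1) by simp
  then show ?thesis by (simp add: d_def)
qed

text \<open>A weak form of the differentiation theorem of Lebesgue: integration by parts shows that \<open>h\<close> is
  orthogonal to all test functions.\<close>
lemma prim_zero_imp: assumes T: "0 < T" and h: "integrable (time_measure T) h"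
    and z: "AE t in time_measure T. prim T h t = 0"
  shows "AE t in time_measure T. h t = 0"
proof (rule fundamental_lemma_L1[OF _ h])
  have z': "prim T h t = 0" if "t \<in> {0..T}" for t
    using continuous_AE_eq[OF T prim_continuous[OF h] continuous_on_const z that] .
  fix \<phi> :: "real \<Rightarrow> real" assume \<phi>: "\<phi> \<in> test_functions {0<..<T}"
  have "(LINT t|time_measure T. \<phi> t * h t) = - (LINT t|time_measure T. deriv \<phi> t * prim T h t)"
    using time_integration_by_parts[OF \<phi> h T] by simp
  also have "(LINT t|time_measure T. deriv \<phi> t * prim T h t) = (LINT t|time_measure T. 0)"
    using z' by (intro Bochner_Integration.integral_cong) auto
  finally show "(LINT t|time_measure T. \<phi> t * h t) = 0" by simp
qed auto

lemma prim_eq_imp: assumes T: "0 < T" and h: "integrable (time_measure T) h" and k: "integrable (time_measure T) k"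
    and e: "AE t in time_measure T. c + prim T h t = d + prim T k t"
  shows "c = d" "AE t in time_measure T. h t = k t"
proof -
  have e': "c + prim T h t = d + prim T k t" if "t \<in> {0..T}" for t
    by (rule continuous_AE_eq[OF T _ _ e that]) (intro continuous_intros prim_continuous h k)+
  show cd: "c = d" using e'[of 0] T by (simp add: prim_0)
  have "AE t in time_measure T. prim T (\<lambda>s. h s - k s) t = 0"
    using e by eventually_elim (simp add: prim_diff h k cd)
  then have "AE t in time_measure T. h t - k t = 0" by (rule prim_zero_imp[OF T, rotated]) (simp add: h k)
  then show "AE t in time_measure T. h t = k t" by eventually_elim simp
qed

text \<open>The constant of integration is the initial value of the continuous representative.\<close>
lemma weak_derivative_initial_value:
  assumes T: "0 < T" and P: "integrable (time_measure T) P" and Q: "integrable (time_measure T) Q"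
    and w: "\<And>\<phi>. \<phi> \<in> test_functions {0<..<T} \<Longrightarrow>
      (LINT t|time_measure T. deriv \<phi> t * P t) = - (LINT t|time_measure T. \<phi> t * Q t)"
    and p: "continuous_on {0..T} p" "AE t in time_measure T. P t = p t"
  shows "AE t in time_measure T. P t = p 0 + prim T Q t"
proof -
  obtain c where c: "AE t in time_measure T. P t = c + prim T Q t"
    by (rule weak_derivative_imp_prim[OF T P Q w]) (auto intro: that)
  have "AE t in time_measure T. p t = c + prim T Q t" using c p(2) by eventually_elim simp
  then have "p 0 = c + prim T Q 0"
    by (intro continuous_AE_eq[OF T p(1)] continuous_intros prim_continuous Q) (use T in auto)
  then show ?thesis using c by (simp add: prim_0)
qed

section \<open>The energy estimate for linear systems\<close>

text \<open>The system \<open>m X' + Y = g\<close> with \<open>Y' = X\<close> in coordinates, where \<open>m\<close> is the mass matrix and the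
  stiffness matrix is the identity. With \<open>N\<^sup>2 = X \<cdot> m X\<close> the energy \<open>N\<^sup>2 + |Y|\<^sup>2\<close> has derivative
  \<open>2 X \<cdot> g \<le> 2 \<gamma> N\<close>. Integration up to a maximum \<open>t\<^sub>0\<close> of \<open>N\<close> and division by \<open>N t\<^sub>0\<close> give
  \<open>N \<le> 2 \<integral> \<gamma>\<close>. This avoids the inequality of Gronwall, and the constant does not grow with \<open>T\<close>.\<close>
lemma coefficient_energy_estimate:
  fixes m :: "nat \<Rightarrow> nat \<Rightarrow> real" and X' g :: "nat \<Rightarrow> real \<Rightarrow> real"
  assumes T: "0 < T"
    and sym: "\<And>i j. i < n \<Longrightarrow> j < n \<Longrightarrow> m i j = m j i"
    and psd: "\<And>c. 0 \<le> (\<Sum>i<n. \<Sum>j<n. m i j * (c i * c j))"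
    and X': "\<And>i. i < n \<Longrightarrow> integrable (time_measure T) (X' i)"
    and X: "\<And>i. X i = prim T (X' i)" and Y: "\<And>i. Y i = prim T (X i)"
    and eq: "AE s in time_measure T. \<forall>i<n. (\<Sum>j<n. m i j * X' j s) + Y i s = g i s"
    and \<gamma>: "integrable (time_measure T) \<gamma>" "\<And>s. 0 \<le> \<gamma> s"
    and bound: "AE s in time_measure T.
      (\<Sum>i<n. X i s * g i s) \<le> \<gamma> s * sqrt (\<Sum>i<n. \<Sum>j<n. m i j * (X i s * X j s))"
    and t: "t \<in> {0..T}"
  shows "sqrt (\<Sum>i<n. \<Sum>j<n. m i j * (X i t * X j t)) \<le> 2 * (LINT s|time_measure T. \<gamma> s)"
    and "sqrt (\<Sum>i<n. (Y i t)\<^sup>2) \<le> 2 * (LINT s|time_measure T. \<gamma> s)"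
proof -
  let ?M = "time_measure T"
  define G where "G = (LINT s|?M. \<gamma> s)"
  have G0: "0 \<le> G" unfolding G_def using \<gamma>(2) by simp
  have Xi: "integrable ?M (X i)" if "i < n" for i unfolding X by (intro integrable_prim X' that)
  define N where "N t = sqrt (\<Sum>i<n. \<Sum>j<n. m i j * (X i t * X j t))" for t
  have Xc: "continuous_on A (X i)" if "i < n" for i A unfolding X by (intro prim_continuous X' that)
  have Nc: "continuous_on {0..T} N" unfolding N_def by (intro continuous_intros Xc) auto
  have N0: "0 \<le> N t" for t unfolding N_def using psd by simp
  \<comment> \<open>Since \<open>N\<close> is continuous, it has a maximum, against which its values in the integral are estimated.\<close>
  obtain t0 where t0: "t0 \<in> {0..T}" "\<And>t. t \<in> {0..T} \<Longrightarrow> N t \<le> N t0"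
    using continuous_attains_sup[OF compact_Icc _ Nc] T by fastforce
  define e where "e s = (\<Sum>i<n. \<Sum>j<n. m i j * (X' i s * X j s + X' j s * X i s)) + (\<Sum>i<n. X i s * Y i s + X i s * Y i s)" for s
  have ie1: "integrable ?M (\<lambda>s. X' i s * X j s)" if "i < n" "j < n" for i j
    unfolding X by (intro integrable_times_prim X' that)
  have ie2: "integrable ?M (\<lambda>s. X i s * Y i s)" if "i < n" for i
    unfolding Y by (intro integrable_times_prim Xi that)
  have ie1': "integrable ?M (\<lambda>s. \<Sum>i<n. \<Sum>j<n. m i j * (X' i s * X j s + X' j s * X i s))"
    by (intro Bochner_Integration.integrable_sum) (auto intro: ie1)
  have ie2': "integrable ?M (\<lambda>s. \<Sum>i<n. X i s * Y i s + X i s * Y i s)"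
    by (intro Bochner_Integration.integrable_sum Bochner_Integration.integrable_add ie2) auto
  have E: "(N t)\<^sup>2 + (\<Sum>i<n. (Y i t)\<^sup>2) = prim T e t" for t
  proof -
    have pX: "prim T (\<lambda>s. X' i s * X j s + X' j s * X i s) t = X i t * X j t" if "i < n" "j < n" for i j
      using prim_product_rule[OF X'[OF that(1)] X'[OF that(2)]] by (simp add: X)
    have pY: "prim T (\<lambda>s. X i s * Y i s + X i s * Y i s) t = Y i t * Y i t" if "i < n" for i
      using prim_product_rule[OF Xi[OF that] Xi[OF that]] by (simp only: Y)
    have "prim T e t = prim T (\<lambda>s. \<Sum>i<n. \<Sum>j<n. m i j * (X' i s * X j s + X' j s * X i s)) t
        + prim T (\<lambda>s. \<Sum>i<n. X i s * Y i s + X i s * Y i s) t"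
      unfolding e_def by (rule prim_add[OF ie1' ie2'])
    also have "prim T (\<lambda>s. \<Sum>i<n. \<Sum>j<n. m i j * (X' i s * X j s + X' j s * X i s)) t
        = (\<Sum>i<n. \<Sum>j<n. m i j * (X i t * X j t))"
    proof -
      have "prim T (\<lambda>s. \<Sum>i<n. \<Sum>j<n. m i j * (X' i s * X j s + X' j s * X i s)) t
          = (\<Sum>i<n. prim T (\<lambda>s. \<Sum>j<n. m i j * (X' i s * X j s + X' j s * X i s)) t)"
        by (intro prim_sum Bochner_Integration.integrable_sum) (auto intro: ie1)
      also have "\<dots> = (\<Sum>i<n. \<Sum>j<n. prim T (\<lambda>s. m i j * (X' i s * X j s + X' j s * X i s)) t)"
        by (intro sum.cong prim_sum) (auto intro: ie1)
      also have "\<dots> = (\<Sum>i<n. \<Sum>j<n. m i j * (X i t * X j t))"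
        by (intro sum.cong refl) (simp add: prim_mult pX)
      finally show ?thesis .
    qed
    also have "prim T (\<lambda>s. \<Sum>i<n. X i s * Y i s + X i s * Y i s) t = (\<Sum>i<n. Y i t * Y i t)"
    proof -
      have "prim T (\<lambda>s. \<Sum>i<n. X i s * Y i s + X i s * Y i s) t
          = (\<Sum>i<n. prim T (\<lambda>s. X i s * Y i s + X i s * Y i s) t)"
        by (intro prim_sum Bochner_Integration.integrable_add ie2) auto
      then show ?thesis using pY by simp
    qed
    finally show ?thesis using psd[of "\<lambda>i. X i t"] by (simp add: N_def power2_eq_square)
  qed
  have ie: "integrable ?M e" unfolding e_def by (rule Bochner_Integration.integrable_add[OF ie1' ie2'])
  have ae: "AE s in ?M. e s \<le> 2 * N t0 * \<gamma> s"
    using eq bound AE_space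
  proof eventually_elim
    case (elim s)
    then have sT: "s \<in> {0..T}" by simp
    have "e s = 2 * (\<Sum>i<n. X i s * ((\<Sum>j<n. m i j * X' j s) + Y i s))"
    proof -
      have "(\<Sum>i<n. \<Sum>j<n. m i j * (X' i s * X j s)) = (\<Sum>j<n. \<Sum>i<n. m i j * (X' i s * X j s))"
        by (rule sum.swap)
      also have "\<dots> = (\<Sum>i<n. \<Sum>j<n. m i j * (X' j s * X i s))"
        using sym by (intro sum.cong refl) auto
      finally have "(\<Sum>i<n. \<Sum>j<n. m i j * (X' i s * X j s)) = (\<Sum>i<n. X i s * (\<Sum>j<n. m i j * X' j s))"
        by (simp add: sum_distrib_left mult_ac)
      moreover have "(\<Sum>i<n. \<Sum>j<n. m i j * (X' j s * X i s)) = (\<Sum>i<n. X i s * (\<Sum>j<n. m i j * X' j s))"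
        by (simp add: sum_distrib_left mult_ac)
      ultimately show ?thesis
        by (simp add: e_def distrib_left sum.distrib sum_distrib_left[symmetric])
    qed
    also have "\<dots> = 2 * (\<Sum>i<n. X i s * g i s)" using elim(1) by simp
    also have "\<dots> \<le> 2 * (\<gamma> s * N s)" using elim(2) by (simp add: N_def)
    also have "\<dots> \<le> 2 * (\<gamma> s * N t0)" using t0(2)[OF sT] \<gamma>(2)[of s] by (simp add: mult_left_mono)
    finally show ?case by (simp add: mult_ac)
  qed
  have main: "(N t)\<^sup>2 + (\<Sum>i<n. (Y i t)\<^sup>2) \<le> 2 * N t0 * G" for t
  proof -
    have "prim T e t \<le> prim T (\<lambda>s. 2 * N t0 * \<gamma> s) t" using ie \<gamma>(1) ae by (intro prim_mono) auto
    also have "\<dots> \<le> (LINT s|?M. 2 * N t0 * \<gamma> s)" using \<gamma> N0 by (intro prim_nonneg_le) auto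
    also have "\<dots> = 2 * N t0 * G" by (simp add: G_def)
    finally show ?thesis using E by simp
  qed
  have Y0: "0 \<le> (\<Sum>i<n. (Y i t)\<^sup>2)" for t by (intro sum_nonneg) auto
  have "N t0 * N t0 \<le> 2 * N t0 * G" using main[of t0] Y0[of t0] by (simp add: power2_eq_square)
  then have Nt0: "N t0 \<le> 2 * G" using N0[of t0] G0
    by (cases "N t0 = 0") (auto simp: mult_le_cancel_left_pos less_le mult.assoc mult.left_commute[of 2])
  have "N t \<le> 2 * G" using t0(2)[OF t] Nt0 by linarith
  then show "sqrt (\<Sum>i<n. \<Sum>j<n. m i j * (X i t * X j t)) \<le> 2 * (LINT s|time_measure T. \<gamma> s)"
    by (simp only: N_def G_def)
  have "0 \<le> (N t)\<^sup>2" by simp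
  then have "(\<Sum>i<n. (Y i t)\<^sup>2) \<le> 2 * N t0 * G" using main[of t] by linarith
  also have "\<dots> \<le> (2 * G)\<^sup>2" using mult_right_mono[OF Nt0 G0] by (simp add: power2_eq_square algebra_simps)
  finally show "sqrt (\<Sum>i<n. (Y i t)\<^sup>2) \<le> 2 * (LINT s|time_measure T. \<gamma> s)"
    using G0 by (intro real_le_lsqrt) (auto simp: G_def)
qed

section \<open>Bochner functions\<close>

text \<open>A functional that is continuous along sequences commutes with the limit of simple functions that
  defines a Bochner function.\<close>
lemma bochner_measurable_compose:
  fixes F :: "('x \<Rightarrow> real) \<Rightarrow> real"
  assumes bm: "bochner_measurable T X N u" and X: "AE t in time_measure T. u t \<in> X"
    and cont: "\<And>v s. v \<in> X \<Longrightarrow> (\<And>k. s k \<in> X) \<Longrightarrow> (\<lambda>k::nat. N (\<lambda>x. v x - s k x)) \<longlonglongrightarrow> 0 \<Longrightarrow>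
      (\<lambda>k. F (s k)) \<longlonglongrightarrow> F v"
  shows "(\<lambda>t. F (u t)) \<in> borel_measurable (time_measure T)"
proof -
  obtain s :: "nat \<Rightarrow> real \<Rightarrow> 'x \<Rightarrow> real" where s: "\<And>k. simple_function (time_measure T) (s k)"
    "\<And>k t. t \<in> {0<..<T} \<Longrightarrow> s k t \<in> X" "AE t in time_measure T. (\<lambda>k. N (\<lambda>x. u t x - s k t x)) \<longlonglongrightarrow> 0"
    using bm unfolding bochner_measurable_def by blast
  have m: "(\<lambda>t. F (s k t)) \<in> borel_measurable (time_measure T)" for k
    using simple_function_compose[OF s(1)[of k], of F]
    by (intro borel_measurable_simple_function) (simp add: comp_def)
  show ?thesis
  proof (rule measurable_AE_cong)
    show "(\<lambda>t. lim (\<lambda>k. F (s k t))) \<in> borel_measurable (time_measure T)"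
      by (intro borel_measurable_lim_metric m)
    show "AE t in time_measure T. F (u t) = lim (\<lambda>k. F (s k t))"
      using s(3) X AE_space
    proof eventually_elim
      case (elim t)
      then have "(\<lambda>k. F (s k t)) \<longlonglongrightarrow> F (u t)" by (intro cont s(2)) auto
      then show ?case by (simp add: limI)
    qed
  qed simp
qed

lemma bochner_measurable_diff:
  assumes "bochner_measurable T X N u" "bochner_measurable T X N v"
    and X: "AE t in time_measure T. u t \<in> X" "AE t in time_measure T. v t \<in> X"
    and d: "\<And>f g. f \<in> X \<Longrightarrow> g \<in> X \<Longrightarrow> (\<lambda>x. f x - g x) \<in> X"
    and N: "\<And>f. 0 \<le> N f" "\<And>f g. f \<in> X \<Longrightarrow> g \<in> X \<Longrightarrow> N (\<lambda>x. f x - g x) \<le> N f + N g"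
  shows "bochner_measurable T X N (\<lambda>t x. u t x - v t x)"
proof -
  obtain s where s: "\<And>k::nat. simple_function (time_measure T) (s k)"
    "\<And>k t. t \<in> {0<..<T} \<Longrightarrow> s k t \<in> X" "AE t in time_measure T. (\<lambda>k. N (\<lambda>x. u t x - s k t x)) \<longlonglongrightarrow> 0"
    using assms(1) unfolding bochner_measurable_def by blast
  obtain r where r: "\<And>k::nat. simple_function (time_measure T) (r k)"
    "\<And>k t. t \<in> {0<..<T} \<Longrightarrow> r k t \<in> X" "AE t in time_measure T. (\<lambda>k. N (\<lambda>x. v t x - r k t x)) \<longlonglongrightarrow> 0"
    using assms(2) unfolding bochner_measurable_def by blast
  have "AE t in time_measure T. (\<lambda>k. N (\<lambda>x. (u t x - v t x) - (s k t x - r k t x))) \<longlonglongrightarrow> 0"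
    using s(3) r(3) X AE_space
  proof eventually_elim
    case (elim t)
    have le: "N (\<lambda>x. (u t x - v t x) - (s k t x - r k t x)) \<le> N (\<lambda>x. u t x - s k t x) + N (\<lambda>x. v t x - r k t x)" for k
    proof -
      have "N (\<lambda>x. (u t x - s k t x) - (v t x - r k t x)) \<le> N (\<lambda>x. u t x - s k t x) + N (\<lambda>x. v t x - r k t x)"
        using elim s(2) r(2) by (intro N d) auto
      then show ?thesis by (simp add: algebra_simps)
    qed
    show ?case
      by (rule tendsto_sandwich[OF _ _ tendsto_const tendsto_add_zero[OF elim(1,2)]]) (simp_all add: N le)
  qed
  moreover have "simple_function (time_measure T) (\<lambda>t x. s k t x - r k t x)" for k
    using simple_function_compose2[OF s(1)[of k] r(1)[of k], of "\<lambda>f g x. f x - g x"] .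
  ultimately show ?thesis unfolding bochner_measurable_def
    using s(2) r(2) d by (intro exI[of _ "\<lambda>k t x. s k t x - r k t x"]) auto
qed

lemma bochner_measurable_mono:
  assumes "bochner_measurable T X N u" "X \<subseteq> Y" "AE t in time_measure T. u t \<in> X"
    "\<And>f g. f \<in> X \<Longrightarrow> g \<in> X \<Longrightarrow> 0 \<le> M (\<lambda>x. f x - g x) \<and> M (\<lambda>x. f x - g x) \<le> N (\<lambda>x. f x - g x)"
  shows "bochner_measurable T Y M u"
proof -
  obtain s where s: "\<And>k::nat. simple_function (time_measure T) (s k)"
    "\<And>k t. t \<in> {0<..<T} \<Longrightarrow> s k t \<in> X" "AE t in time_measure T. (\<lambda>k. N (\<lambda>x. u t x - s k t x)) \<longlonglongrightarrow> 0"
    using assms(1) unfolding bochner_measurable_def by blast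
  have "AE t in time_measure T. (\<lambda>k. M (\<lambda>x. u t x - s k t x)) \<longlonglongrightarrow> 0"
    using s(3) assms(3) AE_space
  proof eventually_elim
    case (elim t)
    then show ?case using assms(4) s(2)
      by (intro tendsto_sandwich[OF _ _ tendsto_const elim(1)]) (auto intro!: always_eventually)
  qed
  then show ?thesis unfolding bochner_measurable_def using s(1,2) assms(2) by (intro exI[of _ s]) blast
qed

lemma Lp_norm_1: "Lp_norm 1 T g = (\<integral>\<^sup>+t. ennreal \<bar>g t\<bar> \<partial>time_measure T)"
  by (simp add: Lp_norm_def Let_def ennreal_enn2real_if)

lemma Lp_norm_inf_AE: "AE t in time_measure T. ennreal \<bar>g t\<bar> \<le> Lp_norm \<infinity> T g"
proof -
  have "AE t in time_measure T. ennreal \<bar>g t\<bar> \<le> esssup (time_measure T) (\<lambda>t. ennreal \<bar>g t\<bar>)"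
    by (rule esssup_AE)
  then show ?thesis by (simp add: Lp_norm_def)
qed

lemma Lp_norm_inf_leI: assumes "g \<in> borel_measurable (time_measure T)"
  "AE t in time_measure T. ennreal \<bar>g t\<bar> \<le> B" shows "Lp_norm \<infinity> T g \<le> B"
  using assms by (simp add: Lp_norm_def esssup_eq_AE) (intro Inf_lower, simp)

lemma Lp_norm_integrable:
  assumes m: "g \<in> borel_measurable (time_measure T)" and p: "p \<in> {1, 2, \<infinity>}" and f: "Lp_norm p T g < \<infinity>"
  shows "integrable (time_measure T) g"
proof -
  let ?M = "time_measure T"
  interpret finite_measure ?M by (rule time_finite)
  note [measurable] = m
  consider "p = 1" | "p = 2" | "p = \<infinity>" using p by auto
  then show ?thesis
  proof cases
    case 1
    then show ?thesis using f m by (intro integrableI_bounded) (auto simp: Lp_norm_1)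
  next
    case 2
    have "(\<integral>\<^sup>+t. ennreal (\<bar>g t\<bar> powr 2) \<partial>?M) < \<infinity>"
    proof (rule ccontr)
      assume "\<not> ?thesis"
      then have "(\<integral>\<^sup>+t. ennreal (\<bar>g t\<bar> powr 2) \<partial>?M) = \<infinity>" by (simp add: not_less top_unique)
      then show False using f 2 by (simp add: Lp_norm_def Let_def)
    qed
    moreover have "\<bar>g t\<bar> powr 2 = norm ((g t)\<^sup>2)" for t by (simp add: powr_numeral)
    ultimately have "integrable ?M (\<lambda>t. (g t)\<^sup>2)" by (intro integrableI_bounded) auto
    then have "integrable ?M (\<lambda>t. 1 + (g t)\<^sup>2)" by simp
    then show ?thesis
    proof (rule Bochner_Integration.integrable_bound)
      have "\<bar>g t\<bar> \<le> 1 + (g t)\<^sup>2" for t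
        using sum_squares_bound[of "\<bar>g t\<bar>" 1] abs_ge_zero[of "g t"] by (simp del: abs_ge_zero)
      then show "AE t in ?M. norm (g t) \<le> norm (1 + (g t)\<^sup>2)" by (auto intro!: AE_I2)
    qed (rule m)
  next
    case 3
    then obtain B where B: "0 \<le> B" "Lp_norm p T g = ennreal B" using f by (cases "Lp_norm p T g") auto
    have "AE t in ?M. norm (g t) \<le> norm B"
      using Lp_norm_inf_AE[where T=T and g=g] by eventually_elim (use B 3 in \<open>auto simp: ennreal_le_iff\<close>)
    moreover have "integrable ?M (\<lambda>_. B)" by simp
    ultimately show ?thesis using Bochner_Integration.integrable_bound[OF _ m] by blast
  qed
qed

lemma Lp_bochner_AE: "u \<in> Lp_bochner p T X N \<Longrightarrow> AE t in time_measure T. u t \<in> X"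
  and Lp_bochner_measurable: "u \<in> Lp_bochner p T X N \<Longrightarrow> bochner_measurable T X N u"
  by (auto simp: Lp_bochner_def)

lemma Lp_bochner_integrable:
  assumes u: "u \<in> Lp_bochner p T X N" and p: "p \<in> {1, 2, \<infinity>}"
    and N: "\<And>v. 0 \<le> N v" "\<And>f g. f \<in> X \<Longrightarrow> g \<in> X \<Longrightarrow> \<bar>N f - N g\<bar> \<le> N (\<lambda>x. f x - g x)"
  shows "integrable (time_measure T) (\<lambda>t. N (u t))"
proof (rule Lp_norm_integrable[OF _ p])
  show "Lp_norm p T (\<lambda>t. N (u t)) < \<infinity>" using u by (simp add: Lp_bochner_def)
  show "(\<lambda>t. N (u t)) \<in> borel_measurable (time_measure T)"
  proof (rule bochner_measurable_compose[OF Lp_bochner_measurable[OF u] Lp_bochner_AE[OF u]])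
    fix v s assume v: "v \<in> X" and s: "\<And>k. s k \<in> X" and l: "(\<lambda>k::nat. N (\<lambda>x. v x - s k x)) \<longlonglongrightarrow> 0"
    have "(\<lambda>k. N (s k) - N v) \<longlonglongrightarrow> 0"
      by (rule tendsto_0_le[OF l, of _ 1]) (use N(1) N(2)[OF v s] in \<open>auto simp: abs_minus_commute intro!: always_eventually\<close>)
    then show "(\<lambda>k. N (s k)) \<longlonglongrightarrow> N v" by (simp add: LIM_zero_iff)
  qed
qed

lemma l2norm_lipschitz: fixes f g :: "'a::euclidean_space \<Rightarrow> 'b::euclidean_space"
  assumes "f \<in> L2 S" "g \<in> L2 S" shows "\<bar>l2norm S f - l2norm S g\<bar> \<le> l2norm S (\<lambda>x. f x - g x)"
  using L2.nrm_triangle_sub[OF assms] L2.nrm_triangle_sub[OF assms(2,1)] L2.nrm_minus_commute[OF assms]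
  unfolding l2norm_eq_nrm by linarith

lemma Lp_L2_integrable_norm: "u \<in> Lp_L2 p T S \<Longrightarrow> p \<in> {1, 2, \<infinity>} \<Longrightarrow> integrable (time_measure T) (\<lambda>t. l2norm S (u t))"
  by (rule Lp_bochner_integrable[OF _ _ l2norm_nonneg l2norm_lipschitz])

lemma l2ip_bound: "v \<in> L2 S \<Longrightarrow> w \<in> L2 S \<Longrightarrow> \<bar>l2ip S v w\<bar> \<le> l2norm S v * l2norm S w"
  unfolding l2ip_eq_vip l2norm_eq_nrm by (rule L2.cauchy_schwarz)

lemma l2ip_tendsto: assumes "v \<in> L2 S" "w \<in> L2 S" "\<And>k. s k \<in> L2 S" "(\<lambda>k::nat. l2norm S (\<lambda>x. v x - s k x)) \<longlonglongrightarrow> 0"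
  shows "(\<lambda>k. l2ip S (s k) w) \<longlonglongrightarrow> l2ip S v w"
proof -
  have "(\<lambda>k. l2ip S v w - l2ip S (s k) w) \<longlonglongrightarrow> 0"
  proof (rule tendsto_0_le[OF assms(4), of _ "l2norm S w"])
    have "\<bar>l2ip S v w - l2ip S (s k) w\<bar> \<le> l2norm S (\<lambda>x. v x - s k x) * l2norm S w" for k
      using l2ip_bound[OF L2_diff[OF assms(1,3)] assms(2)] L2.ip_diff[OF assms(1,3,2)] by (simp add: l2ip_eq_vip)
    then show "\<forall>\<^sub>F k in sequentially. norm (l2ip S v w - l2ip S (s k) w) \<le> norm (l2norm S (\<lambda>x. v x - s k x)) * l2norm S w"
      by simp
  qed
  from tendsto_diff[OF tendsto_const[of "l2ip S v w"] this] show ?thesis by simp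
qed

lemma bochner_L2_measurable_ip: assumes "bochner_measurable T (L2 S) (l2norm S) u" "AE t in time_measure T. u t \<in> L2 S" "w \<in> L2 S"
  shows "(\<lambda>t. l2ip S (u t) w) \<in> borel_measurable (time_measure T)"
  by (rule bochner_measurable_compose[OF assms(1,2)]) (rule l2ip_tendsto[OF _ assms(3)])

lemma Lp_L2_integrable_ip: assumes u: "u \<in> Lp_L2 p T S" and p: "p \<in> {1, 2, \<infinity>}" and w: "w \<in> L2 S"
  shows "integrable (time_measure T) (\<lambda>t. l2ip S (u t) w)"
proof (rule Bochner_Integration.integrable_bound)
  show "integrable (time_measure T) (\<lambda>t. l2norm S (u t) * l2norm S w)"
    using Lp_L2_integrable_norm[OF u p] by simp
  show "(\<lambda>t. l2ip S (u t) w) \<in> borel_measurable (time_measure T)"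
    by (rule bochner_L2_measurable_ip[OF Lp_bochner_measurable[OF u] Lp_bochner_AE[OF u] w])
  show "AE t in time_measure T. norm (l2ip S (u t) w) \<le> norm (l2norm S (u t) * l2norm S w)"
    using Lp_bochner_AE[OF u] by eventually_elim (simp add: l2ip_bound w)
qed

text \<open>The exceptional null set of times depends on the test element \<open>v\<close>. A Bochner function is almost
  separably valued, so countably many \<open>v\<close>, the values of the approximating simple functions, suffice.\<close>
lemma bochner_L2_zero:
  assumes bm: "bochner_measurable T (L2 S) (l2norm S) u" and L: "AE t in time_measure T. u t \<in> L2 S"
    and z: "\<And>v. v \<in> L2 S \<Longrightarrow> AE t in time_measure T. l2ip S (u t) v = 0"
  shows "AE t in time_measure T. l2norm S (u t) = 0"
proof -
  obtain s where s: "\<And>k::nat. simple_function (time_measure T) (s k)"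
    "\<And>k t. t \<in> {0<..<T} \<Longrightarrow> s k t \<in> L2 S" "AE t in time_measure T. (\<lambda>k. l2norm S (\<lambda>x. u t x - s k t x)) \<longlonglongrightarrow> 0"
    using bm unfolding bochner_measurable_def by blast
  define D where "D = (\<Union>k. s k ` {0<..<T})"
  have "countable D" unfolding D_def using s(1) by (intro countable_UN countableI_type countable_finite) (simp add: simple_function_def)
  moreover have "D \<subseteq> L2 S" using s(2) by (auto simp: D_def)
  ultimately have "AE t in time_measure T. \<forall>v\<in>D. l2ip S (u t) v = 0"
    using z by (subst AE_ball_countable) auto
  then show ?thesis using s(3) L AE_space
  proof eventually_elim
    case (elim t)
    have sD: "s k t \<in> D" "s k t \<in> L2 S" for k
      using elim(4) s(2)[of t k] by (auto simp: D_def intro!: exI[of _ k])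
    have "(\<lambda>k. l2ip S (s k t) (u t)) \<longlonglongrightarrow> l2ip S (u t) (u t)"
      by (rule l2ip_tendsto[OF elim(3,3) sD(2) elim(2)])
    moreover have "l2ip S (s k t) (u t) = 0" for k
      using elim(1) sD L2.ip_sym[OF elim(3) sD(2)] by (simp add: l2ip_eq_vip)
    ultimately have "l2ip S (u t) (u t) = 0" by (simp add: LIMSEQ_const_iff)
    then show ?case by (simp add: l2norm_eq_nrm L2.nrm_def l2ip_eq_vip)
  qed
qed

lemma has_dtD: assumes "has_dt T S u w"
  shows "u \<in> Lp_L2 1 T S" "w \<in> Lp_L2 1 T S"
    "\<And>v \<phi>. v \<in> L2 S \<Longrightarrow> \<phi> \<in> test_functions {0<..<T} \<Longrightarrow>
       (LINT t|time_measure T. deriv \<phi> t * l2ip S (u t) v) = - (LINT t|time_measure T. \<phi> t * l2ip S (w t) v)"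
  using assms by (auto simp: has_dt_def weak_time_deriv_def)

lemma has_dt_prim: assumes T: "0 < T" and d: "has_dt T S u w" and v: "v \<in> L2 S"
  obtains c where "AE t in time_measure T. l2ip S (u t) v = c + prim T (\<lambda>s. l2ip S (w s) v) t"
proof (rule weak_derivative_imp_prim[OF T])
  show "integrable (time_measure T) (\<lambda>t. l2ip S (u t) v)" "integrable (time_measure T) (\<lambda>t. l2ip S (w t) v)"
    using has_dtD(1,2)[OF d] v by (auto intro: Lp_L2_integrable_ip)
qed (use has_dtD(3)[OF d v] that in auto)

lemma weak_derivative_unique:
  assumes T: "0 < T" and P: "integrable (time_measure T) P"
    and Q: "integrable (time_measure T) Q" "integrable (time_measure T) Q'"
    and w: "\<And>\<phi>. \<phi> \<in> test_functions {0<..<T} \<Longrightarrow>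
      (LINT t|time_measure T. deriv \<phi> t * P t) = - (LINT t|time_measure T. \<phi> t * Q t)"
      "\<And>\<phi>. \<phi> \<in> test_functions {0<..<T} \<Longrightarrow>
      (LINT t|time_measure T. deriv \<phi> t * P t) = - (LINT t|time_measure T. \<phi> t * Q' t)"
  shows "AE t in time_measure T. Q t = Q' t"
proof -
  obtain c where c: "AE t in time_measure T. P t = c + prim T Q t"
    by (rule weak_derivative_imp_prim[OF T P Q(1) w(1)]) (auto intro: that)
  obtain c' where c': "AE t in time_measure T. P t = c' + prim T Q' t"
    by (rule weak_derivative_imp_prim[OF T P Q(2) w(2)]) (auto intro: that)
  have "AE t in time_measure T. c + prim T Q t = c' + prim T Q' t"
    using c c' by eventually_elim simp
  then show ?thesis by (rule prim_eq_imp(2)[OF T Q])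
qed

lemma Lp_L2_measurable_diff: assumes "u \<in> Lp_L2 p T S" "w \<in> Lp_L2 q T S"
  shows "bochner_measurable T (L2 S) (l2norm S) (\<lambda>t x. u t x - w t x)"
    "AE t in time_measure T. (\<lambda>x. u t x - w t x) \<in> L2 S"
proof -
  show "bochner_measurable T (L2 S) (l2norm S) (\<lambda>t x. u t x - w t x)"
  proof (rule bochner_measurable_diff[OF assms[THEN Lp_bochner_measurable] assms[THEN Lp_bochner_AE]])
    show "l2norm S (\<lambda>x. f x - g x) \<le> l2norm S f + l2norm S g" if "f \<in> L2 S" "g \<in> L2 S" for f g :: "'a \<Rightarrow> real"
      unfolding l2norm_eq_nrm using that by (rule L2.nrm_diff_triangle)
  qed (auto intro: L2_diff)
  show "AE t in time_measure T. (\<lambda>x. u t x - w t x) \<in> L2 S"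
    using assms[THEN Lp_bochner_AE] by eventually_elim (rule L2_diff)
qed

lemma has_dt_unique: fixes S :: "'a::euclidean_space set" assumes T: "0 < T" and "has_dt T S u w" "has_dt T S u w'"
  shows "AE t in time_measure T. l2norm S (\<lambda>x. w t x - w' t x) = 0"
proof (rule bochner_L2_zero)
  note D = has_dtD[OF assms(2)] and D' = has_dtD[OF assms(3)]
  show "bochner_measurable T (L2 S) (l2norm S) (\<lambda>t x. w t x - w' t x)"
    "AE t in time_measure T. (\<lambda>x. w t x - w' t x) \<in> L2 S" by (rule Lp_L2_measurable_diff[OF D(2) D'(2)])+
  fix v :: "'a \<Rightarrow> real" assume v: "v \<in> L2 S"
  have "AE t in time_measure T. l2ip S (w t) v = l2ip S (w' t) v"
    by (rule weak_derivative_unique[OF T Lp_L2_integrable_ip[OF D(1) _ v] Lp_L2_integrable_ip[OF D(2) _ v]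
          Lp_L2_integrable_ip[OF D'(2) _ v] D(3)[OF v] D'(3)[OF v]]) auto
  then show "AE t in time_measure T. l2ip S (\<lambda>x. w t x - w' t x) v = 0"
    using Lp_bochner_AE[OF D(2)] Lp_bochner_AE[OF D'(2)]
    by eventually_elim (simp add: l2ip_eq_vip L2.ip_diff v)
qed

text \<open>The continuous representative of \<open>u\<close> has the same products with \<open>v\<close> as \<open>u\<close>, and these are
  continuous in time up to the initial time.\<close>
lemma L2_initial_value:
  assumes T: "0 < T" and d: "has_dt T S u w" and i: "has_initial_value T (L2 S) (l2norm S) u z" and v: "v \<in> L2 S"
  shows "AE t in time_measure T. l2ip S (u t) v = l2ip S z v + prim T (\<lambda>s. l2ip S (w s) v) t"
proof -
  note D = has_dtD[OF d]
  obtain y where y: "\<And>t. t \<in> {0..T} \<Longrightarrow> y t \<in> L2 S"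
    "\<And>t. t \<in> {0..T} \<Longrightarrow> ((\<lambda>s. l2norm S (\<lambda>x. y s x - y t x)) \<longlongrightarrow> 0) (at t within {0..T})"
    "AE t in time_measure T. l2norm S (\<lambda>x. u t x - y t x) = 0" "l2norm S (\<lambda>x. y 0 x - z x) = 0" and z: "z \<in> L2 S"
    using i unfolding has_initial_value_def by blast
  have dv: "l2ip S f v - l2ip S g v = l2ip S (\<lambda>x. f x - g x) v" if "f \<in> L2 S" "g \<in> L2 S" for f g
    using that v by (simp add: l2ip_eq_vip L2.ip_diff)
  have bd: "\<bar>l2ip S f v - l2ip S g v\<bar> \<le> l2norm S (\<lambda>x. f x - g x) * l2norm S v" if "f \<in> L2 S" "g \<in> L2 S" for f g
    unfolding dv[OF that] using that v by (intro l2ip_bound L2_diff)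
  have "AE t in time_measure T. l2ip S (u t) v = l2ip S (y 0) v + prim T (\<lambda>s. l2ip S (w s) v) t"
  proof (rule weak_derivative_initial_value[OF T Lp_L2_integrable_ip[OF D(1) _ v] Lp_L2_integrable_ip[OF D(2) _ v] D(3)[OF v]])
    show "continuous_on {0..T} (\<lambda>t. l2ip S (y t) v)"
      unfolding continuous_on_def
    proof
      fix t assume t: "t \<in> {0..T}"
      have "((\<lambda>s. l2ip S (y s) v - l2ip S (y t) v) \<longlongrightarrow> 0) (at t within {0..T})"
      proof (rule tendsto_0_le[OF y(2)[OF t], of _ "l2norm S v"])
        show "\<forall>\<^sub>F s in at t within {0..T}. norm (l2ip S (y s) v - l2ip S (y t) v)
            \<le> norm (l2norm S (\<lambda>x. y s x - y t x)) * l2norm S v"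
          unfolding eventually_at_filter using bd y(1) t by (auto intro!: always_eventually)
      qed
      then show "((\<lambda>t. l2ip S (y t) v) \<longlongrightarrow> l2ip S (y t) v) (at t within {0..T})" by (simp add: LIM_zero_iff)
    qed
    show "AE t in time_measure T. l2ip S (u t) v = l2ip S (y t) v"
      using y(3) Lp_bochner_AE[OF D(1)] AE_space
    proof eventually_elim
      case (elim t)
      then show ?case using bd[of "u t" "y t"] y(1)[of t] by simp
    qed
  qed auto
  moreover have "l2ip S (y 0) v = l2ip S z v" using bd[OF y(1) z, of 0] y(4) T by simp
  ultimately show ?thesis by simp
qed

context bounded_domain
begin

lemma h1norm_lipschitz: assumes "f \<in> H1 \<Omega>" "g \<in> H1 \<Omega>"
  shows "\<bar>h1norm \<Omega> f - h1norm \<Omega> g\<bar> \<le> h1norm \<Omega> (\<lambda>x. f x - g x)"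
  using H.nrm_triangle_sub[OF assms] H.nrm_triangle_sub[OF assms(2,1)] H.nrm_minus_commute[OF assms]
    H.diff_mem[OF assms]
  by (simp add: h1norm_eq_nrm assms)

lemma Lp_H10_integrable_norm: "u \<in> Lp_H10 p T \<Omega> \<Longrightarrow> p \<in> {1, 2, \<infinity>} \<Longrightarrow> integrable (time_measure T) (\<lambda>t. h1norm \<Omega> (u t))"
  by (rule Lp_bochner_integrable[OF _ _ h1norm_nonneg h1norm_lipschitz[OF H10_H1 H10_H1]])

lemma Lp_H10_measurable_L2: assumes "u \<in> Lp_H10 p T \<Omega>"
  shows "bochner_measurable T (L2 \<Omega>) (l2norm \<Omega>) u"
  by (rule bochner_measurable_mono[OF Lp_bochner_measurable[OF assms] _ Lp_bochner_AE[OF assms]])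
    (auto simp: H10_L2 l2norm_le_h1norm)

lemma Lp_H10_measurable_diff: assumes "u \<in> Lp_H10 p T \<Omega>" "w \<in> Lp_H10 q T \<Omega>"
  shows "bochner_measurable T (H10 \<Omega>) (h1norm \<Omega>) (\<lambda>t x. u t x - w t x)"
    "AE t in time_measure T. (\<lambda>x. u t x - w t x) \<in> H10 \<Omega>"
proof -
  show "bochner_measurable T (H10 \<Omega>) (h1norm \<Omega>) (\<lambda>t x. u t x - w t x)"
  proof (rule bochner_measurable_diff[OF assms[THEN Lp_bochner_measurable] assms[THEN Lp_bochner_AE]])
    show "h1norm \<Omega> (\<lambda>x. f x - g x) \<le> h1norm \<Omega> f + h1norm \<Omega> g" if "f \<in> H10 \<Omega>" "g \<in> H10 \<Omega>" for f g
      using H.nrm_diff_triangle[OF H10_H1[OF that(1)] H10_H1[OF that(2)]] that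
      by (simp add: h1norm_eq_nrm H10_H1 H10_diff)
  qed (auto intro: H10_diff h1norm_nonneg)
  show "AE t in time_measure T. (\<lambda>x. u t x - w t x) \<in> H10 \<Omega>"
    using assms[THEN Lp_bochner_AE] by eventually_elim (rule H10_diff)
qed

lemma Lp_bochner_subspace: assumes "u \<in> Lp_bochner p T V (h1norm \<Omega>)" "V \<subseteq> H10 \<Omega>" shows "u \<in> Lp_H10 p T \<Omega>"
proof -
  have "bochner_measurable T (H10 \<Omega>) (h1norm \<Omega>) u"
    by (rule bochner_measurable_mono[OF Lp_bochner_measurable[OF assms(1)] assms(2) Lp_bochner_AE[OF assms(1)]])
      (simp add: h1norm_nonneg)
  then show ?thesis using assms Lp_bochner_AE[OF assms(1)] by (auto simp: Lp_bochner_def elim: eventually_mono)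
qed

text \<open>One component of the gradient at a time, so that test functions can be scalar.\<close>
definition gpair :: "'a \<Rightarrow> ('a \<Rightarrow> real) \<Rightarrow> ('a \<Rightarrow> real) \<Rightarrow> real" where
  "gpair i v g = vip \<Omega> (\<lambda>x. wgrad \<Omega> v x \<bullet> i) g"

lemma gpair_diff_left: assumes "v \<in> H1 \<Omega>" "w \<in> H1 \<Omega>" "g \<in> L2 \<Omega>" "i \<in> Basis"
  shows "gpair i (\<lambda>x. v x - w x) g = gpair i v g - gpair i w g"
proof -
  note c = L2_component[OF H1_wgrad_L2 assms(4)]
  have "AE x in lebesgue_on \<Omega>. wgrad \<Omega> (\<lambda>x. v x - w x) x = wgrad \<Omega> v x - wgrad \<Omega> w x"
    using wgrad_add[OF assms(1) H1_scale[OF assms(2), of "-1"]] wgrad_scale[OF assms(2), of "-1"]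
    by eventually_elim simp
  then have "AE x in lebesgue_on \<Omega>. wgrad \<Omega> (\<lambda>x. v x - w x) x \<bullet> i = wgrad \<Omega> v x \<bullet> i - wgrad \<Omega> w x \<bullet> i"
    by eventually_elim (simp add: inner_diff_left)
  then have "gpair i (\<lambda>x. v x - w x) g = vip \<Omega> (\<lambda>x. wgrad \<Omega> v x \<bullet> i - wgrad \<Omega> w x \<bullet> i) g"
    unfolding gpair_def using assms
    by (intro vip_cong L2_diff c H.diff_mem) auto
  then show ?thesis unfolding gpair_def using assms by (simp add: L2.ip_diff c)
qed

lemma gpair_diff_right: assumes "v \<in> H1 \<Omega>" "g \<in> L2 \<Omega>" "h \<in> L2 \<Omega>" "i \<in> Basis"
  shows "gpair i v (\<lambda>x. g x - h x) = gpair i v g - gpair i v h"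
  unfolding gpair_def using assms by (intro L2.ip_diff_right L2_component[OF H1_wgrad_L2])

lemma gpair_bound: assumes "v \<in> H1 \<Omega>" "g \<in> L2 \<Omega>" "i \<in> Basis"
  shows "\<bar>gpair i v g\<bar> \<le> h1norm \<Omega> v * l2norm \<Omega> g"
proof -
  have "\<bar>gpair i v g\<bar> \<le> l2norm \<Omega> (\<lambda>x. wgrad \<Omega> v x \<bullet> i) * l2norm \<Omega> g"
    unfolding gpair_def l2norm_eq_nrm using assms by (intro L2.cauchy_schwarz L2_component[OF H1_wgrad_L2])
  also have "l2norm \<Omega> (\<lambda>x. wgrad \<Omega> v x \<bullet> i) \<le> l2norm \<Omega> (wgrad \<Omega> v)"
    using assms by (intro l2norm_mono L2_measurable L2_component[OF H1_wgrad_L2] H1_wgrad_L2) (auto simp: Basis_le_norm)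
  also have "\<dots> \<le> h1norm \<Omega> v" by (rule l2norm_wgrad_le_h1norm)
  finally show ?thesis by (simp add: mult_right_mono)
qed

lemma gpair_test: assumes "v \<in> H1 \<Omega>" "\<psi> \<in> test_functions \<Omega>" "i \<in> Basis"
  shows "gpair i v \<psi> = - l2ip \<Omega> v (partial i \<psi>)"
  using is_wgradD[OF H1_wgrad[OF assms(1)] assms(2,3)] by (simp add: gpair_def vip_def l2ip_def)

lemma gpair_measurable: assumes "u \<in> Lp_H10 p T \<Omega>" "g \<in> L2 \<Omega>" "i \<in> Basis"
  shows "(\<lambda>t. gpair i (u t) g) \<in> borel_measurable (time_measure T)"
proof (rule bochner_measurable_compose[OF Lp_bochner_measurable[OF assms(1)] Lp_bochner_AE[OF assms(1)]])
  fix v s assume v: "v \<in> H10 \<Omega>" and s: "\<And>k. s k \<in> H10 \<Omega>" and l: "(\<lambda>k::nat. h1norm \<Omega> (\<lambda>x. v x - s k x)) \<longlonglongrightarrow> 0"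
  have "(\<lambda>k. gpair i v g - gpair i (s k) g) \<longlonglongrightarrow> 0"
  proof (rule tendsto_0_le[OF l, of _ "l2norm \<Omega> g"])
    have "\<bar>gpair i v g - gpair i (s k) g\<bar> \<le> h1norm \<Omega> (\<lambda>x. v x - s k x) * l2norm \<Omega> g" for k
      using gpair_bound[OF H10_H1[OF H10_diff[OF v s]] assms(2,3)] gpair_diff_left[OF H10_H1[OF v] H10_H1[OF s] assms(2,3)]
      by simp
    then show "\<forall>\<^sub>F k in sequentially. norm (gpair i v g - gpair i (s k) g) \<le> norm (h1norm \<Omega> (\<lambda>x. v x - s k x)) * l2norm \<Omega> g"
      by (simp add: h1norm_nonneg)
  qed
  from tendsto_diff[OF tendsto_const[of "gpair i v g"] this] show "(\<lambda>k. gpair i (s k) g) \<longlonglongrightarrow> gpair i v g" by simp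
qed

lemma gpair_integrable: assumes "u \<in> Lp_H10 p T \<Omega>" "p \<in> {1, 2, \<infinity>}" "g \<in> L2 \<Omega>" "i \<in> Basis"
  shows "integrable (time_measure T) (\<lambda>t. gpair i (u t) g)"
proof (rule Bochner_Integration.integrable_bound)
  show "integrable (time_measure T) (\<lambda>t. h1norm \<Omega> (u t) * l2norm \<Omega> g)"
    using Lp_H10_integrable_norm[OF assms(1,2)] by simp
  show "AE t in time_measure T. norm (gpair i (u t) g) \<le> norm (h1norm \<Omega> (u t) * l2norm \<Omega> g)"
    using Lp_bochner_AE[OF assms(1)] by eventually_elim (use assms in \<open>auto simp: h1norm_nonneg intro!: gpair_bound H10_H1\<close>)
qed (rule gpair_measurable[OF assms(1,3,4)])

text \<open>If \<open>g\<close> is a test function, the derivative moves to \<open>g\<close> and the claim is the assumption on \<open>L\<^sup>2\<close>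
  products. In general \<open>g\<close> is a limit of test functions, and the pairings converge
  because the \<open>H\<^sup>1\<close> norm of \<open>ut\<close> is integrable in time.\<close>
lemma gpair_prim:
  assumes T: "0 < T" and u: "u \<in> Lp_H10 p T \<Omega>" and ut: "ut \<in> Lp_H10 q T \<Omega>" "q \<in> {1, 2, \<infinity>}"
    and z: "z \<in> H10 \<Omega>"
    and init: "\<And>\<psi>. \<psi> \<in> test_functions \<Omega> \<Longrightarrow>
      AE t in time_measure T. l2ip \<Omega> (u t) \<psi> = l2ip \<Omega> z \<psi> + prim T (\<lambda>s. l2ip \<Omega> (ut s) \<psi>) t"
    and g: "g \<in> L2 \<Omega>" and i: "i \<in> Basis"
  shows "AE t in time_measure T. gpair i (u t) g = gpair i z g + prim T (\<lambda>s. gpair i (ut s) g) t"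
proof -
  obtain \<psi> where \<psi>: "\<And>k::nat. \<psi> k \<in> test_functions \<Omega>" "(\<lambda>k. l2norm \<Omega> (\<lambda>x. g x - \<psi> k x)) \<longlonglongrightarrow> 0"
    by (rule test_function_sequence[OF open_domain bounded_domain g]) (rule that)
  note \<psi>L = test_L2'[OF \<psi>(1)]
  have "AE t in time_measure T. gpair i (u t) (\<psi> k) = gpair i z (\<psi> k) + prim T (\<lambda>s. gpair i (ut s) (\<psi> k)) t" for k
  proof -
    have p: "partial i (\<psi> k) \<in> test_functions \<Omega>" by (rule test_partial[OF \<psi>(1) i])
    have "prim T (\<lambda>s. gpair i (ut s) (\<psi> k)) t = prim T (\<lambda>s. - l2ip \<Omega> (ut s) (partial i (\<psi> k))) t" for t
    proof (rule prim_cong)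
      show "AE s in time_measure T. gpair i (ut s) (\<psi> k) = - l2ip \<Omega> (ut s) (partial i (\<psi> k))"
        using Lp_bochner_AE[OF ut(1)] by eventually_elim (intro gpair_test H10_H1 \<psi> i)
      have "AE t in time_measure T. ut t \<in> L2 \<Omega>" using Lp_bochner_AE[OF ut(1)] by eventually_elim (rule H10_L2)
      then show "(\<lambda>s. - l2ip \<Omega> (ut s) (partial i (\<psi> k))) \<in> borel_measurable (time_measure T)"
        using bochner_L2_measurable_ip[OF Lp_H10_measurable_L2[OF ut(1)] _ test_L2'[OF p]] by measurable
    qed (rule gpair_measurable[OF ut(1) \<psi>L i])
    then have pr: "prim T (\<lambda>s. gpair i (ut s) (\<psi> k)) t = - prim T (\<lambda>s. l2ip \<Omega> (ut s) (partial i (\<psi> k))) t" for t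
      using prim_mult[of T "-1"] by simp
    show ?thesis
      using init[OF p] Lp_bochner_AE[OF u]
    proof eventually_elim
      case (elim t)
      then show ?case using gpair_test[OF H10_H1[OF elim(2)] \<psi>(1) i] gpair_test[OF H10_H1[OF z] \<psi>(1) i]
        by (simp add: pr)
    qed
  qed
  then have "AE t in time_measure T. \<forall>k. gpair i (u t) (\<psi> k) = gpair i z (\<psi> k) + prim T (\<lambda>s. gpair i (ut s) (\<psi> k)) t"
    by (simp add: AE_all_countable)
  then show ?thesis using Lp_bochner_AE[OF u]
  proof eventually_elim
    case (elim t)
    have lim: "(\<lambda>k. gpair i v (\<psi> k)) \<longlonglongrightarrow> gpair i v g" if "v \<in> H10 \<Omega>" for v
    proof -
      have "(\<lambda>k. gpair i v g - gpair i v (\<psi> k)) \<longlonglongrightarrow> 0"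
      proof (rule tendsto_0_le[OF \<psi>(2), of _ "h1norm \<Omega> v"])
        have "\<bar>gpair i v g - gpair i v (\<psi> k)\<bar> \<le> h1norm \<Omega> v * l2norm \<Omega> (\<lambda>x. g x - \<psi> k x)" for k
          using gpair_bound[OF H10_H1[OF that] L2_diff[OF g \<psi>L] i] gpair_diff_right[OF H10_H1[OF that] g \<psi>L i] by simp
        then show "\<forall>\<^sub>F k in sequentially. norm (gpair i v g - gpair i v (\<psi> k)) \<le> norm (l2norm \<Omega> (\<lambda>x. g x - \<psi> k x)) * h1norm \<Omega> v"
          by (simp add: mult.commute)
      qed
      from tendsto_diff[OF tendsto_const[of "gpair i v g"] this] show ?thesis by simp
    qed
    have "(\<lambda>k. prim T (\<lambda>s. gpair i (ut s) g) t - prim T (\<lambda>s. gpair i (ut s) (\<psi> k)) t) \<longlonglongrightarrow> 0"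
    proof (rule tendsto_0_le[OF \<psi>(2), of _ "LINT s|time_measure T. h1norm \<Omega> (ut s)"])
      have "\<bar>prim T (\<lambda>s. gpair i (ut s) g) t - prim T (\<lambda>s. gpair i (ut s) (\<psi> k)) t\<bar>
          \<le> l2norm \<Omega> (\<lambda>x. g x - \<psi> k x) * (LINT s|time_measure T. h1norm \<Omega> (ut s))" for k
      proof -
        note ii = gpair_integrable[OF ut g i] gpair_integrable[OF ut \<psi>L i, of k]
        have "\<bar>prim T (\<lambda>s. gpair i (ut s) g - gpair i (ut s) (\<psi> k)) t\<bar>
            \<le> (LINT s|time_measure T. \<bar>gpair i (ut s) g - gpair i (ut s) (\<psi> k)\<bar>)"
          by (intro prim_abs_le Bochner_Integration.integrable_diff ii)
        also have "\<dots> \<le> (LINT s|time_measure T. l2norm \<Omega> (\<lambda>x. g x - \<psi> k x) * h1norm \<Omega> (ut s))"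
        proof (rule integral_mono_AE)
          show "AE s in time_measure T. \<bar>gpair i (ut s) g - gpair i (ut s) (\<psi> k)\<bar> \<le> l2norm \<Omega> (\<lambda>x. g x - \<psi> k x) * h1norm \<Omega> (ut s)"
            using Lp_bochner_AE[OF ut(1)]
          proof eventually_elim
            case (elim s)
            show ?case using gpair_bound[OF H10_H1[OF elim] L2_diff[OF g \<psi>L] i] gpair_diff_right[OF H10_H1[OF elim] g \<psi>L i]
              by (simp add: mult.commute)
          qed
        qed (use ii Lp_H10_integrable_norm[OF ut] in auto)
        finally show ?thesis by (simp add: prim_diff[OF ii])
      qed
      then show "\<forall>\<^sub>F k in sequentially. norm (prim T (\<lambda>s. gpair i (ut s) g) t - prim T (\<lambda>s. gpair i (ut s) (\<psi> k)) t)
          \<le> norm (l2norm \<Omega> (\<lambda>x. g x - \<psi> k x)) * (LINT s|time_measure T. h1norm \<Omega> (ut s))" by simp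
    qed
    from tendsto_diff[OF tendsto_const[of "prim T (\<lambda>s. gpair i (ut s) g) t"] this]
    have "(\<lambda>k. prim T (\<lambda>s. gpair i (ut s) (\<psi> k)) t) \<longlonglongrightarrow> prim T (\<lambda>s. gpair i (ut s) g) t" by simp
    from tendsto_add[OF lim[OF z] this]
    have "(\<lambda>k. gpair i (u t) (\<psi> k)) \<longlonglongrightarrow> gpair i z g + prim T (\<lambda>s. gpair i (ut s) g) t"
      using elim(1) by simp
    then show ?case using lim[OF elim(2)] LIMSEQ_unique by blast
  qed
qed

end

context energy_form
begin

lemma energy_eq_gpair: assumes "v \<in> H1 \<Omega>" "w \<in> H1 \<Omega>"
  shows "energy v w = (\<Sum>i\<in>Basis. gpair i v (\<lambda>x. a x * (wgrad \<Omega> w x \<bullet> i)))"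
proof -
  have L: "(\<lambda>x. a x * (wgrad \<Omega> w x \<bullet> i)) \<in> L2 \<Omega>" if "i \<in> Basis" for i
    using L2_component[OF weighted_wgrad_L2[OF assms(2)] that] by simp
  have "energy v w = (LINT x|lebesgue_on \<Omega>. (\<Sum>i\<in>Basis. (wgrad \<Omega> v x \<bullet> i) * (a x * (wgrad \<Omega> w x \<bullet> i))))"
    unfolding bform_def
    by (intro Bochner_Integration.integral_cong refl)
      (subst euclidean_inner, simp add: sum_distrib_left mult.left_commute)
  also have "\<dots> = (\<Sum>i\<in>Basis. gpair i v (\<lambda>x. a x * (wgrad \<Omega> w x \<bullet> i)))"
    unfolding gpair_def vip_def inner_real_def
    by (intro Bochner_Integration.integral_sum L2_integrable_mult L2_component[OF H1_wgrad_L2[OF assms(1)]] L)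
  finally show ?thesis .
qed

lemma energy_bound: assumes "v \<in> H10 \<Omega>" "w \<in> H10 \<Omega>"
  shows "\<bar>energy v w\<bar> \<le> h1norm \<Omega> v * (sqrt amax * enorm w)"
proof -
  have "\<bar>energy v w\<bar> \<le> enorm v * enorm w" unfolding enorm_eq_nrm by (rule E.cauchy_schwarz[OF assms])
  also have "\<dots> \<le> (sqrt amax * h1norm \<Omega> v) * enorm w"
    by (intro mult_right_mono enorm_le_h1norm H10_H1 assms) auto
  finally show ?thesis by (simp add: mult_ac)
qed

lemma enorm_lipschitz: assumes "f \<in> H10 \<Omega>" "g \<in> H10 \<Omega>" shows "\<bar>enorm f - enorm g\<bar> \<le> enorm (\<lambda>x. f x - g x)"
  using E.nrm_triangle_sub[OF assms] E.nrm_triangle_sub[OF assms(2,1)] E.nrm_minus_commute[OF assms]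
  unfolding enorm_eq_nrm by linarith

lemma enorm_measurable:
  assumes "bochner_measurable T (H10 \<Omega>) (h1norm \<Omega>) u" "AE t in time_measure T. u t \<in> H10 \<Omega>"
  shows "(\<lambda>t. enorm (u t)) \<in> borel_measurable (time_measure T)"
proof (rule bochner_measurable_compose[OF assms])
  fix v s assume v: "v \<in> H10 \<Omega>" and s: "\<And>k. s k \<in> H10 \<Omega>" and l: "(\<lambda>k::nat. h1norm \<Omega> (\<lambda>x. v x - s k x)) \<longlonglongrightarrow> 0"
  have "(\<lambda>k. enorm v - enorm (s k)) \<longlonglongrightarrow> 0"
  proof (rule tendsto_0_le[OF l, of _ "sqrt amax"])
    have "\<bar>enorm v - enorm (s k)\<bar> \<le> sqrt amax * h1norm \<Omega> (\<lambda>x. v x - s k x)" for k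
      using enorm_lipschitz[OF v s] enorm_le_h1norm[OF H10_H1[OF H10_diff[OF v s]]] order_trans by blast
    then show "\<forall>\<^sub>F k in sequentially. norm (enorm v - enorm (s k)) \<le> norm (h1norm \<Omega> (\<lambda>x. v x - s k x)) * sqrt amax"
      by (simp add: h1norm_nonneg mult.commute)
  qed
  from tendsto_diff[OF tendsto_const[of "enorm v"] this] show "(\<lambda>k. enorm (s k)) \<longlonglongrightarrow> enorm v" by simp
qed

lemma energy_integrable: assumes u: "u \<in> Lp_H10 p T \<Omega>" "p \<in> {1, 2, \<infinity>}" and w: "w \<in> H10 \<Omega>"
  shows "integrable (time_measure T) (\<lambda>t. energy (u t) w)"
proof (rule Bochner_Integration.integrable_bound)
  show "integrable (time_measure T) (\<lambda>t. h1norm \<Omega> (u t) * (sqrt amax * enorm w))"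
    using Lp_H10_integrable_norm[OF u] by simp
  show "(\<lambda>t. energy (u t) w) \<in> borel_measurable (time_measure T)"
  proof (rule bochner_measurable_compose[OF Lp_bochner_measurable[OF u(1)] Lp_bochner_AE[OF u(1)]])
    fix v s assume v: "v \<in> H10 \<Omega>" and s: "\<And>k. s k \<in> H10 \<Omega>" and l: "(\<lambda>k::nat. h1norm \<Omega> (\<lambda>x. v x - s k x)) \<longlonglongrightarrow> 0"
    have "(\<lambda>k. energy v w - energy (s k) w) \<longlonglongrightarrow> 0"
    proof (rule tendsto_0_le[OF l, of _ "sqrt amax * enorm w"])
      have "\<bar>energy v w - energy (s k) w\<bar> \<le> h1norm \<Omega> (\<lambda>x. v x - s k x) * (sqrt amax * enorm w)" for k
        using energy_bound[OF H10_diff[OF v s] w] E.ip_diff[OF v s w] by simp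
      then show "\<forall>\<^sub>F k in sequentially. norm (energy v w - energy (s k) w) \<le> norm (h1norm \<Omega> (\<lambda>x. v x - s k x)) * (sqrt amax * enorm w)"
        by (simp add: h1norm_nonneg)
    qed
    from tendsto_diff[OF tendsto_const[of "energy v w"] this] show "(\<lambda>k. energy (s k) w) \<longlonglongrightarrow> energy v w" by simp
  qed
  show "AE t in time_measure T. norm (energy (u t) w) \<le> norm (h1norm \<Omega> (u t) * (sqrt amax * enorm w))"
    using Lp_bochner_AE[OF u(1)] by eventually_elim (use energy_bound[OF _ w] amax_pos in \<open>auto simp: h1norm_nonneg\<close>)
qed

text \<open>A function whose weak time derivative is known in \<open>L\<^sup>2\<close> and has values in \<open>H\<^sup>1\<^sub>0\<close> can be differentiated
  inside the energy form: \<open>energy (u t) w\<close> is a sum of pairings of partial derivatives with the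
  components of \<open>a \<nabla>w\<close>, which are fixed elements of \<open>L\<^sup>2\<close>.\<close>
lemma energy_prim:
  assumes T: "0 < T" and u: "u \<in> Lp_H10 p T \<Omega>" and ut: "ut \<in> Lp_H10 q T \<Omega>" "q \<in> {1, 2, \<infinity>}"
    and z: "z \<in> H10 \<Omega>"
    and init: "\<And>\<psi>. \<psi> \<in> test_functions \<Omega> \<Longrightarrow>
      AE t in time_measure T. l2ip \<Omega> (u t) \<psi> = l2ip \<Omega> z \<psi> + prim T (\<lambda>s. l2ip \<Omega> (ut s) \<psi>) t"
    and w: "w \<in> H10 \<Omega>"
  shows "AE t in time_measure T. energy (u t) w = energy z w + prim T (\<lambda>s. energy (ut s) w) t"
proof -
  let ?g = "\<lambda>i x. a x * (wgrad \<Omega> w x \<bullet> i)"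
  have L: "?g i \<in> L2 \<Omega>" if "i \<in> Basis" for i
    using L2_component[OF weighted_wgrad_L2[OF H10_H1[OF w]] that] by simp
  have ii: "integrable (time_measure T) (\<lambda>s. gpair i (ut s) (?g i))" if "i \<in> Basis" for i
    by (rule gpair_integrable[OF ut L[OF that] that])
  have "prim T (\<lambda>s. energy (ut s) w) t = prim T (\<lambda>s. \<Sum>i\<in>Basis. gpair i (ut s) (?g i)) t" for t
  proof (rule prim_cong)
    show "AE s in time_measure T. energy (ut s) w = (\<Sum>i\<in>Basis. gpair i (ut s) (?g i))"
      using Lp_bochner_AE[OF ut(1)] by eventually_elim (intro energy_eq_gpair H10_H1 w)
    show "(\<lambda>s. energy (ut s) w) \<in> borel_measurable (time_measure T)"
      using energy_integrable[OF ut w] by simp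
    show "(\<lambda>s. \<Sum>i\<in>Basis. gpair i (ut s) (?g i)) \<in> borel_measurable (time_measure T)"
      by (intro borel_measurable_sum borel_measurable_integrable ii)
  qed
  then have pr: "prim T (\<lambda>s. energy (ut s) w) t = (\<Sum>i\<in>Basis. prim T (\<lambda>s. gpair i (ut s) (?g i)) t)" for t
    using ii by (simp add: prim_sum)
  have "AE t in time_measure T. \<forall>i\<in>Basis. gpair i (u t) (?g i) = gpair i z (?g i) + prim T (\<lambda>s. gpair i (ut s) (?g i)) t"
    using gpair_prim[OF T u ut z init L] by (subst AE_finite_all) auto
  then show ?thesis using Lp_bochner_AE[OF u]
  proof eventually_elim
    case (elim t)
    then show ?case
      by (simp add: energy_eq_gpair H10_H1 w z pr sum.distrib)
  qed
qed

end

section \<open>Meshes\<close>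

text \<open>Just below the graph of the Lipschitz function there are points outside the closure of the domain,
  so no boundary point is interior to the closure. A slit domain shows that this can fail for other
  open sets.\<close>
lemma lipschitz_frontier_subset:
  fixes \<Omega> :: "'a::euclidean_space set"
  assumes "lipschitz_domain \<Omega>" shows "frontier \<Omega> \<subseteq> frontier (closure \<Omega>)"
proof
  fix x assume x: "x \<in> frontier \<Omega>"
  have o: "open \<Omega>" using assms by (simp add: lipschitz_domain_def)
  obtain e r L g where e: "norm e = 1" and r: "0 < r" and g: "L-lipschitz_on UNIV g"
    and gr: "\<And>y. y \<in> ball x r \<Longrightarrow> y \<in> \<Omega> \<longleftrightarrow> g (y - (y \<bullet> e) *\<^sub>R e) < y \<bullet> e"
    using assms x unfolding lipschitz_domain_def by blast
  have gc: "continuous_on UNIV g" by (rule lipschitz_on_continuous_on[OF g])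
  have ee: "e \<bullet> e = 1" using e by (simp add: dot_square_norm)
  have "x \<notin> \<Omega>" using x o by (simp add: frontier_def interior_open)
  then have gx: "x \<bullet> e \<le> g (x - (x \<bullet> e) *\<^sub>R e)" using gr[of x] r by simp
  have "x \<notin> interior (closure \<Omega>)"
  proof
    assume "x \<in> interior (closure \<Omega>)"
    then obtain s where s: "0 < s" "ball x s \<subseteq> closure \<Omega>" by (meson mem_interior)
    define q where "q = min s r / 2"
    have q: "0 < q" "q < s" "q < r" using s r by (auto simp: q_def min_def)
    \<comment> \<open>A point strictly below the graph, and close enough to \<open>x\<close> for the local description to apply.\<close>
    define y where "y = x - q *\<^sub>R e"
    have y: "y \<in> ball x s" "y \<in> ball x r" using q e by (auto simp: y_def dist_norm)
    have ye: "y \<bullet> e = x \<bullet> e - q" by (simp add: y_def inner_diff_left ee)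
    have "y - (y \<bullet> e) *\<^sub>R e = x - (x \<bullet> e) *\<^sub>R e" by (simp add: ye) (simp add: y_def algebra_simps)
    then have lt: "y \<bullet> e < g (y - (y \<bullet> e) *\<^sub>R e)" using gx ye q by simp
    define U where "U = ball x r \<inter> {z. z \<bullet> e < g (z - (z \<bullet> e) *\<^sub>R e)}"
    have "open {z. z \<bullet> e < g (z - (z \<bullet> e) *\<^sub>R e)}"
      by (intro open_Collect_less continuous_intros continuous_on_compose2[OF gc]) auto
    then have "open U" by (simp add: U_def open_Int)
    moreover have "y \<in> U" using lt y by (simp add: U_def)
    moreover have "U \<inter> \<Omega> = {}" using gr by (force simp: U_def)
    ultimately have "y \<notin> closure \<Omega>" using open_Int_closure_eq_empty by blast
    then show False using s(2) y(1) by blast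
  qed
  then show "x \<in> frontier (closure \<Omega>)" using x by (simp add: frontier_def)
qed

locale mesh_domain = bounded_domain \<Omega> for \<Omega> :: "'a::euclidean_space set" +
  fixes TH :: "'a set set"
  assumes lipschitz: "lipschitz_domain \<Omega>" and mesh: "rect_mesh \<Omega> TH"
begin

lemma mesh_finite: "finite TH" and mesh_cover: "\<Union>TH = closure \<Omega>"
  using mesh by (auto simp: rect_mesh_def)

lemma mesh_box: assumes "K \<in> TH" obtains l r where "K = cbox l r" "box l r \<noteq> {}"
proof -
  have "\<exists>l r. K = cbox l r \<and> box l r \<noteq> {}" using mesh assms by (simp add: rect_mesh_def)
  then show thesis using that by blast
qed

lemma mesh_disjoint: "K \<in> TH \<Longrightarrow> K' \<in> TH \<Longrightarrow> K \<noteq> K' \<Longrightarrow> interior K \<inter> interior K' = {}"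
  using mesh by (auto simp: rect_mesh_def)

lemma mesh_sub: "K \<in> TH \<Longrightarrow> K \<subseteq> closure \<Omega>" using mesh_cover by blast

lemma mesh_sets: "K \<in> TH \<Longrightarrow> K \<in> sets lebesgue" by (elim mesh_box) simp

lemma mesh_frontier_null: assumes "K \<in> TH" shows "negligible (frontier K)"
  using assms by (elim mesh_box) (simp add: negligible_convex_frontier)

text \<open>The mesh covers the closure of the domain, so the boundary of the domain lies in the union of the
  finitely many boundaries of mesh boxes. Hence integrals over the domain and over its closure agree.\<close>
lemma frontier_null: "negligible (frontier \<Omega>)"
proof -
  have "frontier \<Omega> \<subseteq> frontier (\<Union>TH)" using lipschitz_frontier_subset[OF lipschitz] mesh_cover by simp
  also have "\<dots> \<subseteq> \<Union>(frontier ` TH)" by (rule frontier_Union_subset[OF mesh_finite])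
  finally have "frontier \<Omega> \<subseteq> \<Union>(frontier ` TH)" .
  moreover have "negligible (\<Union>(frontier ` TH))"
    using mesh_finite mesh_frontier_null by (intro negligible_Union) auto
  ultimately show ?thesis using negligible_subset by blast
qed

lemma AE_frontier: "AE x in lebesgue. x \<notin> frontier \<Omega>"
  using frontier_null by (simp add: negligible_iff_null_sets AE_not_in)

lemma AE_domain_iff: assumes "U \<in> sets lebesgue" "U \<subseteq> closure \<Omega>"
  shows "(AE x in lebesgue_on U. P x) \<longleftrightarrow> (AE x in lebesgue_on \<Omega>. x \<in> U \<longrightarrow> P x)"
proof -
  have fr: "x \<in> \<Omega> \<or> x \<in> frontier \<Omega>" if "x \<in> U" for x
    using assms(2) that open_domain by (auto simp: frontier_def interior_open)
  have "(AE x in lebesgue. x \<in> U \<longrightarrow> P x) \<longleftrightarrow> (AE x in lebesgue. x \<in> \<Omega> \<longrightarrow> x \<in> U \<longrightarrow> P x)"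
  proof
    assume "AE x in lebesgue. x \<in> \<Omega> \<longrightarrow> x \<in> U \<longrightarrow> P x"
    then show "AE x in lebesgue. x \<in> U \<longrightarrow> P x"
      using AE_frontier by eventually_elim (use fr in auto)
  qed (auto elim: eventually_mono)
  then show ?thesis using assms(1) domain_lebesgue by (simp add: AE_restrict_space_iff)
qed

lemma integral_restrict_domain:
  fixes f :: "'a \<Rightarrow> real"
  assumes f: "f \<in> borel_measurable (lebesgue_on \<Omega>)" and U: "U \<in> sets lebesgue" "U \<subseteq> closure \<Omega>"
  shows "(LINT x|lebesgue_on U. f x) = (LINT x|lebesgue_on \<Omega>. indicator U x * f x)"
proof -
  have fr: "x \<in> \<Omega> \<or> x \<in> frontier \<Omega>" if "x \<in> U" for x
    using U(2) that open_domain by (auto simp: frontier_def interior_open)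
  have "(\<lambda>x. if x \<in> \<Omega> then f x else 0) \<in> borel_measurable lebesgue"
    using f domain_lebesgue by (simp add: borel_measurable_if)
  moreover have "(\<lambda>x. if x \<in> \<Omega> then f x else 0) = (\<lambda>x. indicator \<Omega> x * f x)"
    by (auto simp: indicator_def)
  ultimately have "(\<lambda>x. indicator \<Omega> x * f x) \<in> borel_measurable lebesgue" by (simp only:)
  from borel_measurable_times[OF borel_measurable_indicator[OF U(1)] this]
  have m: "(\<lambda>x. indicator U x * (indicator \<Omega> x * f x)) \<in> borel_measurable lebesgue" .
  have ae: "AE x in lebesgue. indicator U x * (indicator \<Omega> x * f x) = indicator U x * f x"
    using AE_frontier by eventually_elim (use fr in \<open>auto simp: indicator_def\<close>)
  have m': "(\<lambda>x. indicator U x * f x) \<in> borel_measurable lebesgue"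
    by (rule borel_measurable_AE[OF m ae])
  have "(LINT x|lebesgue_on U. f x) = (LINT x|lebesgue. indicator U x * f x)"
    using U by (simp add: integral_restrict_space)
  also have "\<dots> = (LINT x|lebesgue. indicator U x * (indicator \<Omega> x * f x))"
    using ae by (intro integral_cong_AE m m') (auto elim: eventually_mono)
  also have "\<dots> = (LINT x|lebesgue. indicator \<Omega> x *\<^sub>R (indicator U x * f x))"
    by (simp add: mult.left_commute)
  also have "\<dots> = (LINT x|lebesgue_on \<Omega>. indicator U x * f x)"
    using domain_lebesgue by (simp add: integral_restrict_space)
  finally show ?thesis .
qed

lemma l2norm_sq: "(l2norm U g)\<^sup>2 = (LINT x|lebesgue_on U. (norm (g x))\<^sup>2)"
  by (simp add: l2norm_def)

lemma l2norm_sq_restrict: fixes g :: "'a \<Rightarrow> 'b::euclidean_space"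
  assumes "g \<in> L2 \<Omega>" "U \<in> sets lebesgue" "U \<subseteq> closure \<Omega>"
  shows "(l2norm U g)\<^sup>2 = (LINT x|lebesgue_on \<Omega>. indicator U x * (norm (g x))\<^sup>2)"
proof -
  have "(\<lambda>x. (norm (g x))\<^sup>2) \<in> borel_measurable (lebesgue_on \<Omega>)"
    using L2_measurable[OF assms(1)] by measurable
  then show ?thesis unfolding l2norm_sq by (rule integral_restrict_domain[OF _ assms(2,3)])
qed

lemma L2_integrable_indicator: fixes g :: "'a \<Rightarrow> 'b::euclidean_space"
  assumes "g \<in> L2 \<Omega>" "U \<in> sets lebesgue"
  shows "integrable (lebesgue_on \<Omega>) (\<lambda>x. indicator U x * (norm (g x))\<^sup>2)"
proof (rule Bochner_Integration.integrable_bound)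
  show "integrable (lebesgue_on \<Omega>) (\<lambda>x. (norm (g x))\<^sup>2)" using assms by (simp add: L2_def)
  have [measurable]: "(indicator U :: 'a \<Rightarrow> real) \<in> borel_measurable (lebesgue_on \<Omega>)"
    using assms(2) by (intro measurable_restrict_space1 borel_measurable_indicator)
  show "(\<lambda>x. indicator U x * (norm (g x))\<^sup>2) \<in> borel_measurable (lebesgue_on \<Omega>)"
    using L2_measurable[OF assms(1)] by measurable
qed (auto simp: indicator_def)

lemma AE_mesh_partition: "AE x in lebesgue_on \<Omega>. (\<Sum>K\<in>TH. indicator K x) = (1::real)"
proof -
  have "negligible (\<Union>(frontier ` TH))"
    using mesh_finite mesh_frontier_null by (auto intro: negligible_Union)
  then have "AE x in lebesgue. x \<notin> \<Union>(frontier ` TH)"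
    by (simp only: negligible_iff_null_sets) (rule AE_not_in)
  then have "AE x in lebesgue. x \<in> \<Omega> \<longrightarrow> (\<Sum>K\<in>TH. indicator K x) = (1::real)"
  proof eventually_elim
    case (elim x)
    show ?case
    proof
      assume "x \<in> \<Omega>"
      then obtain K where K: "K \<in> TH" "x \<in> K" using mesh_cover closure_subset by blast
      have xi: "x \<in> interior K'" if "K' \<in> TH" "x \<in> K'" for K'
        using elim that closure_subset[of K'] by (auto simp: frontier_def)
      have "x \<notin> K'" if "K' \<in> TH" "K' \<noteq> K" for K'
        using mesh_disjoint[OF that(1) K(1) that(2)] xi[OF that(1)] xi[OF K] by blast
      then have "(\<Sum>K'\<in>TH. indicator K' x) = (\<Sum>K'\<in>TH. if K' = K then 1 else 0 :: real)"
        using K by (intro sum.cong) (auto simp: indicator_def)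
      then show "(\<Sum>K\<in>TH. indicator K x) = (1::real)" using K mesh_finite by simp
    qed
  qed
  then show ?thesis using domain_lebesgue by (simp add: AE_restrict_space_iff)
qed

lemma l2norm_sq_sum: fixes g :: "'a \<Rightarrow> 'b::euclidean_space"
  assumes g: "g \<in> L2 \<Omega>"
  shows "(l2norm \<Omega> g)\<^sup>2 = (\<Sum>K\<in>TH. (l2norm K g)\<^sup>2)"
proof -
  have i: "integrable (lebesgue_on \<Omega>) (\<lambda>x. indicator K x * (norm (g x))\<^sup>2)" if "K \<in> TH" for K
    by (rule L2_integrable_indicator[OF g mesh_sets[OF that]])
  have "(\<Sum>K\<in>TH. (l2norm K g)\<^sup>2) = (\<Sum>K\<in>TH. LINT x|lebesgue_on \<Omega>. indicator K x * (norm (g x))\<^sup>2)"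
    by (intro sum.cong refl l2norm_sq_restrict g mesh_sets mesh_sub)
  also have "\<dots> = (LINT x|lebesgue_on \<Omega>. (\<Sum>K\<in>TH. indicator K x * (norm (g x))\<^sup>2))"
    by (intro Bochner_Integration.integral_sum[symmetric] i)
  also have "\<dots> = (LINT x|lebesgue_on \<Omega>. (norm (g x))\<^sup>2)"
  proof (rule integral_cong_AE)
    show "(\<lambda>x. \<Sum>K\<in>TH. indicator K x * (norm (g x))\<^sup>2) \<in> borel_measurable (lebesgue_on \<Omega>)"
      by (intro borel_measurable_sum borel_measurable_integrable i)
    show "(\<lambda>x. (norm (g x))\<^sup>2) \<in> borel_measurable (lebesgue_on \<Omega>)"
      using L2_measurable[OF g] by measurable
    show "AE x in lebesgue_on \<Omega>. (\<Sum>K\<in>TH. indicator K x * (norm (g x))\<^sup>2) = (norm (g x))\<^sup>2"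
      using AE_mesh_partition by eventually_elim (simp add: sum_distrib_right[symmetric])
  qed
  finally show ?thesis by (simp add: l2norm_sq)
qed

lemma patch_closed: assumes "K \<in> TH" shows "closed (patch TH m K)" "patch TH m K \<subseteq> closure \<Omega>"
proof -
  have "closed (patch TH m K) \<and> patch TH m K \<subseteq> closure \<Omega>"
  proof (cases m)
    case 0
    then show ?thesis using assms mesh_sub[OF assms] by (auto elim: mesh_box)
  next
    case (Suc k)
    have "closed (\<Union>{K' \<in> TH. K' \<inter> patch TH k K \<noteq> {}})"
      using mesh_finite by (intro closed_Union) (auto elim: mesh_box)
    then show ?thesis using Suc mesh_sub by auto
  qed
  then show "closed (patch TH m K)" "patch TH m K \<subseteq> closure \<Omega>" by auto
qed

lemma patch_sets: "K \<in> TH \<Longrightarrow> patch TH m K \<in> sets lebesgue"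
  using patch_closed(1) by simp

lemma mesh_size_ge: "K \<in> TH \<Longrightarrow> diameter K \<le> mesh_size TH"
  unfolding mesh_size_def using mesh_finite by simp

lemma mesh_nonempty: "TH \<noteq> {}"
  using mesh_cover lipschitz closure_subset by (force simp: lipschitz_domain_def)

lemma mesh_diameter_pos: assumes "K \<in> TH" shows "0 < diameter K"
proof -
  obtain l r where lr: "K = cbox l r" "box l r \<noteq> {}" by (rule mesh_box[OF assms])
  then have "l \<noteq> r" using box_eq_empty(1)[of l r] nonempty_Basis by auto
  moreover have "l \<in> K" "r \<in> K" using lr box_ne_empty(1) less_imp_le by (auto simp: mem_box box_ne_empty)
  moreover have "bounded K" using lr by simp
  ultimately show ?thesis using diameter_bounded_bound[of K l r] by (metis dist_pos_lt less_le_trans)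
qed

lemma mesh_size_pos: "0 < mesh_size TH"
  using mesh_nonempty mesh_diameter_pos mesh_size_ge by (metis ex_in_conv less_le_trans)

text \<open>The neighbours of an element are boxes with disjoint interiors whose edges are at least
  \<open>H / \<sigma>\<^sup>2\<close> long, and they lie in a cube of side length \<open>4 H\<close> around a point of the element. Comparing
  volumes gives the bound.\<close>
lemma mesh_overlap:
  assumes sr: "shape_regular \<sigma> TH" and qu: "quasi_uniform \<sigma> TH" and K0: "K0 \<in> TH"
  shows "real (card {K \<in> TH. K \<inter> K0 \<noteq> {}}) \<le> (4 * \<sigma>\<^sup>2) ^ DIM('a)"
proof -
  define H where "H = mesh_size TH"
  have H: "0 < H" unfolding H_def by (rule mesh_size_pos)
  define A where "A = {K \<in> TH. K \<inter> K0 \<noteq> {}}"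
  have finA: "finite A" and AT: "A \<subseteq> TH" using mesh_finite by (auto simp: A_def)
  have edge: "H / \<sigma>\<^sup>2 \<le> (r - l) \<bullet> i" and sp: "0 < \<sigma>" if "cbox l r \<in> TH" "i \<in> Basis" for l r i
  proof -
    have d: "0 < diameter (cbox l r)" by (rule mesh_diameter_pos[OF that(1)])
    have 1: "H \<le> \<sigma> * diameter (cbox l r)" using qu that(1) by (simp add: quasi_uniform_def H_def)
    then show s: "0 < \<sigma>" using H d mult_nonpos_nonneg[of \<sigma> "diameter (cbox l r)"] by (cases "\<sigma> \<le> 0") auto
    have 2: "diameter (cbox l r) \<le> \<sigma> * ((r - l) \<bullet> i)" using sr that by (simp add: shape_regular_def)
    have "H \<le> \<sigma> * (\<sigma> * ((r - l) \<bullet> i))" using 1 mult_left_mono[OF 2, of \<sigma>] s by linarith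
    then show "H / \<sigma>\<^sup>2 \<le> (r - l) \<bullet> i" using s by (simp add: field_simps power2_eq_square)
  qed
  obtain i0 :: 'a where "i0 \<in> Basis" using nonempty_Basis by blast
  obtain l0 r0 where lr0: "K0 = cbox l0 r0" "box l0 r0 \<noteq> {}" by (rule mesh_box[OF K0])
  have \<sigma>: "0 < \<sigma>" using sp[of l0 r0 i0] K0 lr0(1) \<open>i0 \<in> Basis\<close> by simp
  have "l0 \<in> K0" using lr0 by (auto simp: mem_box box_ne_empty less_imp_le)
  then obtain x0 where x0: "x0 \<in> K0" by blast
  define B where "B = cbox (x0 - (2 * H) *\<^sub>R One) (x0 + (2 * H) *\<^sub>R One)"
  have bdd: "bounded K" if "K \<in> TH" for K using that by (auto elim: mesh_box)
  have sub: "interior K \<subseteq> B" if KA: "K \<in> A" for K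
  proof
    fix y assume "y \<in> interior K"
    then have yK: "y \<in> K" using interior_subset by blast
    obtain z where z: "z \<in> K" "z \<in> K0" using KA by (auto simp: A_def)
    have "dist y z \<le> H" using diameter_bounded_bound[OF bdd yK z(1)] mesh_size_ge[of K] KA by (force simp: A_def H_def)
    moreover have "dist z x0 \<le> H" using diameter_bounded_bound[OF bdd z(2) x0] mesh_size_ge[OF K0] K0 by (auto simp: H_def)
    ultimately have n: "norm (y - x0) \<le> 2 * H" using dist_triangle[of y x0 z] by (simp add: dist_norm)
    have "\<bar>(y - x0) \<bullet> i\<bar> \<le> 2 * H" if "i \<in> Basis" for i using Basis_le_norm[OF that, of "y - x0"] n by linarith
    then have "x0 \<bullet> i - 2 * H \<le> y \<bullet> i \<and> y \<bullet> i \<le> x0 \<bullet> i + 2 * H" if "i \<in> Basis" for i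
      using that by (fastforce simp: inner_diff_left abs_le_iff)
    then show "y \<in> B" by (simp add: B_def mem_box inner_diff_left inner_add_left)
  qed
  have vol: "(H / \<sigma>\<^sup>2) ^ DIM('a) \<le> measure lborel (interior K)" if K: "K \<in> A" for K
  proof -
    obtain l r where lr: "K = cbox l r" "box l r \<noteq> {}" using mesh_box[of K] K AT by blast
    have le: "l \<bullet> i \<le> r \<bullet> i" if "i \<in> Basis" for i using lr(2) that by (auto simp: box_ne_empty less_imp_le)
    have "(H / \<sigma>\<^sup>2) ^ DIM('a) = (\<Prod>i\<in>(Basis::'a set). H / \<sigma>\<^sup>2)" by simp
    also have "\<dots> \<le> (\<Prod>i\<in>Basis. (r - l) \<bullet> i)"
      using H edge[of l r] K AT lr(1) by (intro prod_mono) auto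
    also have "\<dots> = measure lborel (box l r)"
      using le by (simp add: measure_lborel_box_eq inner_diff_left)
    finally show ?thesis using lr(1) by (simp add: interior_cbox)
  qed
  have "real (card A) * (H / \<sigma>\<^sup>2) ^ DIM('a) = (\<Sum>K\<in>A. (H / \<sigma>\<^sup>2) ^ DIM('a))" by simp
  also have "\<dots> \<le> (\<Sum>K\<in>A. measure lborel (interior K))" by (intro sum_mono vol)
  also have "\<dots> = measure lborel (\<Union>K\<in>A. interior K)"
  proof (rule measure_finite_Union[symmetric, OF finA])
    show "disjoint_family_on interior A"
      unfolding disjoint_family_on_def using mesh_disjoint AT by (meson subsetD)
    show "emeasure lborel (interior K) \<noteq> \<infinity>" if "K \<in> A" for K
      using emeasure_bounded_finite[OF bounded_subset[OF bdd interior_subset], of K] that AT by auto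
  qed auto
  also have "\<dots> \<le> measure lborel B"
  proof (rule measure_mono_fmeasurable)
    show "(\<Union>K\<in>A. interior K) \<subseteq> B" using sub by blast
    show "(\<Union>K\<in>A. interior K) \<in> sets lborel" by (simp add: borel_open open_UN)
  qed (simp add: B_def)
  also have "measure lborel B = (4 * H) ^ DIM('a)"
    using H by (simp add: B_def measure_lborel_cbox_eq inner_diff_left inner_add_left)
  finally have "real (card A) * (H / \<sigma>\<^sup>2) ^ DIM('a) \<le> (4 * H) ^ DIM('a)" .
  then have "real (card A) \<le> (4 * H) ^ DIM('a) / (H / \<sigma>\<^sup>2) ^ DIM('a)"
    using H \<sigma> by (simp add: pos_le_divide_eq)
  also have "\<dots> = (4 * \<sigma>\<^sup>2) ^ DIM('a)"
    unfolding power_divide[symmetric] using H \<sigma> by (intro arg_cong[where f="\<lambda>x. x ^ DIM('a)"]) simp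
  finally show ?thesis by (simp add: A_def)
qed

lemma patch_sum_bound: fixes g :: "'a \<Rightarrow> 'b::euclidean_space"
  assumes sr: "shape_regular \<sigma> TH" and qu: "quasi_uniform \<sigma> TH" and g: "g \<in> L2 \<Omega>"
  shows "(\<Sum>K\<in>TH. (l2norm (patch TH 1 K) g)\<^sup>2) \<le> (4 * \<sigma>\<^sup>2) ^ DIM('a) * (l2norm \<Omega> g)\<^sup>2"
proof -
  have p: "(l2norm (patch TH 1 K) g)\<^sup>2 \<le> (\<Sum>K'\<in>TH. if K' \<inter> K \<noteq> {} then (l2norm K' g)\<^sup>2 else 0)" if K: "K \<in> TH" for K
  proof -
    let ?N = "{K' \<in> TH. K' \<inter> K \<noteq> {}}"
    have i: "integrable (lebesgue_on \<Omega>) (\<lambda>x. indicator K' x * (norm (g x))\<^sup>2)" if "K' \<in> TH" for K'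
      by (rule L2_integrable_indicator[OF g mesh_sets[OF that]])
    have "(l2norm (patch TH 1 K) g)\<^sup>2 = (LINT x|lebesgue_on \<Omega>. indicator (patch TH 1 K) x * (norm (g x))\<^sup>2)"
      by (intro l2norm_sq_restrict g patch_sets patch_closed K)
    also have "\<dots> \<le> (LINT x|lebesgue_on \<Omega>. (\<Sum>K'\<in>?N. indicator K' x * (norm (g x))\<^sup>2))"
    proof (rule integral_mono)
      show "integrable (lebesgue_on \<Omega>) (\<lambda>x. indicator (patch TH 1 K) x * (norm (g x))\<^sup>2)"
        by (rule L2_integrable_indicator[OF g patch_sets[OF K]])
      show "integrable (lebesgue_on \<Omega>) (\<lambda>x. \<Sum>K'\<in>?N. indicator K' x * (norm (g x))\<^sup>2)"
        using i by (intro Bochner_Integration.integrable_sum) auto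
      fix x
      have "indicator (patch TH 1 K) x \<le> (\<Sum>K'\<in>?N. indicator K' x :: real)"
      proof (cases "x \<in> patch TH 1 K")
        case True
        then obtain K' where K': "K' \<in> ?N" "x \<in> K'" by auto
        have "indicator K' x \<le> (\<Sum>K'\<in>?N. indicator K' x :: real)"
          using mesh_finite K'(1) by (intro member_le_sum) auto
        then show ?thesis using K'(2) by (simp add: indicator_def)
      qed (simp add: sum_nonneg)
      then show "indicator (patch TH 1 K) x * (norm (g x))\<^sup>2 \<le> (\<Sum>K'\<in>?N. indicator K' x * (norm (g x))\<^sup>2)"
        by (simp add: mult_right_mono flip: sum_distrib_right)
    qed
    also have "\<dots> = (\<Sum>K'\<in>?N. LINT x|lebesgue_on \<Omega>. indicator K' x * (norm (g x))\<^sup>2)"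
      using i by (intro Bochner_Integration.integral_sum) auto
    also have "\<dots> = (\<Sum>K'\<in>?N. (l2norm K' g)\<^sup>2)"
      by (intro sum.cong refl l2norm_sq_restrict[symmetric] g mesh_sets mesh_sub) auto
    also have "\<dots> = (\<Sum>K'\<in>TH. if K' \<inter> K \<noteq> {} then (l2norm K' g)\<^sup>2 else 0)"
      using mesh_finite by (simp add: sum.inter_filter)
    finally show ?thesis .
  qed
  have "(\<Sum>K\<in>TH. (l2norm (patch TH 1 K) g)\<^sup>2)
      \<le> (\<Sum>K\<in>TH. \<Sum>K'\<in>TH. if K' \<inter> K \<noteq> {} then (l2norm K' g)\<^sup>2 else 0)"
    by (intro sum_mono p)
  also have "\<dots> = (\<Sum>K'\<in>TH. \<Sum>K\<in>TH. if K \<inter> K' \<noteq> {} then (l2norm K' g)\<^sup>2 else 0)"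
    by (subst sum.swap) (simp add: Int_commute)
  also have "\<dots> = (\<Sum>K'\<in>TH. real (card {K \<in> TH. K \<inter> K' \<noteq> {}}) * (l2norm K' g)\<^sup>2)"
    using mesh_finite by (simp add: sum.inter_filter[symmetric])
  also have "\<dots> \<le> (\<Sum>K'\<in>TH. (4 * \<sigma>\<^sup>2) ^ DIM('a) * (l2norm K' g)\<^sup>2)"
    by (intro sum_mono mult_right_mono mesh_overlap[OF sr qu]) auto
  also have "\<dots> = (4 * \<sigma>\<^sup>2) ^ DIM('a) * (l2norm \<Omega> g)\<^sup>2"
    by (simp add: l2norm_sq_sum[OF g] sum_distrib_left)
  finally show ?thesis .
qed

text \<open>Sum the squares over all elements; in the sum over the patches each element is counted once for
  every neighbour.\<close>
lemma local_to_global: fixes f :: "'a \<Rightarrow> 'b::euclidean_space" and g :: "'a \<Rightarrow> 'c::euclidean_space"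
  assumes sr: "shape_regular \<sigma> TH" and qu: "quasi_uniform \<sigma> TH" and f: "f \<in> L2 \<Omega>" and g: "g \<in> L2 \<Omega>"
    and le: "\<And>K. K \<in> TH \<Longrightarrow> l2norm K f \<le> c * l2norm (patch TH 1 K) g"
  shows "l2norm \<Omega> f \<le> \<bar>c\<bar> * sqrt ((4 * \<sigma>\<^sup>2) ^ DIM('a)) * l2norm \<Omega> g"
proof (rule power2_le_imp_le)
  have "(l2norm \<Omega> f)\<^sup>2 = (\<Sum>K\<in>TH. (l2norm K f)\<^sup>2)" by (rule l2norm_sq_sum[OF f])
  also have "\<dots> \<le> (\<Sum>K\<in>TH. c\<^sup>2 * (l2norm (patch TH 1 K) g)\<^sup>2)"
    using le by (intro sum_mono) (simp add: power_mono flip: power_mult_distrib)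
  also have "\<dots> = c\<^sup>2 * (\<Sum>K\<in>TH. (l2norm (patch TH 1 K) g)\<^sup>2)" by (simp add: sum_distrib_left)
  also have "\<dots> \<le> c\<^sup>2 * ((4 * \<sigma>\<^sup>2) ^ DIM('a) * (l2norm \<Omega> g)\<^sup>2)"
    by (intro mult_left_mono patch_sum_bound[OF sr qu g]) auto
  also have "\<dots> = (\<bar>c\<bar> * sqrt ((4 * \<sigma>\<^sup>2) ^ DIM('a)) * l2norm \<Omega> g)\<^sup>2"
    by (simp add: power_mult_distrib)
  finally show "(l2norm \<Omega> f)\<^sup>2 \<le> (\<bar>c\<bar> * sqrt ((4 * \<sigma>\<^sup>2) ^ DIM('a)) * l2norm \<Omega> g)\<^sup>2" .
qed auto

end

section \<open>Finite element spaces and the multiscale space\<close>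

lemma Q1_poly_add: assumes "Q1_poly p" "Q1_poly q" shows "Q1_poly (\<lambda>x. p x + q x)"
proof -
  obtain c d where "\<And>x. p x = (\<Sum>S\<in>Pow Basis. c S * (\<Prod>i\<in>S. x \<bullet> i))"
    "\<And>x. q x = (\<Sum>S\<in>Pow Basis. d S * (\<Prod>i\<in>S. x \<bullet> i))"
    using assms unfolding Q1_poly_def by metis
  then show ?thesis unfolding Q1_poly_def
    by (intro exI[of _ "\<lambda>S. c S + d S"]) (simp add: sum.distrib distrib_right)
qed

lemma Q1_poly_scale: assumes "Q1_poly p" shows "Q1_poly (\<lambda>x. k * p x)"
proof -
  obtain c where "\<And>x. p x = (\<Sum>S\<in>Pow Basis. c S * (\<Prod>i\<in>S. x \<bullet> i))"
    using assms unfolding Q1_poly_def by metis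
  then show ?thesis unfolding Q1_poly_def
    by (intro exI[of _ "\<lambda>S. k * c S"]) (simp add: sum_distrib_left mult.assoc)
qed

lemma Q1_add: assumes "v \<in> Q1 \<T>" "w \<in> Q1 \<T>" shows "(\<lambda>x. v x + w x) \<in> Q1 \<T>"
  unfolding Q1_def
proof (rule CollectI, rule ballI)
  fix K assume "K \<in> \<T>"
  then obtain p q where "Q1_poly p" "AE x in lebesgue_on K. v x = p x" "Q1_poly q" "AE x in lebesgue_on K. w x = q x"
    using assms unfolding Q1_def by blast
  then show "\<exists>q. Q1_poly q \<and> (AE x in lebesgue_on K. v x + w x = q x)"
    by (intro exI[of _ "\<lambda>x. p x + q x"]) (auto intro: Q1_poly_add elim: eventually_elim2)
qed

lemma Q1_scale: assumes "v \<in> Q1 \<T>" shows "(\<lambda>x. k * v x) \<in> Q1 \<T>"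
  unfolding Q1_def
proof (rule CollectI, rule ballI)
  fix K assume "K \<in> \<T>"
  then obtain p where "Q1_poly p" "AE x in lebesgue_on K. v x = p x"
    using assms unfolding Q1_def by blast
  then show "\<exists>q. Q1_poly q \<and> (AE x in lebesgue_on K. k * v x = q x)"
    by (intro exI[of _ "\<lambda>x. k * p x"]) (auto intro: Q1_poly_scale elim: eventually_mono)
qed

lemma Q1_refines: assumes "mesh_refines \<T>' \<T>" "\<And>K. K \<in> \<T> \<Longrightarrow> K \<in> sets lebesgue" "\<And>K. K \<in> \<T>' \<Longrightarrow> K \<in> sets lebesgue"
  shows "Q1 \<T> \<subseteq> Q1 \<T>'"
proof
  fix v assume v: "v \<in> Q1 \<T>"
  show "v \<in> Q1 \<T>'" unfolding Q1_def
  proof (rule CollectI, rule ballI)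
    fix K' assume K': "K' \<in> \<T>'"
    then obtain K where K: "K \<in> \<T>" "K' \<subseteq> K" using assms(1) unfolding mesh_refines_def by blast
    then obtain q where q: "Q1_poly q" "AE x in lebesgue_on K. v x = q x" using v unfolding Q1_def by blast
    have "AE x in lebesgue_on K'. v x = q x"
      using q(2) assms(2)[OF K(1)] assms(3)[OF K'] K(2)
      by (auto simp: AE_restrict_space_iff elim!: eventually_mono)
    then show "\<exists>q. Q1_poly q \<and> (AE x in lebesgue_on K'. v x = q x)" using q(1) by blast
  qed
qed

context mesh_domain
begin

lemma fe_H10: "v \<in> fe_space \<Omega> TH \<Longrightarrow> v \<in> H10 \<Omega>" by (simp add: fe_space_def)

lemma fe_add: "v \<in> fe_space \<Omega> TH \<Longrightarrow> w \<in> fe_space \<Omega> TH \<Longrightarrow> (\<lambda>x. v x + w x) \<in> fe_space \<Omega> TH"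
  by (auto simp: fe_space_def Q1_add H10_add)

lemma fe_scale: "v \<in> fe_space \<Omega> TH \<Longrightarrow> (\<lambda>x. k * v x) \<in> fe_space \<Omega> TH"
  by (auto simp: fe_space_def Q1_scale H10_scale)

lemma fe_diff: "v \<in> fe_space \<Omega> TH \<Longrightarrow> w \<in> fe_space \<Omega> TH \<Longrightarrow> (\<lambda>x. v x - w x) \<in> fe_space \<Omega> TH"
  using fe_add[of v "\<lambda>x. -1 * w x"] fe_scale[of w "-1"] by simp

lemma fe_zero: "(\<lambda>x. 0) \<in> fe_space \<Omega> TH"
proof -
  have "Q1_poly (\<lambda>x::'a. 0)" unfolding Q1_poly_def by (intro exI[of _ "\<lambda>_. 0"]) simp
  then show ?thesis by (auto simp: fe_space_def Q1_def H10_zero intro!: exI[of _ "\<lambda>_. 0"])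
qed

lemma fe_sum: "(\<And>i. i \<in> I \<Longrightarrow> e i \<in> fe_space \<Omega> TH) \<Longrightarrow> (\<lambda>x. \<Sum>i\<in>I. e i x) \<in> fe_space \<Omega> TH"
  by (induction I rule: infinite_finite_induct) (auto simp: fe_zero fe_add)

lemma fe_cong: assumes v: "v \<in> fe_space \<Omega> TH" and eq: "AE x in lebesgue_on \<Omega>. v' x = v x"
  shows "v' \<in> fe_space \<Omega> TH"
proof -
  have "\<exists>q. Q1_poly q \<and> (AE x in lebesgue_on K. v' x = q x)" if K: "K \<in> TH" for K
  proof -
    obtain q where q: "Q1_poly q" "AE x in lebesgue_on K. v x = q x"
      using v K unfolding fe_space_def Q1_def by blast
    have "AE x in lebesgue_on K. v' x = v x"
      using eq by (subst AE_domain_iff[OF mesh_sets[OF K] mesh_sub[OF K]]) (auto elim: eventually_mono)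
    with q(2) have "AE x in lebesgue_on K. v' x = q x" by eventually_elim simp
    then show ?thesis using q(1) by blast
  qed
  then show ?thesis using v H10_cong[OF _ eq] by (auto simp: fe_space_def Q1_def)
qed

end

locale poincare_mesh = energy_form \<Omega> a amin amax + mesh_domain \<Omega> Th
  for \<Omega> :: "'a::euclidean_space set" and a amin amax Th +
  fixes CP :: real
  assumes poincare: "poincare \<Omega> a CP"
begin

lemma l2norm_le_enorm: "v \<in> H10 \<Omega> \<Longrightarrow> l2norm \<Omega> v \<le> \<bar>CP\<bar> * enorm v"
  using poincare unfolding poincare_def
  by (meson abs_ge_self l2norm_nonneg mult_right_mono order_trans)

lemma enorm_zero_imp: assumes "v \<in> H10 \<Omega>" "enorm v = 0"
  shows "l2norm \<Omega> v = 0" "AE x in lebesgue_on \<Omega>. v x = 0"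
proof -
  show *: "l2norm \<Omega> v = 0" using l2norm_le_enorm[OF assms(1)] assms(2) by (simp add: order_antisym)
  show "AE x in lebesgue_on \<Omega>. v x = 0" using l2norm_zero_iff[OF H10_L2[OF assms(1)]] * by simp
qed

text \<open>Elements of the space are determined by finitely many polynomial coefficients, one for each
  element and multilinear monomial.\<close>
lemma fe_subspace_basis:
  assumes "V \<subseteq> fe_space \<Omega> Th" "\<And>v w. v \<in> V \<Longrightarrow> w \<in> V \<Longrightarrow> (\<lambda>x. v x + w x) \<in> V"
    "\<And>v k. v \<in> V \<Longrightarrow> (\<lambda>x. k * v x) \<in> V"
  shows "\<exists>n e. E.spans V n e"
proof -
  define mono where "mono S x = (\<Prod>i\<in>S. x \<bullet> i)" for S :: "'a set" and x :: 'a
  define R where "R v c \<longleftrightarrow> (\<forall>K\<in>Th. AE x in lebesgue_on K. v x = (\<Sum>S\<in>Pow Basis. c (K, S) * mono S x))"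
    for v :: "'a \<Rightarrow> real" and c :: "'a set \<times> 'a set \<Rightarrow> real"
  show ?thesis
  proof (rule E.finite_orthonormal_basis[where R=R and J="Th \<times> Pow Basis"])
    show "finite (Th \<times> Pow (Basis::'a set))" using mesh_finite by simp
    show "V \<subseteq> H10 \<Omega>" using assms(1) fe_H10 by blast
    show "\<exists>c. R v c" if v: "v \<in> V" for v
    proof -
      have "\<forall>K\<in>Th. \<exists>c. AE x in lebesgue_on K. v x = (\<Sum>S\<in>Pow Basis. c S * mono S x)"
      proof
        fix K assume "K \<in> Th"
        then obtain q where q: "Q1_poly q" "AE x in lebesgue_on K. v x = q x"
          using v assms(1) unfolding fe_space_def Q1_def by blast
        then obtain c where "\<forall>x. q x = (\<Sum>S\<in>Pow Basis. c S * mono S x)" unfolding Q1_poly_def mono_def by blast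
        then show "\<exists>c. AE x in lebesgue_on K. v x = (\<Sum>S\<in>Pow Basis. c S * mono S x)" using q(2) by auto
      qed
      from bchoice[OF this] obtain c where
        "\<forall>K\<in>Th. AE x in lebesgue_on K. v x = (\<Sum>S\<in>Pow Basis. c K S * mono S x)" by blast
      then show ?thesis unfolding R_def by (intro exI[of _ "\<lambda>(K, S). c K S"]) simp
    qed
    show "R (\<lambda>x. v x + w x) (\<lambda>j. c j + d j)" if "R v c" "R w d" for v w c d
      unfolding R_def
    proof
      fix K assume "K \<in> Th"
      then have "AE x in lebesgue_on K. v x = (\<Sum>S\<in>Pow Basis. c (K, S) * mono S x)"
        "AE x in lebesgue_on K. w x = (\<Sum>S\<in>Pow Basis. d (K, S) * mono S x)" using that by (auto simp: R_def)
      then show "AE x in lebesgue_on K. v x + w x = (\<Sum>S\<in>Pow Basis. (c (K, S) + d (K, S)) * mono S x)"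
        by eventually_elim (simp add: sum.distrib distrib_right)
    qed
    show "R (\<lambda>x. k *\<^sub>R v x) (\<lambda>j. k * c j)" if "R v c" for v c k
      unfolding R_def
    proof
      fix K assume "K \<in> Th"
      then have "AE x in lebesgue_on K. v x = (\<Sum>S\<in>Pow Basis. c (K, S) * mono S x)" using that by (auto simp: R_def)
      then show "AE x in lebesgue_on K. k *\<^sub>R v x = (\<Sum>S\<in>Pow Basis. (k * c (K, S)) * mono S x)"
        by eventually_elim (simp add: sum_distrib_left mult.assoc)
    qed
    show "E.nrm v = 0" if v: "v \<in> V" "R v c" "\<forall>j\<in>Th \<times> Pow Basis. c j = 0" for v c
    proof -
      have "AE x in lebesgue_on \<Omega>. \<forall>K\<in>Th. x \<in> K \<longrightarrow> v x = 0"
      proof (subst AE_finite_all[OF mesh_finite], rule ballI)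
        fix K assume K: "K \<in> Th"
        then have "AE x in lebesgue_on K. v x = (\<Sum>S\<in>Pow Basis. c (K, S) * mono S x)" using v(2) by (simp add: R_def)
        moreover have "(\<Sum>S\<in>Pow Basis. c (K, S) * mono S x) = 0" for x using v(3) K by (intro sum.neutral) auto
        ultimately have "AE x in lebesgue_on K. v x = 0" by simp
        then show "AE x in lebesgue_on \<Omega>. x \<in> K \<longrightarrow> v x = 0"
          using AE_domain_iff[OF mesh_sets[OF K] mesh_sub[OF K]] by simp
      qed
      then have "AE x in lebesgue_on \<Omega>. v x = 0"
        using AE_space
      proof eventually_elim
        case (elim x)
        then show ?case using mesh_cover closure_subset[of \<Omega>] by auto
      qed
      then have "enorm v = enorm (\<lambda>x. 0)" by (intro enorm_cong H1_zero)
      then show ?thesis using E.nrm_scale[OF H10_zero, of 0] by (simp add: enorm_eq_nrm)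
    qed
  qed (use assms in auto)
qed

end

text \<open>The number \<open>\<mu>\<close> measures the relative localization error; it is \<open>m\<^bsup>d/2\<^esup> \<gamma>\<^sup>m\<close> in the end.\<close>
locale lod_setting = energy_form \<Omega> a amin amax + coarse: mesh_domain \<Omega> TH + poincare_mesh \<Omega> a amin amax Th CP
  for \<Omega> :: "'a::euclidean_space set" and a amin amax TH Th CP +
  fixes \<sigma> CI Cloc \<mu> :: real and IH \<C> :: "('a \<Rightarrow> real) \<Rightarrow> 'a \<Rightarrow> real" and \<C>K :: "'a set \<Rightarrow> ('a \<Rightarrow> real) \<Rightarrow> 'a \<Rightarrow> real"
    and m :: nat and \<pi>h :: "('a \<Rightarrow> real) \<Rightarrow> 'a \<Rightarrow> real"
  assumes shape: "shape_regular \<sigma> TH" and quasi: "quasi_uniform \<sigma> TH" and refines: "mesh_refines Th TH"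
    and projection: "stable_projection \<Omega> a TH Th CI IH"
    and corrector: "is_corrector \<Omega> a TH Th IH \<C>"
    and element_corrector: "is_element_corrector \<Omega> a TH Th IH m \<C>K"
    and localization: "\<And>v. v \<in> fe_space \<Omega> TH \<Longrightarrow>
      l2norm \<Omega> (sgrad \<Omega> a (\<lambda>x. local_corrector TH \<C>K v x - \<C> v x)) \<le> Cloc * \<mu> * l2norm \<Omega> (sgrad \<Omega> a v)"
    and mu_nonneg: "0 \<le> \<mu>"
    and ritz_h: "\<And>v. v \<in> H10 \<Omega> \<Longrightarrow> ritz_proj \<Omega> a (fe_space \<Omega> Th) v (\<pi>h v)"
begin

abbreviation "VH \<equiv> fe_space \<Omega> TH"
abbreviation "Vh \<equiv> fe_space \<Omega> Th"
abbreviation "W \<equiv> kernel_space \<Omega> Th IH"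
abbreviation "V \<equiv> lod_space \<Omega> TH \<C>K"

lemma VH_Vh: "VH \<subseteq> Vh"
  using Q1_refines[OF refines coarse.mesh_sets mesh_sets] by (auto simp: fe_space_def)

lemma IH_mem: "v \<in> H10 \<Omega> \<Longrightarrow> IH v \<in> VH"
  and IH_add: "v \<in> H10 \<Omega> \<Longrightarrow> w \<in> H10 \<Omega> \<Longrightarrow> AE x in lebesgue_on \<Omega>. IH (\<lambda>x. v x + w x) x = IH v x + IH w x"
  and IH_scale: "v \<in> H10 \<Omega> \<Longrightarrow> AE x in lebesgue_on \<Omega>. IH (\<lambda>x. c * v x) x = c * IH v x"
  and IH_idem: "v \<in> H10 \<Omega> \<Longrightarrow> AE x in lebesgue_on \<Omega>. IH (IH v) x = IH v x"
  and IH_stable: "v \<in> H10 \<Omega> \<Longrightarrow> K \<in> TH \<Longrightarrow> l2norm K (sgrad \<Omega> a (IH v)) \<le> CI * l2norm (patch TH 1 K) (sgrad \<Omega> a v)"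
  and W_stable: "w \<in> W \<Longrightarrow> K \<in> TH \<Longrightarrow>
     l2norm K (\<lambda>x. sqrt (a x) * w x) \<le> CI * mesh_size TH * l2norm (patch TH 1 K) (sgrad \<Omega> a w)"
  using projection unfolding stable_projection_def by blast+

lemma IH_diff: assumes v: "v \<in> H10 \<Omega>" and w: "w \<in> H10 \<Omega>"
  shows "AE x in lebesgue_on \<Omega>. IH (\<lambda>x. v x - w x) x = IH v x - IH w x"
  using IH_add[OF v H10_scale[OF w, of "-1"]] IH_scale[OF w, of "-1"] by eventually_elim simp

lemma W_Vh: "w \<in> W \<Longrightarrow> w \<in> Vh" and W_IH: "w \<in> W \<Longrightarrow> AE x in lebesgue_on \<Omega>. IH w x = 0"
  by (auto simp: kernel_space_def)

lemma W_H10: "w \<in> W \<Longrightarrow> w \<in> H10 \<Omega>" by (intro fe_H10 W_Vh)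

lemma W_add: assumes "v \<in> W" "w \<in> W" shows "(\<lambda>x. v x + w x) \<in> W"
proof -
  have "AE x in lebesgue_on \<Omega>. IH (\<lambda>x. v x + w x) x = 0"
    using IH_add[OF W_H10[OF assms(1)] W_H10[OF assms(2)]] W_IH[OF assms(1)] W_IH[OF assms(2)]
    by eventually_elim simp
  then show ?thesis using fe_add[OF W_Vh[OF assms(1)] W_Vh[OF assms(2)]] by (simp add: kernel_space_def)
qed

lemma W_scale: assumes "v \<in> W" shows "(\<lambda>x. k * v x) \<in> W"
proof -
  have "AE x in lebesgue_on \<Omega>. IH (\<lambda>x. k * v x) x = 0"
    using IH_scale[OF W_H10[OF assms(1)]] W_IH[OF assms(1)] by eventually_elim simp
  then show ?thesis using fe_scale[OF W_Vh[OF assms(1)]] by (simp add: kernel_space_def)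
qed

lemma bform_restrict: assumes "v \<in> H1 \<Omega>" "w \<in> H1 \<Omega>" "U \<in> sets lebesgue" "U \<subseteq> closure \<Omega>"
  shows "bform \<Omega> a U v w = vip \<Omega> (wgrad \<Omega> v) (\<lambda>x. indicator U x *\<^sub>R (a x *\<^sub>R wgrad \<Omega> w x))"
proof -
  have m: "(\<lambda>x. a x * (wgrad \<Omega> v x \<bullet> wgrad \<Omega> w x)) \<in> borel_measurable (lebesgue_on \<Omega>)"
    using a_measurable L2_measurable[OF H1_wgrad_L2[OF assms(1)]] L2_measurable[OF H1_wgrad_L2[OF assms(2)]]
    by measurable
  show ?thesis unfolding bform_def vip_def
    by (subst coarse.integral_restrict_domain[OF m assms(3,4)]) (simp add: mult_ac)
qed

lemma restricted_weighted_L2: assumes "w \<in> H1 \<Omega>" "U \<in> sets lebesgue"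
  shows "(\<lambda>x. indicator U x *\<^sub>R (a x *\<^sub>R wgrad \<Omega> w x)) \<in> L2 \<Omega>"
  by (rule L2_mult_bounded[OF weighted_wgrad_L2[OF assms(1)], where B=1])
    (use assms(2) in \<open>auto simp: indicator_def intro!: measurable_restrict_space1 borel_measurable_indicator\<close>)

lemma bform_add: assumes "u \<in> H1 \<Omega>" "v \<in> H1 \<Omega>" "w \<in> H1 \<Omega>" "U \<in> sets lebesgue" "U \<subseteq> closure \<Omega>"
  shows "bform \<Omega> a U (\<lambda>x. u x + v x) w = bform \<Omega> a U u w + bform \<Omega> a U v w"
  by (simp add: bform_restrict assms H1_add vip_wgrad_add restricted_weighted_L2 del: scaleR_scaleR)

lemma bform_scale: assumes "v \<in> H1 \<Omega>" "w \<in> H1 \<Omega>" "U \<in> sets lebesgue" "U \<subseteq> closure \<Omega>"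
  shows "bform \<Omega> a U (\<lambda>x. k * v x) w = k * bform \<Omega> a U v w"
  by (simp add: bform_restrict assms H1_scale vip_wgrad_scale restricted_weighted_L2 del: scaleR_scaleR)

text \<open>A function that vanishes outside the closed set \<open>U\<close> has zero gradient there, so restricting the
  integral to \<open>U\<close> loses nothing.\<close>
lemma bform_local: assumes e: "e \<in> H1 \<Omega>" and U: "closed U" "U \<subseteq> closure \<Omega>"
    and z: "AE x in lebesgue_on (\<Omega> - U). e x = 0"
  shows "bform \<Omega> a U e e = energy e e"
proof -
  have Ul: "U \<in> sets lebesgue" using U(1) by simp
  have o: "open (\<Omega> - U)" using open_domain U(1) by (rule open_Diff)
  have "AE x in lebesgue_on (\<Omega> - U). wgrad \<Omega> e x = 0" by (rule wgrad_zero_on_open[OF e o _ z]) auto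
  then have "AE x in lebesgue_on \<Omega>. x \<notin> U \<longrightarrow> wgrad \<Omega> e x = 0"
    using o domain_lebesgue by (auto simp: AE_restrict_space_iff elim!: eventually_mono)
  then have "AE x in lebesgue_on \<Omega>. indicator U x *\<^sub>R (a x *\<^sub>R wgrad \<Omega> e x) = a x *\<^sub>R wgrad \<Omega> e x"
    by eventually_elim (auto simp: indicator_def)
  then show ?thesis
    unfolding bform_restrict[OF e e Ul U(2)] energy_eq_vip_weighted
    by (intro vip_cong H1_wgrad_L2 e restricted_weighted_L2 weighted_wgrad_L2 Ul) auto
qed

context
  fixes K assumes K: "K \<in> TH"
begin

lemma element_corrector_mem: assumes "v \<in> VH"
  shows "\<C>K K v \<in> W" "AE x in lebesgue_on (\<Omega> - patch TH m K). \<C>K K v x = 0"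
  using element_corrector K assms unfolding is_element_corrector_def local_kernel_space_def by blast+

lemma element_corrector_eq: assumes "v \<in> VH" "w \<in> W" "AE x in lebesgue_on (\<Omega> - patch TH m K). w x = 0"
  shows "bform \<Omega> a (patch TH m K) (\<C>K K v) w = - bform \<Omega> a K v w"
  using element_corrector K assms unfolding is_element_corrector_def local_kernel_space_def by blast

text \<open>On functions supported in the patch the local form is the energy form, which is definite by the
  Poincare inequality. Uniqueness makes the element correctors linear, which is not part of their
  definition, and hence makes the multiscale space a vector space.\<close>
lemma element_corrector_unique:
  assumes e: "e \<in> W" "AE x in lebesgue_on (\<Omega> - patch TH m K). e x = 0"
    and z: "bform \<Omega> a (patch TH m K) e e = 0"
  shows "AE x in lebesgue_on \<Omega>. e x = 0"
proof -
  have "energy e e = 0"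
    using bform_local[OF H10_H1[OF W_H10[OF e(1)]] coarse.patch_closed[OF K] e(2)] z by simp
  then show ?thesis using enorm_zero_imp(2)[OF W_H10[OF e(1)]] by (simp add: enorm_eq)
qed

lemma element_corrector_add: assumes v: "v \<in> VH" and w: "w \<in> VH"
  shows "AE x in lebesgue_on \<Omega>. \<C>K K (\<lambda>x. v x + w x) x = \<C>K K v x + \<C>K K w x"
proof -
  let ?U = "patch TH m K"
  note U = coarse.patch_sets[OF K, of m] coarse.patch_closed(2)[OF K, of m]
  note K' = coarse.mesh_sets[OF K] coarse.mesh_sub[OF K]
  have vw: "(\<lambda>x. v x + w x) \<in> VH" by (rule coarse.fe_add[OF v w])
  note c = element_corrector_mem[OF v] element_corrector_mem[OF w] element_corrector_mem[OF vw]
  define e where "e = (\<lambda>x. \<C>K K (\<lambda>x. v x + w x) x + (-1) * (\<C>K K v x + \<C>K K w x))"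
  have s: "(\<lambda>x. \<C>K K v x + \<C>K K w x) \<in> W" by (rule W_add[OF c(1,3)])
  have eW: "e \<in> W" unfolding e_def by (intro W_add W_scale c)
  have e0: "AE x in lebesgue_on (\<Omega> - ?U). e x = 0"
    using c(2,4,6) by eventually_elim (simp add: e_def)
  note H = H10_H1[OF W_H10]
  have "bform \<Omega> a ?U e e = bform \<Omega> a ?U (\<C>K K (\<lambda>x. v x + w x)) e
      + (-1) * (bform \<Omega> a ?U (\<C>K K v) e + bform \<Omega> a ?U (\<C>K K w) e)"
    by (subst (1) e_def) (simp only: bform_add[OF H[OF c(5)] H1_scale[OF H[OF s]] H[OF eW] U]
        bform_scale[OF H[OF s] H[OF eW] U] bform_add[OF H[OF c(1)] H[OF c(3)] H[OF eW] U])
  also have "\<dots> = 0"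
    using bform_add[OF H10_H1[OF coarse.fe_H10[OF v]] H10_H1[OF coarse.fe_H10[OF w]] H[OF eW] K']
    by (simp add: element_corrector_eq[OF _ eW e0] v w vw)
  finally have "AE x in lebesgue_on \<Omega>. e x = 0" by (rule element_corrector_unique[OF eW e0])
  then show ?thesis by eventually_elim (simp add: e_def)
qed

lemma element_corrector_scale: assumes v: "v \<in> VH"
  shows "AE x in lebesgue_on \<Omega>. \<C>K K (\<lambda>x. k * v x) x = k * \<C>K K v x"
proof -
  let ?U = "patch TH m K"
  note U = coarse.patch_sets[OF K, of m] coarse.patch_closed(2)[OF K, of m]
  note K' = coarse.mesh_sets[OF K] coarse.mesh_sub[OF K]
  have kv: "(\<lambda>x. k * v x) \<in> VH" by (rule coarse.fe_scale[OF v])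
  note c = element_corrector_mem[OF v] element_corrector_mem[OF kv]
  define e where "e = (\<lambda>x. \<C>K K (\<lambda>x. k * v x) x + (- k) * \<C>K K v x)"
  have eW: "e \<in> W" unfolding e_def by (intro W_add W_scale c)
  have e0: "AE x in lebesgue_on (\<Omega> - ?U). e x = 0"
    using c(2,4) by eventually_elim (simp add: e_def)
  note H = H10_H1[OF W_H10]
  have "bform \<Omega> a ?U e e = bform \<Omega> a ?U (\<C>K K (\<lambda>x. k * v x)) e + (- k) * bform \<Omega> a ?U (\<C>K K v) e"
    by (subst (1) e_def) (simp only: bform_add[OF H[OF c(3)] H1_scale[OF H[OF c(1)]] H[OF eW] U]
        bform_scale[OF H[OF c(1)] H[OF eW] U])
  also have "\<dots> = 0"
    using bform_scale[OF H10_H1[OF coarse.fe_H10[OF v]] H[OF eW] K', of k]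
    by (simp add: element_corrector_eq[OF _ eW e0] v kv)
  finally have "AE x in lebesgue_on \<Omega>. e x = 0" by (rule element_corrector_unique[OF eW e0])
  then show ?thesis by eventually_elim (simp add: e_def)
qed

end

lemma local_corrector_Vh: assumes "v \<in> VH" shows "local_corrector TH \<C>K v \<in> Vh"
  unfolding local_corrector_def by (intro fe_sum W_Vh element_corrector_mem(1) assms)

lemma local_corrector_add: assumes "v \<in> VH" "w \<in> VH"
  shows "AE x in lebesgue_on \<Omega>. local_corrector TH \<C>K (\<lambda>x. v x + w x) x
    = local_corrector TH \<C>K v x + local_corrector TH \<C>K w x"
proof -
  have "AE x in lebesgue_on \<Omega>. \<forall>K\<in>TH. \<C>K K (\<lambda>x. v x + w x) x = \<C>K K v x + \<C>K K w x"
    using element_corrector_add[OF _ assms] by (subst AE_finite_all[OF coarse.mesh_finite]) auto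
  then show ?thesis by eventually_elim (simp add: local_corrector_def sum.distrib)
qed

lemma local_corrector_scale: assumes "v \<in> VH"
  shows "AE x in lebesgue_on \<Omega>. local_corrector TH \<C>K (\<lambda>x. k * v x) x = k * local_corrector TH \<C>K v x"
proof -
  have "AE x in lebesgue_on \<Omega>. \<forall>K\<in>TH. \<C>K K (\<lambda>x. k * v x) x = k * \<C>K K v x"
    using element_corrector_scale[OF _ assms] by (subst AE_finite_all[OF coarse.mesh_finite]) auto
  then show ?thesis by eventually_elim (simp add: local_corrector_def sum_distrib_left)
qed

lemma V_Vh: "V \<subseteq> Vh"
proof
  fix w assume "w \<in> V"
  then obtain v where v: "v \<in> VH" "AE x in lebesgue_on \<Omega>. w x = v x + local_corrector TH \<C>K v x"
    by (auto simp: lod_space_def)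
  show "w \<in> Vh" by (rule fe_cong[OF fe_add v(2)]) (use v(1) VH_Vh local_corrector_Vh in auto)
qed

lemma V_H10: "w \<in> V \<Longrightarrow> w \<in> H10 \<Omega>" using V_Vh fe_H10 by blast

lemma V_add: assumes "v \<in> V" "w \<in> V" shows "(\<lambda>x. v x + w x) \<in> V"
proof -
  obtain p where p: "p \<in> VH" "AE x in lebesgue_on \<Omega>. v x = p x + local_corrector TH \<C>K p x"
    using assms(1) by (auto simp: lod_space_def)
  obtain q where q: "q \<in> VH" "AE x in lebesgue_on \<Omega>. w x = q x + local_corrector TH \<C>K q x"
    using assms(2) by (auto simp: lod_space_def)
  have "AE x in lebesgue_on \<Omega>. v x + w x = (p x + q x) + local_corrector TH \<C>K (\<lambda>x. p x + q x) x"
    using p(2) q(2) local_corrector_add[OF p(1) q(1)] by eventually_elim simp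
  then show ?thesis using coarse.fe_add[OF p(1) q(1)] by (auto simp: lod_space_def intro!: bexI[of _ "\<lambda>x. p x + q x"])
qed

lemma V_scale: assumes "v \<in> V" shows "(\<lambda>x. k * v x) \<in> V"
proof -
  obtain p where p: "p \<in> VH" "AE x in lebesgue_on \<Omega>. v x = p x + local_corrector TH \<C>K p x"
    using assms(1) by (auto simp: lod_space_def)
  have "AE x in lebesgue_on \<Omega>. k * v x = k * p x + local_corrector TH \<C>K (\<lambda>x. k * p x) x"
    using p(2) local_corrector_scale[OF p(1), of k] by eventually_elim (simp add: distrib_left)
  then show ?thesis using coarse.fe_scale[OF p(1)] by (auto simp: lod_space_def intro!: bexI[of _ "\<lambda>x. k * p x"])
qed

lemma V_basis: "\<exists>n e. E.spans V n e" by (rule fe_subspace_basis[OF V_Vh V_add V_scale])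

lemma W_basis: "\<exists>n e. E.spans W n e" by (rule fe_subspace_basis[OF _ W_add W_scale]) (auto intro: W_Vh)

text \<open>The constant of the global versions of the elementwise bounds of \<open>I\<^sub>H\<close>.\<close>
definition "stab_const = \<bar>CI\<bar> * sqrt ((4 * \<sigma>\<^sup>2) ^ DIM('a))"

lemma stab_const_nonneg: "0 \<le> stab_const" by (simp add: stab_const_def)

lemma enorm_IH: assumes "v \<in> H10 \<Omega>" shows "enorm (IH v) \<le> stab_const * enorm v"
  unfolding stab_const_def
  by (intro coarse.local_to_global[OF shape quasi] sgrad_L2 H10_H1 coarse.fe_H10 IH_mem assms IH_stable)

lemma weighted_L2: assumes "w \<in> L2 \<Omega>" shows "(\<lambda>x. sqrt (a x) * w x) \<in> L2 \<Omega>"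
proof -
  have "(\<lambda>x. sqrt (a x)) \<in> borel_measurable (lebesgue_on \<Omega>)" using a_measurable by measurable
  then show ?thesis
    using L2_mult_bounded[OF assms, of "\<lambda>x. sqrt (a x)" "sqrt amax"] a_bounds(3) a_pos by (simp add: less_imp_le)
qed

lemma inverse_weighted_L2: assumes "w \<in> L2 \<Omega>" shows "(\<lambda>x. w x / sqrt (a x)) \<in> L2 \<Omega>"
proof -
  have m: "(\<lambda>x. 1 / sqrt (a x)) \<in> borel_measurable (lebesgue_on \<Omega>)" using a_measurable by measurable
  have "\<bar>1 / sqrt (a x)\<bar> \<le> 1 / sqrt amin" for x
    using a_bounds(1) a_bounds(2)[of x] a_pos[of x] by (simp add: frac_le)
  then show ?thesis using L2_mult_bounded[OF assms m, of "1 / sqrt amin"] by simp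
qed

lemma weighted_W: assumes "w \<in> W"
  shows "l2norm \<Omega> (\<lambda>x. sqrt (a x) * w x) \<le> stab_const * mesh_size TH * enorm w"
proof -
  have "l2norm \<Omega> (\<lambda>x. sqrt (a x) * w x) \<le> \<bar>CI * mesh_size TH\<bar> * sqrt ((4 * \<sigma>\<^sup>2) ^ DIM('a)) * enorm w"
    by (intro coarse.local_to_global[OF shape quasi] weighted_L2 sgrad_L2 H10_H1 H10_L2 W_H10 assms W_stable)
  then show ?thesis using coarse.mesh_size_pos by (simp add: stab_const_def abs_mult mult_ac)
qed

lemma l2ip_weighted: assumes "f \<in> L2 \<Omega>" "w \<in> L2 \<Omega>"
  shows "\<bar>l2ip \<Omega> f w\<bar> \<le> l2norm \<Omega> (\<lambda>x. f x / sqrt (a x)) * l2norm \<Omega> (\<lambda>x. sqrt (a x) * w x)"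
proof -
  have "f x * w x = (f x / sqrt (a x)) * (sqrt (a x) * w x)" for x
  proof -
    have "sqrt (a x) \<noteq> 0" using a_pos[of x] by simp
    then show ?thesis by (simp add: field_simps)
  qed
  then have "l2ip \<Omega> f w = l2ip \<Omega> (\<lambda>x. f x / sqrt (a x)) (\<lambda>x. sqrt (a x) * w x)"
    unfolding l2ip_def by (simp only:)
  then show ?thesis using l2ip_bound[OF inverse_weighted_L2[OF assms(1)] weighted_L2[OF assms(2)]] by simp
qed

lemma ritz_h_mem: "v \<in> H10 \<Omega> \<Longrightarrow> \<pi>h v \<in> Vh"
  and ritz_h_orth: "v \<in> H10 \<Omega> \<Longrightarrow> w \<in> Vh \<Longrightarrow> energy (\<lambda>x. v x - \<pi>h v x) w = 0"
  using ritz_h unfolding ritz_proj_def by blast+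

lemma ritz_h_H10: "v \<in> H10 \<Omega> \<Longrightarrow> \<pi>h v \<in> H10 \<Omega>" by (rule fe_H10[OF ritz_h_mem])

lemma ritz_h_energy: "v \<in> H10 \<Omega> \<Longrightarrow> w \<in> Vh \<Longrightarrow> energy (\<pi>h v) w = energy v w"
  using ritz_h_orth[of v w] E.ip_diff[of v "\<pi>h v" w] by (simp add: ritz_h_H10 fe_H10)

lemma ritz_h_enorm: assumes v: "v \<in> H10 \<Omega>" shows "enorm (\<pi>h v) \<le> enorm v"
proof -
  have "(enorm (\<pi>h v))\<^sup>2 = energy v (\<pi>h v)"
    unfolding enorm_eq_nrm E.nrm_sq[OF ritz_h_H10[OF v]] by (rule ritz_h_energy[OF v ritz_h_mem[OF v]])
  also have "\<dots> \<le> enorm v * enorm (\<pi>h v)"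
    unfolding enorm_eq_nrm using E.cauchy_schwarz[OF v ritz_h_H10[OF v]] by linarith
  finally show ?thesis by (cases "enorm (\<pi>h v) = 0") (auto simp: power2_eq_square mult_le_cancel_right less_le)
qed

text \<open>With \<open>v\<^sub>H = I\<^sub>H \<pi>\<^sub>h v\<close> the function \<open>w = \<pi>\<^sub>h v - v\<^sub>H - C v\<^sub>H\<close> lies in the kernel space, which is
  orthogonal to \<open>v\<^sub>H + C v\<^sub>H\<close> in the energy form. So \<open>energy w w = (F, w)\<close>, and the approximation property of
  \<open>I\<^sub>H\<close> gains the factor \<open>H\<close>. The element \<open>v\<^sub>H + C\<^sub>m v\<^sub>H\<close> of the multiscale space, with the localized corrector
  \<open>C\<^sub>m\<close>, competes with the best approximation of \<open>\<pi>\<^sub>h v\<close>, which is also that of \<open>v\<close> because the multiscale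
  space is contained in the fine one.\<close>
lemma ritz_ms_error:
  assumes sp: "E.spans V n e" and v: "v \<in> H10 \<Omega>" and F: "F \<in> L2 \<Omega>"
    and eq: "\<And>w. w \<in> W \<Longrightarrow> energy v w = l2ip \<Omega> F w"
  shows "enorm (\<lambda>x. \<pi>h v x - E.proj n e v x)
      \<le> stab_const * (mesh_size TH * l2norm \<Omega> (\<lambda>x. F x / sqrt (a x)) + \<bar>Cloc\<bar> * \<mu> * enorm v)"
proof -
  define vh where "vh = \<pi>h v"
  have vh: "vh \<in> Vh" "vh \<in> H10 \<Omega>" using ritz_h_mem[OF v] ritz_h_H10[OF v] by (auto simp: vh_def)
  define vH where "vH = IH vh"
  have vH: "vH \<in> VH" unfolding vH_def by (rule IH_mem[OF vh(2)])
  have vH': "vH \<in> Vh" "vH \<in> H10 \<Omega>" using vH VH_Vh coarse.fe_H10 by auto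
  have CvH: "\<C> vH \<in> W" "\<And>w. w \<in> W \<Longrightarrow> energy (\<C> vH) w = - energy vH w"
    using corrector vH unfolding is_corrector_def by blast+
  define q where "q = (\<lambda>x. vH x + \<C> vH x)"
  have q: "q \<in> H10 \<Omega>" "q \<in> Vh" unfolding q_def using H10_add[OF vH'(2) W_H10[OF CvH(1)]] fe_add[OF vH'(1) W_Vh[OF CvH(1)]] by auto
  define wf where "wf = (\<lambda>x. vh x - q x)"
  have wf: "wf \<in> W"
  proof -
    have "AE x in lebesgue_on \<Omega>. IH wf x = 0"
      using IH_diff[OF vh(2) q(1)] IH_add[OF vH'(2) W_H10[OF CvH(1)]] IH_idem[OF vh(2)] W_IH[OF CvH(1)]
      by eventually_elim (simp add: wf_def q_def vH_def)
    moreover have "wf \<in> Vh" unfolding wf_def by (rule fe_diff[OF vh(1) q(2)])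
    ultimately show ?thesis by (simp add: kernel_space_def)
  qed
  note wfH = W_H10[OF wf]
  have "(enorm wf)\<^sup>2 = energy wf wf" unfolding enorm_eq_nrm by (rule E.nrm_sq[OF wfH])
  also have "\<dots> = energy vh wf - energy q wf" by (subst (1) wf_def) (rule E.ip_diff[OF vh(2) q(1) wfH])
  also have "energy q wf = 0"
    unfolding q_def using E.ip_add[OF vH'(2) W_H10[OF CvH(1)] wfH] CvH(2)[OF wf] by simp
  also have "energy vh wf - 0 = l2ip \<Omega> F wf"
    using ritz_h_energy[OF v W_Vh[OF wf]] eq[OF wf] by (simp add: vh_def)
  also have "\<dots> \<le> l2norm \<Omega> (\<lambda>x. F x / sqrt (a x)) * l2norm \<Omega> (\<lambda>x. sqrt (a x) * wf x)"
    using l2ip_weighted[OF F H10_L2[OF wfH]] by linarith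
  also have "\<dots> \<le> l2norm \<Omega> (\<lambda>x. F x / sqrt (a x)) * (stab_const * mesh_size TH * enorm wf)"
    by (intro mult_left_mono weighted_W wf) auto
  finally have "enorm wf * enorm wf \<le> (stab_const * (mesh_size TH * l2norm \<Omega> (\<lambda>x. F x / sqrt (a x)))) * enorm wf"
    by (simp add: power2_eq_square mult_ac)
  moreover have "0 \<le> stab_const * (mesh_size TH * l2norm \<Omega> (\<lambda>x. F x / sqrt (a x)))"
    using stab_const_nonneg coarse.mesh_size_pos by simp
  ultimately have 1: "enorm wf \<le> stab_const * (mesh_size TH * l2norm \<Omega> (\<lambda>x. F x / sqrt (a x)))"
    by (cases "enorm wf = 0") (auto simp: mult_le_cancel_right less_le)
  define L where "L = local_corrector TH \<C>K vH"
  have L: "L \<in> H10 \<Omega>" unfolding L_def by (rule fe_H10[OF local_corrector_Vh[OF vH]])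
  \<comment> \<open>The competitor in the multiscale space.\<close>
  define z where "z = (\<lambda>x. vH x + L x)"
  have z: "z \<in> V" unfolding z_def L_def lod_space_def using vH by auto
  have zH: "z \<in> H10 \<Omega>" by (rule V_H10[OF z])
  have 2: "enorm (\<lambda>x. L x - \<C> vH x) \<le> stab_const * (\<bar>Cloc\<bar> * \<mu> * enorm v)"
  proof -
    have "enorm (\<lambda>x. L x - \<C> vH x) \<le> Cloc * \<mu> * enorm vH" unfolding L_def by (rule localization[OF vH])
    also have "\<dots> \<le> \<bar>Cloc\<bar> * \<mu> * enorm vH" using mu_nonneg by (intro mult_right_mono) auto
    also have "\<dots> \<le> \<bar>Cloc\<bar> * \<mu> * (stab_const * enorm v)"
    proof (intro mult_left_mono)
      have "enorm vH \<le> stab_const * enorm vh" unfolding vH_def by (rule enorm_IH[OF vh(2)])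
      also have "\<dots> \<le> stab_const * enorm v" unfolding vh_def by (intro mult_left_mono ritz_h_enorm v stab_const_nonneg)
      finally show "enorm vH \<le> stab_const * enorm v" .
    qed (use mu_nonneg in simp)
    finally show ?thesis by (simp add: mult_ac)
  qed
  have o: "E.orthonormal n e" using sp by (simp add: E.spans_def)
  define p where "p = E.proj n e v"
  have VH10: "V \<subseteq> H10 \<Omega>" using V_H10 by blast
  have pH: "p \<in> H10 \<Omega>" unfolding p_def by (rule E.proj_mem[OF o])
  have pV: "p \<in> V"
  proof -
    have "(\<lambda>x. \<Sum>i<j. energy v (e i) * e i x) \<in> V" if "j \<le> n" for j
      using that
    proof (induction j)
      case 0
      show ?case using V_scale[OF z, of 0] by simp
    next
      case (Suc j)
      then have "e j \<in> V" using sp by (simp add: E.spans_def)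
      then show ?case using Suc V_add[OF _ V_scale] by simp
    qed
    then show ?thesis by (simp add: p_def E.proj_def)
  qed
  have orth: "energy (\<lambda>x. vh x - p x) w = 0" if w: "w \<in> V" for w
  proof -
    have wH: "w \<in> H10 \<Omega>" by (rule V_H10[OF w])
    have "energy (\<lambda>x. v x - p x) w = 0" unfolding p_def by (rule E.proj_orth_spanned[OF sp VH10 v w])
    moreover have "energy vh w = energy v w" unfolding vh_def by (rule ritz_h_energy[OF v]) (use w V_Vh in blast)
    ultimately show ?thesis using E.ip_diff[OF v pH wH] E.ip_diff[OF vh(2) pH wH] by simp
  qed
  have pz: "(\<lambda>x. p x - z x) \<in> V" using V_add[OF pV V_scale[OF z, of "-1"]] by simp
  have "enorm (\<lambda>x. vh x - p x) \<le> enorm (\<lambda>x. vh x - z x)"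
    unfolding enorm_eq_nrm by (rule E.best_approximation[OF vh(2) pH zH orth[OF pz]])
  also have "(\<lambda>x. vh x - z x) = (\<lambda>x. wf x - (L x - \<C> vH x))"
    by (auto simp: wf_def q_def z_def)
  also have "enorm \<dots> \<le> enorm wf + enorm (\<lambda>x. L x - \<C> vH x)"
    unfolding enorm_eq_nrm by (rule E.nrm_diff_triangle[OF wfH H10_diff[OF L W_H10[OF CvH(1)]]])
  finally show ?thesis using 1 2 by (simp add: vh_def p_def distrib_left)
qed

end

section \<open>The dual space\<close>

context bounded_domain
begin

lemma Hm1_bound: assumes F: "F \<in> Hm1 \<Omega>" and v: "v \<in> H10 \<Omega>"
  shows "\<bar>F v\<bar> \<le> hm1norm \<Omega> F * h1norm \<Omega> v"
proof -
  obtain B where B: "\<And>v. v \<in> H10 \<Omega> \<Longrightarrow> \<bar>F v\<bar> \<le> B * h1norm \<Omega> v" and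
    sc: "\<And>v c. v \<in> H10 \<Omega> \<Longrightarrow> F (\<lambda>x. c * v x) = c * F v"
    using F unfolding Hm1_def by blast
  show ?thesis
  proof (cases "h1norm \<Omega> v = 0")
    case True
    then show ?thesis using B[OF v] by simp
  next
    case False
    then have pos: "0 < h1norm \<Omega> v" using h1norm_nonneg[of v] by simp
    define w where "w = (\<lambda>x. inverse (h1norm \<Omega> v) * v x)"
    have w: "w \<in> H10 \<Omega>" unfolding w_def by (rule H10_scale[OF v])
    have hw: "h1norm \<Omega> w = 1"
      using H.nrm_scale[OF H10_H1[OF v], of "inverse (h1norm \<Omega> v)"] pos
        h1norm_eq_nrm[OF H10_H1[OF v]] h1norm_eq_nrm[OF H10_H1[OF w]] by (simp add: w_def)
    have "\<bar>F w\<bar> \<le> hm1norm \<Omega> F"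
      unfolding hm1norm_def
    proof (rule cSUP_upper)
      show "w \<in> {v \<in> H10 \<Omega>. h1norm \<Omega> v \<le> 1}" using w hw by simp
      show "bdd_above ((\<lambda>v. \<bar>F v\<bar>) ` {v \<in> H10 \<Omega>. h1norm \<Omega> v \<le> 1})"
      proof (rule bdd_aboveI2)
        fix x assume x: "x \<in> {v \<in> H10 \<Omega>. h1norm \<Omega> v \<le> 1}"
        then have "\<bar>F x\<bar> \<le> B * h1norm \<Omega> x" using B by blast
        also have "\<dots> \<le> \<bar>B\<bar> * 1" using x h1norm_nonneg[of x] by (intro mult_mono) auto
        finally show "\<bar>F x\<bar> \<le> \<bar>B\<bar> * 1" .
      qed
    qed
    moreover have "F w = inverse (h1norm \<Omega> v) * F v" unfolding w_def by (rule sc[OF v])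
    ultimately show ?thesis using pos by (simp add: abs_mult field_simps)
  qed
qed

lemma Hm1_diff: assumes F: "F \<in> Hm1 \<Omega>" and G: "G \<in> Hm1 \<Omega>" shows "(\<lambda>v. F v - G v) \<in> Hm1 \<Omega>"
proof -
  obtain B where B: "\<And>v. v \<in> H10 \<Omega> \<Longrightarrow> \<bar>F v\<bar> \<le> B * h1norm \<Omega> v" using F unfolding Hm1_def by blast
  obtain B' where B': "\<And>v. v \<in> H10 \<Omega> \<Longrightarrow> \<bar>G v\<bar> \<le> B' * h1norm \<Omega> v" using G unfolding Hm1_def by blast
  have "\<bar>F v - G v\<bar> \<le> (B + B') * h1norm \<Omega> v" if "v \<in> H10 \<Omega>" for v
    using B[OF that] B'[OF that] by (simp add: distrib_right abs_le_iff)
  then show ?thesis using F G unfolding Hm1_def by (auto simp: right_diff_distrib)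
qed

text \<open>The initial velocity is attained only in \<open>H\<^sup>-\<^sup>1\<close>, which is enough for products with elements of
  \<open>H\<^sup>1\<^sub>0\<close>.\<close>
lemma Hm1_initial_value:
  assumes T: "0 < T" and d: "has_dt T \<Omega> u w"
    and i: "has_initial_value T (Hm1 \<Omega>) (hm1norm \<Omega>) (\<lambda>t. l2ip \<Omega> (u' t)) (l2ip \<Omega> z)"
    and eq: "AE t in time_measure T. \<forall>v\<in>L2 \<Omega>. l2ip \<Omega> (u' t) v = l2ip \<Omega> (u t) v"
    and v: "v \<in> H10 \<Omega>"
  shows "AE t in time_measure T. l2ip \<Omega> (u t) v = l2ip \<Omega> z v + prim T (\<lambda>s. l2ip \<Omega> (w s) v) t"
proof -
  note D = has_dtD[OF d] and vL = H10_L2[OF v]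
  obtain y where y: "\<And>t. t \<in> {0..T} \<Longrightarrow> y t \<in> Hm1 \<Omega>"
    "\<And>t. t \<in> {0..T} \<Longrightarrow> ((\<lambda>s. hm1norm \<Omega> (\<lambda>x. y s x - y t x)) \<longlongrightarrow> 0) (at t within {0..T})"
    "AE t in time_measure T. hm1norm \<Omega> (\<lambda>x. l2ip \<Omega> (u' t) x - y t x) = 0"
    "hm1norm \<Omega> (\<lambda>x. y 0 x - l2ip \<Omega> z x) = 0" and z: "l2ip \<Omega> z \<in> Hm1 \<Omega>"
    and u': "AE t in time_measure T. l2ip \<Omega> (u' t) \<in> Hm1 \<Omega>"
    using i unfolding has_initial_value_def by blast
  have bd: "\<bar>F v - G v\<bar> \<le> hm1norm \<Omega> (\<lambda>x. F x - G x) * h1norm \<Omega> v" if "F \<in> Hm1 \<Omega>" "G \<in> Hm1 \<Omega>" for F G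
    using Hm1_bound[OF Hm1_diff[OF that] v] .
  have "AE t in time_measure T. l2ip \<Omega> (u t) v = y 0 v + prim T (\<lambda>s. l2ip \<Omega> (w s) v) t"
  proof (rule weak_derivative_initial_value[OF T Lp_L2_integrable_ip[OF D(1) _ vL] Lp_L2_integrable_ip[OF D(2) _ vL] D(3)[OF vL]])
    show "continuous_on {0..T} (\<lambda>t. y t v)"
      unfolding continuous_on_def
    proof
      fix t assume t: "t \<in> {0..T}"
      have "((\<lambda>s. y s v - y t v) \<longlongrightarrow> 0) (at t within {0..T})"
      proof (rule tendsto_0_le[OF y(2)[OF t], of _ "h1norm \<Omega> v"])
        have "norm (y s v - y t v) \<le> norm (hm1norm \<Omega> (\<lambda>x. y s x - y t x)) * h1norm \<Omega> v" if "s \<in> {0..T}" for s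
        proof -
          have "\<bar>y s v - y t v\<bar> \<le> hm1norm \<Omega> (\<lambda>x. y s x - y t x) * h1norm \<Omega> v" by (rule bd[OF y(1)[OF that] y(1)[OF t]])
          also have "\<dots> \<le> norm (hm1norm \<Omega> (\<lambda>x. y s x - y t x)) * h1norm \<Omega> v"
            by (intro mult_right_mono h1norm_nonneg) simp
          finally show ?thesis by simp
        qed
        then show "\<forall>\<^sub>F s in at t within {0..T}. norm (y s v - y t v)
            \<le> norm (hm1norm \<Omega> (\<lambda>x. y s x - y t x)) * h1norm \<Omega> v"
          unfolding eventually_at_filter by (auto intro!: always_eventually)
      qed
      then show "((\<lambda>t. y t v) \<longlongrightarrow> y t v) (at t within {0..T})" by (simp add: LIM_zero_iff)
    qed
    show "AE t in time_measure T. l2ip \<Omega> (u t) v = y t v"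
      using y(3) u' eq AE_space
    proof eventually_elim
      case (elim t)
      then show ?case using bd[of "l2ip \<Omega> (u' t)" "y t"] y(1)[of t] vL by simp
    qed
  qed auto
  moreover have "y 0 v = l2ip \<Omega> z v" using bd[OF y(1) z, of 0] y(4) T by simp
  ultimately show ?thesis by simp
qed

end

section \<open>The Ritz projection onto the multiscale space\<close>

locale lod_basis = lod_setting +
  fixes n :: nat and e :: "nat \<Rightarrow> 'a \<Rightarrow> real"
  assumes spans: "E.spans V n e"
begin

lemma ortho: "E.orthonormal n e" using spans by (simp add: E.spans_def)

lemma e_V: "i < n \<Longrightarrow> e i \<in> V" using spans by (simp add: E.spans_def)

lemma e_H10: "i < n \<Longrightarrow> e i \<in> H10 \<Omega>" by (intro V_H10 e_V)

lemma e_L2: "i < n \<Longrightarrow> e i \<in> L2 \<Omega>" by (intro H10_L2 e_H10)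

lemma V_sub: "V \<subseteq> H10 \<Omega>" using V_H10 by blast

definition ritz_error :: "('a \<Rightarrow> real) \<Rightarrow> 'a \<Rightarrow> real" where
  "ritz_error v = (\<lambda>x. v x - E.proj n e v x)"

lemma proj_H10: "E.proj n e v \<in> H10 \<Omega>" by (rule E.proj_mem[OF ortho])

lemma ritz_error_H10: "v \<in> H10 \<Omega> \<Longrightarrow> ritz_error v \<in> H10 \<Omega>"
  unfolding ritz_error_def by (intro H10_diff proj_H10)

lemma comb_H10: "(\<lambda>x. \<Sum>i<n. c i * e i x) \<in> H10 \<Omega>"
  using E.comb_mem[of "{..<n}" e c] e_H10 by simp

lemma ritz_error_orth: "v \<in> H10 \<Omega> \<Longrightarrow> i < n \<Longrightarrow> energy (ritz_error v) (e i) = 0"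
  unfolding ritz_error_def by (rule E.proj_orth[OF ortho])

lemma ritz_error_orth_comb: assumes "v \<in> H10 \<Omega>" shows "energy (ritz_error v) (\<lambda>x. \<Sum>i<n. c i * e i x) = 0"
  using E.ip_comb_right[of "{..<n}" e "ritz_error v" c] e_H10 ritz_error_H10[OF assms] ritz_error_orth[OF assms] by simp

lemma ritz_error_enorm_le: assumes v: "v \<in> H10 \<Omega>" shows "enorm (ritz_error v) \<le> enorm v"
  using E.best_approximation[OF v proj_H10 H10_zero] ritz_error_orth_comb[OF v, of "\<lambda>i. energy v (e i)"]
  by (simp add: enorm_eq_nrm ritz_error_def E.proj_def)

lemma proj_diff: "v \<in> H10 \<Omega> \<Longrightarrow> w \<in> H10 \<Omega> \<Longrightarrow>
    E.proj n e (\<lambda>x. v x - w x) = (\<lambda>x. E.proj n e v x - E.proj n e w x)"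
  unfolding E.proj_def by (auto simp: E.ip_diff e_H10 left_diff_distrib sum_subtractf)

lemma ritz_error_diff: "v \<in> H10 \<Omega> \<Longrightarrow> w \<in> H10 \<Omega> \<Longrightarrow> ritz_error (\<lambda>x. v x - w x) = (\<lambda>x. ritz_error v x - ritz_error w x)"
  by (auto simp: ritz_error_def proj_diff)

lemma ritz_error_V: assumes "v \<in> V" shows "enorm (ritz_error v) = 0" "l2norm \<Omega> (ritz_error v) = 0"
proof -
  show *: "enorm (ritz_error v) = 0" using spans assms by (simp add: E.spans_def ritz_error_def enorm_eq_nrm)
  show "l2norm \<Omega> (ritz_error v) = 0" by (rule enorm_zero_imp(1)[OF ritz_error_H10[OF V_H10[OF assms]] *])
qed

lemma ritz_error_l2_le: "v \<in> H10 \<Omega> \<Longrightarrow> l2norm \<Omega> (ritz_error v) \<le> \<bar>CP\<bar> * enorm v"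
  using l2norm_le_enorm[OF ritz_error_H10] ritz_error_enorm_le by (meson abs_ge_zero mult_left_mono order_trans)

text \<open>Makes the norms of the projection errors measurable functions of time.\<close>
lemma measurable_lipschitz:
  assumes u: "bochner_measurable T (H10 \<Omega>) (h1norm \<Omega>) u" "AE t in time_measure T. u t \<in> H10 \<Omega>"
    and F: "\<And>v w. v \<in> H10 \<Omega> \<Longrightarrow> w \<in> H10 \<Omega> \<Longrightarrow> \<bar>F v - F w\<bar> \<le> k * enorm (\<lambda>x. v x - w x)" and k: "0 \<le> k"
  shows "(\<lambda>t. F (u t)) \<in> borel_measurable (time_measure T)"
proof (rule bochner_measurable_compose[OF u])
  fix v s assume v: "v \<in> H10 \<Omega>" and s: "\<And>j. s j \<in> H10 \<Omega>" and l: "(\<lambda>j::nat. h1norm \<Omega> (\<lambda>x. v x - s j x)) \<longlonglongrightarrow> 0"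
  have "(\<lambda>j. F v - F (s j)) \<longlonglongrightarrow> 0"
  proof (rule tendsto_0_le[OF l, of _ "k * sqrt amax"])
    have "\<bar>F v - F (s j)\<bar> \<le> k * sqrt amax * h1norm \<Omega> (\<lambda>x. v x - s j x)" for j
      using F[OF v s, of j] mult_left_mono[OF enorm_le_h1norm[OF H10_H1[OF H10_diff[OF v s]]] k, of j] by (simp add: mult.assoc)
    then show "\<forall>\<^sub>F j in sequentially. norm (F v - F (s j)) \<le> norm (h1norm \<Omega> (\<lambda>x. v x - s j x)) * (k * sqrt amax)"
      by (simp add: h1norm_nonneg mult.commute)
  qed
  from tendsto_diff[OF tendsto_const[of "F v"] this] show "(\<lambda>j. F (s j)) \<longlonglongrightarrow> F v" by simp
qed

lemma ritz_error_measurable: assumes "u \<in> Lp_H10 p T \<Omega>"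
  shows "(\<lambda>t. l2norm \<Omega> (ritz_error (u t))) \<in> borel_measurable (time_measure T)"
proof (rule measurable_lipschitz[OF Lp_bochner_measurable[OF assms] Lp_bochner_AE[OF assms], of "\<lambda>v. l2norm \<Omega> (ritz_error v)" "\<bar>CP\<bar>"])
  fix v w assume v: "v \<in> H10 \<Omega>" and w: "w \<in> H10 \<Omega>"
  have "\<bar>l2norm \<Omega> (ritz_error v) - l2norm \<Omega> (ritz_error w)\<bar> \<le> l2norm \<Omega> (\<lambda>x. ritz_error v x - ritz_error w x)"
    by (intro l2norm_lipschitz H10_L2 ritz_error_H10 v w)
  also have "\<dots> \<le> \<bar>CP\<bar> * enorm (\<lambda>x. v x - w x)"
    using ritz_error_l2_le[OF H10_diff[OF v w]] by (simp add: ritz_error_diff[OF v w])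
  finally show "\<bar>l2norm \<Omega> (ritz_error v) - l2norm \<Omega> (ritz_error w)\<bar> \<le> \<bar>CP\<bar> * enorm (\<lambda>x. v x - w x)" .
qed simp

lemma ritz_error_integrable: assumes "u \<in> Lp_H10 p T \<Omega>" "p \<in> {1, 2, \<infinity>}"
  shows "integrable (time_measure T) (\<lambda>t. l2norm \<Omega> (ritz_error (u t)))"
proof (rule Bochner_Integration.integrable_bound)
  show "integrable (time_measure T) (\<lambda>t. (\<bar>CP\<bar> * sqrt amax) * h1norm \<Omega> (u t))"
    using Lp_H10_integrable_norm[OF assms] by simp
  show "AE t in time_measure T. norm (l2norm \<Omega> (ritz_error (u t))) \<le> norm ((\<bar>CP\<bar> * sqrt amax) * h1norm \<Omega> (u t))"
    using Lp_bochner_AE[OF assms(1)]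
  proof eventually_elim
    case (elim t)
    have "l2norm \<Omega> (ritz_error (u t)) \<le> \<bar>CP\<bar> * (sqrt amax * h1norm \<Omega> (u t))"
      using ritz_error_l2_le[OF elim] mult_left_mono[OF enorm_le_h1norm[OF H10_H1[OF elim]], of "\<bar>CP\<bar>"] by linarith
    then show ?case using amax_pos by (simp add: h1norm_nonneg mult.assoc)
  qed
qed (rule ritz_error_measurable[OF assms(1)])

lemma ritz_h_measurable: assumes "u \<in> Lp_H10 p T \<Omega>"
  shows "(\<lambda>t. l2norm \<Omega> (\<lambda>x. u t x - \<pi>h (u t) x)) \<in> borel_measurable (time_measure T)"
proof (rule measurable_lipschitz[OF Lp_bochner_measurable[OF assms] Lp_bochner_AE[OF assms],
      of "\<lambda>v. l2norm \<Omega> (\<lambda>x. v x - \<pi>h v x)" "\<bar>CP\<bar>"])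
  fix v w assume v: "v \<in> H10 \<Omega>" and w: "w \<in> H10 \<Omega>"
  define d where "d = (\<lambda>x. v x - w x)"
  define q where "q = (\<lambda>x. \<pi>h v x - \<pi>h w x)"
  have d: "d \<in> H10 \<Omega>" unfolding d_def by (rule H10_diff[OF v w])
  have q: "q \<in> Vh" unfolding q_def by (intro fe_diff ritz_h_mem v w)
  note qH = fe_H10[OF q]
  have "energy d q = energy q q"
    unfolding d_def using E.ip_diff[OF v w qH] E.ip_diff[OF ritz_h_H10[OF v] ritz_h_H10[OF w] qH]
      ritz_h_energy[OF v q] ritz_h_energy[OF w q] by (simp add: q_def)
  then have "energy (\<lambda>x. d x - q x) (\<lambda>x. q x - 0) = 0" using E.ip_diff[OF d qH qH] by simp
  then have le: "enorm (\<lambda>x. d x - q x) \<le> enorm d"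
    using E.best_approximation[OF d qH H10_zero] by (simp add: enorm_eq_nrm)
  have "\<bar>l2norm \<Omega> (\<lambda>x. v x - \<pi>h v x) - l2norm \<Omega> (\<lambda>x. w x - \<pi>h w x)\<bar>
      \<le> l2norm \<Omega> (\<lambda>x. (v x - \<pi>h v x) - (w x - \<pi>h w x))"
    by (intro l2norm_lipschitz H10_L2 H10_diff ritz_h_H10 v w)
  also have "(\<lambda>x. (v x - \<pi>h v x) - (w x - \<pi>h w x)) = (\<lambda>x. d x - q x)" by (auto simp: d_def q_def)
  also have "l2norm \<Omega> \<dots> \<le> \<bar>CP\<bar> * enorm (\<lambda>x. d x - q x)" by (rule l2norm_le_enorm[OF H10_diff[OF d qH]])
  also have "\<dots> \<le> \<bar>CP\<bar> * enorm d" by (intro mult_left_mono le) simp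
  finally show "\<bar>l2norm \<Omega> (\<lambda>x. v x - \<pi>h v x) - l2norm \<Omega> (\<lambda>x. w x - \<pi>h w x)\<bar> \<le> \<bar>CP\<bar> * enorm (\<lambda>x. v x - w x)"
    by (simp add: d_def)
qed simp

definition "lod_rate = mesh_size TH + \<mu>"

definition "ritz_const = stab_const * (1 + \<bar>Cloc\<bar>)"

lemma lod_rate_nonneg: "0 \<le> lod_rate" unfolding lod_rate_def using coarse.mesh_size_pos mu_nonneg by simp

lemma ritz_const_nonneg: "0 \<le> ritz_const" unfolding ritz_const_def using stab_const_nonneg by simp

abbreviation wnorm :: "('a \<Rightarrow> real) \<Rightarrow> real" where
  "wnorm F \<equiv> l2norm \<Omega> (\<lambda>x. F x / sqrt (a x))"

lemma wnorm_minus: "wnorm (\<lambda>x. f x - g x) = wnorm (\<lambda>x. g x - f x)"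
  unfolding l2norm_def by (simp add: power_divide power2_commute)

text \<open>The fine-scale error \<open>v - \<pi>\<^sub>h v\<close> is kept as it is, and the remaining error is controlled in the energy
  norm. The \<open>L\<^sup>2\<close> bound follows by the Poincare inequality and has the same order in \<open>H\<close>.\<close>
lemma ritz_error_bounds:
  assumes v: "v \<in> H10 \<Omega>" and F: "F \<in> L2 \<Omega>" and eq: "\<forall>w\<in>W. energy v w = l2ip \<Omega> F w"
  shows "enorm (ritz_error v) \<le> enorm (\<lambda>x. v x - \<pi>h v x) + ritz_const * (lod_rate * (wnorm F + enorm v))"
    and "l2norm \<Omega> (ritz_error v) \<le> l2norm \<Omega> (\<lambda>x. v x - \<pi>h v x) + \<bar>CP\<bar> * (ritz_const * (lod_rate * (wnorm F + enorm v)))"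
proof -
  let ?g = "\<lambda>x. \<pi>h v x - E.proj n e v x"
  have g: "?g \<in> H10 \<Omega>" by (intro H10_diff ritz_h_H10 v proj_H10)
  have d: "(\<lambda>x. v x - \<pi>h v x) \<in> H10 \<Omega>" by (intro H10_diff ritz_h_H10 v)
  have H: "0 \<le> mesh_size TH" using coarse.mesh_size_pos by simp
  have "mesh_size TH * wnorm F + \<bar>Cloc\<bar> * \<mu> * enorm v \<le> (1 + \<bar>Cloc\<bar>) * (lod_rate * (wnorm F + enorm v))"
  proof -
    have "mesh_size TH * wnorm F \<le> lod_rate * (wnorm F + enorm v)"
      unfolding lod_rate_def using H mu_nonneg by (intro mult_mono) auto
    moreover have "\<mu> * enorm v \<le> lod_rate * (wnorm F + enorm v)"
      unfolding lod_rate_def using H mu_nonneg by (intro mult_mono) auto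
    then have "\<bar>Cloc\<bar> * (\<mu> * enorm v) \<le> \<bar>Cloc\<bar> * (lod_rate * (wnorm F + enorm v))" by (intro mult_left_mono) auto
    ultimately show ?thesis by (simp add: distrib_right mult.assoc)
  qed
  then have "stab_const * (mesh_size TH * wnorm F + \<bar>Cloc\<bar> * \<mu> * enorm v) \<le> ritz_const * (lod_rate * (wnorm F + enorm v))"
    unfolding ritz_const_def mult.assoc using stab_const_nonneg by (intro mult_left_mono) auto
  then have ge: "enorm ?g \<le> ritz_const * (lod_rate * (wnorm F + enorm v))"
    using ritz_ms_error[OF spans v F] eq by fastforce
  have re: "ritz_error v = (\<lambda>x. (v x - \<pi>h v x) + ?g x)" by (simp add: ritz_error_def)
  show "enorm (ritz_error v) \<le> enorm (\<lambda>x. v x - \<pi>h v x) + ritz_const * (lod_rate * (wnorm F + enorm v))"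
    using E.nrm_triangle[OF d g] ge unfolding re enorm_eq_nrm by linarith
  have "l2norm \<Omega> ?g \<le> \<bar>CP\<bar> * (ritz_const * (lod_rate * (wnorm F + enorm v)))"
    using l2norm_le_enorm[OF g] mult_left_mono[OF ge, of "\<bar>CP\<bar>"] by linarith
  then show "l2norm \<Omega> (ritz_error v) \<le> l2norm \<Omega> (\<lambda>x. v x - \<pi>h v x) + \<bar>CP\<bar> * (ritz_const * (lod_rate * (wnorm F + enorm v)))"
    using L2.nrm_triangle[OF H10_L2[OF d] H10_L2[OF g]] unfolding re l2norm_eq_nrm by linarith
qed

text \<open>The exceptional null set of times depends on \<open>w\<close>; since \<open>W\<close> has a finite basis, one null set serves
  for all of \<open>W\<close>.\<close>
lemma AE_all_W:
  assumes v: "AE t in time_measure T. v t \<in> H10 \<Omega>" and F: "AE t in time_measure T. F t \<in> L2 \<Omega>"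
    and eq: "\<And>w. w \<in> H10 \<Omega> \<Longrightarrow> AE t in time_measure T. energy (v t) w = l2ip \<Omega> (F t) w"
  shows "AE t in time_measure T. \<forall>w\<in>W. energy (v t) w = l2ip \<Omega> (F t) w"
proof -
  obtain k b where b: "E.spans W k b" using W_basis by blast
  have bo: "E.orthonormal k b" using b by (simp add: E.spans_def)
  have bH: "b i \<in> H10 \<Omega>" if "i < k" for i using bo that by (simp add: E.orthonormal_def)
  have "AE t in time_measure T. \<forall>i\<in>{..<k}. energy (v t) (b i) = l2ip \<Omega> (F t) (b i)"
    using eq bH by (subst AE_finite_all) auto
  then show ?thesis using v F
  proof eventually_elim
    case (elim t)
    show ?case
    proof
      fix w assume w: "w \<in> W"
      note wH = W_H10[OF w]
      have pH: "E.proj k b w \<in> H10 \<Omega>" by (rule E.proj_mem[OF bo])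
      have WH: "W \<subseteq> H10 \<Omega>" using W_H10 by blast
      have "energy (v t) w = energy w (v t)" by (rule E.ip_sym[OF elim(2) wH])
      also have "\<dots> = (\<Sum>i<k. energy w (b i) * energy (b i) (v t))"
        by (rule E.ip_spanned_expand[OF b WH w elim(2)])
      also have "\<dots> = (\<Sum>i<k. energy w (b i) * l2ip \<Omega> (F t) (b i))"
        using elim(1) E.ip_sym[OF elim(2) bH] by (intro sum.cong) auto
      also have "\<dots> = l2ip \<Omega> (F t) (E.proj k b w)"
        using L2.ip_comb_right[of "{..<k}" b \<Omega> "F t" "\<lambda>i. energy w (b i)"] bH elim(3)
        by (simp add: l2ip_eq_vip E.proj_def H10_L2)
      also have "\<dots> = l2ip \<Omega> (F t) w"
      proof -
        have "enorm (\<lambda>x. w x - E.proj k b w x) = 0" using b w by (simp add: E.spans_def enorm_eq_nrm)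
        then have "l2norm \<Omega> (\<lambda>x. w x - E.proj k b w x) = 0" by (rule enorm_zero_imp(1)[OF H10_diff[OF wH pH]])
        then have "l2ip \<Omega> (F t) (\<lambda>x. w x - E.proj k b w x) = 0"
          using l2ip_bound[OF elim(3) H10_L2[OF H10_diff[OF wH pH]]] by simp
        then show ?thesis using L2.ip_diff_right[OF H10_L2[OF wH] H10_L2[OF pH] elim(3)] by (simp add: l2ip_eq_vip)
      qed
      finally show "energy (v t) w = l2ip \<Omega> (F t) w" .
    qed
  qed
qed

text \<open>In the \<open>b\<close>-orthonormal basis the stiffness matrix is the identity and the mass matrix is the Gram
  matrix of the \<open>L\<^sup>2\<close> products. So \<open>X\<close> and \<open>Y\<close> are the coefficients of the velocity and of the
  position of a solution of the discrete wave equation with load \<open>G\<close>.\<close>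
lemma discrete_energy_estimate:
  fixes X' :: "nat \<Rightarrow> real \<Rightarrow> real" and G :: "real \<Rightarrow> 'a \<Rightarrow> real"
  assumes T: "0 < T" and X': "\<And>i. i < n \<Longrightarrow> integrable (time_measure T) (X' i)"
    and X: "\<And>i. X i = prim T (X' i)" and Y: "\<And>i. Y i = prim T (X i)"
    and G: "AE s in time_measure T. G s \<in> L2 \<Omega>"
    and eq: "\<And>i. i < n \<Longrightarrow> AE s in time_measure T. (\<Sum>j<n. l2ip \<Omega> (e i) (e j) * X' j s) + Y i s = l2ip \<Omega> (G s) (e i)"
    and \<gamma>: "integrable (time_measure T) \<gamma>" "\<And>s. 0 \<le> \<gamma> s"
    and b: "AE s in time_measure T. l2norm \<Omega> (G s) \<le> \<gamma> s" and t: "t \<in> {0..T}"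
  shows "l2norm \<Omega> (\<lambda>x. \<Sum>i<n. X i t * e i x) \<le> 2 * (LINT s|time_measure T. \<gamma> s)"
    and "enorm (\<lambda>x. \<Sum>i<n. Y i t * e i x) \<le> 2 * (LINT s|time_measure T. \<gamma> s)"
proof -
  define m where "m i j = l2ip \<Omega> (e i) (e j)" for i j
  have cL: "(\<lambda>x. \<Sum>i<n. c i * e i x) \<in> L2 \<Omega>" for c by (rule H10_L2[OF comb_H10])
  have nn: "(l2norm \<Omega> (\<lambda>x. \<Sum>i<n. c i * e i x))\<^sup>2 = (\<Sum>i<n. \<Sum>j<n. m i j * (c i * c j))" for c
  proof -
    have "(l2norm \<Omega> (\<lambda>x. \<Sum>i<n. c i * e i x))\<^sup>2 = vip \<Omega> (\<lambda>x. \<Sum>i<n. c i *\<^sub>R e i x) (\<lambda>x. \<Sum>i<n. c i * e i x)"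
      unfolding l2norm_eq_nrm by (simp add: L2.nrm_sq[OF cL])
    also have "\<dots> = (\<Sum>i<n. c i * vip \<Omega> (e i) (\<lambda>x. \<Sum>i<n. c i * e i x))"
      by (rule L2.ip_comb) (use e_L2 cL in auto)
    also have "\<dots> = (\<Sum>i<n. c i * (\<Sum>j<n. c j * m i j))"
    proof (intro sum.cong refl arg_cong2[where f="(*)"])
      fix i assume "i \<in> {..<n}"
      then show "vip \<Omega> (e i) (\<lambda>x. \<Sum>i<n. c i * e i x) = (\<Sum>j<n. c j * m i j)"
        using L2.ip_comb_right[of "{..<n}" e \<Omega> "e i" c] e_L2 by (simp add: m_def l2ip_eq_vip)
    qed
    finally show ?thesis by (simp add: sum_distrib_left mult_ac)
  qed
  then have ns: "sqrt (\<Sum>i<n. \<Sum>j<n. m i j * (c i * c j)) = l2norm \<Omega> (\<lambda>x. \<Sum>i<n. c i * e i x)" for c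
    unfolding nn[symmetric] by simp
  have sym: "m i j = m j i" if "i < n" "j < n" for i j
    unfolding m_def l2ip_eq_vip using that by (intro L2.ip_sym e_L2)
  have psd: "0 \<le> (\<Sum>i<n. \<Sum>j<n. m i j * (c i * c j))" for c unfolding nn[symmetric] by simp
  have eq': "AE s in time_measure T. \<forall>i<n. (\<Sum>j<n. m i j * X' j s) + Y i s = l2ip \<Omega> (G s) (e i)"
  proof -
    have "AE s in time_measure T. \<forall>i\<in>{..<n}. (\<Sum>j<n. m i j * X' j s) + Y i s = l2ip \<Omega> (G s) (e i)"
      using eq by (subst AE_finite_all) (auto simp: m_def)
    then show ?thesis by eventually_elim auto
  qed
  have bound: "AE s in time_measure T. (\<Sum>i<n. X i s * l2ip \<Omega> (G s) (e i)) \<le> \<gamma> s * sqrt (\<Sum>i<n. \<Sum>j<n. m i j * (X i s * X j s))"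
    using G b
  proof eventually_elim
    case (elim s)
    have "(\<Sum>i<n. X i s * l2ip \<Omega> (G s) (e i)) = l2ip \<Omega> (G s) (\<lambda>x. \<Sum>i<n. X i s * e i x)"
      using L2.ip_comb_right[of "{..<n}" e \<Omega> "G s" "\<lambda>i. X i s"] e_L2 elim(1) by (simp add: l2ip_eq_vip)
    also have "\<dots> \<le> l2norm \<Omega> (G s) * l2norm \<Omega> (\<lambda>x. \<Sum>i<n. X i s * e i x)"
      using l2ip_bound[OF elim(1) cL[of "\<lambda>i. X i s"]] by linarith
    also have "\<dots> \<le> \<gamma> s * l2norm \<Omega> (\<lambda>x. \<Sum>i<n. X i s * e i x)" using elim(2) by (intro mult_right_mono) auto
    finally show ?case by (simp add: ns)
  qed
  note est = coefficient_energy_estimate[OF T sym psd X' X Y eq' \<gamma> bound t]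
  show "l2norm \<Omega> (\<lambda>x. \<Sum>i<n. X i t * e i x) \<le> 2 * (LINT s|time_measure T. \<gamma> s)"
    using est(1) by (simp add: ns)
  have "(enorm (\<lambda>x. \<Sum>i<n. Y i t * e i x))\<^sup>2 = (\<Sum>i<n. (Y i t)\<^sup>2)"
    using E.nrm_comb[OF ortho, of "\<lambda>i. Y i t"] by (simp add: enorm_eq_nrm)
  then have "enorm (\<lambda>x. \<Sum>i<n. Y i t * e i x) = sqrt (\<Sum>i<n. (Y i t)\<^sup>2)"
    by (intro real_sqrt_unique[symmetric]) simp_all
  then show "enorm (\<lambda>x. \<Sum>i<n. Y i t * e i x) \<le> 2 * (LINT s|time_measure T. \<gamma> s)"
    using est(2) by simp
qed

end

section \<open>The wave equation and the error equations\<close>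

locale wave_setting = lod_basis +
  fixes T :: real and f :: "real \<Rightarrow> 'a \<Rightarrow> real" and u0 v0 u0d v0d :: "'a \<Rightarrow> real"
    and u ut U Ut :: "real \<Rightarrow> 'a \<Rightarrow> real"
  assumes T: "0 < T" and f: "f \<in> Lp_L2 2 T \<Omega>" and u0: "u0 \<in> H10 \<Omega>" and v0: "v0 \<in> L2 \<Omega>"
    and weak: "weak_solution \<Omega> T a f u0 v0 u" and u_dt: "has_dt T \<Omega> u ut"
    and u0d: "ritz_proj \<Omega> a V u0 u0d"
    and lod: "lod_solution \<Omega> T a f TH \<C>K u0d v0d U" and U_dt: "has_dt T \<Omega> U Ut"
begin

lemma u_H10: "u \<in> Lp_H10 2 T \<Omega>" using weak by (simp add: weak_solution_def)

lemma l2ip_zero_diff: assumes "x \<in> L2 \<Omega>" "y \<in> L2 \<Omega>" "l2norm \<Omega> (\<lambda>s. x s - y s) = 0" "v \<in> L2 \<Omega>"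
  shows "l2ip \<Omega> x v = l2ip \<Omega> y v"
proof -
  have "\<bar>l2ip \<Omega> (\<lambda>s. x s - y s) v\<bar> \<le> 0" using l2ip_bound[OF L2_diff[OF assms(1,2)] assms(4)] assms(3) by simp
  then show ?thesis using L2.ip_diff[OF assms(1,2,4)] by (simp add: l2ip_eq_vip)
qed

text \<open>The second time derivative of a weak solution has values in \<open>H\<^sup>-\<^sup>1\<close>. If the second derivative \<open>utt\<close>
  exists in \<open>L\<^sup>2\<close>, both pairings with \<open>v\<close> are weak derivatives of the same scalar function, hence
  equal.\<close>
lemma wave_equation:
  assumes utt: "has_dt T \<Omega> ut utt" and v: "v \<in> H10 \<Omega>"
  shows "AE t in time_measure T. l2ip \<Omega> (utt t) v + energy (u t) v = l2ip \<Omega> (f t) v"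
    and "AE t in time_measure T. l2ip \<Omega> (ut t) v = l2ip \<Omega> v0 v + prim T (\<lambda>s. l2ip \<Omega> (utt s) v) t"
proof -
  obtain ut' utt' where ut': "has_dt T \<Omega> u ut'"
    and w: "weak_time_deriv T (H10 \<Omega>) (\<lambda>t. l2ip \<Omega> (ut' t)) utt'"
    and eq: "\<forall>v\<in>H10 \<Omega>. AE t in time_measure T. utt' t v + energy (u t) v = l2ip \<Omega> (f t) v"
    and ini: "has_initial_value T (Hm1 \<Omega>) (hm1norm \<Omega>) (\<lambda>t. l2ip \<Omega> (ut' t)) (l2ip \<Omega> v0)"
    using weak unfolding weak_solution_def by blast
  note D = has_dtD[OF utt] and D' = has_dtD[OF ut'] and vL = H10_L2[OF v]
  have "AE t in time_measure T. l2norm \<Omega> (\<lambda>x. ut' t x - ut t x) = 0" by (rule has_dt_unique[OF T ut' u_dt])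
  then have ee: "AE t in time_measure T. \<forall>v\<in>L2 \<Omega>. l2ip \<Omega> (ut' t) v = l2ip \<Omega> (ut t) v"
    using Lp_bochner_AE[OF D(1)] Lp_bochner_AE[OF D'(2)]
    by eventually_elim (auto intro: l2ip_zero_diff)
  show "AE t in time_measure T. l2ip \<Omega> (ut t) v = l2ip \<Omega> v0 v + prim T (\<lambda>s. l2ip \<Omega> (utt s) v) t"
    by (rule Hm1_initial_value[OF T utt ini ee v])
  define F where "F t = l2ip \<Omega> (f t) v - energy (u t) v" for t
  have iF: "integrable (time_measure T) F" unfolding F_def
    by (intro Bochner_Integration.integrable_diff Lp_L2_integrable_ip[OF f _ vL] energy_integrable[OF u_H10 _ v]) auto
  have aeF: "AE t in time_measure T. utt' t v = F t"
    using eq v unfolding F_def by (auto elim: eventually_mono)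
  have "AE t in time_measure T. l2ip \<Omega> (utt t) v = F t"
  proof (rule weak_derivative_unique[OF T Lp_L2_integrable_ip[OF D(1) _ vL] Lp_L2_integrable_ip[OF D(2) _ vL] iF D(3)[OF vL]])
    fix \<phi> assume \<phi>: "\<phi> \<in> test_functions {0<..<T}"
    note [measurable] = test_measurable[OF \<phi>] test_measurable[OF time_test_deriv(1)[OF \<phi>]]
      borel_measurable_integrable[OF iF] borel_measurable_integrable[OF Lp_L2_integrable_ip[OF D(1) _ vL]]
      borel_measurable_integrable[OF Lp_L2_integrable_ip[OF D'(2) _ vL]]
    have mu: "(\<lambda>t. utt' t v) \<in> borel_measurable (time_measure T)"
      by (rule measurable_AE_cong[OF _ _ aeF]) auto
    note [measurable] = mu
    have "(LINT t|time_measure T. deriv \<phi> t * l2ip \<Omega> (ut t) v) = (LINT t|time_measure T. deriv \<phi> t * l2ip \<Omega> (ut' t) v)"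
      by (rule integral_cong_AE) (measurable, use ee vL in \<open>auto elim: eventually_mono\<close>)
    also have "\<dots> = - (LINT t|time_measure T. \<phi> t * utt' t v)"
      using w \<phi> v unfolding weak_time_deriv_def by blast
    also have "(LINT t|time_measure T. \<phi> t * utt' t v) = (LINT t|time_measure T. \<phi> t * F t)"
      by (rule integral_cong_AE) (measurable, use aeF in \<open>auto elim: eventually_mono\<close>)
    finally show "(LINT t|time_measure T. deriv \<phi> t * l2ip \<Omega> (ut t) v) = - (LINT t|time_measure T. \<phi> t * F t)" .
  qed auto
  then show "AE t in time_measure T. l2ip \<Omega> (utt t) v + energy (u t) v = l2ip \<Omega> (f t) v"
    by eventually_elim (simp add: F_def)
qed

lemma u_initial: assumes "v \<in> L2 \<Omega>"
  shows "AE t in time_measure T. l2ip \<Omega> (u t) v = l2ip \<Omega> u0 v + prim T (\<lambda>s. l2ip \<Omega> (ut s) v) t"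
  using L2_initial_value[OF T u_dt _ assms] weak unfolding weak_solution_def by blast

lemma u_energy: assumes "ut \<in> Lp_H10 q T \<Omega>" "q \<in> {1, 2, \<infinity>}" "w \<in> H10 \<Omega>"
  shows "AE t in time_measure T. energy (u t) w = energy u0 w + prim T (\<lambda>s. energy (ut s) w) t"
  by (rule energy_prim[OF T u_H10 assms(1,2) u0 u_initial[OF test_L2'] assms(3)])

lemma ut_energy:
  assumes "has_dt T \<Omega> ut utt" "ut \<in> Lp_H10 p T \<Omega>" "utt \<in> Lp_H10 q T \<Omega>" "q \<in> {1, 2, \<infinity>}" "v0 \<in> H10 \<Omega>" "w \<in> H10 \<Omega>"
  shows "AE t in time_measure T. energy (ut t) w = energy v0 w + prim T (\<lambda>s. energy (utt s) w) t"
  by (rule energy_prim[OF T assms(2,3,4,5) wave_equation(2)[OF assms(1) test_H10] assms(6)])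

text \<open>Two primitives that agree almost everywhere have integrands that agree almost everywhere.\<close>
lemma differentiate_elliptic:
  assumes w: "w \<in> L2 \<Omega>" and p: "integrable (time_measure T) p" "AE t in time_measure T. P t = c + prim T p t"
    and g: "has_dt T \<Omega> g gt" and h: "has_dt T \<Omega> h ht"
    and eq: "AE t in time_measure T. P t = l2ip \<Omega> (\<lambda>x. g t x - h t x) w"
  shows "AE t in time_measure T. p t = l2ip \<Omega> (\<lambda>x. gt t x - ht t x) w"
proof -
  note G = has_dtD[OF g] and H = has_dtD[OF h]
  note ig = Lp_L2_integrable_ip[OF G(2) _ w] and ih = Lp_L2_integrable_ip[OF H(2) _ w]
  obtain cg where cg: "AE t in time_measure T. l2ip \<Omega> (g t) w = cg + prim T (\<lambda>s. l2ip \<Omega> (gt s) w) t"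
    by (rule has_dt_prim[OF T g w])
  obtain ch where ch: "AE t in time_measure T. l2ip \<Omega> (h t) w = ch + prim T (\<lambda>s. l2ip \<Omega> (ht s) w) t"
    by (rule has_dt_prim[OF T h w])
  have "AE t in time_measure T. c + prim T p t = (cg - ch) + prim T (\<lambda>s. l2ip \<Omega> (gt s) w - l2ip \<Omega> (ht s) w) t"
    using p(2) eq cg ch Lp_bochner_AE[OF G(1)] Lp_bochner_AE[OF H(1)]
  proof eventually_elim
    case (elim t)
    then show ?case using L2.ip_diff[OF elim(5,6) w] ig ih by (simp add: l2ip_eq_vip prim_diff)
  qed
  then have "AE t in time_measure T. p t = l2ip \<Omega> (gt t) w - l2ip \<Omega> (ht t) w"
    by (rule prim_eq_imp(2)[OF T p(1), rotated]) (use ig ih in auto)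
  then show ?thesis using Lp_bochner_AE[OF G(2)] Lp_bochner_AE[OF H(2)]
    by eventually_elim (simp add: l2ip_eq_vip L2.ip_diff w)
qed

lemma elliptic_0: assumes "has_dt T \<Omega> ut utt" "w \<in> H10 \<Omega>"
  shows "AE t in time_measure T. energy (u t) w = l2ip \<Omega> (\<lambda>x. f t x - utt t x) w"
  using wave_equation(1)[OF assms] Lp_bochner_AE[OF f] Lp_bochner_AE[OF has_dtD(2)[OF assms(1)]]
proof eventually_elim
  case (elim t)
  then show ?case using L2.ip_diff[OF elim(2,3) H10_L2[OF assms(2)]] by (simp add: l2ip_eq_vip)
qed

lemma elliptic_1: assumes "has_dt T \<Omega> ut utt" "has_dt T \<Omega> utt uttt" "has_dt T \<Omega> f ft"
  "ut \<in> Lp_H10 q T \<Omega>" "q \<in> {1, 2, \<infinity>}" "w \<in> H10 \<Omega>"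
  shows "AE t in time_measure T. energy (ut t) w = l2ip \<Omega> (\<lambda>x. ft t x - uttt t x) w"
  by (rule differentiate_elliptic[OF H10_L2[OF assms(6)] energy_integrable[OF assms(4-6)] u_energy[OF assms(4-6)]
        assms(3,2) elliptic_0[OF assms(1,6)]])

lemma elliptic_2: assumes "has_dt T \<Omega> ut utt" "has_dt T \<Omega> utt uttt" "has_dt T \<Omega> uttt utttt"
  "has_dt T \<Omega> f ft" "has_dt T \<Omega> ft ftt"
  "ut \<in> Lp_H10 p T \<Omega>" "p \<in> {1, 2, \<infinity>}" "utt \<in> Lp_H10 q T \<Omega>" "q \<in> {1, 2, \<infinity>}" "v0 \<in> H10 \<Omega>" "w \<in> H10 \<Omega>"
  shows "AE t in time_measure T. energy (utt t) w = l2ip \<Omega> (\<lambda>x. ftt t x - utttt t x) w"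
  by (rule differentiate_elliptic[OF H10_L2[OF assms(11)] energy_integrable[OF assms(8,9,11)]
        ut_energy[OF assms(1,6,8,9,10,11)] assms(5,3) elliptic_1[OF assms(1,2,4,6,7,11)]])

lemma ritz_error_AE_bounds:
  assumes v: "v \<in> Lp_H10 p T \<Omega>" and g: "g \<in> Lp_L2 q T \<Omega>" and h: "h \<in> Lp_L2 r T \<Omega>"
    and eq: "\<forall>w\<in>H10 \<Omega>. AE t in time_measure T. energy (v t) w = l2ip \<Omega> (\<lambda>x. g t x - h t x) w"
  shows "AE t in time_measure T.
      enorm (ritz_error (v t)) \<le> enorm (\<lambda>x. v t x - \<pi>h (v t) x) + ritz_const * (lod_rate * (wnorm (\<lambda>x. h t x - g t x) + enorm (v t)))
      \<and> l2norm \<Omega> (ritz_error (v t)) \<le> l2norm \<Omega> (\<lambda>x. v t x - \<pi>h (v t) x)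
        + \<bar>CP\<bar> * (ritz_const * (lod_rate * (wnorm (\<lambda>x. h t x - g t x) + enorm (v t))))"
proof -
  have F: "AE t in time_measure T. (\<lambda>x. g t x - h t x) \<in> L2 \<Omega>"
    by (rule Lp_L2_measurable_diff(2)[OF g h])
  have "AE t in time_measure T. \<forall>w\<in>W. energy (v t) w = l2ip \<Omega> (\<lambda>x. g t x - h t x) w"
    by (rule AE_all_W[OF Lp_bochner_AE[OF v] F bspec[OF eq]])
  then show ?thesis using F Lp_bochner_AE[OF v]
    by eventually_elim (subst (1 2) wnorm_minus, intro conjI ritz_error_bounds)
qed

text \<open>The velocity \<open>Ut'\<close> comes with the discrete solution and is regular in time and space; uniqueness of
  weak derivatives identifies it with \<open>Ut\<close>. Products with fixed functions turn the initial conditions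
  into identities between primitives.\<close>
lemma discrete_solution:
  obtains Utt Ut' where "U \<in> Lp_H10 2 T \<Omega>" "Ut' \<in> Lp_H10 2 T \<Omega>" "Utt \<in> Lp_H10 2 T \<Omega>"
    "AE t in time_measure T. U t \<in> V" "AE t in time_measure T. Ut' t \<in> V" "AE t in time_measure T. Utt t \<in> V"
    "has_dt T \<Omega> U Ut'" "has_dt T \<Omega> Ut' Utt"
    "\<And>w. w \<in> V \<Longrightarrow> AE t in time_measure T. l2ip \<Omega> (Utt t) w + energy (U t) w = l2ip \<Omega> (f t) w"
    "\<And>v. v \<in> L2 \<Omega> \<Longrightarrow> AE t in time_measure T. l2ip \<Omega> (U t) v = l2ip \<Omega> u0d v + prim T (\<lambda>s. l2ip \<Omega> (Ut' s) v) t"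
    "\<And>v. v \<in> L2 \<Omega> \<Longrightarrow> AE t in time_measure T. l2ip \<Omega> (Ut' t) v = l2ip \<Omega> v0d v + prim T (\<lambda>s. l2ip \<Omega> (Utt s) v) t"
    "AE t in time_measure T. l2norm \<Omega> (\<lambda>x. Ut t x - Ut' t x) = 0" "v0d \<in> L2 \<Omega>"
proof -
  obtain Ut' Utt where h: "H2_bochner T \<Omega> V U Ut' Utt"
    and eq: "\<forall>w\<in>V. AE t in time_measure T. l2ip \<Omega> (Utt t) w + energy (U t) w = l2ip \<Omega> (f t) w"
    and i: "has_initial_value T (L2 \<Omega>) (l2norm \<Omega>) U u0d" "has_initial_value T (L2 \<Omega>) (l2norm \<Omega>) Ut' v0d"
    using lod unfolding lod_solution_def by blast
  have B: "U \<in> Lp_bochner 2 T V (h1norm \<Omega>)" "Ut' \<in> Lp_bochner 2 T V (h1norm \<Omega>)" "Utt \<in> Lp_bochner 2 T V (h1norm \<Omega>)"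
    and d: "has_dt T \<Omega> U Ut'" "has_dt T \<Omega> Ut' Utt" using h by (auto simp: H2_bochner_def)
  show thesis
    by (rule that[OF B[THEN Lp_bochner_subspace[OF _ V_sub]] B[THEN Lp_bochner_AE] d bspec[OF eq]
          L2_initial_value[OF T d(1) i(1)] L2_initial_value[OF T d(2) i(2)] has_dt_unique[OF T U_dt d(1)]])
      (use i(2) in \<open>auto simp: has_initial_value_def\<close>)
qed

lemma proj_V: assumes "v \<in> V" shows "E.proj n e v \<in> H10 \<Omega>" "l2norm \<Omega> (\<lambda>x. v x - E.proj n e v x) = 0"
  using proj_H10 ritz_error_V(2)[OF assms] by (auto simp: ritz_error_def)

text \<open>The Gram matrix of the basis in \<open>L\<^sup>2\<close> maps the energy coefficients of a function to the \<open>L\<^sup>2\<close> products of its Ritz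
  projection. This turns the discrete wave equation into one for coefficients.\<close>
lemma gram: assumes v: "v \<in> H10 \<Omega>" and i: "i < n"
  shows "(\<Sum>j<n. l2ip \<Omega> (e i) (e j) * energy v (e j)) = l2ip \<Omega> (E.proj n e v) (e i)"
  using L2.ip_comb[of "{..<n}" e \<Omega> "e i" "\<lambda>j. energy v (e j)"] e_L2 i L2.ip_sym[OF e_L2 e_L2]
  by (simp add: E.proj_def l2ip_eq_vip mult.commute)

lemma u0d_H10: "u0d \<in> H10 \<Omega>" and u0d_orth: "w \<in> V \<Longrightarrow> energy u0d w = energy u0 w"
proof -
  show *: "u0d \<in> H10 \<Omega>" using u0d V_H10 by (auto simp: ritz_proj_def)
  show "energy u0d w = energy u0 w" if "w \<in> V" using u0d that E.ip_diff[OF u0 * V_H10[OF that]] by (simp add: ritz_proj_def)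
qed

lemma Lp_diff_AE: assumes "x \<in> Lp_H10 p T \<Omega>" "y \<in> Lp_H10 q T \<Omega>"
  shows "AE t in time_measure T. x t \<in> H10 \<Omega> \<and> y t \<in> H10 \<Omega>"
  using Lp_bochner_AE[OF assms(1)] Lp_bochner_AE[OF assms(2)] by eventually_elim simp

text \<open>The coefficients \<open>c\<close> are those of \<open>w - R v\<close>, because a function and its Ritz projection have the same
  coefficients.\<close>
lemma split_error:
  assumes v: "v \<in> H10 \<Omega>" and w: "w \<in> V" and c: "\<And>i. i < n \<Longrightarrow> energy w (e i) - energy v (e i) = c i"
  shows "l2norm \<Omega> (\<lambda>x. v x - w x) \<le> l2norm \<Omega> (ritz_error v) + l2norm \<Omega> (\<lambda>x. \<Sum>i<n. c i * e i x)"
    and "enorm (\<lambda>x. v x - w x) \<le> enorm (ritz_error v) + enorm (\<lambda>x. \<Sum>i<n. c i * e i x)"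
proof -
  note wH = V_H10[OF w]
  have cs: "(\<lambda>x. \<Sum>i<n. c i * e i x) = (\<lambda>x. E.proj n e w x - E.proj n e v x)"
    unfolding E.proj_def using c by (intro ext) (simp add: sum_subtractf[symmetric] left_diff_distrib[symmetric])
  have id: "(\<lambda>x. v x - w x) = (\<lambda>x. (ritz_error v x - ritz_error w x) - (\<Sum>i<n. c i * e i x))"
    unfolding fun_cong[OF cs] by (auto simp: ritz_error_def)
  note R = ritz_error_H10[OF v] ritz_error_H10[OF wH]
  have "l2norm \<Omega> (\<lambda>x. (ritz_error v x - ritz_error w x) - (\<Sum>i<n. c i * e i x))
      \<le> l2norm \<Omega> (\<lambda>x. ritz_error v x - ritz_error w x) + l2norm \<Omega> (\<lambda>x. \<Sum>i<n. c i * e i x)"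
    unfolding l2norm_eq_nrm by (intro L2.nrm_diff_triangle H10_L2 H10_diff R comb_H10)
  also have "l2norm \<Omega> (\<lambda>x. ritz_error v x - ritz_error w x) \<le> l2norm \<Omega> (ritz_error v) + l2norm \<Omega> (ritz_error w)"
    unfolding l2norm_eq_nrm by (intro L2.nrm_diff_triangle H10_L2 R)
  finally show "l2norm \<Omega> (\<lambda>x. v x - w x) \<le> l2norm \<Omega> (ritz_error v) + l2norm \<Omega> (\<lambda>x. \<Sum>i<n. c i * e i x)"
    unfolding id using ritz_error_V(2)[OF w] by simp
  have "enorm (\<lambda>x. (ritz_error v x - ritz_error w x) - (\<Sum>i<n. c i * e i x))
      \<le> enorm (\<lambda>x. ritz_error v x - ritz_error w x) + enorm (\<lambda>x. \<Sum>i<n. c i * e i x)"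
    unfolding enorm_eq_nrm by (intro E.nrm_diff_triangle H10_diff R comb_H10)
  also have "enorm (\<lambda>x. ritz_error v x - ritz_error w x) \<le> enorm (ritz_error v) + enorm (ritz_error w)"
    unfolding enorm_eq_nrm by (intro E.nrm_diff_triangle R)
  finally show "enorm (\<lambda>x. v x - w x) \<le> enorm (ritz_error v) + enorm (\<lambda>x. \<Sum>i<n. c i * e i x)"
    unfolding id using ritz_error_V(1)[OF w] by simp
qed

text \<open>The equation of the discrete error is integrated in time once: the energy estimate is applied with
  velocity \<open>\<theta> = U - R u\<close> and load \<open>u' - R u' - r\<close>, so that bounding \<open>\<theta>\<close> in \<open>L\<^sup>2\<close> takes one time
  derivative of \<open>u\<close> only. The function \<open>r\<close> represents the error of the initial velocity on \<open>V\<close>.\<close>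
lemma error_L2:
  assumes utt: "has_dt T \<Omega> ut utt" and ut: "ut \<in> Lp_H10 q T \<Omega>" "q \<in> {1, 2, \<infinity>}"
    and c0: "0 \<le> c0" "\<forall>w\<in>V. l2ip \<Omega> (\<lambda>x. v0 x - v0d x) w = l2ip \<Omega> r w" "r \<in> L2 \<Omega>" "l2norm \<Omega> r \<le> c0"
  shows "AE t in time_measure T. l2norm \<Omega> (\<lambda>x. u t x - U t x)
    \<le> l2norm \<Omega> (ritz_error (u t)) + 2 * ((LINT s|time_measure T. l2norm \<Omega> (ritz_error (ut s))) + T * c0)"
proof -
  let ?M = "time_measure T"
  interpret finite_measure ?M by (rule time_finite)
  obtain Utt Ut' where U: "U \<in> Lp_H10 2 T \<Omega>" "Ut' \<in> Lp_H10 2 T \<Omega>" "Utt \<in> Lp_H10 2 T \<Omega>"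
    and UV: "AE t in ?M. U t \<in> V" "AE t in ?M. Ut' t \<in> V" "AE t in ?M. Utt t \<in> V"
    and dU: "has_dt T \<Omega> U Ut'" "has_dt T \<Omega> Ut' Utt"
    and eqU: "\<And>w. w \<in> V \<Longrightarrow> AE t in ?M. l2ip \<Omega> (Utt t) w + energy (U t) w = l2ip \<Omega> (f t) w"
    and iU: "\<And>v. v \<in> L2 \<Omega> \<Longrightarrow> AE t in ?M. l2ip \<Omega> (U t) v = l2ip \<Omega> u0d v + prim T (\<lambda>s. l2ip \<Omega> (Ut' s) v) t"
      "\<And>v. v \<in> L2 \<Omega> \<Longrightarrow> AE t in ?M. l2ip \<Omega> (Ut' t) v = l2ip \<Omega> v0d v + prim T (\<lambda>s. l2ip \<Omega> (Utt s) v) t"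
    and v0d: "v0d \<in> L2 \<Omega>"
    by (rule discrete_solution) (rule that)
  note Dut = has_dtD[OF utt] and DUt = has_dtD[OF dU(2)]
  define X' where "X' i s = energy (Ut' s) (e i) - energy (ut s) (e i)" for i s
  define X where "X i = prim T (X' i)" for i
  define Y where "Y i = prim T (X i)" for i
  have two: "(2::ennreal) \<in> {1, 2, \<infinity>}" by simp
  have iX': "integrable ?M (X' i)" if "i < n" for i
    unfolding X'_def by (intro Bochner_Integration.integrable_diff energy_integrable[OF U(2) two] energy_integrable[OF ut] e_H10 that)
  have U_energy: "AE t in ?M. energy (U t) w = energy u0d w + prim T (\<lambda>s. energy (Ut' s) w) t" if "w \<in> H10 \<Omega>" for w
    by (rule energy_prim[OF T U(1,2) two u0d_H10 iU(1)[OF test_L2'] that])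
  have Xeq: "AE t in ?M. energy (U t) (e i) - energy (u t) (e i) = X i t" if i: "i < n" for i
    using U_energy[OF e_H10[OF i]] u_energy[OF ut e_H10[OF i]]
  proof eventually_elim
    case (elim t)
    then show ?case
      using u0d_orth[OF e_V[OF i]]
        prim_diff[OF energy_integrable[OF U(2) two e_H10[OF i]] energy_integrable[OF ut e_H10[OF i]]]
      by (simp add: X_def X'_def[abs_def])
  qed
  define G where "G s = (\<lambda>x. ritz_error (ut s) x - r x)" for s
  \<comment> \<open>The difference of the two wave equations, integrated in time.\<close>
  have Yeq: "AE t in ?M. l2ip \<Omega> (\<lambda>x. ut t x - Ut' t x) (e i) = l2ip \<Omega> r (e i) + Y i t" if i: "i < n" for i
  proof -
    note eL = e_L2[OF i]
    note i1 = Lp_L2_integrable_ip[OF Dut(2) _ eL] and i2 = Lp_L2_integrable_ip[OF DUt(2) _ eL]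
    have d: "AE s in ?M. l2ip \<Omega> (utt s) (e i) - l2ip \<Omega> (Utt s) (e i) = X i s"
      using wave_equation(1)[OF utt e_H10[OF i]] eqU[OF e_V[OF i]] Xeq[OF i] by eventually_elim simp
    have pY: "prim T (\<lambda>s. l2ip \<Omega> (utt s) (e i)) t - prim T (\<lambda>s. l2ip \<Omega> (Utt s) (e i)) t = Y i t" for t
    proof -
      have "prim T (\<lambda>s. l2ip \<Omega> (utt s) (e i) - l2ip \<Omega> (Utt s) (e i)) t = Y i t"
        unfolding Y_def X_def
      proof (rule prim_cong)
        show "AE s in ?M. l2ip \<Omega> (utt s) (e i) - l2ip \<Omega> (Utt s) (e i) = prim T (X' i) s" using d by (simp add: X_def)
        show "(\<lambda>s. l2ip \<Omega> (utt s) (e i) - l2ip \<Omega> (Utt s) (e i)) \<in> borel_measurable ?M"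
          using i1 i2 by (intro borel_measurable_diff borel_measurable_integrable) auto
      qed (rule prim_measurable[OF iX'[OF i]])
      then show ?thesis using i1 i2 by (simp add: prim_diff)
    qed
    show ?thesis
      using wave_equation(2)[OF utt e_H10[OF i]] iU(2)[OF eL] Lp_bochner_AE[OF Dut(1)] Lp_bochner_AE[OF DUt(1)]
    proof eventually_elim
      case (elim t)
      have "l2ip \<Omega> (\<lambda>x. ut t x - Ut' t x) (e i) = l2ip \<Omega> (ut t) (e i) - l2ip \<Omega> (Ut' t) (e i)"
        using L2.ip_diff[OF elim(3,4) eL] by (simp add: l2ip_eq_vip)
      also have "\<dots> = (l2ip \<Omega> v0 (e i) - l2ip \<Omega> v0d (e i)) + Y i t" using elim(1,2) pY[of t] by simp
      also have "l2ip \<Omega> v0 (e i) - l2ip \<Omega> v0d (e i) = l2ip \<Omega> r (e i)"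
        using bspec[OF c0(2) e_V[OF i]] L2.ip_diff[OF v0 v0d eL] by (simp add: l2ip_eq_vip)
      finally show ?case .
    qed
  qed
  have eq: "AE s in ?M. (\<Sum>j<n. l2ip \<Omega> (e i) (e j) * X' j s) + Y i s = l2ip \<Omega> (G s) (e i)" if i: "i < n" for i
    using Yeq[OF i] Lp_diff_AE[OF ut(1) U(2)] UV(2)
  proof eventually_elim
    case (elim s)
    then have H: "ut s \<in> H10 \<Omega>" "Ut' s \<in> H10 \<Omega>" by auto
    note eL = e_L2[OF i] and L = H10_L2[OF H(1)] H10_L2[OF H(2)]
    have "(\<Sum>j<n. l2ip \<Omega> (e i) (e j) * X' j s) = l2ip \<Omega> (E.proj n e (Ut' s)) (e i) - l2ip \<Omega> (E.proj n e (ut s)) (e i)"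
      unfolding X'_def using gram[OF H(1) i] gram[OF H(2) i] by (simp add: right_diff_distrib sum_subtractf)
    also have "l2ip \<Omega> (E.proj n e (Ut' s)) (e i) = l2ip \<Omega> (Ut' s) (e i)"
      using l2ip_zero_diff[OF L(2) H10_L2[OF proj_H10] proj_V(2)[OF elim(3)] eL] by simp
    finally have 1: "(\<Sum>j<n. l2ip \<Omega> (e i) (e j) * X' j s) = l2ip \<Omega> (Ut' s) (e i) - l2ip \<Omega> (E.proj n e (ut s)) (e i)" .
    have "l2ip \<Omega> (G s) (e i) = l2ip \<Omega> (ritz_error (ut s)) (e i) - l2ip \<Omega> r (e i)"
      unfolding G_def using L2.ip_diff[OF H10_L2[OF ritz_error_H10[OF H(1)]] c0(3) eL] by (simp add: l2ip_eq_vip)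
    also have "l2ip \<Omega> (ritz_error (ut s)) (e i) = l2ip \<Omega> (ut s) (e i) - l2ip \<Omega> (E.proj n e (ut s)) (e i)"
      unfolding ritz_error_def using L2.ip_diff[OF L(1) H10_L2[OF proj_H10] eL] by (simp add: l2ip_eq_vip)
    also have "l2ip \<Omega> (ut s) (e i) = l2ip \<Omega> (Ut' s) (e i) + l2ip \<Omega> r (e i) + Y i s"
      using elim(1) L2.ip_diff[OF L eL] by (simp add: l2ip_eq_vip)
    finally show ?case using 1 by simp
  qed
  have rI: "integrable ?M (\<lambda>s. l2norm \<Omega> (ritz_error (ut s)))" by (rule ritz_error_integrable[OF ut])
  have GL: "AE s in ?M. G s \<in> L2 \<Omega>"
    using Lp_bochner_AE[OF ut(1)] unfolding G_def by eventually_elim (intro L2_diff H10_L2 ritz_error_H10 c0(3))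
  have Gb: "AE s in ?M. l2norm \<Omega> (G s) \<le> l2norm \<Omega> (ritz_error (ut s)) + c0"
    using Lp_bochner_AE[OF ut(1)] unfolding G_def
  proof eventually_elim
    case (elim s)
    show ?case using L2.nrm_diff_triangle[OF H10_L2[OF ritz_error_H10[OF elim]] c0(3)] c0(4) unfolding l2norm_eq_nrm by linarith
  qed
  have Gi: "integrable ?M (\<lambda>s. l2norm \<Omega> (ritz_error (ut s)) + c0)" using rI by simp
  note est = discrete_energy_estimate(1)[OF T iX' X_def Y_def GL eq Gi _ Gb]
  have "(LINT s|?M. l2norm \<Omega> (ritz_error (ut s)) + c0) = (LINT s|?M. l2norm \<Omega> (ritz_error (ut s))) + T * c0"
    using rI T by (simp add: measure_restrict_space)
  then have est': "l2norm \<Omega> (\<lambda>x. \<Sum>i<n. X i t * e i x) \<le> 2 * ((LINT s|?M. l2norm \<Omega> (ritz_error (ut s))) + T * c0)"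
    if "t \<in> {0..T}" for t using est[OF _ _ _ that] c0(1) by simp
  have "AE t in ?M. \<forall>i\<in>{..<n}. energy (U t) (e i) - energy (u t) (e i) = X i t"
    using Xeq by (subst AE_finite_all) auto
  then show ?thesis using Lp_bochner_AE[OF u_H10] UV(1) AE_space
  proof eventually_elim
    case (elim t)
    have "l2norm \<Omega> (\<lambda>x. u t x - U t x) \<le> l2norm \<Omega> (ritz_error (u t)) + l2norm \<Omega> (\<lambda>x. \<Sum>i<n. X i t * e i x)"
      by (rule split_error(1)[OF elim(2,3)]) (use elim(1) in auto)
    then show ?case using est'[of t] elim(4) by simp
  qed
qed

text \<open>The discrete error solves the discrete wave equation with load \<open>u'' - R u''\<close>. Its initial values
  vanish, because both discrete initial values are Ritz projections.\<close>
lemma error_energy: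
  assumes utt: "has_dt T \<Omega> ut utt" and ut: "ut \<in> Lp_H10 p T \<Omega>" "p \<in> {1, 2, \<infinity>}"
    and uttH: "utt \<in> Lp_H10 q T \<Omega>" "q \<in> {1, 2, \<infinity>}"
    and v0d: "ritz_proj \<Omega> a V v0 v0d"
  shows "AE t in time_measure T. l2norm \<Omega> (\<lambda>x. ut t x - Ut t x)
    \<le> l2norm \<Omega> (ritz_error (ut t)) + 2 * (LINT s|time_measure T. l2norm \<Omega> (ritz_error (utt s)))"
    and "AE t in time_measure T. enorm (\<lambda>x. u t x - U t x)
    \<le> enorm (ritz_error (u t)) + 2 * (LINT s|time_measure T. l2norm \<Omega> (ritz_error (utt s)))"
proof -
  let ?M = "time_measure T"
  obtain Utt Ut' where U: "U \<in> Lp_H10 2 T \<Omega>" "Ut' \<in> Lp_H10 2 T \<Omega>" "Utt \<in> Lp_H10 2 T \<Omega>"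
    and UV: "AE t in ?M. U t \<in> V" "AE t in ?M. Ut' t \<in> V" "AE t in ?M. Utt t \<in> V"
    and eqU: "\<And>w. w \<in> V \<Longrightarrow> AE t in ?M. l2ip \<Omega> (Utt t) w + energy (U t) w = l2ip \<Omega> (f t) w"
    and iU: "\<And>v. v \<in> L2 \<Omega> \<Longrightarrow> AE t in ?M. l2ip \<Omega> (U t) v = l2ip \<Omega> u0d v + prim T (\<lambda>s. l2ip \<Omega> (Ut' s) v) t"
      "\<And>v. v \<in> L2 \<Omega> \<Longrightarrow> AE t in ?M. l2ip \<Omega> (Ut' t) v = l2ip \<Omega> v0d v + prim T (\<lambda>s. l2ip \<Omega> (Utt s) v) t"
    and Ut: "AE t in ?M. l2norm \<Omega> (\<lambda>x. Ut t x - Ut' t x) = 0"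
    by (rule discrete_solution) (rule that)
  have v0H: "v0 \<in> H10 \<Omega>" and v0dV: "v0d \<in> V" using v0d by (auto simp: ritz_proj_def)
  note v0dH = V_H10[OF v0dV]
  have v0o: "energy v0d w = energy v0 w" if "w \<in> V" for w
    using v0d that E.ip_diff[OF v0H v0dH V_H10[OF that]] by (simp add: ritz_proj_def)
  define X' where "X' i s = energy (Utt s) (e i) - energy (utt s) (e i)" for i s
  define X where "X i = prim T (X' i)" for i
  define Y where "Y i = prim T (X i)" for i
  have two: "(2::ennreal) \<in> {1, 2, \<infinity>}" by simp
  have iX': "integrable ?M (X' i)" if "i < n" for i
    unfolding X'_def by (intro Bochner_Integration.integrable_diff energy_integrable[OF U(3) two] energy_integrable[OF uttH] e_H10 that)
  have U_energy: "AE t in ?M. energy (U t) w = energy u0d w + prim T (\<lambda>s. energy (Ut' s) w) t" if "w \<in> H10 \<Omega>" for w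
    by (rule energy_prim[OF T U(1,2) two u0d_H10 iU(1)[OF test_L2'] that])
  have Ut_energy: "AE t in ?M. energy (Ut' t) w = energy v0d w + prim T (\<lambda>s. energy (Utt s) w) t" if "w \<in> H10 \<Omega>" for w
    by (rule energy_prim[OF T U(2,3) two v0dH iU(2)[OF test_L2'] that])
  have Xeq: "AE t in ?M. energy (Ut' t) (e i) - energy (ut t) (e i) = X i t" if i: "i < n" for i
    using Ut_energy[OF e_H10[OF i]] ut_energy[OF utt ut(1) uttH v0H e_H10[OF i]]
  proof eventually_elim
    case (elim t)
    then show ?case
      using v0o[OF e_V[OF i]]
        prim_diff[OF energy_integrable[OF U(3) two e_H10[OF i]] energy_integrable[OF uttH e_H10[OF i]]]
      by (simp add: X_def X'_def[abs_def])
  qed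
  have Yeq: "AE t in ?M. energy (U t) (e i) - energy (u t) (e i) = Y i t" if i: "i < n" for i
  proof -
    note i1 = energy_integrable[OF U(2) two e_H10[OF i]] and i2 = energy_integrable[OF ut e_H10[OF i]]
    have pY: "prim T (\<lambda>s. energy (Ut' s) (e i)) t - prim T (\<lambda>s. energy (ut s) (e i)) t = Y i t" for t
    proof -
      have "prim T (\<lambda>s. energy (Ut' s) (e i) - energy (ut s) (e i)) t = Y i t"
        unfolding Y_def X_def
      proof (rule prim_cong)
        show "AE s in ?M. energy (Ut' s) (e i) - energy (ut s) (e i) = prim T (X' i) s" using Xeq[OF i] by (simp add: X_def)
        show "(\<lambda>s. energy (Ut' s) (e i) - energy (ut s) (e i)) \<in> borel_measurable ?M"
          using i1 i2 by (intro borel_measurable_diff borel_measurable_integrable) auto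
      qed (rule prim_measurable[OF iX'[OF i]])
      then show ?thesis using i1 i2 by (simp add: prim_diff)
    qed
    show ?thesis
      using U_energy[OF e_H10[OF i]] u_energy[OF ut e_H10[OF i]]
      by eventually_elim (use u0d_orth[OF e_V[OF i]] pY in \<open>simp add: algebra_simps\<close>)
  qed
  have uttA: "AE s in ?M. utt s \<in> H10 \<Omega>" by (rule Lp_bochner_AE[OF uttH(1)])
  have eq: "AE s in ?M. (\<Sum>j<n. l2ip \<Omega> (e i) (e j) * X' j s) + Y i s = l2ip \<Omega> (ritz_error (utt s)) (e i)" if i: "i < n" for i
    using Yeq[OF i] Lp_diff_AE[OF uttH(1) U(3)] UV(3) wave_equation(1)[OF utt e_H10[OF i]] eqU[OF e_V[OF i]]
  proof eventually_elim
    case (elim s)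
    then have H: "utt s \<in> H10 \<Omega>" "Utt s \<in> H10 \<Omega>" by auto
    note eL = e_L2[OF i] and L = H10_L2[OF H(1)] H10_L2[OF H(2)]
    have "(\<Sum>j<n. l2ip \<Omega> (e i) (e j) * X' j s) = l2ip \<Omega> (E.proj n e (Utt s)) (e i) - l2ip \<Omega> (E.proj n e (utt s)) (e i)"
      unfolding X'_def using gram[OF H(1) i] gram[OF H(2) i] by (simp add: right_diff_distrib sum_subtractf)
    also have "l2ip \<Omega> (E.proj n e (Utt s)) (e i) = l2ip \<Omega> (Utt s) (e i)"
      using l2ip_zero_diff[OF L(2) H10_L2[OF proj_H10] proj_V(2)[OF elim(3)] eL] by simp
    finally have 1: "(\<Sum>j<n. l2ip \<Omega> (e i) (e j) * X' j s) = l2ip \<Omega> (Utt s) (e i) - l2ip \<Omega> (E.proj n e (utt s)) (e i)" .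
    have "l2ip \<Omega> (ritz_error (utt s)) (e i) = l2ip \<Omega> (utt s) (e i) - l2ip \<Omega> (E.proj n e (utt s)) (e i)"
      unfolding ritz_error_def using L2.ip_diff[OF L(1) H10_L2[OF proj_H10] eL] by (simp add: l2ip_eq_vip)
    then show ?case using 1 elim(1,4,5) by simp
  qed
  have rI: "integrable ?M (\<lambda>s. l2norm \<Omega> (ritz_error (utt s)))" by (rule ritz_error_integrable[OF uttH])
  have GL: "AE s in ?M. ritz_error (utt s) \<in> L2 \<Omega>" using uttA by eventually_elim (intro H10_L2 ritz_error_H10)
  note est = discrete_energy_estimate[OF T iX' X_def Y_def GL eq rI l2norm_nonneg]
  have est1: "l2norm \<Omega> (\<lambda>x. \<Sum>i<n. X i t * e i x) \<le> 2 * (LINT s|?M. l2norm \<Omega> (ritz_error (utt s)))"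
    and est2: "enorm (\<lambda>x. \<Sum>i<n. Y i t * e i x) \<le> 2 * (LINT s|?M. l2norm \<Omega> (ritz_error (utt s)))"
    if "t \<in> {0..T}" for t using est[OF _ _ _ that] by simp_all
  have "AE t in ?M. \<forall>i\<in>{..<n}. energy (Ut' t) (e i) - energy (ut t) (e i) = X i t"
    using Xeq by (subst AE_finite_all) auto
  then show "AE t in ?M. l2norm \<Omega> (\<lambda>x. ut t x - Ut t x)
    \<le> l2norm \<Omega> (ritz_error (ut t)) + 2 * (LINT s|time_measure T. l2norm \<Omega> (ritz_error (utt s)))"
    using Lp_bochner_AE[OF ut(1)] UV(2) AE_space Ut Lp_bochner_AE[OF has_dtD(2)[OF U_dt]]
  proof eventually_elim
    case (elim t)
    note L = H10_L2[OF elim(2)] H10_L2[OF V_H10[OF elim(3)]] elim(6)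
    have "l2norm \<Omega> (\<lambda>x. ut t x - Ut t x) \<le> l2norm \<Omega> (\<lambda>x. ut t x - Ut' t x) + l2norm \<Omega> (\<lambda>x. Ut' t x - Ut t x)"
      by (rule l2norm_triangle_via[OF L])
    also have "l2norm \<Omega> (\<lambda>x. Ut' t x - Ut t x) = 0"
      using elim(5) L2.nrm_minus_commute[OF L(2,3)] by (simp add: l2norm_eq_nrm)
    also have "l2norm \<Omega> (\<lambda>x. ut t x - Ut' t x) \<le> l2norm \<Omega> (ritz_error (ut t)) + l2norm \<Omega> (\<lambda>x. \<Sum>i<n. X i t * e i x)"
      by (rule split_error(1)[OF elim(2,3)]) (use elim(1) in auto)
    finally show ?case using est1[of t] elim(4) by simp
  qed
  have "AE t in ?M. \<forall>i\<in>{..<n}. energy (U t) (e i) - energy (u t) (e i) = Y i t"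
    using Yeq by (subst AE_finite_all) auto
  then show "AE t in ?M. enorm (\<lambda>x. u t x - U t x)
    \<le> enorm (ritz_error (u t)) + 2 * (LINT s|time_measure T. l2norm \<Omega> (ritz_error (utt s)))"
    using Lp_bochner_AE[OF u_H10] UV(1) AE_space
  proof eventually_elim
    case (elim t)
    have "enorm (\<lambda>x. u t x - U t x) \<le> enorm (ritz_error (u t)) + enorm (\<lambda>x. \<Sum>i<n. Y i t * e i x)"
      by (rule split_error(2)[OF elim(2,3)]) (use elim(1) in auto)
    then show ?case using est2[of t] elim(4) by simp
  qed
qed

end

section \<open>The error estimates\<close>

lemma l2norm_bochner_measurable:
  assumes "bochner_measurable T (L2 S) (l2norm S) u" "AE t in time_measure T. u t \<in> L2 S"
  shows "(\<lambda>t. l2norm S (u t)) \<in> borel_measurable (time_measure T)"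
proof (rule bochner_measurable_compose[OF assms])
  fix v s assume v: "v \<in> L2 S" and s: "\<And>k. s k \<in> L2 S" and l: "(\<lambda>k::nat. l2norm S (\<lambda>x. v x - s k x)) \<longlonglongrightarrow> 0"
  have "(\<lambda>k. l2norm S (s k) - l2norm S v) \<longlonglongrightarrow> 0"
    by (rule tendsto_0_le[OF l, of _ 1])
      (use l2norm_lipschitz[OF v s] in \<open>auto simp: abs_minus_commute intro!: always_eventually\<close>)
  then show "(\<lambda>k. l2norm S (s k)) \<longlonglongrightarrow> l2norm S v" by (simp add: LIM_zero_iff)
qed

text \<open>The bookkeeping of constants is done in extended nonnegative reals, because the norms on the right
  hand side may be infinite.\<close>
lemma combine_L2:
  fixes C :: ennreal
  assumes "2 \<le> C" "2 * k \<le> C" "2 * \<tau> \<le> C"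
  shows "(d0 + k * \<delta> * (a0 + b0)) + 2 * ((d1 + k * \<delta> * (a1 + b1)) + \<tau> * c0)
    \<le> C * ((\<delta> * (a0 + a1 + b0 + b1) + (d0 + d1)) + c0)"
proof -
  have C1: "1 \<le> C" using assms(1) order_trans[of 1 2 C] by simp
  have kC: "k \<le> C" using assms(2) order_trans[of k "2 * k" C] by (simp add: mult_2)
  have "(d0 + k * \<delta> * (a0 + b0)) + 2 * ((d1 + k * \<delta> * (a1 + b1)) + \<tau> * c0)
      = (1 * d0 + k * (\<delta> * (a0 + b0))) + ((2 * d1 + (2 * k) * (\<delta> * (a1 + b1))) + (2 * \<tau>) * c0)"
    by (simp add: distrib_left mult.assoc)
  also have "\<dots> \<le> (C * d0 + C * (\<delta> * (a0 + b0))) + ((C * d1 + C * (\<delta> * (a1 + b1))) + C * c0)"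
    by (intro add_mono mult_right_mono C1 kC assms) auto
  also have "\<dots> = C * ((\<delta> * (a0 + a1 + b0 + b1) + (d0 + d1)) + c0)"
    by (simp add: distrib_left add_ac)
  finally show ?thesis .
qed

lemma combine_energy:
  fixes C :: ennreal
  assumes "1 \<le> C" "k \<le> C" "4 * k' \<le> C" "4 * \<tau> \<le> C"
  shows "((d1 + k' * \<delta> * (a1 + b1)) + 2 * (\<tau> * d2 + k' * \<delta> * (a2 + b2)))
      + ((e0 + k * \<delta> * (a0 + b0)) + 2 * (\<tau> * d2 + k' * \<delta> * (a2 + b2)))
    \<le> C * (\<delta> * (a0 + a1 + a2 + b0 + b1 + b2) + (d1 + e0 + d2))"
proof -
  have k'C: "k' \<le> C"
  proof -
    have "1 * k' \<le> 4 * k'" by (intro mult_right_mono) auto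
    then show ?thesis using assms(3) order_trans by simp
  qed
  have double: "2 * z + 2 * z = 4 * z" for z :: ennreal
    by (metis distrib_right numeral_Bit0)
  have "((d1 + k' * \<delta> * (a1 + b1)) + 2 * (\<tau> * d2 + k' * \<delta> * (a2 + b2)))
      + ((e0 + k * \<delta> * (a0 + b0)) + 2 * (\<tau> * d2 + k' * \<delta> * (a2 + b2)))
      = ((1 * d1 + k' * (\<delta> * (a1 + b1))) + (1 * e0 + k * (\<delta> * (a0 + b0))))
        + (2 * (\<tau> * d2 + k' * \<delta> * (a2 + b2)) + 2 * (\<tau> * d2 + k' * \<delta> * (a2 + b2)))"
    by (simp only: mult_1_left mult.assoc add_ac)
  also have "\<dots> = ((1 * d1 + k' * (\<delta> * (a1 + b1))) + (1 * e0 + k * (\<delta> * (a0 + b0))))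
        + ((4 * \<tau>) * d2 + (4 * k') * (\<delta> * (a2 + b2)))"
    unfolding double by (simp only: distrib_left mult.assoc)
  also have "\<dots> \<le> ((C * d1 + C * (\<delta> * (a1 + b1))) + (C * e0 + C * (\<delta> * (a0 + b0))))
        + (C * d2 + C * (\<delta> * (a2 + b2)))"
    by (intro add_mono mult_right_mono k'C assms) auto
  also have "\<dots> = C * (\<delta> * (a0 + a1 + a2 + b0 + b1 + b2) + (d1 + e0 + d2))"
    by (simp add: distrib_left add_ac)
  finally show ?thesis .
qed

lemma time_emeasure: "0 < T \<Longrightarrow> emeasure (time_measure T) {0<..<T} = ennreal T"
  by (simp add: emeasure_restrict_space)

context wave_setting
begin

definition "error_const = 4 * (1 + \<bar>CP\<bar>) * ritz_const + 4 * T + 4"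

lemma wnorm_measurable:
  fixes w :: "real \<Rightarrow> 'a \<Rightarrow> real"
  assumes "bochner_measurable T (L2 \<Omega>) (l2norm \<Omega>) w" "AE t in time_measure T. w t \<in> L2 \<Omega>"
  shows "(\<lambda>t. wnorm (w t)) \<in> borel_measurable (time_measure T)"
proof (rule bochner_measurable_compose[OF assms])
  fix v :: "'a \<Rightarrow> real" and s
  assume v: "v \<in> L2 \<Omega>" and s: "\<And>k. s k \<in> L2 \<Omega>" and l: "(\<lambda>k::nat. l2norm \<Omega> (\<lambda>x. v x - s k x)) \<longlonglongrightarrow> 0"
  have "(\<lambda>k. wnorm v - wnorm (s k)) \<longlonglongrightarrow> 0"
  proof (rule tendsto_0_le[OF l, of _ "1 / sqrt amin"])
    have "\<bar>wnorm v - wnorm (s k)\<bar> \<le> 1 / sqrt amin * l2norm \<Omega> (\<lambda>x. v x - s k x)" for k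
    proof -
      note d = L2_diff[OF v s, of k]
      have "\<bar>wnorm v - wnorm (s k)\<bar> \<le> l2norm \<Omega> (\<lambda>x. v x / sqrt (a x) - s k x / sqrt (a x))"
        by (intro l2norm_lipschitz inverse_weighted_L2 v s)
      also have "\<dots> = wnorm (\<lambda>x. v x - s k x)" by (simp add: diff_divide_distrib)
      also have "\<dots> \<le> l2norm \<Omega> (\<lambda>x. (1 / sqrt amin) *\<^sub>R (v x - s k x))"
      proof (rule l2norm_mono)
        show "AE x in lebesgue_on \<Omega>. norm ((v x - s k x) / sqrt (a x)) \<le> norm ((1 / sqrt amin) *\<^sub>R (v x - s k x))"
        proof (intro AE_I2)
          fix x
          have "1 / sqrt (a x) \<le> 1 / sqrt amin"
            using a_bounds(1) a_bounds(2)[of x] by (simp add: frac_le)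
          then have "1 / sqrt (a x) * \<bar>v x - s k x\<bar> \<le> 1 / sqrt amin * \<bar>v x - s k x\<bar>"
            by (rule mult_right_mono) simp
          then show "norm ((v x - s k x) / sqrt (a x)) \<le> norm ((1 / sqrt amin) *\<^sub>R (v x - s k x))"
            using a_pos[of x] a_bounds(1) by (simp add: abs_mult)
        qed
      qed (intro L2_measurable inverse_weighted_L2 d L2_scale)+
      also have "\<dots> = 1 / sqrt amin * l2norm \<Omega> (\<lambda>x. v x - s k x)"
        unfolding l2norm_eq_nrm using a_bounds(1) by (subst L2.nrm_scale[OF d]) simp
      finally show ?thesis .
    qed
    then show "\<forall>\<^sub>F k in sequentially. norm (wnorm v - wnorm (s k)) \<le> norm (l2norm \<Omega> (\<lambda>x. v x - s k x)) * (1 / sqrt amin)"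
      by simp
  qed
  from tendsto_diff[OF tendsto_const[of "wnorm v"] this] show "(\<lambda>k. wnorm (s k)) \<longlonglongrightarrow> wnorm v" by simp
qed

lemma ennreal_bound:
  assumes "x \<le> d + \<bar>c\<bar> * (ritz_const * (lod_rate * (p + q)))" "0 \<le> d" "0 \<le> p" "0 \<le> q"
  shows "ennreal x \<le> ennreal d + ennreal (\<bar>c\<bar> * ritz_const) * ennreal lod_rate * (ennreal p + ennreal q)"
proof -
  have "ennreal x \<le> ennreal (d + \<bar>c\<bar> * (ritz_const * (lod_rate * (p + q))))" by (intro ennreal_leI assms)
  also have "\<dots> = ennreal d + ennreal (\<bar>c\<bar> * ritz_const * lod_rate * (p + q))"
    using assms ritz_const_nonneg lod_rate_nonneg by (simp add: ennreal_plus[symmetric] mult.assoc del: ennreal_plus)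
  also have "ennreal (\<bar>c\<bar> * ritz_const * lod_rate * (p + q)) = ennreal (\<bar>c\<bar> * ritz_const) * ennreal lod_rate * (ennreal p + ennreal q)"
    using assms ritz_const_nonneg lod_rate_nonneg by (simp add: ennreal_mult)
  finally show ?thesis .
qed

lemma ritz_error_sup_bounds:
  assumes v: "v \<in> Lp_H10 p T \<Omega>" and g: "g \<in> Lp_L2 q T \<Omega>" and h: "h \<in> Lp_L2 r T \<Omega>"
    and eq: "\<forall>w\<in>H10 \<Omega>. AE t in time_measure T. energy (v t) w = l2ip \<Omega> (\<lambda>x. g t x - h t x) w"
  shows "AE t in time_measure T. ennreal (enorm (ritz_error (v t)))
      \<le> Lp_L2_norm \<infinity> T \<Omega> (\<lambda>t. sgrad \<Omega> a (\<lambda>x. v t x - \<pi>h (v t) x)) + ennreal ritz_const * ennreal lod_rate *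
        (Lp_L2_norm \<infinity> T \<Omega> (\<lambda>t x. (h t x - g t x) / sqrt (a x)) + Lp_L2_norm \<infinity> T \<Omega> (\<lambda>t. sgrad \<Omega> a (v t)))"
    and "AE t in time_measure T. ennreal (l2norm \<Omega> (ritz_error (v t)))
      \<le> Lp_L2_norm \<infinity> T \<Omega> (\<lambda>t x. v t x - \<pi>h (v t) x) + ennreal (\<bar>CP\<bar> * ritz_const) * ennreal lod_rate *
        (Lp_L2_norm \<infinity> T \<Omega> (\<lambda>t x. (h t x - g t x) / sqrt (a x)) + Lp_L2_norm \<infinity> T \<Omega> (\<lambda>t. sgrad \<Omega> a (v t)))"
proof -
  note sup = Lp_norm_inf_AE[where T=T and g="\<lambda>t. l2norm \<Omega> (\<lambda>x. (h t x - g t x) / sqrt (a x))"]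
    Lp_norm_inf_AE[where T=T and g="\<lambda>t. enorm (v t)"]
  show "AE t in time_measure T. ennreal (enorm (ritz_error (v t)))
      \<le> Lp_L2_norm \<infinity> T \<Omega> (\<lambda>t. sgrad \<Omega> a (\<lambda>x. v t x - \<pi>h (v t) x)) + ennreal ritz_const * ennreal lod_rate *
        (Lp_L2_norm \<infinity> T \<Omega> (\<lambda>t x. (h t x - g t x) / sqrt (a x)) + Lp_L2_norm \<infinity> T \<Omega> (\<lambda>t. sgrad \<Omega> a (v t)))"
    using ritz_error_AE_bounds[OF assms] sup Lp_norm_inf_AE[where T=T and g="\<lambda>t. enorm (\<lambda>x. v t x - \<pi>h (v t) x)"]
  proof eventually_elim
    case (elim t)
    have "ennreal (enorm (ritz_error (v t))) \<le> ennreal (enorm (\<lambda>x. v t x - \<pi>h (v t) x))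
        + ennreal (\<bar>1\<bar> * ritz_const) * ennreal lod_rate * (ennreal (wnorm (\<lambda>x. h t x - g t x)) + ennreal (enorm (v t)))"
      by (rule ennreal_bound) (use elim(1) in auto)
    also have "\<dots> \<le> Lp_L2_norm \<infinity> T \<Omega> (\<lambda>t. sgrad \<Omega> a (\<lambda>x. v t x - \<pi>h (v t) x)) + ennreal (\<bar>1\<bar> * ritz_const) * ennreal lod_rate *
        (Lp_L2_norm \<infinity> T \<Omega> (\<lambda>t x. (h t x - g t x) / sqrt (a x)) + Lp_L2_norm \<infinity> T \<Omega> (\<lambda>t. sgrad \<Omega> a (v t)))"
      using elim(2-4) unfolding Lp_L2_norm_def by (intro add_mono mult_left_mono) auto
    finally show ?case by simp
  qed
  show "AE t in time_measure T. ennreal (l2norm \<Omega> (ritz_error (v t)))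
      \<le> Lp_L2_norm \<infinity> T \<Omega> (\<lambda>t x. v t x - \<pi>h (v t) x) + ennreal (\<bar>CP\<bar> * ritz_const) * ennreal lod_rate *
        (Lp_L2_norm \<infinity> T \<Omega> (\<lambda>t x. (h t x - g t x) / sqrt (a x)) + Lp_L2_norm \<infinity> T \<Omega> (\<lambda>t. sgrad \<Omega> a (v t)))"
    using ritz_error_AE_bounds[OF assms] sup Lp_norm_inf_AE[where T=T and g="\<lambda>t. l2norm \<Omega> (\<lambda>x. v t x - \<pi>h (v t) x)"]
  proof eventually_elim
    case (elim t)
    have "ennreal (l2norm \<Omega> (ritz_error (v t))) \<le> ennreal (l2norm \<Omega> (\<lambda>x. v t x - \<pi>h (v t) x))
        + ennreal (\<bar>CP\<bar> * ritz_const) * ennreal lod_rate * (ennreal (wnorm (\<lambda>x. h t x - g t x)) + ennreal (enorm (v t)))"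
      by (rule ennreal_bound) (use elim(1) in auto)
    also have "\<dots> \<le> Lp_L2_norm \<infinity> T \<Omega> (\<lambda>t x. v t x - \<pi>h (v t) x) + ennreal (\<bar>CP\<bar> * ritz_const) * ennreal lod_rate *
        (Lp_L2_norm \<infinity> T \<Omega> (\<lambda>t x. (h t x - g t x) / sqrt (a x)) + Lp_L2_norm \<infinity> T \<Omega> (\<lambda>t. sgrad \<Omega> a (v t)))"
      using elim(2-4) unfolding Lp_L2_norm_def by (intro add_mono mult_left_mono) auto
    finally show ?case .
  qed
qed

lemma ritz_error_integral_bound:
  assumes v: "v \<in> Lp_H10 p T \<Omega>" "p \<in> {1, 2, \<infinity>}" and g: "g \<in> Lp_L2 q T \<Omega>" and h: "h \<in> Lp_L2 r T \<Omega>"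
    and eq: "\<forall>w\<in>H10 \<Omega>. AE t in time_measure T. energy (v t) w = l2ip \<Omega> (\<lambda>x. g t x - h t x) w"
    and D: "D \<in> borel_measurable (time_measure T)" "AE t in time_measure T. ennreal (l2norm \<Omega> (\<lambda>x. v t x - \<pi>h (v t) x)) \<le> D t"
  shows "ennreal (LINT t|time_measure T. l2norm \<Omega> (ritz_error (v t)))
      \<le> (\<integral>\<^sup>+t. D t \<partial>time_measure T) + ennreal (\<bar>CP\<bar> * ritz_const) * ennreal lod_rate *
        (Lp_L2_norm 1 T \<Omega> (\<lambda>t x. (h t x - g t x) / sqrt (a x)) + Lp_L2_norm 1 T \<Omega> (\<lambda>t. sgrad \<Omega> a (v t)))"
proof -
  let ?M = "time_measure T"
  have [measurable]: "(\<lambda>t. wnorm (\<lambda>x. h t x - g t x)) \<in> borel_measurable ?M"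
    by (rule wnorm_measurable[OF Lp_L2_measurable_diff[OF h g]])
  have [measurable]: "(\<lambda>t. enorm (v t)) \<in> borel_measurable ?M"
    by (rule enorm_measurable[OF Lp_bochner_measurable[OF v(1)] Lp_bochner_AE[OF v(1)]])
  note [measurable] = D(1)
  have "ennreal (LINT t|?M. l2norm \<Omega> (ritz_error (v t))) = (\<integral>\<^sup>+t. ennreal (l2norm \<Omega> (ritz_error (v t))) \<partial>?M)"
    by (rule nn_integral_eq_integral[symmetric, OF ritz_error_integrable[OF v]]) simp
  also have "\<dots> \<le> (\<integral>\<^sup>+t. (D t + ennreal (\<bar>CP\<bar> * ritz_const) * ennreal lod_rate
      * (ennreal (wnorm (\<lambda>x. h t x - g t x)) + ennreal (enorm (v t)))) \<partial>?M)"
  proof (rule nn_integral_mono_AE)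
    show "AE t in ?M. ennreal (l2norm \<Omega> (ritz_error (v t))) \<le> D t + ennreal (\<bar>CP\<bar> * ritz_const) * ennreal lod_rate
      * (ennreal (wnorm (\<lambda>x. h t x - g t x)) + ennreal (enorm (v t)))"
      using ritz_error_AE_bounds[OF v(1) g h eq] D(2)
    proof eventually_elim
      case (elim t)
      have "ennreal (l2norm \<Omega> (ritz_error (v t))) \<le> ennreal (l2norm \<Omega> (\<lambda>x. v t x - \<pi>h (v t) x))
        + ennreal (\<bar>CP\<bar> * ritz_const) * ennreal lod_rate * (ennreal (wnorm (\<lambda>x. h t x - g t x)) + ennreal (enorm (v t)))"
        by (rule ennreal_bound) (use elim(1) in auto)
      also have "\<dots> \<le> D t + ennreal (\<bar>CP\<bar> * ritz_const) * ennreal lod_rate * (ennreal (wnorm (\<lambda>x. h t x - g t x)) + ennreal (enorm (v t)))"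
        by (intro add_right_mono elim(2))
      finally show ?case .
    qed
  qed
  also have "\<dots> = (\<integral>\<^sup>+t. D t \<partial>?M) + ennreal (\<bar>CP\<bar> * ritz_const) * ennreal lod_rate *
      ((\<integral>\<^sup>+t. ennreal (wnorm (\<lambda>x. h t x - g t x)) \<partial>?M) + (\<integral>\<^sup>+t. ennreal (enorm (v t)) \<partial>?M))"
    by (simp add: nn_integral_add nn_integral_cmult)
  finally show ?thesis by (simp add: Lp_L2_norm_def Lp_norm_1)
qed

lemma error_const_bounds: "1 \<le> error_const" "2 \<le> error_const" "2 * (\<bar>CP\<bar> * ritz_const) \<le> error_const" "2 * T \<le> error_const" "ritz_const \<le> error_const"
  "4 * (\<bar>CP\<bar> * ritz_const) \<le> error_const" "4 * T \<le> error_const"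
proof -
  have e: "error_const = 4 * ritz_const + 4 * (\<bar>CP\<bar> * ritz_const) + 4 * T + 4" by (simp add: error_const_def algebra_simps)
  have "0 \<le> \<bar>CP\<bar> * ritz_const" using ritz_const_nonneg by simp
  then show "1 \<le> error_const" "2 \<le> error_const" "2 * (\<bar>CP\<bar> * ritz_const) \<le> error_const" "2 * T \<le> error_const" "ritz_const \<le> error_const"
    "4 * (\<bar>CP\<bar> * ritz_const) \<le> error_const" "4 * T \<le> error_const"
    unfolding e using T ritz_const_nonneg by linarith+
qed

lemma ennreal_numeral_mult_le: "numeral k * x \<le> c \<Longrightarrow> 0 \<le> x \<Longrightarrow> numeral k * ennreal x \<le> ennreal c"
  by (metis ennreal_leI ennreal_mult ennreal_numeral zero_le_numeral)

text \<open>The bound \<open>c0\<close> for the error of the initial velocity is zero for the \<open>L\<^sup>2\<close> projection and the \<open>L\<^sup>2\<close> norm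
  of that error for the Ritz projection.\<close>
theorem L2_error_estimate:
  assumes utt: "has_dt T \<Omega> ut utt" and uttt: "has_dt T \<Omega> utt uttt" and ft: "has_dt T \<Omega> f ft"
    and ut: "ut \<in> Lp_H10 1 T \<Omega>"
    and c0: "0 \<le> c0" "\<forall>w\<in>V. l2ip \<Omega> (\<lambda>x. v0 x - v0d x) w = l2ip \<Omega> r w" "r \<in> L2 \<Omega>" "l2norm \<Omega> r \<le> c0"
  shows "Lp_L2_norm \<infinity> T \<Omega> (\<lambda>t x. u t x - U t x) \<le> ennreal error_const *
      ((ennreal lod_rate * (Lp_L2_norm \<infinity> T \<Omega> (\<lambda>t x. (utt t x - f t x) / sqrt (a x))
               + Lp_L2_norm 1 T \<Omega> (\<lambda>t x. (uttt t x - ft t x) / sqrt (a x))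
               + Lp_L2_norm \<infinity> T \<Omega> (\<lambda>t. sgrad \<Omega> a (u t))
               + Lp_L2_norm 1 T \<Omega> (\<lambda>t. sgrad \<Omega> a (ut t)))
            + (Lp_L2_norm \<infinity> T \<Omega> (\<lambda>t x. u t x - \<pi>h (u t) x)
               + Lp_L2_norm 1 T \<Omega> (\<lambda>t x. ut t x - \<pi>h (ut t) x))) + ennreal c0)"
    (is "_ \<le> ennreal error_const * ((ennreal lod_rate * (?a0 + ?a1 + ?b0 + ?b1) + (?d0 + ?d1)) + ennreal c0)")
proof -
  let ?M = "time_measure T" and ?k = "ennreal (\<bar>CP\<bar> * ritz_const)" and ?\<delta> = "ennreal lod_rate"
  have one: "(1::ennreal) \<in> {1, 2, \<infinity>}" by simp
  define I where "I = (LINT s|?M. l2norm \<Omega> (ritz_error (ut s)))"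
  have I0: "0 \<le> I" unfolding I_def by simp
  have "ennreal I \<le> (\<integral>\<^sup>+t. ennreal (l2norm \<Omega> (\<lambda>x. ut t x - \<pi>h (ut t) x)) \<partial>?M) + ?k * ?\<delta> * (?a1 + ?b1)"
    unfolding I_def
  proof (rule ritz_error_integral_bound[OF ut one has_dtD(2)[OF ft] has_dtD(2)[OF uttt]])
    show "\<forall>w\<in>H10 \<Omega>. AE t in ?M. energy (ut t) w = l2ip \<Omega> (\<lambda>x. ft t x - uttt t x) w"
      using elliptic_1[OF utt uttt ft ut one] by blast
    show "(\<lambda>t. ennreal (l2norm \<Omega> (\<lambda>x. ut t x - \<pi>h (ut t) x))) \<in> borel_measurable ?M"
      using ritz_h_measurable[OF ut] by measurable
  qed simp
  then have Ib: "ennreal I \<le> ?d1 + ?k * ?\<delta> * (?a1 + ?b1)" by (simp add: Lp_L2_norm_def Lp_norm_1)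
  have ell: "\<forall>w\<in>H10 \<Omega>. AE t in ?M. energy (u t) w = l2ip \<Omega> (\<lambda>x. f t x - utt t x) w"
    using elliptic_0[OF utt] by blast
  have "AE t in ?M. ennreal (l2norm \<Omega> (\<lambda>x. u t x - U t x))
      \<le> (?d0 + ?k * ?\<delta> * (?a0 + ?b0)) + 2 * ((?d1 + ?k * ?\<delta> * (?a1 + ?b1)) + ennreal T * ennreal c0)"
    using error_L2[OF utt ut one c0]
      ritz_error_sup_bounds(2)[OF u_H10 f has_dtD(2)[OF utt] ell]
  proof eventually_elim
    case (elim t)
    have "ennreal (l2norm \<Omega> (\<lambda>x. u t x - U t x)) \<le> ennreal (l2norm \<Omega> (ritz_error (u t)) + 2 * (I + T * c0))"
      using elim(1) by (intro ennreal_leI) (simp add: I_def)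
    also have "\<dots> = ennreal (l2norm \<Omega> (ritz_error (u t))) + 2 * (ennreal I + ennreal T * ennreal c0)"
      using I0 c0(1) T by (simp add: ennreal_mult)
    also have "\<dots> \<le> (?d0 + ?k * ?\<delta> * (?a0 + ?b0)) + 2 * ((?d1 + ?k * ?\<delta> * (?a1 + ?b1)) + ennreal T * ennreal c0)"
      by (intro add_mono mult_left_mono elim(2) Ib order_refl) auto
    finally show ?case .
  qed
  moreover have "(?d0 + ?k * ?\<delta> * (?a0 + ?b0)) + 2 * ((?d1 + ?k * ?\<delta> * (?a1 + ?b1)) + ennreal T * ennreal c0)
      \<le> ennreal error_const * ((?\<delta> * (?a0 + ?a1 + ?b0 + ?b1) + (?d0 + ?d1)) + ennreal c0)"
  proof (rule combine_L2)
    show "2 \<le> ennreal error_const" using ennreal_leI[OF error_const_bounds(2)] by simp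
    show "2 * ?k \<le> ennreal error_const" using error_const_bounds(3) ritz_const_nonneg by (intro ennreal_numeral_mult_le) auto
    show "2 * ennreal T \<le> ennreal error_const" using error_const_bounds(4) T by (intro ennreal_numeral_mult_le) auto
  qed
  ultimately have ae: "AE t in ?M. ennreal \<bar>l2norm \<Omega> (\<lambda>x. u t x - U t x)\<bar>
      \<le> ennreal error_const * ((?\<delta> * (?a0 + ?a1 + ?b0 + ?b1) + (?d0 + ?d1)) + ennreal c0)"
    by (auto elim!: eventually_mono intro: order_trans)
  have "(\<lambda>t. l2norm \<Omega> (\<lambda>x. u t x - U t x)) \<in> borel_measurable ?M"
    by (rule l2norm_bochner_measurable[OF Lp_L2_measurable_diff[OF has_dtD(1)[OF u_dt] has_dtD(1)[OF U_dt]]])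
  from Lp_norm_inf_leI[OF this ae] show ?thesis by (subst Lp_L2_norm_def)
qed

theorem energy_error_estimate:
  assumes utt: "has_dt T \<Omega> ut utt" and uttt: "has_dt T \<Omega> utt uttt" and utttt: "has_dt T \<Omega> uttt utttt"
    and ft: "has_dt T \<Omega> f ft" and ftt: "has_dt T \<Omega> ft ftt"
    and ut: "ut \<in> Lp_H10 \<infinity> T \<Omega>" and uttH: "utt \<in> Lp_H10 1 T \<Omega>"
    and v0d: "ritz_proj \<Omega> a V v0 v0d"
  shows "Lp_L2_norm \<infinity> T \<Omega> (\<lambda>t x. ut t x - Ut t x)
           + Lp_L2_norm \<infinity> T \<Omega> (\<lambda>t. sgrad \<Omega> a (\<lambda>x. u t x - U t x))
         \<le> ennreal error_const *
           (ennreal lod_rate * (Lp_L2_norm \<infinity> T \<Omega> (\<lambda>t x. (utt t x - f t x) / sqrt (a x))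
               + Lp_L2_norm \<infinity> T \<Omega> (\<lambda>t x. (uttt t x - ft t x) / sqrt (a x))
               + Lp_L2_norm 1 T \<Omega> (\<lambda>t x. (utttt t x - ftt t x) / sqrt (a x))
               + Lp_L2_norm \<infinity> T \<Omega> (\<lambda>t. sgrad \<Omega> a (u t))
               + Lp_L2_norm \<infinity> T \<Omega> (\<lambda>t. sgrad \<Omega> a (ut t))
               + Lp_L2_norm 1 T \<Omega> (\<lambda>t. sgrad \<Omega> a (utt t)))
            + (Lp_L2_norm \<infinity> T \<Omega> (\<lambda>t x. ut t x - \<pi>h (ut t) x)
               + Lp_L2_norm \<infinity> T \<Omega> (\<lambda>t. sgrad \<Omega> a (\<lambda>x. u t x - \<pi>h (u t) x))
               + Lp_L2_norm \<infinity> T \<Omega> (\<lambda>t x. utt t x - \<pi>h (utt t) x)))"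
    (is "_ \<le> ennreal error_const * (ennreal lod_rate * (?a0 + ?a1 + ?a2 + ?b0 + ?b1 + ?b2) + (?d1 + ?e0 + ?d2))")
proof -
  let ?M = "time_measure T" and ?k = "ennreal (\<bar>CP\<bar> * ritz_const)" and ?\<delta> = "ennreal lod_rate" and ?K = "ennreal ritz_const"
  have p1: "(1::ennreal) \<in> {1, 2, \<infinity>}" and pinf: "(\<infinity>::ennreal) \<in> {1, 2, \<infinity>}" by auto
  have v0H: "v0 \<in> H10 \<Omega>" using v0d by (simp add: ritz_proj_def)
  define J where "J = (LINT s|?M. l2norm \<Omega> (ritz_error (utt s)))"
  have J0: "0 \<le> J" unfolding J_def by simp
  have "ennreal J \<le> (\<integral>\<^sup>+t. ?d2 \<partial>?M) + ?k * ?\<delta> * (?a2 + ?b2)"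
    unfolding J_def
  proof (rule ritz_error_integral_bound[OF uttH p1 has_dtD(2)[OF ftt] has_dtD(2)[OF utttt]])
    show "\<forall>w\<in>H10 \<Omega>. AE t in ?M. energy (utt t) w = l2ip \<Omega> (\<lambda>x. ftt t x - utttt t x) w"
      using elliptic_2[OF utt uttt utttt ft ftt ut pinf uttH p1 v0H] by blast
    show "AE t in ?M. ennreal (l2norm \<Omega> (\<lambda>x. utt t x - \<pi>h (utt t) x)) \<le> ?d2"
      using Lp_norm_inf_AE[where T=T and g="\<lambda>t. l2norm \<Omega> (\<lambda>x. utt t x - \<pi>h (utt t) x)"] by (simp add: Lp_L2_norm_def)
  qed simp
  also have "(\<integral>\<^sup>+t. ?d2 \<partial>?M) = ennreal T * ?d2" using time_emeasure[OF T] by (simp add: mult.commute)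
  finally have Jb: "ennreal J \<le> ennreal T * ?d2 + ?k * ?\<delta> * (?a2 + ?b2)" .
  define B1 where "B1 = (?d1 + ?k * ?\<delta> * (?a1 + ?b1)) + 2 * (ennreal T * ?d2 + ?k * ?\<delta> * (?a2 + ?b2))"
  define B2 where "B2 = (?e0 + ?K * ?\<delta> * (?a0 + ?b0)) + 2 * (ennreal T * ?d2 + ?k * ?\<delta> * (?a2 + ?b2))"
  have ell: "\<forall>w\<in>H10 \<Omega>. AE t in ?M. energy (u t) w = l2ip \<Omega> (\<lambda>x. f t x - utt t x) w"
    using elliptic_0[OF utt] by blast
  have ell1: "\<forall>w\<in>H10 \<Omega>. AE t in ?M. energy (ut t) w = l2ip \<Omega> (\<lambda>x. ft t x - uttt t x) w"
    using elliptic_1[OF utt uttt ft ut pinf] by blast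
  note err = error_energy[OF utt ut pinf uttH p1 v0d]
  have "AE t in ?M. ennreal \<bar>l2norm \<Omega> (\<lambda>x. ut t x - Ut t x)\<bar> \<le> B1"
    using err(1) ritz_error_sup_bounds(2)[OF ut has_dtD(2)[OF ft] has_dtD(2)[OF uttt] ell1]
  proof eventually_elim
    case (elim t)
    have "ennreal (l2norm \<Omega> (\<lambda>x. ut t x - Ut t x)) \<le> ennreal (l2norm \<Omega> (ritz_error (ut t)) + 2 * J)"
      using elim(1) by (intro ennreal_leI) (simp add: J_def)
    also have "\<dots> = ennreal (l2norm \<Omega> (ritz_error (ut t))) + 2 * ennreal J"
      using J0 by (simp add: ennreal_mult)
    also have "\<dots> \<le> B1" unfolding B1_def by (intro add_mono mult_left_mono elim(2) Jb) auto
    finally show ?case by simp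
  qed
  moreover have "(\<lambda>t. l2norm \<Omega> (\<lambda>x. ut t x - Ut t x)) \<in> borel_measurable ?M"
    by (rule l2norm_bochner_measurable[OF Lp_L2_measurable_diff[OF has_dtD(2)[OF u_dt] has_dtD(2)[OF U_dt]]])
  ultimately have 1: "Lp_L2_norm \<infinity> T \<Omega> (\<lambda>t x. ut t x - Ut t x) \<le> B1"
    unfolding Lp_L2_norm_def by (intro Lp_norm_inf_leI)
  have U: "U \<in> Lp_H10 2 T \<Omega>" by (rule discrete_solution)
  have "AE t in ?M. ennreal \<bar>enorm (\<lambda>x. u t x - U t x)\<bar> \<le> B2"
    using err(2) ritz_error_sup_bounds(1)[OF u_H10 f has_dtD(2)[OF utt] ell]
  proof eventually_elim
    case (elim t)
    have "ennreal (enorm (\<lambda>x. u t x - U t x)) \<le> ennreal (enorm (ritz_error (u t)) + 2 * J)"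
      using elim(1) by (intro ennreal_leI) (simp add: J_def)
    also have "\<dots> = ennreal (enorm (ritz_error (u t))) + 2 * ennreal J"
      using J0 by (simp add: ennreal_mult)
    also have "\<dots> \<le> B2" unfolding B2_def by (intro add_mono mult_left_mono elim(2) Jb) auto
    finally show ?case by simp
  qed
  moreover have "(\<lambda>t. enorm (\<lambda>x. u t x - U t x)) \<in> borel_measurable ?M"
    by (rule enorm_measurable[OF Lp_H10_measurable_diff[OF u_H10 U]])
  ultimately have 2: "Lp_L2_norm \<infinity> T \<Omega> (\<lambda>t. sgrad \<Omega> a (\<lambda>x. u t x - U t x)) \<le> B2"
    unfolding Lp_L2_norm_def by (intro Lp_norm_inf_leI)
  have "Lp_L2_norm \<infinity> T \<Omega> (\<lambda>t x. ut t x - Ut t x) + Lp_L2_norm \<infinity> T \<Omega> (\<lambda>t. sgrad \<Omega> a (\<lambda>x. u t x - U t x)) \<le> B1 + B2"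
    by (rule add_mono[OF 1 2])
  also have "B1 + B2 \<le> ennreal error_const * (?\<delta> * (?a0 + ?a1 + ?a2 + ?b0 + ?b1 + ?b2) + (?d1 + ?e0 + ?d2))"
    unfolding B1_def B2_def
  proof (rule combine_energy)
    show "1 \<le> ennreal error_const" using ennreal_leI[OF error_const_bounds(1)] by simp
    show "?K \<le> ennreal error_const" by (rule ennreal_leI[OF error_const_bounds(5)])
    show "4 * ?k \<le> ennreal error_const" using error_const_bounds(6) ritz_const_nonneg by (intro ennreal_numeral_mult_le) auto
    show "4 * ennreal T \<le> ennreal error_const" using error_const_bounds(7) T by (intro ennreal_numeral_mult_le) auto
  qed
  finally show ?thesis .
qed

end

lemma rect_mesh_bounded:
  fixes \<Omega> :: "'a::euclidean_space set"
  assumes "rect_mesh \<Omega> TH" shows "bounded \<Omega>"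
proof -
  have fin: "finite TH" and box: "\<forall>K\<in>TH. \<exists>l r. K = cbox l r \<and> box l r \<noteq> {}" and cl: "\<Union>TH = closure \<Omega>"
    using assms by (simp_all add: rect_mesh_def)
  have "bounded K" if "K \<in> TH" for K
    using bspec[OF box that] by auto
  then have "bounded (closure \<Omega>)" unfolding cl[symmetric] using fin by (intro bounded_Union) auto
  then show ?thesis by (rule bounded_subset[OF _ closure_subset])
qed

lemma high_contrast_bounds:
  fixes \<Omega> :: "'a::euclidean_space set"
  assumes "high_contrast_coeff \<Omega> c \<epsilon> a" "open \<Omega>" "bounded \<Omega>"
  obtains amin amax where "energy_form \<Omega> a amin amax"
proof -
  obtain a0 \<Omega>\<epsilon> where a: "0 < a0" "\<Omega>\<epsilon> \<in> sets lebesgue" "a = (\<lambda>x. if x \<in> \<Omega>\<epsilon> then a0 else 1)"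
    using assms(1) unfolding high_contrast_coeff_def by blast
  have "a \<in> borel_measurable lebesgue" unfolding a(3) using a(2) by (intro measurable_If_set) auto
  then have "a \<in> borel_measurable (lebesgue_on \<Omega>)" by (rule measurable_restrict_space1)
  then have "energy_form \<Omega> a (min a0 1) (max a0 1)"
    using a assms by unfold_locales auto
  then show thesis by (rule that)
qed

theorem theorem4p4:
  fixes \<Omega> :: "'a::euclidean_space set"
    and T c \<sigma> CI CP Cloc \<gamma> :: real
  assumes "lipschitz_domain \<Omega>" and "0 < T" and "0 < \<gamma>" and "\<gamma> < 1"
  shows "\<exists>C>0. \<forall>\<epsilon> a TH Th IH m \<C> \<C>K \<pi>h f u0 v0 u ut u0d v0d U Ut.
    0 < \<epsilon> \<longrightarrow> high_contrast_coeff \<Omega> c \<epsilon> a \<longrightarrow>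
    rect_mesh \<Omega> TH \<longrightarrow> shape_regular \<sigma> TH \<longrightarrow> quasi_uniform \<sigma> TH \<longrightarrow>
    rect_mesh \<Omega> Th \<longrightarrow> shape_regular \<sigma> Th \<longrightarrow> mesh_refines Th TH \<longrightarrow> resolves Th a \<longrightarrow>
    stable_projection \<Omega> a TH Th CI IH \<longrightarrow> poincare \<Omega> a CP \<longrightarrow>
    is_corrector \<Omega> a TH Th IH \<C> \<longrightarrow> is_element_corrector \<Omega> a TH Th IH m \<C>K \<longrightarrow>
    localization_bound \<Omega> a TH m Cloc \<gamma> \<C> \<C>K \<longrightarrow>
    (\<forall>v\<in>H10 \<Omega>. ritz_proj \<Omega> a (fe_space \<Omega> Th) v (\<pi>h v)) \<longrightarrow>
    f \<in> Lp_L2 2 T \<Omega> \<longrightarrow> u0 \<in> H10 \<Omega> \<longrightarrow> v0 \<in> L2 \<Omega> \<longrightarrow>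
    weak_solution \<Omega> T a f u0 v0 u \<longrightarrow> has_dt T \<Omega> u ut \<longrightarrow>
    ritz_proj \<Omega> a (lod_space \<Omega> TH \<C>K) u0 u0d \<longrightarrow>
    lod_solution \<Omega> T a f TH \<C>K u0d v0d U \<longrightarrow> has_dt T \<Omega> U Ut \<longrightarrow>
    (let \<delta> = ennreal (mesh_size TH + real m powr (real DIM('a) / 2) * \<gamma> ^ m) in
      (\<forall>utt uttt utttt ft ftt.
         has_dt T \<Omega> ut utt \<longrightarrow> has_dt T \<Omega> utt uttt \<longrightarrow> has_dt T \<Omega> uttt utttt \<longrightarrow>
         has_dt T \<Omega> f ft \<longrightarrow> has_dt T \<Omega> ft ftt \<longrightarrow>
         uttt \<in> Lp_L2 \<infinity> T \<Omega> \<longrightarrow> ft \<in> Lp_L2 \<infinity> T \<Omega> \<longrightarrow>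
         utttt \<in> Lp_L2 1 T \<Omega> \<longrightarrow> ftt \<in> Lp_L2 1 T \<Omega> \<longrightarrow>
         ut \<in> Lp_H10 \<infinity> T \<Omega> \<longrightarrow> utt \<in> Lp_H10 1 T \<Omega> \<longrightarrow>
         ritz_proj \<Omega> a (lod_space \<Omega> TH \<C>K) v0 v0d \<longrightarrow>
         Lp_L2_norm \<infinity> T \<Omega> (\<lambda>t x. ut t x - Ut t x)
           + Lp_L2_norm \<infinity> T \<Omega> (\<lambda>t. sgrad \<Omega> a (\<lambda>x. u t x - U t x))
         \<le> ennreal C *
           (\<delta> * (Lp_L2_norm \<infinity> T \<Omega> (\<lambda>t x. (utt t x - f t x) / sqrt (a x))
               + Lp_L2_norm \<infinity> T \<Omega> (\<lambda>t x. (uttt t x - ft t x) / sqrt (a x))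
               + Lp_L2_norm 1 T \<Omega> (\<lambda>t x. (utttt t x - ftt t x) / sqrt (a x))
               + Lp_L2_norm \<infinity> T \<Omega> (\<lambda>t. sgrad \<Omega> a (u t))
               + Lp_L2_norm \<infinity> T \<Omega> (\<lambda>t. sgrad \<Omega> a (ut t))
               + Lp_L2_norm 1 T \<Omega> (\<lambda>t. sgrad \<Omega> a (utt t)))
            + (Lp_L2_norm \<infinity> T \<Omega> (\<lambda>t x. ut t x - \<pi>h (ut t) x)
               + Lp_L2_norm \<infinity> T \<Omega> (\<lambda>t. sgrad \<Omega> a (\<lambda>x. u t x - \<pi>h (u t) x))
               + Lp_L2_norm \<infinity> T \<Omega> (\<lambda>t x. utt t x - \<pi>h (utt t) x)))) \<and>
      (\<forall>utt uttt ft.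
         has_dt T \<Omega> ut utt \<longrightarrow> has_dt T \<Omega> utt uttt \<longrightarrow> has_dt T \<Omega> f ft \<longrightarrow>
         utt \<in> Lp_L2 \<infinity> T \<Omega> \<longrightarrow> uttt \<in> Lp_L2 1 T \<Omega> \<longrightarrow> ft \<in> Lp_L2 1 T \<Omega> \<longrightarrow>
         ut \<in> Lp_H10 1 T \<Omega> \<longrightarrow>
         (let R = \<delta> * (Lp_L2_norm \<infinity> T \<Omega> (\<lambda>t x. (utt t x - f t x) / sqrt (a x))
               + Lp_L2_norm 1 T \<Omega> (\<lambda>t x. (uttt t x - ft t x) / sqrt (a x))
               + Lp_L2_norm \<infinity> T \<Omega> (\<lambda>t. sgrad \<Omega> a (u t))
               + Lp_L2_norm 1 T \<Omega> (\<lambda>t. sgrad \<Omega> a (ut t)))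
            + (Lp_L2_norm \<infinity> T \<Omega> (\<lambda>t x. u t x - \<pi>h (u t) x)
               + Lp_L2_norm 1 T \<Omega> (\<lambda>t x. ut t x - \<pi>h (ut t) x))
          in (l2_proj \<Omega> (lod_space \<Omega> TH \<C>K) v0 v0d \<longrightarrow>
                Lp_L2_norm \<infinity> T \<Omega> (\<lambda>t x. u t x - U t x) \<le> ennreal C * R) \<and>
             (ritz_proj \<Omega> a (lod_space \<Omega> TH \<C>K) v0 v0d \<longrightarrow>
                Lp_L2_norm \<infinity> T \<Omega> (\<lambda>t x. u t x - U t x)
                  \<le> ennreal C * (R + ennreal (l2norm \<Omega> (\<lambda>x. v0 x - v0d x)))))))"
proof -
  define K where "K = (\<bar>CI\<bar> * sqrt ((4 * \<sigma>\<^sup>2) ^ DIM('a))) * (1 + \<bar>Cloc\<bar>)"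
  define C where "C = 4 * (1 + \<bar>CP\<bar>) * K + 4 * T + 4"
  have "0 \<le> K" unfolding K_def by simp
  then have C: "0 < C" unfolding C_def using \<open>0 < T\<close> by (simp add: add_nonneg_pos)
  show ?thesis
  proof (intro exI[of _ C] conjI C allI impI, goal_cases)
    case prems: (1 \<epsilon> a TH Th IH m \<C> \<C>K \<pi>h f u0 v0 u ut u0d v0d U Ut)
    have op: "open \<Omega>" using assms(1) by (simp add: lipschitz_domain_def)
    have bd: "bounded \<Omega>" by (rule rect_mesh_bounded[OF prems(3)])
    obtain amin amax where "energy_form \<Omega> a amin amax"
      by (rule high_contrast_bounds[OF prems(2) op bd])
    then interpret energy_form \<Omega> a amin amax .
    define \<mu> where "\<mu> = real m powr (real DIM('a) / 2) * \<gamma> ^ m"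
    have \<mu>: "0 \<le> \<mu>" unfolding \<mu>_def using assms(3) by simp
    have "lod_setting \<Omega> a amin amax TH Th CP \<sigma> CI Cloc \<mu> IH \<C> \<C>K m \<pi>h"
      using prems assms \<mu> unfolding localization_bound_def \<mu>_def[symmetric]
      by unfold_locales auto
    then interpret L: lod_setting \<Omega> a amin amax TH Th CP \<sigma> CI Cloc \<mu> IH \<C> \<C>K m \<pi>h .
    obtain n e where "E.spans L.V n e" using L.V_basis by blast
    then interpret B: lod_basis \<Omega> a amin amax TH Th CP \<sigma> CI Cloc \<mu> IH \<C> \<C>K m \<pi>h n e
      by unfold_locales
    interpret S: wave_setting \<Omega> a amin amax TH Th CP \<sigma> CI Cloc \<mu> IH \<C> \<C>K m \<pi>h n e T f u0 v0 u0d v0d u ut U Ut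
      using prems assms(2) by unfold_locales auto
    have C_eq: "S.error_const = C"
      by (simp add: S.error_const_def B.ritz_const_def L.stab_const_def C_def K_def)
    have lod_rate: "ennreal (mesh_size TH + real m powr (real DIM('a) / 2) * \<gamma> ^ m) = ennreal B.lod_rate"
      unfolding B.lod_rate_def unfolding \<mu>_def by (rule refl)
    show ?case unfolding Let_def lod_rate
    proof (intro conjI allI impI, goal_cases)
      case (1 utt uttt utttt ft ftt)
      then show ?case using S.energy_error_estimate[of utt uttt utttt ft ftt] by (simp only: C_eq)
    next
      case (2 utt uttt ft)
      have "v0d \<in> L2 \<Omega>" by (rule S.discrete_solution)
      then have ball: "\<forall>w\<in>L.V. l2ip \<Omega> (\<lambda>x. v0 x - v0d x) w = l2ip \<Omega> (\<lambda>x. 0) w"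
        using 2(8) by (simp add: l2_proj_def l2ip_def)
      have zero: "l2norm \<Omega> (\<lambda>x. 0 :: real) \<le> 0" by (simp add: l2norm_def)
      from S.L2_error_estimate[OF 2(1,2,3,7) order_refl ball L2_zero zero]
      show ?case by (simp only: C_eq ennreal_0 add_0_right)
    next
      case (3 utt uttt ft)
      have "v0d \<in> L2 \<Omega>" by (rule S.discrete_solution)
      then have r: "(\<lambda>x. v0 x - v0d x) \<in> L2 \<Omega>" using prems L2_diff by blast
      have ball: "\<forall>w\<in>L.V. l2ip \<Omega> (\<lambda>x. v0 x - v0d x) w = l2ip \<Omega> (\<lambda>x. v0 x - v0d x) w" by simp
      from S.L2_error_estimate[OF 3(1,2,3,7) l2norm_nonneg ball r order_refl]
      show ?case by (simp only: C_eq)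
    qed
  qed
qed

end
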